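(* Let $\{\Omega_h\}_h$ be a family of polyhedral meshes satisfying assumption (A1), and let $k\ge 1$. For every global degree of freedom $\nu$ of $V_h^k(\Omega_h)$ set $$h_\nu := \frac{1}{|\omega_\nu|}\sum_{E\in\omega_\nu} h_E .$$ Let $p_h$ be a piecewise polynomial function on $\Omega_h$ of degree at most $k$. Let $\tilde w_h$ be the (discontinuous) function with $\tilde w_h|_E\in V_h^k(E)$ for each $E\in\Omega_h$ and local degrees of freedom $$\mathrm{dof}^E_\nu(\tilde w_h) := h_\nu\,\mathrm{dof}^E_\nu(p_h),$$ and let $w_h := \pi(\tilde w_h)\in V_h^k(\Omega_h)$, where $\pi$ is the Oswald (averaging) interpolant. Then there is a constant $C>0$ independent of the mesh size such that for every element $E\in\Omega_h$ $$\|\tilde w_h - w_h\|_{0,E}^2 \le C\, h_E \sum_{F\in\mathcal F(\omega_E)} h_F^2\,\|[\![p_h]\!]\|_{0,F}^2 ,$$ where $\omega_E$ is the set of elements of $\Omega_h$ sharing at least one vertex with $E$, and $\mathcal F(\omega_E)$ is the set of all internal faces $F$ such that $F=\partial E_1\cap\partial E_2$ with $E_1,E_2\in\omega_E$.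
   Context: **Mesh.** $\Omega\subset\mathbb R^3$ is a polyhedral domain; each $\Omega_h$ is a conforming partition of $\Omega$ into polyhedra. $E$, $F$, $e$ denote elements, faces, edges; $h_D$, $|D|$, $\mathbf x_D$ are the diameter, measure and centroid of $D\in\{E,F,e\}$. Assumption (A1): there is $\rho>0$ independent of $h$ such that every $E$ and every face $F$ is star-shaped with respect to a ball of radius $\ge\rho h_E$, resp. $\ge \rho h_F$; $h_F\ge\rho h_E$ for every face $F$ of every $E$; and there is $C\ge1$ with $h_E\le C h_K$ for all adjacent elements $E,K$ (local quasi-uniformity). **Spaces.** $\Pi^{\nabla,D}_k: H^1(D)\to\mathbb P_k(D)$ ($D=E$ or $F$) is defined by $\int_D\nabla(v-\Pi^{\nabla,D}_kv)\cdot\nabla q=0$ for all $q\in\mathbb P_k(D)$ and $\int_{\partial D}(v-\Pi^{\nabla,D}_kv)=0$. The face space is $V_h^k(F)=\{v\in H^1(F)\cap C^0(\partial F): v|_e\in\mathbb P_k(e)\ \forall e\subset\partial F,\ \Delta_Fv\in\mathbb P_k(F),\ (v-\Pi^{\nabla,F}_kv,q)_{0,F}=0\ \forall q\in\mathbb P_k(F)\setminus\mathbb P_{k-2}(F)\}$, and the element space is $V_h^k(E)=\{v\in H^1(E)\cap C^0(\partial E): v|_F\in V_h^k(F)\ \forall F\subset\partial E,\ \Delta v\in\mathbb P_k(E),\ (v-\Pi^{\nabla,E}_kv,p)_{0,E}=0\ \forall p\in\mathbb P_k(E)\setminus\mathbb P_{k-2}(E)\}$. The global space is $V_h^k(\Omega_h)=\{v\in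 H^1(\Omega): v|_E\in V_h^k(E)\ \forall E\}$. **Degrees of freedom (DoFs)** of $V_h^k(E)$: values at vertices; for $k>1$, values at the $k-1$ inner Gauss–Lobatto points of each edge, moments $\frac1{|F|}\int_F v\,m$ for $m\in\mathcal M_{k-2}(F)$ on each face, and moments $\frac1{|E|}\int_Ev\,m$ for $m\in\mathcal M_{k-2}(E)$, where $\mathcal M_n(D)=\{((\mathbf x-\mathbf x_D)/h_D)^{\alpha}:|\alpha|\le n\}$ are scaled monomials. $\mathrm{dof}^E_\nu(v)$ is the value of DoF $\nu$ on $v|_E$. **Oswald interpolant.** For $v$ with $v|_E\in V_h^k(E)$ for all $E$ (possibly discontinuous), $\pi(v)\in V_h^k(\Omega_h)$ is defined by $\mathrm{dof}_\nu(\pi(v))=\frac1{|\omega_\nu|}\sum_{E\in\omega_\nu}\mathrm{dof}_\nu^E(v)$, where $\omega_\nu$ is the set of elements having $\nu$ as a local DoF and $|\omega_\nu|$ its cardinality. **Jump.** For an internal face $F=\partial E^+\cap\partial E^-$, $[\![p]\!]=p|_{E^+}-p|_{E^-}$. $\|\cdot\|_{0,D}$ is the $L^2(D)$ norm. *)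

theory Defs
  imports "HOL-Analysis.Analysis" "HOL-Computational_Algebra.Polynomial"
begin

subsection \<open>Polynomials and scaled monomials\<close>

definition monomial :: "('n::finite \<Rightarrow> nat) \<Rightarrow> real^'n \<Rightarrow> real" where
  "monomial \<alpha> x = (\<Prod>i\<in>UNIV. (x $ i) ^ \<alpha> i)"

definition mdegree :: "('n::finite \<Rightarrow> nat) \<Rightarrow> nat" where
  "mdegree \<alpha> = (\<Sum>i\<in>UNIV. \<alpha> i)"

definition Polys :: "nat \<Rightarrow> (real^'n::finite \<Rightarrow> real) set" where
  "Polys k = {p. \<exists>c. p = (\<lambda>x. \<Sum>\<alpha> | mdegree \<alpha> \<le> k. c \<alpha> * monomial \<alpha> x)}"

definition centroid :: "(real^'n::finite) set \<Rightarrow> real^'n" where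
  "centroid D = (1 / measure lebesgue D) *\<^sub>R (LINT x:D|lebesgue. x)"

definition scaled_monomial :: "(real^'n::finite) set \<Rightarrow> ('n \<Rightarrow> nat) \<Rightarrow> real^'n \<Rightarrow> real" where
  "scaled_monomial D \<alpha> x = monomial \<alpha> ((1 / diameter D) *\<^sub>R (x - centroid D))"

subsection \<open>Sobolev functions, traces, weak Laplacian\<close>

definition grad :: "('a::euclidean_space \<Rightarrow> real) \<Rightarrow> 'a \<Rightarrow> 'a" where
  "grad f x = (THE g. GDERIV f x :> g)"

definition C1 :: "('a::euclidean_space \<Rightarrow> real) \<Rightarrow> bool" where
  "C1 f \<longleftrightarrow> (\<forall>x. GDERIV f x :> grad f x) \<and> continuous_on UNIV (grad f)"

definition test_function :: "'a::euclidean_space set \<Rightarrow> ('a \<Rightarrow> real) \<Rightarrow> bool" where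
  "test_function U \<phi> \<longleftrightarrow> C1 \<phi> \<and> (\<exists>K. compact K \<and> K \<subseteq> U \<and> (\<forall>x. x \<notin> K \<longrightarrow> \<phi> x = 0))"

definition L2 :: "'a::euclidean_space set \<Rightarrow> ('a \<Rightarrow> 'b::euclidean_space) \<Rightarrow> bool" where
  "L2 U f \<longleftrightarrow> set_borel_measurable lebesgue U f \<and> set_integrable lebesgue U (\<lambda>x. (norm (f x))\<^sup>2)"

definition L2_norm :: "'a::euclidean_space set \<Rightarrow> ('a \<Rightarrow> real) \<Rightarrow> real" where
  "L2_norm D f = sqrt (LINT x:D|lebesgue. (f x)\<^sup>2)"

text \<open>\<open>H1 U v G\<close>: \<open>v\<close> belongs to $H^1(U)$ and \<open>G\<close> is its weak gradient.\<close>

definition H1 :: "'a::euclidean_space set \<Rightarrow> ('a \<Rightarrow> real) \<Rightarrow> ('a \<Rightarrow> 'a) \<Rightarrow> bool" where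
  "H1 U v G \<longleftrightarrow> L2 U v \<and> L2 U G \<and>
     (\<forall>\<phi>. test_function U \<phi> \<longrightarrow>
        (LINT x:U|lebesgue. v x *\<^sub>R grad \<phi> x) = - (LINT x:U|lebesgue. \<phi> x *\<^sub>R G x))"

text \<open>For \<open>v\<close> with weak gradient \<open>G\<close>, \<open>weak_laplacian U G r\<close> says $\Delta v = r$ in the sense of
  distributions on \<open>U\<close>.\<close>

definition weak_laplacian ::
    "'a::euclidean_space set \<Rightarrow> ('a \<Rightarrow> 'a) \<Rightarrow> ('a \<Rightarrow> real) \<Rightarrow> bool" where
  "weak_laplacian U G r \<longleftrightarrow>
     (\<forall>\<phi>. test_function U \<phi> \<longrightarrow>
        (LINT x:U|lebesgue. G x \<bullet> grad \<phi> x) = - (LINT x:U|lebesgue. r x * \<phi> x))"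

text \<open>A function \<open>v\<close> on a closed cell \<open>D\<close> represents an $H^1$ function in the interior together with
  its boundary values. The next predicate says that these boundary values are the trace of the
  interior function: the trace operator is the continuous extension of the restriction of $C^1$
  functions to the boundary. \<open>J\<close> is integration over the boundary of \<open>D\<close>.\<close>

definition boundary_values_are_trace ::
    "'a::euclidean_space set \<Rightarrow> (('a \<Rightarrow> real) \<Rightarrow> real) \<Rightarrow> ('a \<Rightarrow> real) \<Rightarrow> ('a \<Rightarrow> 'a) \<Rightarrow> bool" where
  "boundary_values_are_trace D J v G \<longleftrightarrow>
     (\<exists>u :: nat \<Rightarrow> 'a \<Rightarrow> real. (\<forall>n. C1 (u n)) \<and>
        (\<lambda>n. LINT x:interior D|lebesgue. (u n x - v x)\<^sup>2) \<longlonglongrightarrow> 0 \<and>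
        (\<lambda>n. LINT x:interior D|lebesgue. (norm (grad (u n) x - G x))\<^sup>2) \<longlonglongrightarrow> 0 \<and>
        (\<lambda>n. J (\<lambda>x. (u n x - v x)\<^sup>2)) \<longlonglongrightarrow> 0)"

subsection \<open>Integration over edges and planar faces\<close>

text \<open>A Cartesian coordinate system on the affine hull of \<open>D\<close>; the dimension of the coordinate space
  is fixed by the type and has to agree with that of \<open>D\<close>.\<close>

definition chart :: "'a::euclidean_space set \<Rightarrow> 'b::euclidean_space \<Rightarrow> 'a" where
  "chart D = (SOME \<phi>. (\<exists>c L. linear L \<and> (\<forall>x. norm (L x) = norm x) \<and> \<phi> = (\<lambda>x. c + L x))
                    \<and> range \<phi> = affine hull D)"

abbreviation face_chart :: "(real^3) set \<Rightarrow> real^2 \<Rightarrow> real^3" where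
  "face_chart F \<equiv> chart F"

text \<open>The part of \<open>S\<close> in the plane of \<open>F\<close>, in the coordinates of that plane.\<close>

definition flat :: "(real^3) set \<Rightarrow> (real^3) set \<Rightarrow> (real^2) set" where
  "flat F S = face_chart F -` S"

definition edge_integral :: "'a::euclidean_space set \<Rightarrow> ('a \<Rightarrow> real) \<Rightarrow> real" where
  "edge_integral e f =
     (let \<phi> = (chart e :: real \<Rightarrow> 'a) in LINT t:(\<phi> -` e)|lebesgue. f (\<phi> t))"

definition face_integral :: "(real^3) set \<Rightarrow> (real^3 \<Rightarrow> real) \<Rightarrow> real" where
  "face_integral F f = (LINT y:flat F F|lebesgue. f (face_chart F y))"

definition face_L2_norm :: "(real^3) set \<Rightarrow> (real^3 \<Rightarrow> real) \<Rightarrow> real" where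
  "face_L2_norm F f = sqrt (face_integral F (\<lambda>x. (f x)\<^sup>2))"

subsection \<open>Polyhedral meshes\<close>

text \<open>The last condition is local connectedness at the boundary. It holds for Lipschitz domains and
  excludes polyhedra that touch themselves at a point or along an edge.\<close>

definition polyhedral_domain :: "(real^3) set \<Rightarrow> bool" where
  "polyhedral_domain \<Omega> \<longleftrightarrow> open \<Omega> \<and> connected \<Omega> \<and> \<Omega> \<noteq> {} \<and>
     interior (closure \<Omega>) = \<Omega> \<and>
     (\<exists>\<P>. finite \<P> \<and> (\<forall>P\<in>\<P>. polytope P) \<and> closure \<Omega> = \<Union>\<P>) \<and>
     (\<forall>x\<in>frontier \<Omega>. \<exists>r0>0. \<forall>r. 0 < r \<and> r < r0 \<longrightarrow> connected (\<Omega> \<inter> ball x r))"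

text \<open>All cells are closed sets. Faces and elements need not be convex, and neighbouring faces of an
  element may be coplanar (so hanging nodes are ordinary vertices), which is why the lower-dimensional
  cells are part of the data.\<close>

record mesh =
  verts :: "(real^3) set"
  edges :: "(real^3) set set"
  faces :: "(real^3) set set"
  elems :: "(real^3) set set"

definition edges_of :: "mesh \<Rightarrow> (real^3) set \<Rightarrow> (real^3) set set" where
  "edges_of T F = {e \<in> edges T. e \<subseteq> rel_frontier F}"

definition faces_of :: "mesh \<Rightarrow> (real^3) set \<Rightarrow> (real^3) set set" where
  "faces_of T E = {F \<in> faces T. F \<subseteq> frontier E}"

text \<open>Conformity: boundaries of cells are unions of cells, and distinct cells (of any dimensions) have
  disjoint relative interiors. Hence the intersection of two cells is a union of common cells.\<close>

definition conforming_mesh :: "(real^3) set \<Rightarrow> mesh \<Rightarrow> bool" where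
  "conforming_mesh \<Omega> T \<longleftrightarrow>
     finite (verts T) \<and> finite (edges T) \<and> finite (faces T) \<and> finite (elems T) \<and>
     (\<forall>e\<in>edges T. \<exists>a\<in>verts T. \<exists>b\<in>verts T. a \<noteq> b \<and> e = closed_segment a b) \<and>
     (\<forall>F\<in>faces T. compact F \<and> aff_dim F = 2 \<and> connected (rel_interior F) \<and>
        closure (rel_interior F) = F \<and> rel_frontier F = \<Union>(edges_of T F)) \<and>
     (\<forall>E\<in>elems T. compact E \<and> E \<noteq> {} \<and> connected (interior E) \<and>
        closure (interior E) = E \<and> frontier E = \<Union>(faces_of T E)) \<and>
     (\<forall>x\<in>verts T. \<exists>e\<in>edges T. x \<in> e) \<and>
     (\<forall>e\<in>edges T. \<exists>F\<in>faces T. e \<in> edges_of T F) \<and>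
     (\<forall>F\<in>faces T. \<exists>E\<in>elems T. F \<in> faces_of T E) \<and>
     (\<Union>(elems T)) = closure \<Omega> \<and>
     pairwise (\<lambda>X Y. rel_interior X \<inter> rel_interior Y = {})
       ((\<lambda>x. {x}) ` verts T \<union> edges T \<union> faces T \<union> elems T)"

text \<open>Used for elements (affine hull the whole space) and for faces (the ball is then a disc in the
  plane of the face).\<close>

definition star_shaped_wrt_ball :: "'a::euclidean_space set \<Rightarrow> real \<Rightarrow> bool" where
  "star_shaped_wrt_ball D r \<longleftrightarrow>
     (\<exists>c\<in>affine hull D. ball c r \<inter> affine hull D \<subseteq> D \<and>
        (\<forall>y\<in>ball c r \<inter> affine hull D. \<forall>x\<in>D. closed_segment x y \<subseteq> D))"

definition adjacent :: "mesh \<Rightarrow> (real^3) set \<Rightarrow> (real^3) set \<Rightarrow> bool" where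
  "adjacent T E K \<longleftrightarrow> E \<in> elems T \<and> K \<in> elems T \<and> E \<noteq> K \<and> faces_of T E \<inter> faces_of T K \<noteq> {}"

definition assumption_A1 :: "mesh set \<Rightarrow> bool" where
  "assumption_A1 \<T> \<longleftrightarrow>
     (\<exists>\<rho>>0. \<forall>T\<in>\<T>. \<forall>E\<in>elems T.
        (\<exists>r\<ge>\<rho> * diameter E. star_shaped_wrt_ball E r) \<and>
        (\<forall>F\<in>faces_of T E. (\<exists>r\<ge>\<rho> * diameter F. star_shaped_wrt_ball F r) \<and>
           diameter F \<ge> \<rho> * diameter E)) \<and>
     (\<exists>C\<ge>1. \<forall>T\<in>\<T>. \<forall>E K. adjacent T E K \<longrightarrow> diameter E \<le> C * diameter K)"

subsection \<open>Virtual element spaces\<close>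

definition is_nabla_projection ::
    "nat \<Rightarrow> (real^'n::finite) set \<Rightarrow> ((real^'n \<Rightarrow> real) \<Rightarrow> real) \<Rightarrow> (real^'n \<Rightarrow> real) \<Rightarrow>
     (real^'n \<Rightarrow> real^'n) \<Rightarrow> (real^'n \<Rightarrow> real) \<Rightarrow> bool" where
  "is_nabla_projection k D J v G p \<longleftrightarrow> p \<in> Polys k \<and>
     (\<forall>q\<in>Polys k. (LINT x:interior D|lebesgue. (G x - grad p x) \<bullet> grad q x) = 0) \<and>
     J (\<lambda>x. v x - p x) = 0"

text \<open>The conditions common to the face space (\<open>n = 2\<close>) and the element space (\<open>n = 3\<close>). Here \<open>J\<close> is
  integration over the boundary of the cell \<open>D\<close> and \<open>facet_condition\<close> is the condition on the
  restrictions to the edges or faces. Test polynomials ``in $P_k \setminus P_{k-2}$'' are those in the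
  complement of $P_{k-2}$ spanned by the scaled monomials of degree $k-1$ and $k$; the plain
  set difference would span all of $P_k$.\<close>

definition enhanced_vem ::
    "nat \<Rightarrow> (real^'n::finite) set \<Rightarrow> ((real^'n \<Rightarrow> real) \<Rightarrow> real) \<Rightarrow>
     ((real^'n \<Rightarrow> real) \<Rightarrow> bool) \<Rightarrow> (real^'n \<Rightarrow> real) \<Rightarrow> bool" where
  "enhanced_vem k D J facet_condition v \<longleftrightarrow>
     continuous_on (frontier D) v \<and> facet_condition v \<and>
     (\<exists>G. H1 (interior D) v G \<and> boundary_values_are_trace D J v G \<and>
        (\<exists>r\<in>Polys k. weak_laplacian (interior D) G r) \<and>
        (\<exists>p. is_nabla_projection k D J v G p \<and>
           (\<forall>\<alpha>. k < mdegree \<alpha> + 2 \<and> mdegree \<alpha> \<le> k \<longrightarrow>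
              (LINT x:D|lebesgue. (v x - p x) * scaled_monomial D \<alpha> x) = 0)))"

definition V_face :: "nat \<Rightarrow> mesh \<Rightarrow> (real^3) set \<Rightarrow> (real^2 \<Rightarrow> real) set" where
  "V_face k T F = {u. enhanced_vem k (flat F F)
     (\<lambda>f. \<Sum>e\<in>edges_of T F. edge_integral (flat F e) f)
     (\<lambda>u. \<forall>e\<in>edges_of T F. \<exists>q\<in>Polys k. \<forall>y\<in>flat F e. u y = q y) u}"

definition V_elem :: "nat \<Rightarrow> mesh \<Rightarrow> (real^3) set \<Rightarrow> (real^3 \<Rightarrow> real) set" where
  "V_elem k T E = {v. enhanced_vem k E
     (\<lambda>f. \<Sum>F\<in>faces_of T E. face_integral F f)
     (\<lambda>v. \<forall>F\<in>faces_of T E. v \<circ> face_chart F \<in> V_face k T F) v}"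

definition V_global :: "nat \<Rightarrow> (real^3) set \<Rightarrow> mesh \<Rightarrow> (real^3 \<Rightarrow> real) set" where
  "V_global k \<Omega> T = {v. (\<exists>G. H1 \<Omega> v G) \<and> (\<forall>E\<in>elems T. v \<in> V_elem k T E)}"

subsection \<open>Degrees of freedom\<close>

definition legendre :: "nat \<Rightarrow> real poly" where
  "legendre n = smult (1 / (2 ^ n * fact n)) ((pderiv ^^ n) ([:-1, 0, 1:] ^ n))"

text \<open>The inner nodes of the \<open>k + 1\<close> point Gauss--Lobatto rule are the \<open>k - 1\<close> zeros of the derivative
  of the Legendre polynomial of degree \<open>k\<close>. They are symmetric, so the orientation of the edge does
  not matter.\<close>

definition gauss_lobatto_inner :: "nat \<Rightarrow> 'a::euclidean_space set \<Rightarrow> 'a set" where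
  "gauss_lobatto_inner k e =
     {((1 - t) / 2) *\<^sub>R a + ((1 + t) / 2) *\<^sub>R b | a b t.
        e = closed_segment a b \<and> poly (pderiv (legendre k)) t = 0}"

text \<open>\<open>Point_Value\<close> covers the vertices and the inner Gauss--Lobatto points of the edges.\<close>

datatype dof =
    Point_Value "real^3"
  | Face_Moment "(real^3) set" "2 \<Rightarrow> nat"
  | Elem_Moment "(real^3) set" "3 \<Rightarrow> nat"

definition local_dofs :: "nat \<Rightarrow> mesh \<Rightarrow> (real^3) set \<Rightarrow> dof set" where
  "local_dofs k T E =
     {Point_Value x | x. x \<in> verts T \<and> x \<in> E} \<union>
     {Point_Value x | x e. e \<in> edges T \<and> e \<subseteq> E \<and> x \<in> gauss_lobatto_inner k e} \<union>
     {Face_Moment F \<alpha> | F \<alpha>. F \<in> faces_of T E \<and> mdegree \<alpha> + 2 \<le> k} \<union>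
     {Elem_Moment E \<alpha> | \<alpha>. mdegree \<alpha> + 2 \<le> k}"

fun dof_value :: "dof \<Rightarrow> (real^3 \<Rightarrow> real) \<Rightarrow> real" where
  "dof_value (Point_Value x) v = v x"
| "dof_value (Face_Moment F \<alpha>) v =
     (LINT y:flat F F|lebesgue. v (face_chart F y) * scaled_monomial (flat F F) \<alpha> y)
       / measure lebesgue (flat F F)"
| "dof_value (Elem_Moment E \<alpha>) v =
     (LINT x:E|lebesgue. v x * scaled_monomial E \<alpha> x) / measure lebesgue E"

definition dof_patch :: "nat \<Rightarrow> mesh \<Rightarrow> dof \<Rightarrow> (real^3) set set" where
  "dof_patch k T \<nu> = {E \<in> elems T. \<nu> \<in> local_dofs k T E}"

definition h_dof :: "nat \<Rightarrow> mesh \<Rightarrow> dof \<Rightarrow> real" where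
  "h_dof k T \<nu> = (\<Sum>E\<in>dof_patch k T \<nu>. diameter E) / card (dof_patch k T \<nu>)"

text \<open>A possibly discontinuous function \<open>v\<close> on the mesh is given by its restrictions \<open>v E\<close> to the
  elements. \<open>is_oswald k \<Omega> T v w\<close> says that \<open>w\<close> is the Oswald interpolant of \<open>v\<close>; it is a
  relation because the interior values of \<open>w\<close> matter only up to null sets.\<close>

definition is_oswald ::
    "nat \<Rightarrow> (real^3) set \<Rightarrow> mesh \<Rightarrow> ((real^3) set \<Rightarrow> real^3 \<Rightarrow> real) \<Rightarrow> (real^3 \<Rightarrow> real) \<Rightarrow> bool" where
  "is_oswald k \<Omega> T v w \<longleftrightarrow> w \<in> V_global k \<Omega> T \<and>
     (\<forall>\<nu> \<in> (\<Union>E\<in>elems T. local_dofs k T E).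
        dof_value \<nu> w =
          (\<Sum>E\<in>dof_patch k T \<nu>. dof_value \<nu> (v E)) / card (dof_patch k T \<nu>))"

subsection \<open>Patches and jumps\<close>

definition elem_patch :: "mesh \<Rightarrow> (real^3) set \<Rightarrow> (real^3) set set" where
  "elem_patch T E = {K \<in> elems T. \<exists>x\<in>verts T. x \<in> E \<and> x \<in> K}"

definition patch_faces :: "mesh \<Rightarrow> (real^3) set \<Rightarrow> (real^3) set set" where
  "patch_faces T E = {F \<in> faces T. \<exists>E1\<in>elem_patch T E. \<exists>E2\<in>elem_patch T E.
     E1 \<noteq> E2 \<and> F \<in> faces_of T E1 \<and> F \<in> faces_of T E2}"

text \<open>The two elements sharing an internal face, labelled \<open>+\<close> and \<open>-\<close> in a fixed arbitrary order.\<close>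

definition face_sides :: "mesh \<Rightarrow> (real^3) set \<Rightarrow> (real^3) set \<times> (real^3) set" where
  "face_sides T F = (SOME (Ep, Em). Ep \<in> elems T \<and> Em \<in> elems T \<and> Ep \<noteq> Em \<and>
     F \<in> faces_of T Ep \<and> F \<in> faces_of T Em)"

definition jump ::
    "mesh \<Rightarrow> ((real^3) set \<Rightarrow> real^3 \<Rightarrow> real) \<Rightarrow> (real^3) set \<Rightarrow> real^3 \<Rightarrow> real" where
  "jump T p F x = p (fst (face_sides T F)) x - p (snd (face_sides T F)) x"

end

theory Submission
  imports Defs
begin

text \<open>The degrees of freedom of \<open>wt - w\<close> on an element \<open>E\<close> are averages, with weight at most a multiple of the size
  of \<open>E\<close>, of differences between the polynomials on the elements that carry the degree of freedom. Two elements at a point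
  are linked by a chain of elements that share faces through that point, because a generic segment near the point avoids all
  edges; packing balls bounds the length of the chain, and the jump at a point of a face is bounded by its norm in \<open>L2\<close> of the face.

  It remains to bound a virtual function \<open>v\<close> by its degrees of freedom, first on the faces and then on the element.
  If they are at most \<open>m\<close>, the divergence theorem bounds the elliptic projection, and hence all moments of \<open>v\<close> up to order \<open>k\<close>.
  Testing the equation of \<open>v\<close> with its truncation at height \<open>m\<close> bounds \<open>v\<close> in terms of its Laplacian, a polynomial; testing it
  with bumps bounds the Laplacian in terms of \<open>v\<close>. The two estimates close because the moments control the integral of \<open>v\<close>
  times its Laplacian. The maximum principle for \<open>v\<close> plus a quadratic function then gives a bound at every point.\<close>

section \<open>Polynomials\<close>

text \<open>The powers of the mesh size balance as follows. On a face, a polynomial of degree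
  \<open>k\<close> is bounded by a multiple of \<open>1/h_F\<close> times its L2 norm, so its square
  times \<open>h_F^4\<close> is bounded by the weighted term \<open>h_F^2 * norm^2\<close> of the
  claim. A difference of degrees of freedom is then at most a multiple of
  \<open>h_E * h_E^(-2)\<close> times the root of the jump sum, and its square times the volume
  \<open>h_E^3\<close> leaves the factor \<open>h_E\<close>. Cells are arbitrary star-shaped
  polytopes, so there is no reference cell to map to and no compactness argument over shapes. Its
  place is taken by explicit interpolation formulas and by polar coordinates around star centres,
  which yield the divergence theorem, a Poincare inequality and an estimate near the boundary.
  Traces are known only as limits of C1 functions; boundary estimates are therefore proved for C1
  functions and passed to the limit. No step gains a small factor. The circular estimates close
  because the energy inequality bounds the square of the truncated function by the first power of
  the Laplacian.\<close>

lemma finite_mdegree_le: "finite {\<alpha>::'n::finite \<Rightarrow> nat. mdegree \<alpha> \<le> k}"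
proof (rule finite_subset)
  show "{\<alpha>::'n \<Rightarrow> nat. mdegree \<alpha> \<le> k} \<subseteq> (\<Pi>\<^sub>E i\<in>UNIV. {..k})"
  proof clarify
    fix \<alpha> :: "'n \<Rightarrow> nat" assume "mdegree \<alpha> \<le> k"
    then have "\<alpha> i \<le> k" for i
      using member_le_sum[of i UNIV \<alpha>] by (simp add: mdegree_def)
    then show "\<alpha> \<in> (\<Pi>\<^sub>E i\<in>UNIV. {..k})" by auto
  qed
qed (simp add: finite_PiE)

lemma monomial_mult: "monomial \<alpha> x * monomial \<beta> x = monomial (\<lambda>i. \<alpha> i + \<beta> i) x"
  by (simp add: monomial_def power_add prod.distrib)

lemma mdegree_add: "mdegree (\<lambda>i. \<alpha> i + \<beta> i) = mdegree \<alpha> + mdegree \<beta>"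
  by (simp add: mdegree_def sum.distrib)

lemma Polys_monomial: "mdegree \<alpha> \<le> k \<Longrightarrow> monomial \<alpha> \<in> Polys k"
  unfolding Polys_def
  by (rule CollectI, rule exI[of _ "\<lambda>\<beta>. if \<beta> = \<alpha> then 1 else 0"])
     (rule ext, simp add: if_distrib[of "\<lambda>x. x * _"] sum.delta finite_mdegree_le cong: if_cong)

lemma Polys_add: "p \<in> Polys k \<Longrightarrow> q \<in> Polys k \<Longrightarrow> (\<lambda>x. p x + q x) \<in> Polys k"
  unfolding Polys_def
  by clarify (rule_tac x="\<lambda>\<alpha>. c \<alpha> + ca \<alpha>" in exI, simp add: distrib_right sum.distrib)

lemma Polys_cmult: "p \<in> Polys k \<Longrightarrow> (\<lambda>x. a * p x) \<in> Polys k"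
  unfolding Polys_def
  by clarify (rule_tac x="\<lambda>\<alpha>. a * c \<alpha>" in exI, simp add: sum_distrib_left mult.assoc)

lemma Polys_zero: "(\<lambda>x. 0) \<in> Polys k"
  unfolding Polys_def by (rule CollectI, rule exI[of _ "\<lambda>_. 0"]) simp

lemma Polys_diff: "p \<in> Polys k \<Longrightarrow> q \<in> Polys k \<Longrightarrow> (\<lambda>x. p x - q x) \<in> Polys k"
  using Polys_add[OF _ Polys_cmult[of q k "-1"], of p] by simp

lemma Polys_sum: "finite A \<Longrightarrow> (\<And>i. i \<in> A \<Longrightarrow> f i \<in> Polys k) \<Longrightarrow> (\<lambda>x. \<Sum>i\<in>A. f i x) \<in> Polys k"
  by (induction A rule: finite_induct) (auto simp: Polys_zero intro: Polys_add)

lemma Polys_mono: "p \<in> Polys j \<Longrightarrow> j \<le> k \<Longrightarrow> p \<in> Polys k"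
proof -
  assume p: "p \<in> Polys j" and "j \<le> k"
  then obtain c where "p = (\<lambda>x. \<Sum>\<alpha> | mdegree \<alpha> \<le> j. c \<alpha> * monomial \<alpha> x)"
    by (auto simp: Polys_def)
  then show ?thesis
    using \<open>j \<le> k\<close> by (auto intro!: Polys_sum finite_mdegree_le Polys_cmult Polys_monomial)
qed

lemma Polys_mult:
  assumes "p \<in> Polys j" "q \<in> Polys k" shows "(\<lambda>x. p x * q x) \<in> Polys (j + k)"
proof -
  obtain c d where c: "p = (\<lambda>x. \<Sum>\<alpha> | mdegree \<alpha> \<le> j. c \<alpha> * monomial \<alpha> x)"
     and d: "q = (\<lambda>x. \<Sum>\<alpha> | mdegree \<alpha> \<le> k. d \<alpha> * monomial \<alpha> x)"
    using assms by (auto simp: Polys_def)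
  have "(\<lambda>x. p x * q x) = (\<lambda>x. \<Sum>\<alpha> | mdegree \<alpha> \<le> j. \<Sum>\<beta> | mdegree \<beta> \<le> k.
          (c \<alpha> * d \<beta>) * monomial (\<lambda>i. \<alpha> i + \<beta> i) x)"
    unfolding c d sum_product monomial_mult[symmetric] by (simp add: algebra_simps)
  then show ?thesis
    by (auto intro!: Polys_sum finite_mdegree_le Polys_cmult Polys_monomial simp: mdegree_add)
qed

lemma Polys_const: "(\<lambda>x. a) \<in> Polys k"
  using Polys_cmult[OF Polys_monomial[of "\<lambda>_. 0" k], of a] by (simp add: mdegree_def monomial_def)

lemma Polys_component:
  assumes "k \<ge> 1" shows "(\<lambda>x::real^'n::finite. x $ i) \<in> Polys k"
proof -
  let ?a = "\<lambda>j. if j = i then 1 else (0::nat)"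
  have "monomial ?a = (\<lambda>x. x $ i)"
  proof
    fix x :: "real^'n"
    have "monomial ?a x = (\<Prod>j\<in>UNIV. if j = i then x $ j else 1)"
      unfolding monomial_def by (rule prod.cong) auto
    then show "monomial ?a x = x $ i" by (simp add: prod.delta)
  qed
  moreover have "mdegree ?a \<le> k" using assms by (simp add: mdegree_def)
  ultimately show ?thesis using Polys_monomial[of ?a k] by metis
qed

lemma Polys_power:
  assumes "p \<in> Polys j" shows "(\<lambda>x. p x ^ m) \<in> Polys (j * m)"
proof (induction m)
  case 0 show ?case by (simp add: Polys_const)
next
  case (Suc m) then show ?case using Polys_mult[OF assms Suc] by simp
qed

lemma Polys_prod:
  assumes "finite A" "\<And>i. i \<in> A \<Longrightarrow> f i \<in> Polys (d i)"
  shows "(\<lambda>x. \<Prod>i\<in>A. f i x) \<in> Polys (\<Sum>i\<in>A. d i)"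
  using assms
  by (induction A rule: finite_induct) (auto simp: Polys_const intro: Polys_mult)

lemma Polys_compose:
  fixes \<phi> :: "real^'m::finite \<Rightarrow> real^'n::finite"
  assumes q: "q \<in> Polys k" and \<phi>: "\<And>i. (\<lambda>y. \<phi> y $ i) \<in> Polys 1"
  shows "(\<lambda>y. q (\<phi> y)) \<in> Polys k"
proof -
  obtain c where c: "q = (\<lambda>x. \<Sum>\<alpha> | mdegree \<alpha> \<le> k. c \<alpha> * monomial \<alpha> x)"
    using q by (auto simp: Polys_def)
  have "(\<lambda>y. monomial \<alpha> (\<phi> y)) \<in> Polys k" if "mdegree \<alpha> \<le> k" for \<alpha>
  proof -
    have "(\<lambda>y. \<Prod>i\<in>UNIV. (\<phi> y $ i) ^ \<alpha> i) \<in> Polys (\<Sum>i\<in>UNIV. \<alpha> i)"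
      using Polys_prod[OF finite_class.finite_UNIV Polys_power[OF \<phi>]] by simp
    then show ?thesis using that Polys_mono unfolding monomial_def mdegree_def by blast
  qed
  then show ?thesis unfolding c by (auto intro!: Polys_sum finite_mdegree_le Polys_cmult)
qed

lemma Polys_affine_component:
  assumes "linear L" shows "(\<lambda>y::real^'m::finite. (p + L y) $ i) \<in> Polys 1"
proof -
  have eq: "(p + L y) $ i = p $ i + (\<Sum>j\<in>UNIV. (L (axis j 1) $ i) * (y $ j))" for y
  proof -
    have "L y = L (\<Sum>j\<in>UNIV. (y $ j) *\<^sub>R axis j 1)"
      using basis_expansion[of y] by (simp add: scalar_mult_eq_scaleR)
    also have "\<dots> = (\<Sum>j\<in>UNIV. (y $ j) *\<^sub>R L (axis j 1))"
      by (simp add: linear_sum[OF assms] linear_cmul[OF assms])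
    finally show ?thesis by (simp add: mult.commute)
  qed
  show ?thesis unfolding eq
    by (intro Polys_add Polys_const Polys_sum Polys_cmult Polys_component) auto
qed

lemma Polys_affine:
  fixes L :: "real^'m::finite \<Rightarrow> real^'n::finite"
  assumes "q \<in> Polys k" "linear L" shows "(\<lambda>y. q (p + L y)) \<in> Polys k"
  by (rule Polys_compose[OF assms(1) Polys_affine_component[OF assms(2)]])

lemma Polys_translate_scale:
  fixes q :: "real^'m::finite \<Rightarrow> real"
  assumes "q \<in> Polys k" shows "(\<lambda>y. q (p + a *\<^sub>R y)) \<in> Polys k"
  by (rule Polys_affine[OF assms]) (simp add: linear_iff scaleR_add_right)

text \<open>Restriction to lines reduces pointwise estimates for polynomials to Lagrange
  interpolation in one variable. The constants then depend on \<open>k\<close> and on a fixed set of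
  nodes only, not on the polynomial or the cell.\<close>

lemma Polys_line:
  fixes q :: "real^'n::finite \<Rightarrow> real"
  assumes "q \<in> Polys k"
  obtains f where "degree f \<le> k" "\<And>t. q (x + t *\<^sub>R d) = poly f t"
proof -
  obtain c where c: "q = (\<lambda>x. \<Sum>\<alpha> | mdegree \<alpha> \<le> k. c \<alpha> * monomial \<alpha> x)"
    using assms by (auto simp: Polys_def)
  define f where "f = (\<Sum>\<alpha> | mdegree \<alpha> \<le> k. smult (c \<alpha>) (\<Prod>i\<in>UNIV. [:x $ i, d $ i:] ^ \<alpha> i))"
  have "degree (\<Prod>i\<in>UNIV. [:x $ i, d $ i:] ^ \<alpha> i) \<le> mdegree \<alpha>" for \<alpha>
  proof -
    have "degree (\<Prod>i\<in>UNIV. [:x $ i, d $ i:] ^ \<alpha> i) \<le> (\<Sum>i\<in>UNIV. degree ([:x $ i, d $ i:] ^ \<alpha> i))"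
      using degree_prod_sum_le[of UNIV "\<lambda>i. [:x $ i, d $ i:] ^ \<alpha> i"] by (simp add: o_def)
    also have "\<dots> \<le> (\<Sum>i\<in>UNIV. \<alpha> i)"
    proof (rule sum_mono)
      fix i have "degree ([:x $ i, d $ i:] ^ \<alpha> i) \<le> degree [:x $ i, d $ i:] * \<alpha> i" by (rule degree_power_le)
      also have "\<dots> \<le> 1 * \<alpha> i" by (intro mult_right_mono) auto
      finally show "degree ([:x $ i, d $ i:] ^ \<alpha> i) \<le> \<alpha> i" by simp
    qed
    finally show ?thesis by (simp add: mdegree_def)
  qed
  then have "degree f \<le> k" unfolding f_def
    by (intro degree_sum_le finite_mdegree_le) (auto intro: order_trans[OF degree_smult_le] order_trans)
  moreover have "q (x + t *\<^sub>R d) = poly f t" for t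
    by (simp add: c f_def poly_sum poly_prod monomial_def mult.commute)
  ultimately show ?thesis using that by blast
qed

lemma continuous_on_monomial [continuous_intros]: "continuous_on S (monomial \<alpha>)"
  unfolding monomial_def[abs_def] by (intro continuous_intros)

lemma continuous_on_Polys:
  assumes "q \<in> Polys k" shows "continuous_on S q"
  using assms by (auto simp: Polys_def intro!: continuous_intros)

text \<open>The difference of \<open>f\<close> and its interpolant has degree at most
  \<open>k\<close> and vanishes at \<open>k + 1\<close> nodes, hence is zero. The nodes are left
  arbitrary: they are taken close to 1 for extrapolation, in the unit interval for derivatives and
  coefficients, and at the Gauss-Lobatto points for edges.\<close>

lemma lagrange_basis:
  fixes I :: "real set"
  assumes "finite I" "card I = Suc k"
  obtains L :: "real \<Rightarrow> real poly" where
    "\<And>f. degree f \<le> k \<Longrightarrow> f = (\<Sum>i\<in>I. smult (poly f i) (L i))" "\<And>i. i \<in> I \<Longrightarrow> degree (L i) \<le> k"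
proof -
  define L where "L i = (\<Prod>j\<in>I-{i}. smult (1 / (i - j)) [:-j, 1:])" for i
  have pL: "poly (L i) j = (if i = j then 1 else 0)" if "i \<in> I" "j \<in> I" for i j
  proof (cases "i = j")
    case True
    have "poly (smult (1 / (i - m)) [:-m, 1:]) i = 1" if "m \<noteq> i" for m
      using that by (simp add: diff_divide_distrib[symmetric])
    then show ?thesis using True unfolding L_def poly_prod by (auto intro!: prod.neutral)
  next
    case False
    then have "j \<in> I - {i}" using that by auto
    then show ?thesis using False assms unfolding L_def poly_prod
      by (auto intro!: prod_zero bexI[of _ j])
  qed
  have dL: "degree (L i) \<le> k" if "i \<in> I" for i
  proof -
    have "degree (L i) \<le> (\<Sum>j\<in>I-{i}. degree (smult (1 / (i - j)) [:-j, 1:]))"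
      unfolding L_def using degree_prod_sum_le[of "I-{i}" "\<lambda>j. smult (1 / (i - j)) [:-j, 1:]"] assms(1)
      by (simp add: o_def)
    also have "\<dots> \<le> (\<Sum>j\<in>I-{i}. 1)"
      by (intro sum_mono) (auto intro!: order_trans[OF degree_smult_le])
    also have "\<dots> = k" using assms that by simp
    finally show ?thesis .
  qed
  have "f = (\<Sum>i\<in>I. smult (poly f i) (L i))" if f: "degree f \<le> k" for f
  proof (rule ccontr)
    define g where "g = f - (\<Sum>i\<in>I. smult (poly f i) (L i))"
    assume "f \<noteq> (\<Sum>i\<in>I. smult (poly f i) (L i))"
    then have g0: "g \<noteq> 0" by (simp add: g_def)
    have "degree g \<le> k" unfolding g_def using assms
      by (intro degree_diff_le f degree_sum_le) (auto intro: order_trans[OF degree_smult_le] dL)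
    have "poly g i = 0" if "i \<in> I" for i
    proof -
      have "(\<Sum>j\<in>I. poly f j * poly (L j) i) = (\<Sum>j\<in>I. if j = i then poly f j else 0)"
        using that by (intro sum.cong) (auto simp: pL)
      then show ?thesis using that assms by (simp add: g_def poly_sum)
    qed
    then have "I \<subseteq> {x. poly g x = 0}" by auto
    then have "card I \<le> card {x. poly g x = 0}" using poly_roots_finite[OF g0] by (rule card_mono[rotated])
    also have "\<dots> \<le> degree g" using card_poly_roots_bound[OF g0] .
    finally show False using assms \<open>degree g \<le> k\<close> by simp
  qed
  then show ?thesis using that dL by blast
qed

section \<open>Change of variables and integrability on bounded sets\<close>

lemma integral_lebesgue_affine:
  fixes f :: "'a::euclidean_space \<Rightarrow> real"
  assumes "f \<in> borel_measurable borel" "t \<noteq> 0"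
  shows "(LINT y|lebesgue. f (a + t *\<^sub>R y)) = (1 / \<bar>t\<bar> ^ DIM('a)) * (LINT x|lebesgue. f x)"
proof -
  have [measurable]: "f \<in> borel_measurable borel" by fact
  have "(LINT x|lborel. f x) = (LINT x|density (distr lborel borel (\<lambda>x. a + t *\<^sub>R x)) (\<lambda>_. ennreal (\<bar>t\<bar>^DIM('a))). f x)"
    using lborel_affine[OF assms(2), of a] by simp
  also have "\<dots> = \<bar>t\<bar>^DIM('a) * (LINT y|lborel. f (a + t *\<^sub>R y))"
    by (subst integral_density) (auto simp: integral_distr)
  finally show ?thesis using assms(2) by (simp add: integral_completion)
qed

lemma set_integrable_continuous:
  fixes f :: "'a::euclidean_space \<Rightarrow> 'b::euclidean_space"
  assumes "continuous_on UNIV f" "bounded S" "S \<in> sets lebesgue"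
  shows "set_integrable lebesgue S f"
proof -
  obtain a b where "S \<subseteq> cbox a b" using bounded_subset_cbox_symmetric[OF assms(2)] by metis
  moreover have "set_integrable lebesgue (cbox a b) f"
    using absolutely_integrable_continuous assms(1) continuous_on_subset by blast
  ultimately show ?thesis using assms(3) set_integrable_subset by blast
qed

text \<open>The value at \<open>z\<close> is recovered from values on the segment from
  \<open>z\<close> to \<open>y\<close> at points as close to \<open>y\<close> as desired. Nodes and
  coefficients depend neither on \<open>q\<close> nor on \<open>z\<close> and \<open>y\<close>, so
  the identity can be integrated in \<open>y\<close>; this transports information from a ball around
  the star centre to remote points.\<close>

lemma Polys_extrapolate:
  fixes \<delta> :: real
  assumes "0 < \<delta>"
  obtains I :: "real set" and cf where "finite I" "I \<subseteq> {1-\<delta><..1}"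
    "\<And>(q::real^'n::finite \<Rightarrow> real) z y. q \<in> Polys k \<Longrightarrow> q z = (\<Sum>i\<in>I. cf i * q (z + i *\<^sub>R (y - z)))"
proof -
  \<comment> \<open>The nodes start at 1 and stay within \<open>\<delta>\<close> of it. Dividing by
    \<open>Suc k\<close> instead of \<open>k\<close> keeps the last node strictly above
    \<open>1 - \<delta>\<close> and makes sense for \<open>k = 0\<close>.\<close>
  define I where "I = (\<lambda>j. 1 - \<delta> * (real j / real (Suc k))) ` {..k}"
  have I: "finite I" "card I = Suc k" "I \<subseteq> {1-\<delta><..1}"
  proof -
    have "\<delta> * (real j / real (Suc k)) < \<delta>" if "j \<le> k" for j
      using that assms mult_strict_left_mono[of "real j / real (Suc k)" 1 \<delta>] by simp
    moreover have "0 \<le> \<delta> * (real j / real (Suc k))" for j using assms by simp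
    ultimately show "I \<subseteq> {1-\<delta><..1}" unfolding I_def by (simp add: image_subset_iff)
  qed (use assms in \<open>auto simp: I_def card_image inj_on_def\<close>)
  obtain L where L: "\<And>f. degree f \<le> k \<Longrightarrow> f = (\<Sum>i\<in>I. smult (poly f i) (L i))"
    using lagrange_basis[OF I(1,2)] by metis
  have "q z = (\<Sum>i\<in>I. poly (L i) 0 * q (z + i *\<^sub>R (y - z)))" if q: "q \<in> Polys k" for q :: "real^'n \<Rightarrow> real" and z y
  proof -
    obtain f where f: "degree f \<le> k" "\<And>t. q (z + t *\<^sub>R (y - z)) = poly f t"
      using Polys_line[OF q] by metis
    have "poly f 0 = (\<Sum>i\<in>I. poly f i * poly (L i) 0)"
      using arg_cong[OF L[OF f(1)], of "\<lambda>p. poly p 0"] by (simp add: poly_sum)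
    then show ?thesis using f(2)[of 0] by (simp add: f(2) mult.commute)
  qed
  then show ?thesis by (rule that[OF I(1,3)])
qed

section \<open>Gradients of polynomials\<close>

lemma GDERIV_monomial:
  "GDERIV (monomial \<alpha>) (x::real^'n::finite) :> (\<chi> j. real (\<alpha> j) * monomial (\<alpha>(j := \<alpha> j - 1)) x)"
proof -
  have d: "((\<lambda>x::real^'n. (x $ i) ^ \<alpha> i) has_derivative (\<lambda>h. real (\<alpha> i) * (h $ i) * (x $ i) ^ (\<alpha> i - 1))) (at x)" for i
    by (rule has_derivative_eq_rhs, rule has_derivative_power, rule bounded_linear_imp_has_derivative, rule bounded_linear_vec_nth) (simp add: mult_ac)
  have "(monomial \<alpha> has_derivative (\<lambda>h. \<Sum>i\<in>UNIV. (real (\<alpha> i) * (h $ i) * (x $ i) ^ (\<alpha> i - 1)) * (\<Prod>j\<in>UNIV - {i}. (x $ j) ^ \<alpha> j))) (at x)"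
    unfolding monomial_def[abs_def] by (rule has_derivative_prod) (rule d)
  also have "(\<lambda>h. \<Sum>i\<in>UNIV. (real (\<alpha> i) * (h $ i) * (x $ i) ^ (\<alpha> i - 1)) * (\<Prod>j\<in>UNIV - {i}. (x $ j) ^ \<alpha> j))
     = (\<lambda>h. h \<bullet> (\<chi> j. real (\<alpha> j) * monomial (\<alpha>(j := \<alpha> j - 1)) x))"
  proof
    fix h :: "real^'n"
    have "(x $ i) ^ (\<alpha> i - 1) * (\<Prod>j\<in>UNIV - {i}. (x $ j) ^ \<alpha> j) = monomial (\<alpha>(i := \<alpha> i - 1)) x" for i
      unfolding monomial_def by (subst (2) prod.remove[of _ i]) auto
    then show "(\<Sum>i\<in>UNIV. (real (\<alpha> i) * (h $ i) * (x $ i) ^ (\<alpha> i - 1)) * (\<Prod>j\<in>UNIV - {i}. (x $ j) ^ \<alpha> j)) = h \<bullet> (\<chi> j. real (\<alpha> j) * monomial (\<alpha>(j := \<alpha> j - 1)) x)"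
      unfolding inner_vec_def by (auto intro!: sum.cong)
  qed
  finally show ?thesis by (simp add: gderiv_def)
qed

lemma GDERIV_unique:
  assumes "GDERIV f x :> g" "GDERIV f x :> g'" shows "g = g'"
proof -
  have "(\<lambda>h. h \<bullet> g) = (\<lambda>h. h \<bullet> g')"
    using assms has_derivative_unique unfolding gderiv_def by blast
  then have "\<forall>h. h \<bullet> g = h \<bullet> g'" by (simp add: fun_eq_iff)
  then show ?thesis using vector_eq_ldot[of g g'] vector_eq_rdot[of g g'] by blast
qed

lemma grad_eqI: "GDERIV f x :> g \<Longrightarrow> grad f x = g"
  unfolding grad_def by (rule the_equality) (auto intro: GDERIV_unique)

lemma GDERIV_sum:
  assumes "finite A" "\<And>i. i \<in> A \<Longrightarrow> GDERIV (f i) x :> g i"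
  shows "GDERIV (\<lambda>x. \<Sum>i\<in>A. f i x) x :> (\<Sum>i\<in>A. g i)"
  using assms unfolding gderiv_def by (auto intro!: derivative_eq_intros simp: inner_sum_right)

lemma Polys_GDERIV:
  fixes q :: "real^'n::finite \<Rightarrow> real"
  assumes "q \<in> Polys k"
  shows "GDERIV q x :> grad q x" "(\<lambda>x. grad q x $ i) \<in> Polys (k - 1)" "continuous_on UNIV (grad q)"
proof -
  obtain c where c: "q = (\<lambda>x. \<Sum>\<alpha> | mdegree \<alpha> \<le> k. c \<alpha> * monomial \<alpha> x)"
    using assms by (auto simp: Polys_def)
  define g where "g x = (\<Sum>\<alpha> | mdegree \<alpha> \<le> k. c \<alpha> *\<^sub>R (\<chi> j. real (\<alpha> j) * monomial (\<alpha>(j := \<alpha> j - 1)) x))" for x :: "real^'n"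
  have "GDERIV q x :> g x" for x
    unfolding c g_def
  proof (rule GDERIV_sum[OF finite_mdegree_le])
    fix \<alpha> :: "'n \<Rightarrow> nat"
    show "GDERIV (\<lambda>x. c \<alpha> * monomial \<alpha> x) x :> c \<alpha> *\<^sub>R (\<chi> j. real (\<alpha> j) * monomial (\<alpha>(j := \<alpha> j - 1)) x)"
      using has_derivative_mult_right[OF GDERIV_monomial[unfolded gderiv_def], of "c \<alpha>"]
      by (simp add: gderiv_def)
  qed
  then have 1: "\<And>x. GDERIV q x :> g x" by auto
  then have g: "grad q = g" by (auto intro!: ext grad_eqI)
  show "GDERIV q x :> grad q x" unfolding g by (rule 1)
  show *: "(\<lambda>x. grad q x $ i) \<in> Polys (k - 1)" for i
  proof -
    have "(\<lambda>x. real (\<alpha> i) * monomial (\<alpha>(i := \<alpha> i - 1)) x) \<in> Polys (k - 1)" if "mdegree \<alpha> \<le> k" for \<alpha>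
    \<comment> \<open>For a zero exponent the natural subtraction \<open>\<alpha> i - 1\<close>
      stays at zero and the degree does not drop; the factor \<open>real (\<alpha> i)\<close> then
      kills the term.\<close>
    proof (cases "\<alpha> i = 0")
      case False
      have "mdegree (\<alpha>(i := \<alpha> i - 1)) = (\<Sum>j\<in>UNIV-{i}. \<alpha> j) + (\<alpha> i - 1)"
        unfolding mdegree_def by (subst sum.remove[of _ i]) auto
      moreover have "mdegree \<alpha> = (\<Sum>j\<in>UNIV-{i}. \<alpha> j) + \<alpha> i"
        unfolding mdegree_def by (subst sum.remove[of _ i]) auto
      ultimately show ?thesis using that False by (intro Polys_cmult Polys_monomial) auto
    qed (simp add: Polys_zero)
    then have "(\<lambda>x. \<Sum>\<alpha> | mdegree \<alpha> \<le> k. c \<alpha> * (real (\<alpha> i) * monomial (\<alpha>(i := \<alpha> i - 1)) x)) \<in> Polys (k - 1)"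
      by (rule Polys_sum[OF finite_mdegree_le Polys_cmult]) simp
    then show ?thesis unfolding g g_def by (simp add: sum_component)
  qed
  show "continuous_on UNIV (grad q)"
  proof -
    have "continuous_on UNIV (\<lambda>x. \<chi> i. grad q x $ i)"
      by (intro continuous_on_vec_lambda continuous_on_Polys[OF *])
    then show ?thesis by simp
  qed
qed

lemma Polys_C1: "q \<in> Polys k \<Longrightarrow> C1 q"
  by (simp add: C1_def Polys_GDERIV)

text \<open>An inverse inequality of Markov type. Along the direction of the gradient the polynomial
  depends on one variable, and the derivative at 0 of a polynomial of degree at most
  \<open>k\<close> is a fixed linear combination of its values at \<open>k + 1\<close> nodes of the
  unit interval.\<close>

lemma Polys_grad_bound:
  "\<exists>C>0. \<forall>q\<in>Polys k. \<forall>(z::real^'n::finite) h S. h > 0 \<longrightarrow> (\<forall>x\<in>cball z h. \<bar>q x\<bar> \<le> S) \<longrightarrow> norm (grad q z) * h \<le> C * S"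
proof -
  define I where "I = (\<lambda>j. real j / real (Suc k)) ` {..k}"
  have I: "finite I" "card I = Suc k" "I \<subseteq> {0..1}"
    unfolding I_def by (auto simp: card_image inj_on_def)
  obtain L where L: "\<And>f. degree f \<le> k \<Longrightarrow> f = (\<Sum>i\<in>I. smult (poly f i) (L i))"
    using lagrange_basis[OF I(1,2)] by metis
  define C where "C = 1 + (\<Sum>i\<in>I. \<bar>poly (pderiv (L i)) 0\<bar>)"
  have "C > 0" unfolding C_def by (intro add_pos_nonneg sum_nonneg) auto
  moreover have "norm (grad q z) * h \<le> C * S"
    if q: "q \<in> Polys k" and h: "h > 0" and S: "\<forall>x\<in>cball z h. \<bar>q x\<bar> \<le> S" for q and z :: "real^'n" and h S
  proof -
    have "\<bar>q z\<bar> \<le> S" using S h by auto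
    then have S0: "S \<ge> 0" by linarith
    show ?thesis
    proof (cases "grad q z = 0")
      case True then show ?thesis using S0 \<open>C > 0\<close> by simp
    next
      case False
      \<comment> \<open>A vector of length \<open>h\<close> in the direction of the gradient: the
        derivative along \<open>e\<close> is exactly \<open>norm (grad q z) * h\<close>, and the
        nodes stay in the ball of radius \<open>h\<close>.\<close>
      define e where "e = (h / norm (grad q z)) *\<^sub>R grad q z"
      have ne: "norm e = h" using False h by (simp add: e_def)
      obtain f where f: "degree f \<le> k" "\<And>t. q (z + t *\<^sub>R e) = poly f t"
        using Polys_line[OF q] by metis
      have *: "((\<lambda>t. q (z + t *\<^sub>R e)) has_derivative (\<lambda>s. (s *\<^sub>R e) \<bullet> grad q z)) (at 0)"
      proof (rule has_derivative_compose[of "\<lambda>t. z + t *\<^sub>R e" "\<lambda>s. s *\<^sub>R e" _ _ q])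
        show "((\<lambda>t. z + t *\<^sub>R e) has_derivative (\<lambda>s. s *\<^sub>R e)) (at 0)"
          by (auto intro!: derivative_eq_intros)
        show "(q has_derivative (\<lambda>b. b \<bullet> grad q z)) (at (z + 0 *\<^sub>R e))"
          using Polys_GDERIV(1)[OF q, of z] by (simp add: gderiv_def)
      qed
      have "(poly f has_real_derivative (e \<bullet> grad q z)) (at 0)"
        unfolding has_field_derivative_def
      proof (rule has_derivative_eq_rhs)
        show "(poly f has_derivative (\<lambda>s. (s *\<^sub>R e) \<bullet> grad q z)) (at 0)" using * unfolding f .
      qed (simp add: fun_eq_iff)
      then have "e \<bullet> grad q z = poly (pderiv f) 0"
        using DERIV_unique poly_DERIV by blast
      also have "\<dots> = (\<Sum>i\<in>I. poly f i * poly (pderiv (L i)) 0)"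
        using arg_cong[OF L[OF f(1)], of "\<lambda>p. poly (pderiv p) 0"]
        by (simp add: higher_pderiv_sum[of 1, simplified] pderiv_smult poly_sum)
      also have "\<dots> \<le> (\<Sum>i\<in>I. S * \<bar>poly (pderiv (L i)) 0\<bar>)"
      proof (rule sum_mono)
        fix i assume "i \<in> I"
        then have "0 \<le> i" "i \<le> 1" using I(3) by auto
        then have "z + i *\<^sub>R e \<in> cball z h" using ne h by (simp add: dist_norm mult_left_le_one_le)
        then have "\<bar>poly f i\<bar> \<le> S" using S f(2) by metis
        then have "\<bar>poly f i * poly (pderiv (L i)) 0\<bar> \<le> S * \<bar>poly (pderiv (L i)) 0\<bar>"
          unfolding abs_mult by (intro mult_right_mono) auto
        then show "poly f i * poly (pderiv (L i)) 0 \<le> S * \<bar>poly (pderiv (L i)) 0\<bar>" by linarith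
      qed
      also have "\<dots> \<le> C * S" unfolding C_def using S0 by (simp add: sum_distrib_left[symmetric] algebra_simps)
      also have "e \<bullet> grad q z = norm (grad q z) * h"
        using False by (simp add: e_def dot_square_norm power2_eq_square)
      finally show ?thesis .
    qed
  qed
  ultimately show ?thesis by blast
qed

text \<open>The bound \<open>S\<close> is assumed on a cube instead of a ball because the
  coefficients are extracted by tensor products of one-dimensional interpolation, whose nodes form a
  grid in the cube.\<close>

definition coeff_bounded :: "nat \<Rightarrow> real \<Rightarrow> (real^'n::finite \<Rightarrow> real) \<Rightarrow> bool" where
  "coeff_bounded k C q \<longleftrightarrow> (\<forall>(x0::real^'n::finite) h S. h > 0 \<longrightarrow> (\<forall>x. (\<forall>i. \<bar>x $ i - x0 $ i\<bar> \<le> h) \<longrightarrow> \<bar>q x\<bar> \<le> S) \<longrightarrow>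
     (\<exists>c. (\<forall>x. q x = (\<Sum>\<alpha> | mdegree \<alpha> \<le> k. c \<alpha> * monomial \<alpha> ((1/h) *\<^sub>R (x - x0)))) \<and> (\<forall>\<alpha>. mdegree \<alpha> \<le> k \<longrightarrow> \<bar>c \<alpha>\<bar> \<le> C * S)))"

text \<open>Each coefficient is a fixed linear combination of values on a grid. In one variable the
  coefficient of index \<open>a\<close> is the sum over the nodes of the value times
  \<open>coeff (L i) a\<close>; in several variables the products of these weights do the
  same.\<close>

lemma Polys_coeff_bound: "\<exists>C>0. \<forall>q\<in>Polys k. coeff_bounded k C (q :: real^'n::finite \<Rightarrow> real)"
proof -
  define I where "I = (\<lambda>j. real j / real (Suc k)) ` {..k}"
  have I: "finite I" "card I = Suc k" "I \<subseteq> {0..1}"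
    unfolding I_def by (auto simp: card_image inj_on_def)
  obtain L where L: "\<And>f. degree f \<le> k \<Longrightarrow> f = (\<Sum>i\<in>I. smult (poly f i) (L i))"
    using lagrange_basis[OF I(1,2)] by metis
  \<comment> \<open>Interpolation reproduces the monomial of degree \<open>b\<close>; comparing
    coefficients shows that the weights \<open>coeff (L i) a\<close> are dual to the powers.\<close>
  have co: "(\<Sum>i\<in>I. coeff (L i) a * i ^ b) = (if a = b then 1 else 0)" if "b \<le> k" for a b
  proof -
    have "coeff (monom (1::real) b) a = (\<Sum>i\<in>I. i ^ b * coeff (L i) a)"
      by (subst L) (auto simp: coeff_sum poly_monom degree_monom_eq that)
    then show ?thesis by (simp add: coeff_monom mult.commute split: if_splits)
  qed
  let ?P = "\<Pi>\<^sub>E j\<in>(UNIV::'n set). I"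
  define w where "w \<alpha> \<iota> = (\<Prod>j\<in>(UNIV::'n set). coeff (L (\<iota> j)) (\<alpha> j))" for \<alpha> \<iota>
  define C where "C = 1 + (\<Sum>\<alpha> | mdegree \<alpha> \<le> k. \<Sum>\<iota>\<in>?P. \<bar>w \<alpha> \<iota>\<bar>)"
  have "C > 0" unfolding C_def by (intro add_pos_nonneg sum_nonneg) auto
  have fP: "finite ?P" using I by (auto intro: finite_PiE)
  have wm: "(\<Sum>\<iota>\<in>?P. w \<alpha> \<iota> * monomial \<beta> (\<chi> j. \<iota> j)) = (if \<alpha> = \<beta> then 1 else 0)" if "mdegree \<beta> \<le> k" for \<alpha> \<beta>
  proof -
    have b: "\<beta> j \<le> k" for j
      using member_le_sum[of j UNIV \<beta>] that by (simp add: mdegree_def)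
    have "(\<Sum>\<iota>\<in>?P. w \<alpha> \<iota> * monomial \<beta> (\<chi> j. \<iota> j)) = (\<Sum>\<iota>\<in>?P. \<Prod>j\<in>UNIV. coeff (L (\<iota> j)) (\<alpha> j) * (\<iota> j) ^ \<beta> j)"
      by (simp add: w_def monomial_def prod.distrib)
    also have "\<dots> = (\<Prod>j\<in>UNIV. \<Sum>i\<in>I. coeff (L i) (\<alpha> j) * i ^ \<beta> j)"
      using I by (subst prod_sum_PiE) auto
    also have "\<dots> = (\<Prod>j\<in>UNIV. if \<alpha> j = \<beta> j then 1 else 0)" by (simp add: co b)
    also have "\<dots> = (if \<alpha> = \<beta> then 1 else 0)"
    proof (cases "\<alpha> = \<beta>")
      case False
      then obtain j where "\<alpha> j \<noteq> \<beta> j" by blast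
      then show ?thesis using False by (subst prod_zero) auto
    qed simp
    finally show ?thesis .
  qed
  show ?thesis unfolding coeff_bounded_def
  proof (intro exI[of _ C] conjI ballI allI impI)
    fix q :: "real^'n \<Rightarrow> real" and x0 :: "real^'n" and h S :: real
    assume q: "q \<in> Polys k" and h: "h > 0" and S: "\<forall>x. (\<forall>i. \<bar>x $ i - x0 $ i\<bar> \<le> h) \<longrightarrow> \<bar>q x\<bar> \<le> S"
    have "\<bar>q x0\<bar> \<le> S" using S h by auto
    then have S0: "S \<ge> 0" by linarith
    have "(\<lambda>y. q (x0 + h *\<^sub>R y)) \<in> Polys k" by (rule Polys_translate_scale[OF q])
    then obtain c where c: "(\<lambda>y. q (x0 + h *\<^sub>R y)) = (\<lambda>y. \<Sum>\<alpha> | mdegree \<alpha> \<le> k. c \<alpha> * monomial \<alpha> y)"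
      by (auto simp: Polys_def)
    have c': "q (x0 + h *\<^sub>R y) = (\<Sum>\<alpha> | mdegree \<alpha> \<le> k. c \<alpha> * monomial \<alpha> y)" for y
      using fun_cong[OF c] .
    have "q x = (\<Sum>\<alpha> | mdegree \<alpha> \<le> k. c \<alpha> * monomial \<alpha> ((1/h) *\<^sub>R (x - x0)))" for x
      using c'[of "(1/h) *\<^sub>R (x - x0)"] h by simp
    moreover have "\<bar>c \<alpha>\<bar> \<le> C * S" if a: "mdegree \<alpha> \<le> k" for \<alpha>
    proof -
      have "(\<Sum>\<iota>\<in>?P. w \<alpha> \<iota> * q (x0 + h *\<^sub>R (\<chi> j. \<iota> j))) = (\<Sum>\<iota>\<in>?P. \<Sum>\<beta> | mdegree \<beta> \<le> k. c \<beta> * (w \<alpha> \<iota> * monomial \<beta> (\<chi> j. \<iota> j)))"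
        unfolding c' by (simp add: sum_distrib_left mult_ac)
      also have "\<dots> = (\<Sum>\<beta> | mdegree \<beta> \<le> k. c \<beta> * (\<Sum>\<iota>\<in>?P. w \<alpha> \<iota> * monomial \<beta> (\<chi> j. \<iota> j)))"
        by (subst sum.swap) (simp add: sum_distrib_left)
      also have "\<dots> = (\<Sum>\<beta> | mdegree \<beta> \<le> k. if \<alpha> = \<beta> then c \<beta> else 0)"
        by (rule sum.cong) (auto simp: wm)
      also have "\<dots> = c \<alpha>" using a by (simp add: sum.delta finite_mdegree_le)
      finally have "c \<alpha> = (\<Sum>\<iota>\<in>?P. w \<alpha> \<iota> * q (x0 + h *\<^sub>R (\<chi> j. \<iota> j)))" ..
      then have "\<bar>c \<alpha>\<bar> \<le> (\<Sum>\<iota>\<in>?P. \<bar>w \<alpha> \<iota> * q (x0 + h *\<^sub>R (\<chi> j. \<iota> j))\<bar>)" by simp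
      also have "\<dots> \<le> (\<Sum>\<iota>\<in>?P. \<bar>w \<alpha> \<iota>\<bar> * S)"
      proof (rule sum_mono)
        fix \<iota> assume "\<iota> \<in> ?P"
        then have "\<iota> j \<in> {0..1}" for j using I(3) by (auto simp: PiE_iff)
        then have "\<bar>(x0 + h *\<^sub>R (\<chi> j. \<iota> j)) $ j - x0 $ j\<bar> \<le> h" for j using h by (auto simp: abs_mult intro!: mult_left_le)
        then have "\<bar>q (x0 + h *\<^sub>R (\<chi> j. \<iota> j))\<bar> \<le> S" using S by blast
        then show "\<bar>w \<alpha> \<iota> * q (x0 + h *\<^sub>R (\<chi> j. \<iota> j))\<bar> \<le> \<bar>w \<alpha> \<iota>\<bar> * S"
          unfolding abs_mult by (rule mult_left_mono) auto
      qed
      also have "\<dots> = (\<Sum>\<iota>\<in>?P. \<bar>w \<alpha> \<iota>\<bar>) * S" by (simp add: sum_distrib_right)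
      also have "\<dots> \<le> C * S"
      proof (rule mult_right_mono[OF _ S0])
        have "(\<Sum>\<iota>\<in>?P. \<bar>w \<alpha> \<iota>\<bar>) \<le> (\<Sum>\<alpha> | mdegree \<alpha> \<le> k. \<Sum>\<iota>\<in>?P. \<bar>w \<alpha> \<iota>\<bar>)"
          using a by (intro member_le_sum[of \<alpha> _ "\<lambda>\<alpha>. \<Sum>\<iota>\<in>?P. \<bar>w \<alpha> \<iota>\<bar>"] sum_nonneg finite_mdegree_le) auto
        then show "(\<Sum>\<iota>\<in>?P. \<bar>w \<alpha> \<iota>\<bar>) \<le> C" by (simp add: C_def)
      qed
      finally show ?thesis .
    qed
    ultimately show "\<exists>c. (\<forall>x. q x = (\<Sum>\<alpha> | mdegree \<alpha> \<le> k. c \<alpha> * monomial \<alpha> ((1/h) *\<^sub>R (x - x0)))) \<and> (\<forall>\<alpha>. mdegree \<alpha> \<le> k \<longrightarrow> \<bar>c \<alpha>\<bar> \<le> C * S)"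
      by blast
  qed fact
qed

section \<open>Polar coordinates in star-shaped cells\<close>

text \<open>The map \<open>\<kappa>\<close> matches the two standard bases, so it carries boxes to
  boxes and preserves Lebesgue measure. Composed with it, \<open>f\<close> becomes an orthogonal
  transformation of the Cartesian space, to which invariance of the measure under orthogonal maps
  applies.\<close>

lemma distr_lborel_isometry:
  fixes f :: "'a::euclidean_space \<Rightarrow> real^'n::{finite,wellorder}"
  assumes lin: "linear f" and nrm: "\<And>x. norm (f x) = norm x" and dim: "DIM('a) = CARD('n)"
  shows "distr lborel borel f = lborel"
proof -
  obtain \<beta> where \<beta>: "bij_betw \<beta> (Basis::'a set) (Basis::((real,'n) vec) set)"
    using finite_same_card_bij[of "Basis::'a set" "Basis::((real,'n) vec) set"] dim by auto
  define \<kappa> where "\<kappa> x = (\<Sum>b\<in>Basis. (x \<bullet> \<beta> b) *\<^sub>R b)" for x :: "(real,'n) vec"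
  have [simp]: "\<kappa> x \<bullet> b = x \<bullet> \<beta> b" if "b \<in> Basis" for x b
    using that by (simp add: \<kappa>_def inner_sum_left inner_Basis sum.delta if_distrib[of "\<lambda>x. _ * x"] cong: if_cong)
  have [measurable]: "f \<in> borel_measurable borel" using lin
    by (intro borel_measurable_continuous_onI linear_continuous_on) (simp add: linear_conv_bounded_linear)
  have linK: "linear \<kappa>" unfolding \<kappa>_def
    by (rule linearI) (simp_all add: inner_left_distrib scaleR_add_left sum.distrib scaleR_sum_right)
  have [measurable]: "\<kappa> \<in> borel_measurable borel"
    using linK by (intro borel_measurable_continuous_onI linear_continuous_on) (simp add: linear_conv_bounded_linear)
  have nK: "norm (\<kappa> x) = norm x" for x
  proof -
    have "norm (\<kappa> x) ^ 2 = (\<Sum>b\<in>Basis. (x \<bullet> \<beta> b)^2)"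
      unfolding power2_norm_eq_inner by (subst euclidean_inner) (simp add: power2_eq_square)
    also have "\<dots> = (\<Sum>b\<in>Basis. (x \<bullet> b)^2)"
      using sum.reindex_bij_betw[OF \<beta>, of "\<lambda>b. (x \<bullet> b)^2"] .
    also have "\<dots> = norm x ^ 2"
      unfolding power2_norm_eq_inner by (subst euclidean_inner) (simp add: power2_eq_square)
    finally show ?thesis by simp
  qed
  have K: "lborel = distr lborel borel \<kappa>"
  proof (rule lborel_eqI)
    fix l u :: 'a assume lu: "\<And>b. b \<in> Basis \<Longrightarrow> l \<bullet> b \<le> u \<bullet> b"
    define S where "S w = (\<Sum>b\<in>Basis. (w \<bullet> b) *\<^sub>R \<beta> b)" for w :: 'a
    have S: "S w \<bullet> \<beta> b = w \<bullet> b" if b: "b \<in> Basis" for w b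
    proof -
      have "S w \<bullet> \<beta> b = (\<Sum>a\<in>Basis. if a = b then w \<bullet> a else 0)"
        unfolding S_def inner_sum_left using bij_betwE[OF \<beta>] b bij_betw_imp_inj_on[OF \<beta>]
        by (intro sum.cong) (auto simp: inner_Basis inj_on_eq_iff)
      then show ?thesis using b by (simp add: sum.delta)
    qed
    have im: "\<beta> ` Basis = Basis" using \<beta> by (rule bij_betw_imp_surj_on)
    have all: "(\<forall>b\<in>Basis. Q (\<beta> b)) = (\<forall>b\<in>Basis. Q b)" for Q by (metis im imageE imageI)
    have "\<kappa> -` box l u = box (S l) (S u)"
      unfolding box_def using all[of "\<lambda>b. S l \<bullet> b < _ \<bullet> b \<and> _ \<bullet> b < S u \<bullet> b"] by (auto simp: S)
    moreover have "S l \<bullet> b \<le> S u \<bullet> b" if "b \<in> Basis" for b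
      using that lu all[of "\<lambda>b. S l \<bullet> b \<le> S u \<bullet> b"] by (auto simp: S)
    moreover have "(\<Prod>b\<in>Basis. (S u - S l) \<bullet> b) = (\<Prod>b\<in>Basis. (u - l) \<bullet> b)"
      unfolding prod.reindex_bij_betw[OF \<beta>, symmetric] by (intro prod.cong) (auto simp: inner_diff_left S)
    ultimately show "emeasure (distr lborel borel \<kappa>) (box l u) = (\<Prod>b\<in>Basis. (u - l) \<bullet> b)"
      by (subst emeasure_distr) auto
  qed auto
  let ?g = "f \<circ> \<kappa>"
  have og: "orthogonal_transformation ?g"
    using linear_compose[OF linK lin] by (simp add: orthogonal_transformation nrm nK)
  have "lborel = distr lborel borel ?g"
  proof (rule lborel_eqI)
    fix l u :: "(real,'n) vec" assume lu: "\<And>b. b \<in> Basis \<Longrightarrow> l \<bullet> b \<le> u \<bullet> b"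
    have "?g -` box l u = inv ?g ` box l u"
      using bij_vimage_eq_inv_image[OF orthogonal_transformation_bij[OF og]] .
    moreover have "inv ?g ` box l u \<in> lmeasurable \<and> measure lebesgue (inv ?g ` box l u) = measure lebesgue (box l u)"
      using measurable_orthogonal_image[OF orthogonal_transformation_inv[OF og]]
        measure_orthogonal_image[OF orthogonal_transformation_inv[OF og]] by auto
    ultimately have m: "?g -` box l u \<in> lmeasurable" "measure lebesgue (?g -` box l u) = measure lebesgue (box l u)" by auto
    have b: "?g -` box l u \<in> sets borel"
      using measurable_sets_borel[of ?g borel "box l u"] by (simp add: measurable_comp)
    have "emeasure (distr lborel borel ?g) (box l u) = emeasure lborel (?g -` box l u)"
      by (subst emeasure_distr) auto
    also have "\<dots> = emeasure lebesgue (?g -` box l u)" using b by simp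
    also have "\<dots> = ennreal (measure lebesgue (box l u))"
      using m by (simp add: emeasure_eq_measure2)
    also have "\<dots> = (\<Prod>b\<in>Basis. (u - l) \<bullet> b)"
      using lu by (simp add: measure_lborel_box_eq)
    finally show "emeasure (distr lborel borel ?g) (box l u) = (\<Prod>b\<in>Basis. (u - l) \<bullet> b)" .
  qed auto
  moreover have "distr lborel borel ?g = distr (distr lborel borel \<kappa>) borel f"
    by (subst distr_distr) auto
  ultimately show ?thesis using K by simp
qed

lemma nn_integral_affine:
  fixes g :: "'a::euclidean_space \<Rightarrow> ennreal"
  assumes [measurable]: "g \<in> borel_measurable borel" and "s \<noteq> 0"
  shows "(\<integral>\<^sup>+y. g y \<partial>lborel) = ennreal (\<bar>s\<bar> ^ DIM('a)) * (\<integral>\<^sup>+y. g (a + s *\<^sub>R y) \<partial>lborel)"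
  by (subst lborel_affine[OF assms(2), of a]) (simp add: nn_integral_density nn_integral_distr nn_integral_cmult)

text \<open>The map sending \<open>(y, z)\<close> to \<open>L y + z n\<close> is an isometry,
  because \<open>n\<close> is a unit normal of the range of \<open>L\<close>; Tonelli's theorem on
  the product gives the slices.\<close>

lemma nn_integral_hyperplane_slices:
  fixes L :: "'b::euclidean_space \<Rightarrow> real^'n::{finite,wellorder}"
  assumes [measurable]: "f \<in> borel_measurable borel" and lin: "linear L" and nrm: "\<And>x. norm (L x) = norm x"
    and dim: "DIM('b) + 1 = CARD('n)" and n: "norm n = 1" "\<And>y. L y \<bullet> n = 0"
  shows "(\<integral>\<^sup>+x. f x \<partial>lborel) = (\<integral>\<^sup>+z. \<integral>\<^sup>+y. f (a + L y + z *\<^sub>R n) \<partial>lborel \<partial>lborel)"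
proof -
  define \<Psi> where "\<Psi> p = L (fst p) + snd p *\<^sub>R n" for p :: "'b \<times> real"
  have lin\<Psi>: "linear \<Psi>" unfolding \<Psi>_def
    by (rule linearI) (simp_all add: linear_add[OF lin] linear_cmul[OF lin] algebra_simps)
  have [measurable]: "\<Psi> \<in> borel_measurable borel"
    using lin\<Psi> by (intro borel_measurable_continuous_onI linear_continuous_on) (simp add: linear_conv_bounded_linear)
  have "norm (\<Psi> p)^2 = norm p ^ 2" for p
  proof -
    have "norm (\<Psi> p)^2 = norm (L (fst p))^2 + norm (snd p *\<^sub>R n)^2"
      unfolding \<Psi>_def power2_norm_eq_inner using n(2)[of "fst p"] by (simp add: inner_add_left inner_add_right inner_commute)
    then show ?thesis by (simp add: nrm n norm_prod_def)
  qed
  then have "distr lborel borel \<Psi> = lborel"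
    using dim by (intro distr_lborel_isometry lin\<Psi>) auto
  then have "(\<integral>\<^sup>+x. f x \<partial>lborel) = (\<integral>\<^sup>+p. f (a + \<Psi> p) \<partial>lborel)"
    using nn_integral_affine[of f 1 a]
    by (simp, subst nn_integral_distr[symmetric, of \<Psi> _ borel]) auto
  also have "\<dots> = (\<integral>\<^sup>+p. f (a + \<Psi> p) \<partial>(lborel \<Otimes>\<^sub>M lborel))" by (simp add: lborel_prod)
  also have "\<dots> = (\<integral>\<^sup>+z. \<integral>\<^sup>+y. f (a + \<Psi> (y, z)) \<partial>lborel \<partial>lborel)"
    by (subst lborel_pair.nn_integral_snd[symmetric]) (auto simp: lborel_prod)
  finally show ?thesis by (simp add: \<Psi>_def add.assoc)
qed

text \<open>Polar coordinates with apex \<open>a\<close> over the hyperplane through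
  \<open>p\<close>: slice at height \<open>s * d\<close> and rescale the slice by \<open>s\<close>.
  The factor \<open>d\<close> stems from the height and the power of \<open>s\<close> from the
  rescaling. Since \<open>f\<close> vanishes below the apex, only positive \<open>s\<close>
  contribute.\<close>

lemma nn_integral_cone:
  fixes L :: "'b::euclidean_space \<Rightarrow> real^'n::{finite,wellorder}"
  assumes [measurable]: "f \<in> borel_measurable borel" and lin: "linear L" and nrm: "\<And>x. norm (L x) = norm x"
    and dim: "DIM('b) + 1 = CARD('n)" and n: "norm n = 1" "\<And>y. L y \<bullet> n = 0"
    and d: "d = (p - a) \<bullet> n" "d > 0" and z: "\<And>x. (x - a) \<bullet> n \<le> 0 \<Longrightarrow> f x = 0"
  shows "(\<integral>\<^sup>+x. f x \<partial>lborel) = (\<integral>\<^sup>+s. \<integral>\<^sup>+y.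
     indicator {0<..} s * (ennreal (d * s ^ DIM('b)) * f (a + s *\<^sub>R (p + L y - a))) \<partial>lborel \<partial>lborel)"
proof -
  have contL: "continuous_on UNIV L" using lin by (simp add: linear_conv_bounded_linear linear_continuous_on)
  have [measurable]: "L \<in> borel_measurable borel"
    using contL by (intro borel_measurable_continuous_onI)
  \<comment> \<open>\<open>a + d n\<close> is the foot of the perpendicular from \<open>a\<close> on
    the hyperplane through \<open>p\<close>. The coordinates \<open>y0\<close> of \<open>p\<close>
    relative to this foot are needed to write the points of a slice as points on rays from
    \<open>a\<close>.\<close>
  have "\<exists>y0. L y0 = p - a - d *\<^sub>R n"
  proof -
    have inj: "inj L" using linear_injective_0[OF lin] nrm by (metis norm_eq_zero)
    have "dim (range L) = DIM('b)" using dim_image_eq[OF lin, of UNIV] inj by simp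
    have sub: "subspace (range L)" using lin linear_subspace_image subspace_UNIV by blast
    have orth: "n \<notin> range L" using n by (metis imageE inner_eq_zero_iff norm_zero zero_neq_one)
    have "span (range L) = range L" using sub by (rule span_eq_iff[THEN iffD2])
    with orth have "n \<notin> span (range L)" by metis
    then have "dim (insert n (range L)) = DIM((real,'n) vec)" using dim \<open>dim (range L) = DIM('b)\<close>
      by (simp add: dim_insert del: span_eq_iff)
    then have "span (insert n (range L)) = UNIV" using dim_eq_full by blast
    then have "p - a \<in> span (insert n (range L))" by simp
    then obtain k where "p - a - k *\<^sub>R n \<in> span (range L)" using span_breakdown_eq by blast
    then obtain y0 where y0: "p - a - k *\<^sub>R n = L y0" using \<open>span (range L) = range L\<close> by auto
    have "k = d"
    proof -
      have "(p - a - k *\<^sub>R n) \<bullet> n = 0" using y0 n by simp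
      then show ?thesis using d n by (simp add: inner_diff_left dot_square_norm)
    qed
    then show ?thesis using y0 by auto
  qed
  then obtain y0 where y0: "L y0 = p - a - d *\<^sub>R n" ..
  define F where "F z = (\<integral>\<^sup>+y. f (a + L y + z *\<^sub>R n) \<partial>lborel)" for z
  have [measurable]: "F \<in> borel_measurable borel" unfolding F_def by measurable
  have "(\<integral>\<^sup>+x. f x \<partial>lborel) = (\<integral>\<^sup>+z. F z \<partial>lborel)"
    unfolding F_def by (rule nn_integral_hyperplane_slices[OF assms(1-6)])
  also have "\<dots> = ennreal d * (\<integral>\<^sup>+s. F (s * d) \<partial>lborel)"
    using nn_integral_affine[of F d 0] d by (simp add: mult.commute)
  also have "\<dots> = (\<integral>\<^sup>+s. ennreal d * F (s * d) \<partial>lborel)"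
    by (subst nn_integral_cmult) auto
  also have "\<dots> = (\<integral>\<^sup>+s. \<integral>\<^sup>+y.
     indicator {0<..} s * (ennreal (d * s ^ DIM('b)) * f (a + s *\<^sub>R (p + L y - a))) \<partial>lborel \<partial>lborel)"
  proof (rule nn_integral_cong)
    fix s :: real
    show "ennreal d * F (s * d) = (\<integral>\<^sup>+y. indicator {0<..} s * (ennreal (d * s ^ DIM('b)) * f (a + s *\<^sub>R (p + L y - a))) \<partial>lborel)"
    proof (cases "s > 0")
      case True
      have "F (s * d) = ennreal (s ^ DIM('b)) * (\<integral>\<^sup>+y. f (a + L (s *\<^sub>R y0 + s *\<^sub>R y) + (s * d) *\<^sub>R n) \<partial>lborel)"
        unfolding F_def using True by (subst nn_integral_affine[of _ s "s *\<^sub>R y0"]) auto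
      moreover have "a + L (s *\<^sub>R y0 + s *\<^sub>R y) + (s * d) *\<^sub>R n = a + s *\<^sub>R (p + L y - a)" for y
        by (simp add: linear_add[OF lin] linear_cmul[OF lin] y0 algebra_simps)
      ultimately have "F (s * d) = ennreal (s ^ DIM('b)) * (\<integral>\<^sup>+y. f (a + s *\<^sub>R (p + L y - a)) \<partial>lborel)" by simp
      then have "ennreal d * F (s * d) = ennreal (d * s ^ DIM('b)) * (\<integral>\<^sup>+y. f (a + s *\<^sub>R (p + L y - a)) \<partial>lborel)"
        using d True by (simp add: ennreal_mult mult.assoc)
      then show ?thesis using True by (subst nn_integral_cmult[symmetric, OF _ ] | simp)+
    next
      case False
      have "f (a + L y + (s * d) *\<^sub>R n) = 0" for y
        using False d n by (intro z) (auto simp: inner_add_left dot_square_norm mult_nonpos_nonneg)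
      then show ?thesis using False by (simp add: F_def)
    qed
  qed
  finally show ?thesis .
qed

text \<open>One setting serves both levels of the stability argument: a face in its plane with its
  edges, and an element with its faces. The boundary pieces are given by isometric parametrisations
  with null overlaps, because they need not be convex and two of them may lie in one hyperplane. The
  length \<open>h\<close> is identified with the diameter only later, in
  \<open>vem_bounded\<close>.\<close>

locale star_cell =
  fixes D :: "(real^'n::{finite,wellorder}) set" and c and h \<rho> :: real and I :: "'i set"
    and Y :: "'i \<Rightarrow> 'b::euclidean_space set" and P :: "'i \<Rightarrow> (real,'n) vec" and L :: "'i \<Rightarrow> 'b \<Rightarrow> (real,'n) vec"
  assumes compact_D: "compact D" and h_pos: "0 < h" and \<rho>_pos: "0 < \<rho>" and \<rho>_le: "\<rho> \<le> 1"
    and D_subset: "D \<subseteq> cball c h" and ball_subset: "ball c (\<rho> * h) \<subseteq> D"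
    and star: "\<And>x b. b \<in> ball c (\<rho> * h) \<Longrightarrow> x \<in> D \<Longrightarrow> closed_segment x b \<subseteq> D"
    and finite_I: "finite I" and frontier_D: "frontier D = (\<Union>i\<in>I. (\<lambda>y. P i + L i y) ` Y i)"
    and compact_Y: "\<And>i. i \<in> I \<Longrightarrow> compact (Y i)" and interior_Y: "\<And>i. i \<in> I \<Longrightarrow> interior (Y i) \<noteq> {}"
    and linear_L: "\<And>i. i \<in> I \<Longrightarrow> linear (L i)" and norm_L: "\<And>i y. i \<in> I \<Longrightarrow> norm (L i y) = norm y"
    and dim_b: "DIM('b) + 1 = CARD('n)"
    and overlap: "\<And>i j. i \<in> I \<Longrightarrow> j \<in> I \<Longrightarrow> i \<noteq> j \<Longrightarrow>
       negligible {y \<in> Y i. P i + L i y \<in> (\<lambda>y. P j + L j y) ` Y j}"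
begin

definition \<Phi> :: "'i \<Rightarrow> 'b \<Rightarrow> (real,'n) vec" where "\<Phi> i y = P i + L i y"

lemma frontier_\<Phi>: "frontier D = (\<Union>i\<in>I. \<Phi> i ` Y i)"
  using frontier_D by (simp add: \<Phi>_def[abs_def])

lemma overlap_\<Phi>: "i \<in> I \<Longrightarrow> j \<in> I \<Longrightarrow> i \<noteq> j \<Longrightarrow> negligible {y \<in> Y i. \<Phi> i y \<in> \<Phi> j ` Y j}"
  using overlap by (simp add: \<Phi>_def[abs_def])

lemma dist_\<Phi>: "i \<in> I \<Longrightarrow> dist (\<Phi> i y) (\<Phi> i z) = dist y z"
  unfolding \<Phi>_def dist_norm using norm_L[of i "y - z"] linear_diff[OF linear_L, of i y z] by simp

lemma inj_\<Phi>: "i \<in> I \<Longrightarrow> inj (\<Phi> i)"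
  by (metis dist_\<Phi> dist_eq_0_iff injI)

lemma continuous_\<Phi>: "i \<in> I \<Longrightarrow> continuous_on S (\<Phi> i)"
  unfolding \<Phi>_def[abs_def] using linear_L
  by (intro continuous_intros linear_continuous_on) (simp add: linear_conv_bounded_linear)

lemma measurable_\<Phi>: "i \<in> I \<Longrightarrow> \<Phi> i \<in> borel_measurable borel"
  by (intro borel_measurable_continuous_onI continuous_\<Phi>)

lemma \<Phi>_in_frontier: "i \<in> I \<Longrightarrow> y \<in> Y i \<Longrightarrow> \<Phi> i y \<in> frontier D"
  unfolding frontier_\<Phi> by blast

lemma closed_D: "closed D" using compact_D compact_imp_closed by blast

lemma frontier_subset: "frontier D \<subseteq> D" using closed_D frontier_subset_eq by blast

lemma \<Phi>_in_D: "i \<in> I \<Longrightarrow> y \<in> Y i \<Longrightarrow> \<Phi> i y \<in> D"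
  using \<Phi>_in_frontier frontier_subset by blast

lemma star_point:
  assumes "a \<in> ball c (\<rho> * h)" "x \<in> D" "0 \<le> t" "t \<le> 1" shows "a + t *\<^sub>R (x - a) \<in> D"
proof -
  have "a + t *\<^sub>R (x - a) = (1 - (1 - t)) *\<^sub>R x + (1 - t) *\<^sub>R a" by (simp add: algebra_simps)
  then have "a + t *\<^sub>R (x - a) \<in> closed_segment x a"
    unfolding closed_segment_def using assms by (auto intro!: exI[of _ "1 - t"])
  then show ?thesis using star assms by blast
qed

text \<open>A point \<open>z\<close> of the small ball equals \<open>b + t (x - b)\<close>, where
  \<open>b\<close> is the apex \<open>a\<close> moved by the offset of \<open>z\<close> divided by
  \<open>1 - t\<close>; the radius is exactly such that \<open>b\<close> remains in the ball of star
  centres.\<close>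

lemma shrink_ball:
  assumes a: "a \<in> ball c (\<rho> * h)" and x: "x \<in> D" and t: "0 \<le> t" "t < 1"
  shows "ball (a + t *\<^sub>R (x - a)) ((1 - t) * (\<rho> * h - dist c a)) \<subseteq> D"
proof
  fix z assume z: "z \<in> ball (a + t *\<^sub>R (x - a)) ((1 - t) * (\<rho> * h - dist c a))"
  define b where "b = a + (1 / (1 - t)) *\<^sub>R (z - (a + t *\<^sub>R (x - a)))"
  have "dist a b = dist z (a + t *\<^sub>R (x - a)) / (1 - t)"
    using t by (simp add: b_def dist_norm)
  also have "\<dots> < \<rho> * h - dist c a" using z t by (simp add: divide_less_eq dist_commute mult.commute)
  finally have "b \<in> ball c (\<rho> * h)" using dist_triangle[of c b a] by simp
  then have "b + t *\<^sub>R (x - b) \<in> D" using star_point x t by simp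
  moreover have "b + t *\<^sub>R (x - b) = z"
  proof -
    have "(1 - t) *\<^sub>R b = (1 - t) *\<^sub>R a + (z - (a + t *\<^sub>R (x - a)))" using t by (simp add: b_def scaleR_add_right)
    then show ?thesis by (simp add: algebra_simps)
  qed
  ultimately show "z \<in> D" by simp
qed

lemma shrink_interior:
  assumes "a \<in> ball c (\<rho> * h)" "x \<in> D" "0 \<le> t" "t < 1"
  shows "a + t *\<^sub>R (x - a) \<in> interior D"
proof (rule interiorI[OF open_ball _ shrink_ball[OF assms]])
  show "a + t *\<^sub>R (x - a) \<in> ball (a + t *\<^sub>R (x - a)) ((1 - t) * (\<rho> * h - dist c a))" using assms by simp
qed

lemma c_in_ball: "c \<in> ball c (\<rho> * h)" using \<rho>_pos h_pos by simp

lemma ball_interior: "ball c (\<rho> * h) \<subseteq> interior D" using ball_subset by (simp add: interior_maximal)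

text \<open>Of two frontier points on one ray from a star centre, the nearer one would be interior
  by \<open>shrink_interior\<close>.\<close>

lemma ray_unique:
  assumes a: "a \<in> ball c (\<rho> * h)" and x: "x \<in> frontier D" "y \<in> frontier D"
    and e: "s *\<^sub>R (x - a) = t *\<^sub>R (y - a)" and "0 < s" "0 < t"
  shows "s = t" "x = y"
proof -
  have *: "\<not> s < t" if "s *\<^sub>R (x - a) = t *\<^sub>R (y - a)" "0 < s" "0 < t" "x \<in> frontier D" "y \<in> frontier D" for s t x y
  proof
    assume "s < t"
    have "y = a + (s / t) *\<^sub>R (x - a)"
    proof -
      have "(s / t) *\<^sub>R (x - a) = (1 / t) *\<^sub>R (s *\<^sub>R (x - a))" by simp
      also have "\<dots> = y - a" using that by simp
      finally show ?thesis by simp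
    qed
    moreover have "a + (s / t) *\<^sub>R (x - a) \<in> interior D"
      using \<open>s < t\<close> that a frontier_subset by (intro shrink_interior) auto
    ultimately show False using that by (auto simp: frontier_def)
  qed
  show "s = t" using *[OF e \<open>0 < s\<close> \<open>0 < t\<close> x] *[OF e[symmetric] \<open>0 < t\<close> \<open>0 < s\<close> x(2,1)] by linarith
  then show "x = y" using e \<open>0 < t\<close> by simp
qed

text \<open>If the hyperplane of a piece came closer to \<open>c\<close> than
  \<open>\<rho> * h\<close>, it would contain a star centre \<open>b\<close>. Moving from a
  chart-interior point of the piece slightly towards \<open>b\<close> stays in the piece, but also
  enters the interior of the cell, although the piece belongs to the frontier. This lower bound on
  heights is all the boundary regularity that the later estimates use.\<close>

lemma normal_exists:
  assumes i: "i \<in> I"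
  shows "\<exists>n. norm n = 1 \<and> (\<forall>y. L i y \<bullet> n = 0) \<and> (P i - c) \<bullet> n \<ge> \<rho> * h"
proof -
  have "dim (range (L i)) < DIM((real,'n) vec)"
    using dim_image_le[OF linear_L[OF i], of UNIV] dim_b by simp
  then obtain n0 where n0: "n0 \<noteq> 0" "\<And>y. y \<in> span (range (L i)) \<Longrightarrow> orthogonal n0 y"
    using orthogonal_to_subspace_exists by metis
  define n1 where "n1 = (1 / norm n0) *\<^sub>R n0"
  have n1: "norm n1 = 1" "\<And>y. L i y \<bullet> n1 = 0"
    using n0(1) n0(2)[OF span_base, OF rangeI] by (auto simp: n1_def orthogonal_def inner_commute)
  define n where "n = (if (P i - c) \<bullet> n1 \<ge> 0 then n1 else - n1)"
  have n: "norm n = 1" "\<And>y. L i y \<bullet> n = 0" "(P i - c) \<bullet> n \<ge> 0" using n1 by (auto simp: n_def)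
  have "(P i - c) \<bullet> n \<ge> \<rho> * h"
  proof (rule ccontr)
    define d where "d = (P i - c) \<bullet> n"
    assume "\<not> (P i - c) \<bullet> n \<ge> \<rho> * h"
    then have d: "0 \<le> d" "d < \<rho> * h" using n by (auto simp: d_def)
    define b where "b = c + d *\<^sub>R n"
    have b: "b \<in> ball c (\<rho> * h)" using d n by (simp add: b_def dist_norm)
    have "P i - b \<in> range (L i)"
    proof -
      have "inj (L i)" using linear_injective_0[OF linear_L[OF i]] norm_L[OF i] by (metis norm_eq_zero)
      then have "dim (range (L i)) = DIM('b)" using dim_image_eq[OF linear_L[OF i], of UNIV] by simp
      have sub: "subspace (range (L i))" using linear_L[OF i] linear_subspace_image subspace_UNIV by blast
      have sp: "span (range (L i)) = range (L i)" using sub by (rule span_eq_iff[THEN iffD2])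
      have "n \<notin> range (L i)" using n by (metis imageE inner_eq_zero_iff norm_zero zero_neq_one)
      then have "n \<notin> span (range (L i))" unfolding sp .
      then have "dim (insert n (range (L i))) = dim (range (L i)) + 1" by (simp only: dim_insert if_False)
      then have "dim (insert n (range (L i))) = DIM((real,'n) vec)"
        using dim_b \<open>dim (range (L i)) = DIM('b)\<close> by simp
      then have "span (insert n (range (L i))) = UNIV" using dim_eq_full by blast
      then have "P i - b \<in> span (insert n (range (L i)))" by simp
      then obtain k where "P i - b - k *\<^sub>R n \<in> span (range (L i))" using span_breakdown_eq by blast
      then have k: "P i - b - k *\<^sub>R n \<in> range (L i)" by (simp only: sp)
      then obtain y where y: "P i - b - k *\<^sub>R n = L i y" by blast
      have "(P i - b - k *\<^sub>R n) \<bullet> n = 0" unfolding y by (rule n(2))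
      moreover have "(P i - b) \<bullet> n = 0" using n by (simp add: b_def d_def inner_diff_left inner_add_left dot_square_norm)
      ultimately have "k = 0" using n by (simp add: inner_diff_left dot_square_norm)
      then show ?thesis using k by simp
    qed
    then obtain yb where yb: "\<Phi> i yb = b"
    proof -
      obtain z where "P i - b = L i z" using \<open>P i - b \<in> range (L i)\<close> by blast
      then have "L i (- z) = b - P i" using linear_neg[OF linear_L[OF i], of z] by (metis minus_diff_eq)
      then have "\<Phi> i (- z) = b" by (simp add: \<Phi>_def)
      then show ?thesis by (rule that)
    qed
    obtain y0 where y0: "y0 \<in> interior (Y i)" using interior_Y[OF i] by blast
    then obtain e where e: "e > 0" "ball y0 e \<subseteq> Y i" by (meson interior_subset mem_interior)
    \<comment> \<open>Small enough for \<open>y1\<close>, which lies a fraction \<open>1 - t\<close>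
      of the way from \<open>yb\<close> to \<open>y0\<close>, to remain in the chart domain.\<close>
    obtain t where t: "0 < t" "t < 1" "t * dist y0 yb < e"
    proof -
      define t where "t = min (1/2) (e / (2 * (dist y0 yb + 1)))"
      have "t * dist y0 yb \<le> (e / (2 * (dist y0 yb + 1))) * dist y0 yb" by (intro mult_right_mono) (auto simp: t_def)
      also have "\<dots> = e * (dist y0 yb / (2 * (dist y0 yb + 1)))" by simp
      also have "\<dots> < e * 1"
      proof (rule mult_strict_left_mono[OF _ e(1)])
        have "0 < 2 * (dist y0 yb + 1)" by (intro mult_pos_pos add_nonneg_pos) auto
        then show "dist y0 yb / (2 * (dist y0 yb + 1)) < 1" by (subst divide_less_eq_1_pos) auto
      qed
      also have "e * 1 = e" by simp
      finally show ?thesis using e(1) by (intro that[of t]) (auto simp: t_def add_nonneg_pos)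
    qed
    define y1 where "y1 = yb + (1 - t) *\<^sub>R (y0 - yb)"
    have "y0 - y1 = t *\<^sub>R (y0 - yb)" by (simp add: y1_def algebra_simps)
    then have "dist y0 y1 < e" using t by (simp add: dist_norm)
    then have "y1 \<in> Y i" using e by auto
    moreover have "\<Phi> i y1 = b + (1 - t) *\<^sub>R (\<Phi> i y0 - b)"
      unfolding yb[symmetric] by (simp add: \<Phi>_def y1_def linear_add[OF linear_L[OF i]] linear_diff[OF linear_L[OF i]] linear_cmul[OF linear_L[OF i]])
    moreover have "b + (1 - t) *\<^sub>R (\<Phi> i y0 - b) \<in> interior D"
      using t y0 \<Phi>_in_D[OF i] interior_subset by (intro shrink_interior b) auto
    ultimately show False using \<Phi>_in_frontier[OF i, of y1] by (auto simp: frontier_def)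
  qed
  then show ?thesis using n by blast
qed

definition \<nu> :: "'i \<Rightarrow> (real,'n) vec" where
  "\<nu> i = (SOME n. norm n = 1 \<and> (\<forall>y. L i y \<bullet> n = 0) \<and> (P i - c) \<bullet> n \<ge> \<rho> * h)"

lemma \<nu>: assumes "i \<in> I" shows "norm (\<nu> i) = 1" "L i y \<bullet> \<nu> i = 0" "(P i - c) \<bullet> \<nu> i \<ge> \<rho> * h"
  using someI_ex[OF normal_exists[OF assms]] unfolding \<nu>_def[symmetric] by auto

lemma height_pos: assumes "i \<in> I" "a \<in> ball c (\<rho> * h)" shows "(P i - a) \<bullet> \<nu> i > 0"
proof -
  have "(a - c) \<bullet> \<nu> i \<le> norm (a - c)" using Cauchy_Schwarz_ineq2[of "a - c" "\<nu> i"] \<nu>(1)[OF assms(1)] by auto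
  then have "(a - c) \<bullet> \<nu> i < \<rho> * h" using assms by (simp add: dist_norm norm_minus_commute)
  then show ?thesis using \<nu>(3)[OF assms(1)] by (simp add: inner_diff_left)
qed

lemma height_\<Phi>: "i \<in> I \<Longrightarrow> (\<Phi> i y - a) \<bullet> \<nu> i = (P i - a) \<bullet> \<nu> i"
  by (simp add: \<Phi>_def inner_diff_left inner_add_left \<nu>)

text \<open>The open cone with apex \<open>a\<close> over piece \<open>i\<close>. Describing it by
  radial projection onto the hyperplane of the piece makes it Borel measurable, because the piece is
  compact.\<close>

definition cone :: "(real,'n) vec \<Rightarrow> 'i \<Rightarrow> (real,'n) vec set" where
  "cone a i = {x. 0 < (x - a) \<bullet> \<nu> i \<and> (x - a) \<bullet> \<nu> i < (P i - a) \<bullet> \<nu> i \<and>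
     a + ((P i - a) \<bullet> \<nu> i / ((x - a) \<bullet> \<nu> i)) *\<^sub>R (x - a) \<in> \<Phi> i ` Y i}"

lemma cone_iff:
  assumes i: "i \<in> I" and a: "a \<in> ball c (\<rho> * h)" and s: "s > 0"
  shows "a + s *\<^sub>R (\<Phi> i y - a) \<in> cone a i \<longleftrightarrow> s < 1 \<and> y \<in> Y i"
proof -
  let ?d = "(P i - a) \<bullet> \<nu> i"
  have d: "?d > 0" by (rule height_pos[OF i a])
  have "(a + s *\<^sub>R (\<Phi> i y - a) - a) \<bullet> \<nu> i = s * ?d" by (simp add: height_\<Phi>[OF i])
  moreover have "a + (?d / (s * ?d)) *\<^sub>R (a + s *\<^sub>R (\<Phi> i y - a) - a) = \<Phi> i y" using s d by simp
  moreover have "\<Phi> i y \<in> \<Phi> i ` Y i \<longleftrightarrow> y \<in> Y i" using inj_\<Phi>[OF i] by (simp add: inj_image_mem_iff)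
  moreover have "s * ?d < ?d \<longleftrightarrow> s < 1" using d by simp
  ultimately show ?thesis unfolding cone_def using s d by simp
qed

lemma in_coneE:
  assumes i: "i \<in> I" and a: "a \<in> ball c (\<rho> * h)" and x: "x \<in> cone a i"
  obtains s y where "0 < s" "s < 1" "y \<in> Y i" "x = a + s *\<^sub>R (\<Phi> i y - a)"
proof -
  let ?d = "(P i - a) \<bullet> \<nu> i" and ?z = "(x - a) \<bullet> \<nu> i"
  have d: "?d > 0" by (rule height_pos[OF i a])
  obtain y where y: "y \<in> Y i" "\<Phi> i y = a + (?d / ?z) *\<^sub>R (x - a)" and z: "0 < ?z" "?z < ?d"
    using x unfolding cone_def by force
  show ?thesis
    by (rule that[of "?z / ?d" y]) (use y z d in auto)
qed

lemma measurable_cone: assumes i: "i \<in> I" shows "cone a i \<in> sets borel"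
proof -
  have "closed (\<Phi> i ` Y i)" using compact_continuous_image[OF continuous_\<Phi>[OF i] compact_Y[OF i]] compact_imp_closed by blast
  then have [measurable]: "\<Phi> i ` Y i \<in> sets borel" by simp
  have "{x \<in> space borel. 0 < (x - a) \<bullet> \<nu> i \<and> (x - a) \<bullet> \<nu> i < (P i - a) \<bullet> \<nu> i \<and>
     a + ((P i - a) \<bullet> \<nu> i / ((x - a) \<bullet> \<nu> i)) *\<^sub>R (x - a) \<in> \<Phi> i ` Y i} \<in> sets borel"
    by measurable
  then show ?thesis by (simp add: cone_def)
qed

abbreviation (input) polar :: "(real,'n) vec \<Rightarrow> 'i \<Rightarrow> ((real,'n) vec \<Rightarrow> ennreal) \<Rightarrow> 'b \<Rightarrow> real \<Rightarrow> ennreal" where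
  "polar a i g y s \<equiv> indicator {0<..<1} s * (ennreal ((P i - a) \<bullet> \<nu> i * s ^ DIM('b)) * g (a + s *\<^sub>R (\<Phi> i y - a)))"

lemma nn_integral_one_cone:
  assumes i: "i \<in> I" and a: "a \<in> ball c (\<rho> * h)" and g[measurable]: "g \<in> borel_measurable borel"
  shows "(\<integral>\<^sup>+x. indicator (cone a i) x * g x \<partial>lborel) = (\<integral>\<^sup>+y. \<integral>\<^sup>+s. indicator (Y i) y * polar a i g y s \<partial>lborel \<partial>lborel)"
proof -
  have [measurable]: "cone a i \<in> sets borel" "\<Phi> i \<in> borel_measurable borel" "Y i \<in> sets borel"
    using measurable_cone[OF i] measurable_\<Phi>[OF i] borel_closed[OF compact_imp_closed[OF compact_Y[OF i]]] by auto
  let ?f = "\<lambda>x. indicator (cone a i) x * g x"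
  have fm: "?f \<in> borel_measurable borel" by measurable
  have "(\<integral>\<^sup>+x. ?f x \<partial>lborel) = (\<integral>\<^sup>+s. \<integral>\<^sup>+y.
     indicator {0<..} s * (ennreal ((P i - a) \<bullet> \<nu> i * s ^ DIM('b)) * ?f (a + s *\<^sub>R (P i + L i y - a))) \<partial>lborel \<partial>lborel)"
    by (rule nn_integral_cone[OF fm linear_L[OF i] norm_L[OF i] dim_b \<nu>(1)[OF i] \<nu>(2)[OF i] refl height_pos[OF i a]])
       (auto simp: cone_def indicator_def)
  also have "\<dots> = (\<integral>\<^sup>+s. \<integral>\<^sup>+y. indicator (Y i) y * polar a i g y s \<partial>lborel \<partial>lborel)"
  proof (intro nn_integral_cong)
    fix s :: real and y
    show "indicator {0<..} s * (ennreal ((P i - a) \<bullet> \<nu> i * s ^ DIM('b)) * ?f (a + s *\<^sub>R (P i + L i y - a))) =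
      indicator (Y i) y * polar a i g y s"
      unfolding \<Phi>_def[symmetric]
      by (cases "s > 0") (simp_all add: indicator_def cone_iff[OF i a])
  qed
  also have "\<dots> = (\<integral>\<^sup>+y. \<integral>\<^sup>+s. indicator (Y i) y * polar a i g y s \<partial>lborel \<partial>lborel)"
    by (rule lborel_pair.Fubini') measurable
  finally show ?thesis .
qed

lemma negligible_hyperplane': "i \<in> I \<Longrightarrow> negligible (\<Phi> i ` Y i)"
proof -
  assume i: "i \<in> I"
  have "\<Phi> i ` Y i \<subseteq> {x. \<nu> i \<bullet> x = \<nu> i \<bullet> P i}"
    using \<nu>(2)[OF i] by (auto simp: \<Phi>_def inner_add_left inner_commute[of "\<nu> i"])
  moreover have "\<nu> i \<noteq> 0" using \<nu>(1)[OF i] by auto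
  ultimately show ?thesis using negligible_hyperplane negligible_subset by blast
qed

lemma negligible_frontier: "negligible (frontier D)"
  unfolding frontier_\<Phi> using finite_I negligible_hyperplane' by (intro negligible_Union) auto

text \<open>Rays from \<open>a\<close> leave the cell exactly once, so the cones cover it up to the
  frontier and the apex. A point in two cones lies on a ray through a common point of two pieces; in
  polar coordinates over one piece such directions form a null set.\<close>

lemma AE_in_one_cone:
  assumes a: "a \<in> ball c (\<rho> * h)"
  shows "AE x in lborel. indicator D x = (\<Sum>i\<in>I. indicator (cone a i) x :: ennreal)"
proof -
  define N where "N = frontier D \<union> {a}"
  have "AE x in lborel. x \<notin> N"
  proof -
    have "negligible N" unfolding N_def using negligible_frontier by simp
    then have "AE x in lebesgue. x \<notin> N" by (simp add: negligible_iff_null_sets AE_not_in)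
    moreover have "N \<in> sets borel" unfolding N_def by (simp add: frontier_closed borel_closed)
    ultimately show ?thesis using AE_completion_iff[of "\<lambda>x. x \<notin> N" lborel] by simp
  qed
  moreover have "AE x in lborel. \<forall>i\<in>I. \<forall>j\<in>I. i \<noteq> j \<longrightarrow> x \<notin> cone a i \<inter> cone a j"
  proof (intro AE_finite_allI finite_I)
    fix i j assume i: "i \<in> I" and j: "j \<in> I"
    show "AE x in lborel. i \<noteq> j \<longrightarrow> x \<notin> cone a i \<inter> cone a j"
    proof (cases "i = j")
      case False
      let ?N = "{y \<in> Y i. \<Phi> i y \<in> \<Phi> j ` Y j}"
      have neg: "AE y in lborel. y \<notin> ?N"
      proof -
        have "closed (\<Phi> j ` Y j)" using compact_continuous_image[OF continuous_\<Phi>[OF j] compact_Y[OF j]] compact_imp_closed by blast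
        then have "closed (\<Phi> i -` (\<Phi> j ` Y j))" by (rule closed_vimage[OF _ continuous_\<Phi>[OF i]])
        then have "closed (Y i \<inter> \<Phi> i -` (\<Phi> j ` Y j))" by (rule closed_Int[OF compact_imp_closed[OF compact_Y[OF i]]])
        moreover have "?N = Y i \<inter> \<Phi> i -` (\<Phi> j ` Y j)" by auto
        ultimately have "?N \<in> sets borel" by simp
        moreover have "AE y in lebesgue. y \<notin> ?N"
          using overlap_\<Phi>[OF i j False] by (simp only: negligible_iff_null_sets AE_not_in)
        ultimately show ?thesis using AE_completion_iff[of "\<lambda>x. x \<notin> ?N" lborel] by simp
      qed
      have [measurable]: "cone a i \<in> sets borel" "cone a j \<in> sets borel"
        using measurable_cone i j by auto
      have "emeasure lborel (cone a i \<inter> cone a j) = (\<integral>\<^sup>+x. indicator (cone a i) x * indicator (cone a j) x \<partial>lborel)"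
        unfolding indicator_inter_arith[symmetric] by (rule nn_integral_indicator[symmetric]) simp
      also have "\<dots> = (\<integral>\<^sup>+y. \<integral>\<^sup>+s. indicator (Y i) y * polar a i (indicator (cone a j)) y s \<partial>lborel \<partial>lborel)"
        by (rule nn_integral_one_cone[OF i a]) measurable
      also have "\<dots> = (\<integral>\<^sup>+y. 0 \<partial>(lborel::'b measure))"
      proof (rule nn_integral_cong_AE, use neg in eventually_elim)
        case (elim y)
        have zero: "indicator (Y i) y * polar a i (indicator (cone a j)) y s = 0" for s :: real
        proof (rule ccontr)
          assume "indicator (Y i) y * polar a i (indicator (cone a j)) y s \<noteq> 0"
          then have y: "y \<in> Y i" and s: "0 < s" and cj: "a + s *\<^sub>R (\<Phi> i y - a) \<in> cone a j"
            by (auto simp: indicator_def split: if_splits)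
          obtain t z where tz: "0 < t" "z \<in> Y j" "a + s *\<^sub>R (\<Phi> i y - a) = a + t *\<^sub>R (\<Phi> j z - a)"
            using in_coneE[OF j a cj] by metis
          have "\<Phi> i y = \<Phi> j z"
            by (rule ray_unique(2)[OF a _ _ _ s tz(1)]) (use tz y i j \<Phi>_in_frontier in auto)
          then show False using elim y tz by auto
        qed
        show ?case unfolding zero by simp
      qed
      finally have "cone a i \<inter> cone a j \<in> null_sets lborel" by (auto intro: null_setsI)
      from AE_not_in[OF this] show ?thesis by (rule eventually_mono) simp
    qed simp
  qed
  ultimately show ?thesis
  proof eventually_elim
    case (elim x)
    show ?case
    proof (cases "x \<in> D")
      case True
      then have xi: "x \<in> interior D" "x \<noteq> a" using elim(1) closed_D by (auto simp: N_def frontier_def)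
      obtain d where d: "0 < d" "a + d *\<^sub>R (x - a) \<in> frontier D"
      proof (rule ray_to_frontier[of D a "x - a"])
        show "bounded D" using compact_D by (rule compact_imp_bounded)
        show "a \<in> interior D" using a ball_interior by blast
        show "x - a \<noteq> 0" using xi by simp
      qed
      \<comment> \<open>Otherwise the exit point would lie between \<open>a\<close> and the interior
        point \<open>x\<close>, and would be interior itself.\<close>
      have "d > 1"
      proof (rule ccontr)
        assume "\<not> d > 1"
        then have "a + d *\<^sub>R (x - a) \<in> interior D"
          using d xi shrink_interior[OF a True, of d] by (cases "d = 1") auto
        then show False using d by (auto simp: frontier_def)
      qed
      obtain i where "i \<in> I" "a + d *\<^sub>R (x - a) \<in> \<Phi> i ` Y i"
        using d(2) unfolding frontier_\<Phi> by blast
      then obtain y where iy: "i \<in> I" "y \<in> Y i" "\<Phi> i y = a + d *\<^sub>R (x - a)"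
        by (metis imageE)
      have "x = a + (1/d) *\<^sub>R (\<Phi> i y - a)" using d iy by simp
      then have "x \<in> cone a i" using cone_iff[OF iy(1) a, of "1/d" y] \<open>d > 1\<close> iy by simp
      then have "indicator (cone a j) x = (if j = i then 1 else 0::ennreal)" if "j \<in> I" for j
        using that elim(2) iy(1) by (auto simp: indicator_def)
      then show ?thesis using True iy(1) finite_I by (simp add: sum.delta)
    next
      case False
      have "x \<notin> cone a i" if i: "i \<in> I" for i
      proof
        assume "x \<in> cone a i"
        then obtain s y where "0 < s" "s < 1" "y \<in> Y i" "x = a + s *\<^sub>R (\<Phi> i y - a)"
          using in_coneE[OF i a] by metis
        then have "x \<in> D" using star_point[OF a \<Phi>_in_D[OF i], of y s] by simp
        then show False using False by simp
      qed
      then show ?thesis using False by simp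
    qed
  qed
qed

lemma nn_integral_polar:
  assumes a: "a \<in> ball c (\<rho> * h)" and g[measurable]: "g \<in> borel_measurable borel"
  shows "(\<integral>\<^sup>+x. indicator D x * g x \<partial>lborel) = (\<Sum>i\<in>I. \<integral>\<^sup>+y. \<integral>\<^sup>+s. indicator (Y i) y * polar a i g y s \<partial>lborel \<partial>lborel)"
proof -
  have "(\<integral>\<^sup>+x. indicator D x * g x \<partial>lborel) = (\<integral>\<^sup>+x. (\<Sum>i\<in>I. indicator (cone a i) x * g x) \<partial>lborel)"
    using AE_in_one_cone[OF a] by (intro nn_integral_cong_AE) (auto simp: sum_distrib_right)
  also have "\<dots> = (\<Sum>i\<in>I. \<integral>\<^sup>+x. indicator (cone a i) x * g x \<partial>lborel)"
    using measurable_cone by (intro nn_integral_sum) (simp add: borel_measurable_times_ennreal)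
  also have "\<dots> = (\<Sum>i\<in>I. \<integral>\<^sup>+y. \<integral>\<^sup>+s. indicator (Y i) y * polar a i g y s \<partial>lborel \<partial>lborel)"
    by (intro sum.cong nn_integral_one_cone a g) auto
  finally show ?thesis .
qed

end

section \<open>Functions of class C1, truncations and cut-off functions\<close>

lemma C1I:
  assumes "\<And>x. GDERIV f x :> g x" "continuous_on UNIV g"
  shows "C1 f" "grad f = g"
proof -
  show g: "grad f = g" using assms(1) grad_eqI by blast
  show "C1 f" unfolding C1_def g using assms by blast
qed

lemma C1_GDERIV: "C1 f \<Longrightarrow> GDERIV f x :> grad f x"
  by (simp add: C1_def)

lemma C1_continuous:
  assumes "C1 f" shows "continuous_on S f"
proof (rule continuous_at_imp_continuous_on, rule ballI)
  fix x show "isCont f x"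
    using C1_GDERIV[OF assms, of x] unfolding gderiv_def by (rule has_derivative_continuous)
qed

lemma C1_continuous_grad: "C1 f \<Longrightarrow> continuous_on S (grad f)"
  unfolding C1_def using continuous_on_subset by blast

lemma C1_mult:
  assumes "C1 f" "C1 g"
  shows "C1 (\<lambda>x. f x * g x)" "grad (\<lambda>x. f x * g x) = (\<lambda>x. f x *\<^sub>R grad g x + g x *\<^sub>R grad f x)"
proof -
  have *: "GDERIV (\<lambda>x. f x * g x) x :> f x *\<^sub>R grad g x + g x *\<^sub>R grad f x" for x
    by (rule GDERIV_mult[OF C1_GDERIV[OF assms(1)] C1_GDERIV[OF assms(2)]])
  have "continuous_on UNIV (\<lambda>x. f x *\<^sub>R grad g x + g x *\<^sub>R grad f x)"
    by (intro continuous_intros C1_continuous C1_continuous_grad assms)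
  from C1I[OF * this] show "C1 (\<lambda>x. f x * g x)"
    "grad (\<lambda>x. f x * g x) = (\<lambda>x. f x *\<^sub>R grad g x + g x *\<^sub>R grad f x)" by auto
qed

lemma C1_add:
  assumes "C1 f" "C1 g"
  shows "C1 (\<lambda>x. f x + g x)" "grad (\<lambda>x. f x + g x) = (\<lambda>x. grad f x + grad g x)"
proof -
  have *: "GDERIV (\<lambda>x. f x + g x) x :> grad f x + grad g x" for x
    by (rule GDERIV_add[OF C1_GDERIV[OF assms(1)] C1_GDERIV[OF assms(2)]])
  have "continuous_on UNIV (\<lambda>x. grad f x + grad g x)"
    by (intro continuous_intros C1_continuous_grad assms)
  from C1I[OF * this] show "C1 (\<lambda>x. f x + g x)" "grad (\<lambda>x. f x + g x) = (\<lambda>x. grad f x + grad g x)" by auto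
qed

lemma C1_const: "C1 (\<lambda>x. k)" "grad (\<lambda>x. k) = (\<lambda>x. 0)"
  using C1I[of "\<lambda>x. k" "\<lambda>x. 0"] by (auto intro: GDERIV_const)

lemma C1_cmult:
  assumes "C1 f" shows "C1 (\<lambda>x. k * f x)" "grad (\<lambda>x. k * f x) = (\<lambda>x. k *\<^sub>R grad f x)"
  using C1_mult[OF C1_const(1) assms, of k] by (auto simp: C1_const)

lemma C1_diff:
  assumes "C1 f" "C1 g"
  shows "C1 (\<lambda>x. f x - g x)" "grad (\<lambda>x. f x - g x) = (\<lambda>x. grad f x - grad g x)"
  using C1_add[OF assms(1) C1_cmult(1)[OF assms(2), of "-1"]] C1_cmult(2)[OF assms(2), of "-1"] by auto

lemma C1_compose:
  assumes "C1 f" "\<And>s. (T has_real_derivative T' s) (at s)" "continuous_on UNIV T'"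
  shows "C1 (\<lambda>x. T (f x))" "grad (\<lambda>x. T (f x)) = (\<lambda>x. T' (f x) *\<^sub>R grad f x)"
proof -
  have *: "GDERIV (\<lambda>x. T (f x)) x :> T' (f x) *\<^sub>R grad f x" for x
    by (rule GDERIV_DERIV_compose[OF C1_GDERIV[OF assms(1)] assms(2)])
  have "continuous_on UNIV (\<lambda>x. T' (f x) *\<^sub>R grad f x)"
    by (intro continuous_intros continuous_on_compose2[OF assms(3)] C1_continuous C1_continuous_grad assms(1)) auto
  from C1I[OF * this] show "C1 (\<lambda>x. T (f x))" "grad (\<lambda>x. T (f x)) = (\<lambda>x. T' (f x) *\<^sub>R grad f x)" by auto
qed

lemma C1_along_line:
  assumes "C1 f"
  shows "((\<lambda>s. f (a + s *\<^sub>R v)) has_real_derivative (v \<bullet> grad f (a + s *\<^sub>R v))) (at s)"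
proof -
  have "((\<lambda>s. f (a + s *\<^sub>R v)) has_derivative (\<lambda>r. (r *\<^sub>R v) \<bullet> grad f (a + s *\<^sub>R v))) (at s)"
  proof (rule has_derivative_compose[of "\<lambda>s. a + s *\<^sub>R v" "\<lambda>r. r *\<^sub>R v" _ _ f])
    show "((\<lambda>s. a + s *\<^sub>R v) has_derivative (\<lambda>r. r *\<^sub>R v)) (at s)" by (auto intro!: derivative_eq_intros)
    show "(f has_derivative (\<lambda>b. b \<bullet> grad f (a + s *\<^sub>R v))) (at (a + s *\<^sub>R v))"
      using C1_GDERIV[OF assms, of "a + s *\<^sub>R v"] by (simp add: gderiv_def)
  qed
  then show ?thesis unfolding has_field_derivative_def
    by (rule has_derivative_eq_rhs) (simp add: fun_eq_iff)
qed

section \<open>Cauchy-Schwarz inequalities\<close>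

lemma integral_Cauchy_Schwarz:
  fixes f g :: "'a \<Rightarrow> real"
  assumes [measurable]: "f \<in> borel_measurable M" "g \<in> borel_measurable M"
    and f: "integrable M (\<lambda>x. (f x)^2)" and g: "integrable M (\<lambda>x. (g x)^2)"
  shows "integrable M (\<lambda>x. f x * g x)"
    "\<bar>LINT x|M. f x * g x\<bar> \<le> sqrt (LINT x|M. (f x)^2) * sqrt (LINT x|M. (g x)^2)"
proof -
  have amgm: "\<bar>a * b\<bar> \<le> a^2 + b^2" for a b :: real
  proof -
    have "0 \<le> \<bar>a\<bar> * \<bar>b\<bar>" by simp
    then have "\<bar>a\<bar> * \<bar>b\<bar> \<le> 2 * \<bar>a\<bar> * \<bar>b\<bar>" by linarith
    also have "\<dots> \<le> a^2 + b^2" using sum_squares_bound[of "\<bar>a\<bar>" "\<bar>b\<bar>"] by simp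
    finally show ?thesis by (simp add: abs_mult)
  qed
  show i: "integrable M (\<lambda>x. f x * g x)"
    by (rule Bochner_Integration.integrable_bound[OF Bochner_Integration.integrable_add[OF f g]]) (auto intro!: AE_I2 simp: amgm)
  define A B where "A = (LINT x|M. (f x)^2)" and "B = (LINT x|M. (g x)^2)"
  have A0: "A \<ge> 0" and B0: "B \<ge> 0" unfolding A_def B_def by (auto intro!: integral_nonneg_AE)
  define X where "X = (LINT x|M. f x * g x)"
  have q: "0 \<le> A + 2 * t * X + t^2 * B" for t
  proof -
    have "0 \<le> (LINT x|M. (f x + t * g x)^2)" by (auto intro!: integral_nonneg_AE)
    also have "\<dots> = (LINT x|M. (f x)^2 + ((2 * t) * (f x * g x) + t^2 * (g x)^2))"
      by (rule Bochner_Integration.integral_cong) (auto simp: power2_eq_square algebra_simps)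
    also have "\<dots> = A + 2 * t * X + t^2 * B"
      using f g i unfolding A_def B_def X_def by (simp add: integral_add)
    finally show ?thesis .
  qed
  have "X^2 \<le> A * B"
  proof (cases "B = 0")
    case True
    have "X = 0"
    proof (rule ccontr)
      assume "X \<noteq> 0"
      \<comment> \<open>With \<open>B = 0\<close> the quadratic is affine in \<open>t\<close>, and
        this choice gives it the value -1.\<close>
      then show False using q[of "- (A + 1) / (2 * X)"] A0 True by (simp add: field_simps)
    qed
    then show ?thesis using True by simp
  next
    case False
    then have "B > 0" using B0 by simp
    have "A + 2 * (- X / B) * X + (- X / B)^2 * B = A - X^2 / B" using False by (simp add: power2_eq_square field_simps)
    then have "X^2 / B \<le> A" using q[of "- X / B"] by simp
    then show ?thesis using \<open>B > 0\<close> by (simp add: field_simps)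
  qed
  then have "sqrt (X^2) \<le> sqrt (A * B)" by (rule real_sqrt_le_mono)
  then show "\<bar>X\<bar> \<le> sqrt A * sqrt B" by (simp add: real_sqrt_mult)
qed

lemma integral_Icc_Cauchy_Schwarz:
  fixes f :: "real \<Rightarrow> real"
  assumes "continuous_on {a..b} f" "a \<le> b"
  shows "(LINT s:{a..b}|lborel. f s)^2 \<le> (b - a) * (LINT s:{a..b}|lborel. (f s)^2)"
proof -
  let ?f = "\<lambda>s. indicat_real {a..b} s * f s" and ?g = "indicat_real {a..b}"
  have sq: "(?f s)^2 = indicat_real {a..b} s * (f s)^2" "(?g s)^2 = indicat_real {a..b} s" "?f s * ?g s = indicat_real {a..b} s * f s" for s
    by (auto simp: indicator_def)
  have i1: "integrable lborel ?f" using borel_integrable_atLeastAtMost'[OF assms(1)] by (simp add: set_integrable_def)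
  have i2: "integrable lborel (\<lambda>s. indicat_real {a..b} s * (f s)^2)"
    using borel_integrable_atLeastAtMost'[OF continuous_on_power[OF assms(1), of 2]] by (simp add: set_integrable_def)
  have i3: "integrable lborel ?g" by (rule integrable_real_indicator) (auto simp: emeasure_lborel_Icc_eq)
  have m: "?f \<in> borel_measurable lborel" using i1 by (rule borel_measurable_integrable)
  have "\<bar>LINT s|lborel. ?f s * ?g s\<bar> \<le> sqrt (LINT s|lborel. (?f s)^2) * sqrt (LINT s|lborel. (?g s)^2)"
    by (rule integral_Cauchy_Schwarz(2)[OF m]) (use i2 i3 in \<open>simp_all only: sq, simp_all\<close>)
  then have "\<bar>LINT s|lborel. ?f s\<bar> \<le> sqrt (LINT s|lborel. indicat_real {a..b} s * (f s)^2) * sqrt (b - a)"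
    unfolding sq using assms(2) by simp
  then have "\<bar>LINT s|lborel. ?f s\<bar>^2 \<le> (sqrt (LINT s|lborel. indicat_real {a..b} s * (f s)^2) * sqrt (b - a))^2"
    by (rule power_mono) simp
  also have "\<dots> = (b - a) * (LINT s|lborel. indicat_real {a..b} s * (f s)^2)"
    using assms(2) by (simp add: power_mult_distrib integral_nonneg_AE)
  finally show ?thesis by (simp add: set_lebesgue_integral_def)
qed

text \<open>Squaring the positive part removes the kink on the unit sphere, so that the gradient is
  continuous.\<close>

definition bump :: "'a::euclidean_space \<Rightarrow> real" where
  "bump z = (max 0 (1 - (norm z)^2))^2"

definition bump_grad :: "'a::euclidean_space \<Rightarrow> 'a" where
  "bump_grad z = (- 4 * max 0 (1 - (norm z)^2)) *\<^sub>R z"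

lemma norm_bump_grad: "norm (bump_grad z) \<le> 4 * indicator (ball 0 1) z"
proof (cases "norm z < 1")
  case True
  have "norm (bump_grad z) = 4 * max 0 (1 - (norm z)^2) * norm z" by (simp add: bump_grad_def abs_mult)
  also have "\<dots> \<le> 4 * 1 * 1" using True by (intro mult_mono) auto
  finally show ?thesis using True by simp
next
  case False
  then have "1 \<le> (norm z)^2" by (simp add: one_le_power)
  then have "max 0 (1 - (norm z)^2) = 0" by simp
  then show ?thesis using False by (simp add: bump_grad_def)
qed

lemma bump_eq_0: "norm z \<ge> 1 \<Longrightarrow> bump z = 0"
  using one_le_power[of "norm z" 2] by (simp add: bump_def max_absorb1)

lemma bump_nonneg: "bump z \<ge> 0" by (simp add: bump_def)

lemma bump_le_1: "bump z \<le> 1" unfolding bump_def by (rule power_le_one) auto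

text \<open>At 0 the difference quotient is either that of \<open>g\<close> or zero; it is dominated
  by a quantity tending to \<open>g' 0 = 0\<close>.\<close>

lemma DERIV_max_0:
  fixes g g' :: "real \<Rightarrow> real"
  assumes g: "\<And>a. a \<ge> 0 \<Longrightarrow> (g has_real_derivative g' a) (at a)" and g0: "g' 0 = 0"
  shows "((\<lambda>s. g (max 0 s)) has_real_derivative g' (max 0 s)) (at s)"
proof -
  consider "s > 0" | "s < 0" | "s = 0" by linarith
  then show ?thesis
  proof cases
    case 1
    have "((\<lambda>s. g (max 0 s)) has_real_derivative g' s) (at s)"
      by (rule has_field_derivative_transform_within[OF g 1]) (use 1 in \<open>auto simp: dist_real_def\<close>)
    then show ?thesis using 1 by simp
  next
    case 2
    have "((\<lambda>s. g (max 0 s)) has_real_derivative 0) (at s)"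
      by (rule has_field_derivative_transform_within[of "\<lambda>_. g 0" _ _ _ "-s"]) (use 2 in \<open>auto simp: dist_real_def\<close>)
    then show ?thesis using 2 g0 by simp
  next
    case 3
    have "((\<lambda>x. (g x - g 0) / (x - 0)) \<longlongrightarrow> 0) (at 0)"
      using g[of 0] g0 by (simp add: has_field_derivative_iff)
    then have "((\<lambda>x. (g (max 0 x) - g 0) / (x - 0)) \<longlongrightarrow> 0) (at 0)"
    proof (rule Lim_transform_bound[rotated], intro always_eventually allI)
      fix x :: real
      show "norm ((g (max 0 x) - g 0) / (x - 0)) \<le> norm ((g x - g 0) / (x - 0))"
      proof (cases "x \<ge> 0")
        case False
        then have "norm ((g (max 0 x) - g 0) / (x - 0)) = 0" by simp
        then show ?thesis by (metis norm_ge_zero)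
      qed simp
    qed
    then show ?thesis using 3 g0 by (simp add: has_field_derivative_iff)
  qed
qed

text \<open>A C1 substitute for the positive part: slope between 0 and 1, zero exactly for
  nonpositive arguments, and within \<open>m\<close> of the positive part. Composition with C1
  approximations therefore stays C1 and can be turned into test functions.\<close>

definition soft :: "real \<Rightarrow> real \<Rightarrow> real" where "soft m s = sqrt ((max 0 s)^2 + m^2) - m"
definition soft' :: "real \<Rightarrow> real \<Rightarrow> real" where "soft' m s = max 0 s / sqrt ((max 0 s)^2 + m^2)"

lemma DERIV_max_0_square: "((\<lambda>s. (max 0 s)^2) has_real_derivative 2 * max 0 s) (at (s::real))"
  by (rule DERIV_max_0[of "\<lambda>a. a^2" "\<lambda>a. 2 * a"]) (auto intro!: derivative_eq_intros)

lemma soft_DERIV: assumes "m > 0" shows "(soft m has_real_derivative soft' m s) (at s)"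
proof -
  have "((\<lambda>a. sqrt (a^2 + m^2) - m) has_real_derivative (a / sqrt (a^2 + m^2))) (at a)" for a
  proof -
    have "a^2 + m^2 > 0" using assms by (simp add: add_nonneg_pos)
    then show ?thesis by (auto intro!: derivative_eq_intros simp: field_simps)
  qed
  from DERIV_max_0[of "\<lambda>a. sqrt (a^2 + m^2) - m" "\<lambda>a. a / sqrt (a^2 + m^2)" s, OF this]
  show ?thesis unfolding soft_def[abs_def] soft'_def by simp
qed

lemma soft_cont: assumes "m > 0" shows "continuous_on UNIV (soft' m)"
proof -
  have "sqrt ((max 0 s)^2 + m^2) \<noteq> 0" for s using assms by (simp add: add_nonneg_eq_0_iff)
  then show ?thesis unfolding soft'_def[abs_def] by (intro continuous_intros) auto
qed

lemma soft'_bounds: assumes "m > 0" shows "0 \<le> soft' m s" "soft' m s \<le> 1"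
proof -
  have "max 0 s \<le> sqrt ((max 0 s)^2 + m^2)" by (rule real_le_rsqrt) simp
  moreover have "sqrt ((max 0 s)^2 + m^2) > 0" using assms by (simp add: add_nonneg_pos)
  ultimately show "0 \<le> soft' m s" "soft' m s \<le> 1" by (auto simp: soft'_def divide_le_eq_1)
qed

lemma soft_nonpos [simp]: "m > 0 \<Longrightarrow> s \<le> 0 \<Longrightarrow> soft m s = 0" "s \<le> 0 \<Longrightarrow> soft' m s = 0"
  by (auto simp: soft_def soft'_def max_def)

lemma soft_bounds: assumes "m > 0" "s \<ge> 0" shows "s - m \<le> soft m s" "soft m s \<le> s" "0 \<le> soft m s"
proof -
  have "s \<le> sqrt (s^2 + m^2)" by (rule real_le_rsqrt) simp
  then show "s - m \<le> soft m s" using assms by (simp add: soft_def)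
  have "sqrt (s^2 + m^2) \<le> s + m" using assms by (intro real_le_lsqrt) (auto simp: power2_eq_square algebra_simps)
  then show "soft m s \<le> s" using assms by (simp add: soft_def)
  have "m \<le> sqrt (s^2 + m^2)" by (rule real_le_rsqrt) simp
  then show "0 \<le> soft m s" using assms by (simp add: soft_def)
qed

lemma soft_eq_0: assumes "m > 0" "soft m s = 0" shows "s \<le> 0"
proof (rule ccontr)
  assume "\<not> s \<le> 0"
  then have "m^2 < s^2 + m^2" by simp
  then have "sqrt (m^2) < sqrt (s^2 + m^2)" by (rule real_sqrt_less_mono)
  then show False using assms \<open>\<not> s \<le> 0\<close> by (simp add: soft_def)
qed

text \<open>An odd function with slope at most one that vanishes for arguments up to
  \<open>m\<close> in modulus and stays within \<open>2 * m\<close> of the identity. Composed with a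
  function whose boundary values are at most \<open>m\<close> it has zero trace, as the energy
  estimate requires, and it still controls that function up to \<open>2 * m\<close>.\<close>

definition trunc :: "real \<Rightarrow> real \<Rightarrow> real" where "trunc m s = soft m (s - m) - soft m (- s - m)"
definition trunc' :: "real \<Rightarrow> real \<Rightarrow> real" where "trunc' m s = soft' m (s - m) + soft' m (- s - m)"

lemma trunc_DERIV: assumes "m > 0" shows "(trunc m has_real_derivative trunc' m s) (at s)"
proof -
  have "((\<lambda>s. soft m (s - m)) has_real_derivative soft' m (s - m) * 1) (at s)"
    by (rule DERIV_chain2[OF soft_DERIV[OF assms]]) (auto intro!: derivative_eq_intros)
  moreover have "((\<lambda>s. soft m (- s - m)) has_real_derivative soft' m (- s - m) * (-1)) (at s)"
    by (rule DERIV_chain2[OF soft_DERIV[OF assms]]) (auto intro!: derivative_eq_intros)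
  ultimately show ?thesis unfolding trunc_def[abs_def] trunc'_def by (auto intro!: derivative_eq_intros)
qed

lemma trunc_props:
  assumes "m > 0"
  shows "continuous_on UNIV (trunc' m)" "0 \<le> trunc' m s" "trunc' m s \<le> 1" "\<bar>s\<bar> \<le> m \<Longrightarrow> trunc m s = 0" "\<bar>s - trunc m s\<bar> \<le> 2 * m"
proof -
  show "continuous_on UNIV (trunc' m)" unfolding trunc'_def[abs_def]
    by (intro continuous_intros continuous_on_compose2[OF soft_cont[OF assms]]) auto
  show "0 \<le> trunc' m s" "trunc' m s \<le> 1"
    using soft'_bounds[OF assms, of "s - m"] soft'_bounds[OF assms, of "- s - m"] assms
    unfolding trunc'_def by (cases "s \<ge> 0"; simp)+
  show "\<bar>s\<bar> \<le> m \<Longrightarrow> trunc m s = 0" using assms by (simp add: trunc_def)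
  show "\<bar>s - trunc m s\<bar> \<le> 2 * m"
  proof -
    consider "s \<ge> m" | "s \<le> - m" | "\<bar>s\<bar> \<le> m" by linarith
    then show ?thesis
    proof cases
      case 1
      then have "trunc m s = soft m (s - m)" using assms by (simp add: trunc_def)
      then show ?thesis using soft_bounds[OF assms, of "s - m"] 1 assms by simp
    next
      case 2
      then have "trunc m s = - soft m (- s - m)" using assms by (simp add: trunc_def)
      then show ?thesis using soft_bounds[OF assms, of "- s - m"] 2 assms by simp
    next
      case 3
      then show ?thesis using assms by (simp add: trunc_def)
    qed
  qed
qed

lemma C1_sq_dist: "C1 (\<lambda>x::'a::euclidean_space. (norm (x - c))^2)" "grad (\<lambda>x. (norm (x - c))^2) = (\<lambda>x. 2 *\<^sub>R (x - c))"
proof -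
  have "GDERIV (\<lambda>x. (norm (x - c))^2) x :> 2 *\<^sub>R (x - c)" for x :: 'a
    unfolding gderiv_def power2_norm_eq_inner
    by (auto intro!: derivative_eq_intros simp: inner_commute)
  moreover have "continuous_on UNIV (\<lambda>x::'a. 2 *\<^sub>R (x - c))" by (intro continuous_intros)
  ultimately show "C1 (\<lambda>x::'a. (norm (x - c))^2)" "grad (\<lambda>x. (norm (x - c))^2) = (\<lambda>x. 2 *\<^sub>R (x - c))"
    by (rule C1I)+
qed

lemma C1_coord: "C1 (\<lambda>x::'a::euclidean_space. x \<bullet> b)" "grad (\<lambda>x. x \<bullet> b) = (\<lambda>x. b)"
proof -
  have "GDERIV (\<lambda>x. x \<bullet> b) x :> b" for x :: 'a
    unfolding gderiv_def by (auto intro!: derivative_eq_intros)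
  from C1I[OF this] show "C1 (\<lambda>x::'a. x \<bullet> b)" "grad (\<lambda>x. x \<bullet> b) = (\<lambda>x. b)" by auto
qed

lemma C1_affine_arg:
  assumes "C1 f" shows "C1 (\<lambda>x. f (k *\<^sub>R (x - p)))" "grad (\<lambda>x. f (k *\<^sub>R (x - p))) = (\<lambda>x. k *\<^sub>R grad f (k *\<^sub>R (x - p)))"
proof -
  have "GDERIV (\<lambda>x. f (k *\<^sub>R (x - p))) x :> k *\<^sub>R grad f (k *\<^sub>R (x - p))" for x
  proof -
    have "((\<lambda>x. f (k *\<^sub>R (x - p))) has_derivative (\<lambda>d. (k *\<^sub>R d) \<bullet> grad f (k *\<^sub>R (x - p)))) (at x)"
    proof (rule has_derivative_compose[of "\<lambda>x. k *\<^sub>R (x - p)" "\<lambda>d. k *\<^sub>R d" _ _ f])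
      show "((\<lambda>x. k *\<^sub>R (x - p)) has_derivative (\<lambda>d. k *\<^sub>R d)) (at x)" by (auto intro!: derivative_eq_intros)
      show "(f has_derivative (\<lambda>b. b \<bullet> grad f (k *\<^sub>R (x - p)))) (at (k *\<^sub>R (x - p)))"
        using C1_GDERIV[OF assms] by (simp add: gderiv_def)
    qed
    then show ?thesis by (simp add: gderiv_def)
  qed
  moreover have "continuous_on UNIV (\<lambda>x. k *\<^sub>R grad f (k *\<^sub>R (x - p)))"
    by (intro continuous_intros continuous_on_compose2[OF C1_continuous_grad[OF assms]]) auto
  ultimately show "C1 (\<lambda>x. f (k *\<^sub>R (x - p)))" "grad (\<lambda>x. f (k *\<^sub>R (x - p))) = (\<lambda>x. k *\<^sub>R grad f (k *\<^sub>R (x - p)))"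
    by (rule C1I)+
qed

lemma C1_bump: "C1 (bump :: 'a::euclidean_space \<Rightarrow> real)" "grad (bump :: 'a \<Rightarrow> real) = bump_grad"
proof -
  have f: "C1 (\<lambda>x::'a. 1 - (norm x)^2)" "grad (\<lambda>x::'a. 1 - (norm x)^2) = (\<lambda>x. - 2 *\<^sub>R x)"
    using C1_diff[OF C1_const(1)[of 1] C1_sq_dist(1)[of 0]] by (simp_all add: C1_const(2)[of 1] C1_sq_dist(2)[of 0, simplified])
  note T = DERIV_max_0_square
  have c: "continuous_on UNIV (\<lambda>s::real. 2 * max 0 s)" by (intro continuous_intros)
  show "C1 (bump :: 'a \<Rightarrow> real)" unfolding bump_def[abs_def] by (rule C1_compose(1)[OF f(1) T c])
  show "grad (bump :: 'a \<Rightarrow> real) = bump_grad" unfolding bump_def[abs_def] bump_grad_def[abs_def]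
    by (subst C1_compose(2)[OF f(1) T c]) (simp add: f(2) fun_eq_iff)
qed

text \<open>The cube makes the gradient, a multiple of \<open>bump\<close> times the position, again
  C1. The partial derivatives of the bump are then admissible test functions, which permits two
  integrations by parts.\<close>

definition bump3 :: "'a::euclidean_space \<Rightarrow> real" where
  "bump3 z = (max 0 (1 - (norm z)^2)) ^ 3"

lemma C1_bump3: "C1 (bump3 :: 'a::euclidean_space \<Rightarrow> real)" "grad (bump3 :: 'a \<Rightarrow> real) = (\<lambda>z. (- 6 * bump z) *\<^sub>R z)"
proof -
  have f: "C1 (\<lambda>x::'a. 1 - (norm x)^2)" "grad (\<lambda>x::'a. 1 - (norm x)^2) = (\<lambda>x. - 2 *\<^sub>R x)"
    using C1_diff[OF C1_const(1)[of 1] C1_sq_dist(1)[of 0]] by (simp_all add: C1_const(2)[of 1] C1_sq_dist(2)[of 0, simplified])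
  have T: "((\<lambda>s. (max 0 s) ^ 3) has_real_derivative 3 * (max 0 s)^2) (at s)" for s :: real
    by (rule DERIV_max_0[of "\<lambda>a. a ^ 3" "\<lambda>a. 3 * a^2"]) (auto intro!: derivative_eq_intros)
  have c: "continuous_on UNIV (\<lambda>s::real. 3 * (max 0 s)^2)" by (intro continuous_intros)
  show "C1 (bump3 :: 'a \<Rightarrow> real)" unfolding bump3_def[abs_def] by (rule C1_compose(1)[OF f(1) T c])
  show "grad (bump3 :: 'a \<Rightarrow> real) = (\<lambda>z. (- 6 * bump z) *\<^sub>R z)" unfolding bump3_def[abs_def] bump_def
    by (subst C1_compose(2)[OF f(1) T c]) (simp add: f(2) fun_eq_iff)
qed

lemma bump3_eq_0: "norm z \<ge> 1 \<Longrightarrow> bump3 z = 0"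
  using one_le_power[of "norm z" 2] by (simp add: bump3_def max_absorb1)

lemma bump3_nonneg: "bump3 z \<ge> 0" by (simp add: bump3_def)

lemma bump3_le_1: "bump3 z \<le> 1" unfolding bump3_def by (rule power_le_one) auto

lemma norm_scaled_ge_1: "s > 0 \<Longrightarrow> x \<notin> cball p s \<Longrightarrow> 1 \<le> norm ((1/s) *\<^sub>R (x - p))"
  unfolding norm_scaleR by (simp add: dist_norm norm_minus_commute le_divide_eq_1)

lemma bump3_outside: "s > 0 \<Longrightarrow> x \<notin> cball p s \<Longrightarrow> bump3 ((1/s) *\<^sub>R (x - p)) = 0"
  by (rule bump3_eq_0[OF norm_scaled_ge_1])

lemma bump3_ge: "norm z \<le> 1/2 \<Longrightarrow> 1/8 \<le> bump3 z"
proof -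
  assume "norm z \<le> 1/2"
  then have "(norm z)^2 \<le> (1/2)^2" by (intro power_mono) auto
  then have "1/2 \<le> max 0 (1 - (norm z)^2)" unfolding power2_eq_square[of "1/2::real"] by linarith
  then have "(1/2)^3 \<le> bump3 z" unfolding bump3_def by (rule power_mono) simp
  then show ?thesis by (simp add: power3_eq_cube)
qed

section \<open>Packing of balls and cut-off functions\<close>

lemma card_disjoint_balls:
  fixes z :: "'i \<Rightarrow> 'a::euclidean_space"
  assumes fin: "finite W" and r: "0 < r"
    and disj: "\<And>i j. i \<in> W \<Longrightarrow> j \<in> W \<Longrightarrow> i \<noteq> j \<Longrightarrow> ball (z i) r \<inter> ball (z j) r = {}"
    and sub: "\<And>i. i \<in> W \<Longrightarrow> ball (z i) r \<subseteq> ball x R" and R: "0 < R"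
  shows "real (card W) * r ^ DIM('a) \<le> R ^ DIM('a)"
proof -
  define \<omega> where "\<omega> = measure lebesgue (ball (0::'a) 1)"
  have \<omega>: "\<omega> > 0" using content_ball_pos[of 1 "0::'a"] by (simp add: \<omega>_def)
  have vol: "measure lebesgue (ball (a::'a) s) = \<omega> * s ^ DIM('a)" if "s > 0" for a s
    using content_ball_conv_unit_ball[of s a] that by (simp add: \<omega>_def mult.commute)
  have "real (card W) * (\<omega> * r ^ DIM('a)) = (\<Sum>i\<in>W. measure lebesgue (ball (z i) r))"
    unfolding vol[OF r] by simp
  also have "\<dots> = measure lebesgue (\<Union>i\<in>W. ball (z i) r)"
  proof (rule measure_finite_Union[symmetric, OF fin])
    show "disjoint_family_on (\<lambda>i. ball (z i) r) W" using disj unfolding disjoint_family_on_def by blast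
    show "emeasure lebesgue (ball (z i) r) \<noteq> \<infinity>" for i
      using emeasure_bounded_finite[OF bounded_ball, of "z i" r] by simp
  qed auto
  also have "\<dots> \<le> measure lebesgue (ball x R)" using sub fin by (intro measure_mono_fmeasurable) auto
  also have "\<dots> = \<omega> * R ^ DIM('a)" by (rule vol[OF R])
  finally show ?thesis using \<omega> by simp
qed

text \<open>Comparing volumes bounds the cardinality of separated subsets, so one of greatest
  cardinality exists. Any point of \<open>S\<close> at distance at least \<open>r\<close> from it
  could be added, hence there is none.\<close>

lemma separated_net:
  fixes S :: "'a::euclidean_space set"
  assumes S: "bounded S" and r: "0 < r"
  obtains X where "finite X" "X \<subseteq> S" "\<And>a b. a \<in> X \<Longrightarrow> b \<in> X \<Longrightarrow> a \<noteq> b \<Longrightarrow> r \<le> dist a b" "\<And>y. y \<in> S \<Longrightarrow> \<exists>a\<in>X. dist a y < r"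
proof -
  define P where "P X \<longleftrightarrow> finite X \<and> X \<subseteq> S \<and> (\<forall>a\<in>X. \<forall>b\<in>X. a \<noteq> b \<longrightarrow> r \<le> dist a b)" for X
  obtain R where R: "R > 0" "S \<subseteq> ball 0 R" using S bounded_subset_ballD by blast
  obtain N :: nat where N: "(R + r) ^ DIM('a) / (r / 2) ^ DIM('a) \<le> N" using real_arch_simple by blast
  have "card X \<le> N" if X: "P X" for X
  proof -
    have "real (card X) * (r / 2) ^ DIM('a) \<le> (R + r) ^ DIM('a)"
    proof (rule card_disjoint_balls[of X _ "\<lambda>a. a" 0])
      show "ball a (r / 2) \<inter> ball b (r / 2) = {}" if "a \<in> X" "b \<in> X" "a \<noteq> b" for a b
        using X that r by (auto simp: P_def disjoint_ballI)
      show "ball a (r / 2) \<subseteq> ball 0 (R + r)" if "a \<in> X" for a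
      proof (rule ball_subset_ball_iff[THEN iffD2, OF disjI1])
        show "dist a 0 + r / 2 \<le> R + r" using X that R(2) r by (force simp: P_def)
      qed
    qed (use X r R in \<open>auto simp: P_def\<close>)
    then have "real (card X) \<le> (R + r) ^ DIM('a) / (r / 2) ^ DIM('a)" by (subst pos_le_divide_eq) (use r in auto)
    then show ?thesis using N by linarith
  qed
  then have "\<forall>X. P X \<longrightarrow> card X < Suc N" by (simp add: less_Suc_eq_le)
  moreover have "P {}" by (simp add: P_def)
  ultimately obtain X where X: "P X" "\<And>Y. P Y \<Longrightarrow> card Y \<le> card X" using ex_has_greatest_nat[of P "{}" card "Suc N"] by blast
  have "\<exists>a\<in>X. dist a y < r" if y: "y \<in> S" for y
  proof (rule ccontr)
    assume n: "\<not> ?thesis"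
    then have "y \<notin> X" using r by force
    moreover have "P (insert y X)" using X(1) y n by (auto simp: P_def dist_commute not_less)
    ultimately show False using X(2)[of "insert y X"] X(1) by (simp add: P_def)
  qed
  then show ?thesis using that[of X] X(1) by (auto simp: P_def)
qed

lemma C1_sum:
  assumes "finite X" "\<And>a. a \<in> X \<Longrightarrow> C1 (f a)"
  shows "C1 (\<lambda>x. \<Sum>a\<in>X. f a x)" "grad (\<lambda>x. \<Sum>a\<in>X. f a x) = (\<lambda>x. \<Sum>a\<in>X. grad (f a) x)"
proof -
  have "C1 (\<lambda>x. \<Sum>a\<in>X. f a x) \<and> grad (\<lambda>x. \<Sum>a\<in>X. f a x) = (\<lambda>x. \<Sum>a\<in>X. grad (f a) x)"
    using assms
  proof (induction X rule: finite_induct)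
    case (insert a X)
    then show ?case using C1_add[of "f a" "\<lambda>x. \<Sum>a\<in>X. f a x"] by auto
  qed (auto simp: C1_const)
  then show "C1 (\<lambda>x. \<Sum>a\<in>X. f a x)" "grad (\<lambda>x. \<Sum>a\<in>X. f a x) = (\<lambda>x. \<Sum>a\<in>X. grad (f a) x)" by auto
qed

lemma norm_grad_bump3: "norm (grad bump3 z) \<le> 6" "1 \<le> norm z \<Longrightarrow> grad bump3 z = 0"
proof -
  show 0: "grad bump3 z = 0" if "1 \<le> norm z" for z :: 'a using that by (simp add: C1_bump3(2) bump_eq_0)
  show "norm (grad bump3 z) \<le> 6"
  proof (cases "1 \<le> norm z")
    case False
    have "bump z * norm z \<le> 1 * 1" using False by (intro mult_mono bump_le_1 bump_nonneg) auto
    then show ?thesis by (simp add: C1_bump3(2) abs_mult bump_nonneg)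
  qed (simp add: 0)
qed

text \<open>A sum of bumps at the points of a separated net, cut off at height one; the separation bounds the number of
  bumps that do not vanish at a given point.\<close>

lemma cutoff_exists:
  fixes S :: "'a::euclidean_space set"
  assumes S: "bounded S" and \<delta>: "\<delta> > 0"
  obtains \<eta> where "C1 \<eta>" "\<And>x. 0 \<le> \<eta> x" "\<And>x. \<eta> x \<le> 1" "\<And>x. x \<in> S \<Longrightarrow> \<eta> x = 1"
    "\<And>x. ball x \<delta> \<inter> S = {} \<Longrightarrow> \<eta> x = 0" "\<And>x. norm (grad \<eta> x) \<le> 96 * 5 ^ DIM('a) / \<delta>"
proof -
  obtain X where X: "finite X" "X \<subseteq> S" "\<And>a b. a \<in> X \<Longrightarrow> b \<in> X \<Longrightarrow> a \<noteq> b \<Longrightarrow> \<delta> / 2 \<le> dist a b" "\<And>y. y \<in> S \<Longrightarrow> \<exists>a\<in>X. dist a y < \<delta> / 2"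
    by (rule separated_net[OF S half_gt_zero[OF \<delta>]]) (rule that)
  define \<beta> where "\<beta> a x = bump3 ((1/\<delta>) *\<^sub>R (x - a))" for a x :: 'a
  have \<beta>: "C1 (\<beta> a)" "grad (\<beta> a) = (\<lambda>x. (1/\<delta>) *\<^sub>R grad bump3 ((1/\<delta>) *\<^sub>R (x - a)))" for a
    unfolding \<beta>_def[abs_def] by (rule C1_affine_arg[OF C1_bump3(1)])+
  have nrm: "norm ((1/\<delta>) *\<^sub>R (x - a)) = dist a x / \<delta>" for a x :: 'a
    unfolding norm_scaleR using \<delta> by (simp add: dist_norm norm_minus_commute)
  define \<psi> where "\<psi> x = (\<Sum>a\<in>X. \<beta> a x)" for x
  have \<psi>: "C1 \<psi>" "grad \<psi> = (\<lambda>x. \<Sum>a\<in>X. grad (\<beta> a) x)" unfolding \<psi>_def[abs_def] by (rule C1_sum[OF X(1) \<beta>(1)])+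
  have \<psi>0: "\<psi> x \<ge> 0" for x unfolding \<psi>_def \<beta>_def by (intro sum_nonneg bump3_nonneg)
  have g\<psi>: "norm (grad \<psi> x) \<le> 6 * 5 ^ DIM('a) / \<delta>" for x
  proof -
    \<comment> \<open>Only net points closer than \<open>\<delta>\<close> contribute to the gradient
      at \<open>x\<close>. Their balls of radius \<open>\<delta> / 4\<close> are disjoint and lie in
      a ball of five times that radius, which bounds their number independently of
      \<open>S\<close>.\<close>
    let ?X = "{a\<in>X. dist a x < \<delta>}"
    have "real (card ?X) * (\<delta> / 4) ^ DIM('a) \<le> (5 * \<delta> / 4) ^ DIM('a)"
    proof (rule card_disjoint_balls[of _ _ "\<lambda>a. a" x])
      show "ball a (\<delta> / 4) \<inter> ball b (\<delta> / 4) = {}" if "a \<in> ?X" "b \<in> ?X" "a \<noteq> b" for a b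
        using X(3)[of a b] that by (auto intro!: disjoint_ballI)
      show "ball a (\<delta> / 4) \<subseteq> ball x (5 * \<delta> / 4)" if "a \<in> ?X" for a
        using that by (intro ball_subset_ball_iff[THEN iffD2, OF disjI1]) simp
    qed (use X(1) \<delta> in auto)
    also have "\<dots> = 5 ^ DIM('a) * (\<delta> / 4) ^ DIM('a)" by (simp add: power_mult_distrib power_divide)
    finally have card: "real (card ?X) \<le> 5 ^ DIM('a)" using \<delta> by simp
    have "grad \<psi> x = (\<Sum>a\<in>?X. grad (\<beta> a) x)" unfolding \<psi>(2)
    proof (rule sum.mono_neutral_right)
      show "\<forall>a\<in>X - ?X. grad (\<beta> a) x = 0"
      proof
        fix a assume "a \<in> X - ?X"
        then have "\<delta> \<le> dist a x" by auto
        then have "1 \<le> norm ((1/\<delta>) *\<^sub>R (x - a))" unfolding nrm using \<delta> by simp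
        then show "grad (\<beta> a) x = 0" unfolding \<beta>(2) by (simp only: norm_grad_bump3(2) scaleR_zero_right)
      qed
    qed (use X(1) in auto)
    also have "norm \<dots> \<le> (\<Sum>a\<in>?X. 6 / \<delta>)"
    proof (rule order_trans[OF norm_sum sum_mono])
      show "norm (grad (\<beta> a) x) \<le> 6 / \<delta>" for a
        using norm_grad_bump3(1)[of "(1/\<delta>) *\<^sub>R (x - a)"] \<delta> unfolding \<beta>(2) norm_scaleR by (simp add: divide_right_mono)
    qed
    also have "\<dots> \<le> 5 ^ DIM('a) * (6 / \<delta>)" using card \<delta> by (simp add: mult_right_mono divide_right_mono)
    finally show ?thesis by (simp add: mult.commute)
  qed
  \<comment> \<open>A bump is at least 1/8 on half its radius, so \<open>u\<close> is nonpositive on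
    \<open>S\<close>, while \<open>u = 1\<close> at distance \<open>\<delta>\<close>. One minus the
    squared positive part of \<open>u\<close> is then the cut-off function.\<close>
  define u where "u x = 1 - 8 * \<psi> x" for x
  have u: "C1 u" "grad u = (\<lambda>x. - 8 *\<^sub>R grad \<psi> x)"
    unfolding u_def[abs_def] using C1_diff[OF C1_const(1)[of 1] C1_cmult(1)[OF \<psi>(1), of 8]] C1_cmult(2)[OF \<psi>(1), of 8]
    by (simp_all add: C1_const(2)[of 1])
  have T: "((\<lambda>s. 1 - (max 0 s)^2) has_real_derivative - 2 * max 0 s) (at s)" for s :: real
    using DERIV_diff[OF DERIV_const[of 1] DERIV_max_0_square] by simp
  have c: "continuous_on UNIV (\<lambda>s::real. - 2 * max 0 s)" by (intro continuous_intros)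
  define \<eta> where "\<eta> x = 1 - (max 0 (u x))^2" for x
  have m: "0 \<le> max 0 (u x)" "max 0 (u x) \<le> 1" for x using \<psi>0[of x] by (auto simp: u_def)
  have \<eta>: "C1 \<eta>" "grad \<eta> = (\<lambda>x. (- 2 * max 0 (u x)) *\<^sub>R grad u x)" unfolding \<eta>_def[abs_def] by (rule C1_compose[OF u(1) T c])+
  show ?thesis
  proof (rule that[OF \<eta>(1)])
    fix x
    show "0 \<le> \<eta> x" "\<eta> x \<le> 1" using power_le_one[OF m, of x 2] by (auto simp: \<eta>_def)
    show "\<eta> x = 1" if x: "x \<in> S"
    proof -
      obtain a where a: "a \<in> X" "dist a x < \<delta> / 2" using X(4)[OF x] by blast
      have "1/8 \<le> \<beta> a x" unfolding \<beta>_def by (rule bump3_ge) (unfold nrm, use a \<delta> in \<open>simp add: divide_le_eq\<close>)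
      also have "\<beta> a x \<le> \<psi> x" unfolding \<psi>_def by (rule member_le_sum[OF a(1) _ X(1)]) (simp add: \<beta>_def bump3_nonneg)
      finally show ?thesis by (simp add: \<eta>_def u_def)
    qed
    show "\<eta> x = 0" if x: "ball x \<delta> \<inter> S = {}"
    proof -
      have "\<beta> a x = 0" if "a \<in> X" for a
      proof -
        have "\<not> dist x a < \<delta>" using x X(2) that by auto
        then show ?thesis unfolding \<beta>_def by (intro bump3_eq_0) (unfold nrm, use \<delta> in \<open>simp add: dist_commute\<close>)
      qed
      then show ?thesis by (simp add: \<eta>_def u_def \<psi>_def)
    qed
    have "norm (grad \<eta> x) = 16 * max 0 (u x) * norm (grad \<psi> x)" using m(1)[of x] by (simp add: \<eta>(2) u(2) abs_mult)
    also have "\<dots> \<le> 16 * 1 * (6 * 5 ^ DIM('a) / \<delta>)" using m by (intro mult_mono g\<psi>) auto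
    finally show "norm (grad \<eta> x) \<le> 96 * 5 ^ DIM('a) / \<delta>" by simp
  qed
qed

section \<open>Divergence theorem and layer estimate\<close>

context star_cell begin

definition bint :: "((real,'n) vec \<Rightarrow> real) \<Rightarrow> real" where
  "bint f = (\<Sum>i\<in>I. LINT y:Y i|lebesgue. f (\<Phi> i y))"

lemma D_borel [measurable]: "D \<in> sets borel" using closed_D by simp

lemma Y_borel: "i \<in> I \<Longrightarrow> Y i \<in> sets borel"
  by (rule borel_closed[OF compact_imp_closed[OF compact_Y]])

lemma bounded_D: "bounded D" by (rule compact_imp_bounded[OF compact_D])

lemma set_integrable_D:
  fixes f :: "(real,'n) vec \<Rightarrow> 'c::euclidean_space"
  shows "continuous_on UNIV f \<Longrightarrow> set_integrable lebesgue D f"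
  using D_borel by (intro set_integrable_continuous[OF _ bounded_D]) auto

lemma set_integrable_Y:
  fixes f :: "(real,'n) vec \<Rightarrow> real"
  assumes "continuous_on UNIV f" "i \<in> I" shows "set_integrable lebesgue (Y i) (\<lambda>y. f (\<Phi> i y))"
proof (rule set_integrable_continuous)
  show "continuous_on UNIV (\<lambda>y. f (\<Phi> i y))"
    by (rule continuous_on_compose2[OF assms(1) continuous_\<Phi>[OF assms(2)]]) auto
  show "bounded (Y i)" by (rule compact_imp_bounded[OF compact_Y[OF assms(2)]])
  show "Y i \<in> sets lebesgue" using Y_borel[OF assms(2)] by simp
qed

lemma dist_c_le: "x \<in> D \<Longrightarrow> norm (x - c) \<le> h"
  using D_subset by (auto simp: dist_norm norm_minus_commute)

lemma height_le: assumes "i \<in> I" shows "(P i - c) \<bullet> \<nu> i \<le> h"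
proof -
  obtain y where "y \<in> Y i" using interior_Y[OF assms] interior_subset by blast
  have "(P i - c) \<bullet> \<nu> i = (\<Phi> i y - c) \<bullet> \<nu> i" using height_\<Phi>[OF assms] by simp
  also have "\<dots> \<le> norm (\<Phi> i y - c) * norm (\<nu> i)" by (rule norm_cauchy_schwarz)
  also have "\<dots> \<le> h" using dist_c_le[OF \<Phi>_in_D[OF assms \<open>y \<in> Y i\<close>]] \<nu>(1)[OF assms] by simp
  finally show ?thesis .
qed

text \<open>The density of polar coordinates on the product of chart and radius, real-valued so that
  Fubini's theorem can be applied to signed integrands.\<close>

definition pw :: "(real,'n) vec \<Rightarrow> 'i \<Rightarrow> 'b \<times> real \<Rightarrow> real" where
  "pw a i p = indicator (Y i) (fst p) * (indicator {0<..<1} (snd p) * ((P i - a) \<bullet> \<nu> i * snd p ^ DIM('b)))"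

abbreviation (input) ray :: "(real,'n) vec \<Rightarrow> 'i \<Rightarrow> 'b \<times> real \<Rightarrow> (real,'n) vec" where
  "ray a i p \<equiv> a + snd p *\<^sub>R (\<Phi> i (fst p) - a)"

lemma pw_integrable:
  assumes g: "continuous_on UNIV g" and i: "i \<in> I"
  shows "integrable (lborel \<Otimes>\<^sub>M lborel) (\<lambda>p. pw a i p * g (ray a i p))"
proof -
  let ?f = "\<lambda>p::'b\<times>real. ((P i - a) \<bullet> \<nu> i * snd p ^ DIM('b)) * g (ray a i p)"
  have "continuous_on UNIV ?f"
    by (intro continuous_intros continuous_on_compose2[OF g] continuous_on_compose2[OF continuous_\<Phi>[OF i]]) auto
  moreover have "bounded (Y i \<times> {0<..<1::real})"
    using compact_imp_bounded[OF compact_Y[OF i]] by (intro bounded_Times) auto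
  moreover have B: "Y i \<times> {0<..<1::real} \<in> sets borel"
    using Y_borel[OF i] by (intro borel_Times) auto
  ultimately have "set_integrable lebesgue (Y i \<times> {0<..<1::real}) ?f"
    by (intro set_integrable_continuous) auto
  moreover have "(\<lambda>p. indicat_real (Y i \<times> {0<..<1::real}) p *\<^sub>R ?f p) \<in> borel_measurable lborel"
    using B \<open>continuous_on UNIV ?f\<close> by (intro borel_measurable_scaleR borel_measurable_indicator) (auto intro: borel_measurable_continuous_onI)
  ultimately have "integrable lborel (\<lambda>p. indicat_real (Y i \<times> {0<..<1::real}) p *\<^sub>R ?f p)"
    unfolding set_integrable_def by (subst (asm) integrable_completion) auto
  moreover have "indicat_real (Y i \<times> {0<..<1::real}) p *\<^sub>R ?f p = pw a i p * g (ray a i p)" for p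
    by (cases p) (auto simp: pw_def indicator_def)
  ultimately have "integrable lborel (\<lambda>p. pw a i p * g (ray a i p))" by (simp only:)
  then show ?thesis by (simp add: lborel_prod)
qed

lemma integral_polar_nonneg:
  assumes a: "a \<in> ball c (\<rho> * h)" and g: "continuous_on UNIV g" and g0: "\<And>x. g x \<ge> 0"
  shows "(LINT x:D|lebesgue. g x) = (\<Sum>i\<in>I. LINT p|(lborel \<Otimes>\<^sub>M lborel). pw a i p * g (ray a i p))"
proof -
  have gm[measurable]: "g \<in> borel_measurable borel" using g by (rule borel_measurable_continuous_onI)
  have iD: "integrable lborel (\<lambda>x. indicat_real D x * g x)"
    using set_integrable_D[OF g] unfolding set_integrable_def by (subst (asm) integrable_completion) auto
  have pw0: "pw a i p * g (ray a i p) \<ge> 0" if "i \<in> I" for i p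
    using height_pos[OF that a] g0 by (auto simp: pw_def indicator_def)
  have "ennreal (LINT x:D|lebesgue. g x) = ennreal (LINT x|lborel. indicat_real D x * g x)"
    unfolding set_lebesgue_integral_def by (subst integral_completion) auto
  also have "\<dots> = (\<integral>\<^sup>+x. ennreal (indicat_real D x * g x) \<partial>lborel)"
    using g0 by (intro nn_integral_eq_integral[symmetric] iD) auto
  also have "\<dots> = (\<integral>\<^sup>+x. indicator D x * ennreal (g x) \<partial>lborel)"
    by (intro nn_integral_cong) (auto simp: indicator_def)
  also have "\<dots> = (\<Sum>i\<in>I. \<integral>\<^sup>+y. \<integral>\<^sup>+s. indicator (Y i) y * polar a i (\<lambda>x. ennreal (g x)) y s \<partial>lborel \<partial>lborel)"
    by (rule nn_integral_polar[OF a]) measurable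
  also have "\<dots> = (\<Sum>i\<in>I. ennreal (LINT p|(lborel \<Otimes>\<^sub>M lborel). pw a i p * g (ray a i p)))"
  proof (rule sum.cong[OF refl])
    fix i assume i: "i \<in> I"
    have "(\<integral>\<^sup>+y. \<integral>\<^sup>+s. indicator (Y i) y * polar a i (\<lambda>x. ennreal (g x)) y s \<partial>lborel \<partial>lborel)
      = (\<integral>\<^sup>+y. \<integral>\<^sup>+s. ennreal (pw a i (y, s) * g (a + snd (y, s) *\<^sub>R (\<Phi> i (fst (y, s)) - a))) \<partial>lborel \<partial>lborel)"
      using height_pos[OF i a] by (intro nn_integral_cong) (auto simp: pw_def indicator_def ennreal_mult g0)
    also have "\<dots> = (\<integral>\<^sup>+p. ennreal (pw a i p * g (ray a i p)) \<partial>(lborel \<Otimes>\<^sub>M lborel))"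
      by (rule lborel.nn_integral_fst) (use pw_integrable[OF g i, of a] in \<open>auto intro: borel_measurable_integrable measurable_compose_rev[OF _ measurable_ennreal]\<close>)
    also have "\<dots> = ennreal (LINT p|(lborel \<Otimes>\<^sub>M lborel). pw a i p * g (ray a i p))"
      using pw0[OF i] by (intro nn_integral_eq_integral pw_integrable g i) auto
    finally show "(\<integral>\<^sup>+y. \<integral>\<^sup>+s. indicator (Y i) y * polar a i (\<lambda>x. ennreal (g x)) y s \<partial>lborel \<partial>lborel)
      = ennreal (LINT p|(lborel \<Otimes>\<^sub>M lborel). pw a i p * g (ray a i p))" .
  qed
  also have "\<dots> = ennreal (\<Sum>i\<in>I. LINT p|(lborel \<Otimes>\<^sub>M lborel). pw a i p * g (ray a i p))"
    using pw0 by (intro sum_ennreal integral_nonneg_AE) auto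
  finally show ?thesis
    using pw0 g0 by (subst (asm) ennreal_inj) (auto intro!: sum_nonneg integral_nonneg_AE simp: set_lebesgue_integral_def)
qed

lemma integral_polar:
  assumes a: "a \<in> ball c (\<rho> * h)" and g: "continuous_on UNIV g"
  shows "(LINT x:D|lebesgue. g x) = (\<Sum>i\<in>I. LINT p|(lborel \<Otimes>\<^sub>M lborel). pw a i p * g (ray a i p))"
proof -
  let ?p = "\<lambda>x. max (g x) 0" and ?n = "\<lambda>x. max (- g x) 0"
  have c: "continuous_on UNIV ?p" "continuous_on UNIV ?n" by (intro continuous_intros g)+
  have gd: "g x = ?p x - ?n x" for x by auto
  have "(LINT x:D|lebesgue. g x) = (LINT x:D|lebesgue. ?p x - ?n x)" using gd by simp
  also have "\<dots> = (LINT x:D|lebesgue. ?p x) - (LINT x:D|lebesgue. ?n x)"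
    by (rule set_integral_diff(2)) (auto intro!: set_integrable_D c)
  also have "\<dots> = (\<Sum>i\<in>I. (LINT p|(lborel \<Otimes>\<^sub>M lborel). pw a i p * ?p (ray a i p)) -
      (LINT p|(lborel \<Otimes>\<^sub>M lborel). pw a i p * ?n (ray a i p)))"
    by (subst (1 2) integral_polar_nonneg[OF a]) (auto simp: c sum_subtractf)
  also have "\<dots> = (\<Sum>i\<in>I. LINT p|(lborel \<Otimes>\<^sub>M lborel). pw a i p * g (ray a i p))"
  proof (rule sum.cong[OF refl])
    fix i assume i: "i \<in> I"
    have "pw a i p * g (ray a i p) =
      pw a i p * ?p (ray a i p) - pw a i p * ?n (ray a i p)" for p
      by (subst gd) (simp add: right_diff_distrib)
    then show "(LINT p|(lborel \<Otimes>\<^sub>M lborel). pw a i p * ?p (ray a i p)) -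
      (LINT p|(lborel \<Otimes>\<^sub>M lborel). pw a i p * ?n (ray a i p)) =
      (LINT p|(lborel \<Otimes>\<^sub>M lborel). pw a i p * g (ray a i p))"
      using Bochner_Integration.integral_diff[OF pw_integrable[OF c(1) i, of a] pw_integrable[OF c(2) i, of a]] by simp
  qed
  finally show ?thesis .
qed

text \<open>The divergence theorem for the field \<open>f(x) (x - a)\<close>. On a ray, the
  integrand times the Jacobian power of \<open>s\<close> is the derivative of \<open>s^n f\<close>,
  so the radial integral collapses to the boundary value; on piece \<open>i\<close> the normal
  component of \<open>x - a\<close> is the constant height.\<close>

lemma integral_radial:
  assumes a: "a \<in> ball c (\<rho> * h)" and f: "C1 f"
  shows "(LINT x:D|lebesgue. real CARD('n) * f x + (x - a) \<bullet> grad f x) =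
    (\<Sum>i\<in>I. (P i - a) \<bullet> \<nu> i * (LINT y:Y i|lebesgue. f (\<Phi> i y)))"
proof -
  let ?g = "\<lambda>x. real CARD('n) * f x + (x - a) \<bullet> grad f x"
  have g: "continuous_on UNIV ?g"
    by (intro continuous_intros C1_continuous C1_continuous_grad f)
  have "(LINT p|(lborel \<Otimes>\<^sub>M lborel). pw a i p * ?g (ray a i p)) = (P i - a) \<bullet> \<nu> i * (LINT y:Y i|lebesgue. f (\<Phi> i y))" if i: "i \<in> I" for i
  proof -
    let ?d = "(P i - a) \<bullet> \<nu> i"
    have "(LINT p|(lborel \<Otimes>\<^sub>M lborel). pw a i p * ?g (ray a i p))
      = (LINT y|lborel. LINT s|lborel. pw a i (y, s) * ?g (a + s *\<^sub>R (\<Phi> i y - a)))"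
      by (subst lborel_pair.integral_fst'[OF pw_integrable[OF g i], symmetric]) simp
    also have "\<dots> = (LINT y|lborel. ?d * (indicat_real (Y i) y * f (\<Phi> i y)))"
    proof (rule Bochner_Integration.integral_cong[OF refl])
      fix y
      let ?v = "\<Phi> i y - a"
      let ?F = "\<lambda>s. s ^ CARD('n) * f (a + s *\<^sub>R ?v)"
      let ?F' = "\<lambda>s. s ^ DIM('b) * ?g (a + s *\<^sub>R ?v)"
      have n: "CARD('n) = Suc DIM('b)" using dim_b by simp
      have F: "(?F has_real_derivative ?F' s) (at s)" for s
        unfolding n by (rule derivative_eq_intros C1_along_line[OF f] refl)+ (simp add: n algebra_simps)
      have "(LINT s|lborel. pw a i (y, s) * ?g (a + s *\<^sub>R ?v)) = (LINT s|lborel. (indicat_real (Y i) y * ?d) * (indicator {0..1} s *\<^sub>R ?F' s))"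
      proof (rule integral_cong_AE)
        have [measurable]: "(\<lambda>s. ?g (a + s *\<^sub>R ?v)) \<in> borel_measurable borel"
          by (intro borel_measurable_continuous_onI continuous_on_compose2[OF g] continuous_intros) auto
        show "(\<lambda>s. pw a i (y, s) * ?g (a + s *\<^sub>R ?v)) \<in> borel_measurable lborel"
          unfolding pw_def fst_conv snd_conv by measurable
        show "(\<lambda>s. (indicat_real (Y i) y * ?d) * (indicator {0..1} s *\<^sub>R ?F' s)) \<in> borel_measurable lborel"
          by measurable
        show "AE s in lborel. pw a i (y, s) * ?g (a + s *\<^sub>R ?v) = (indicat_real (Y i) y * ?d) * (indicator {0..1} s *\<^sub>R ?F' s)"
          using AE_lborel_singleton[of "0::real"] AE_lborel_singleton[of "1::real"]
          by eventually_elim (auto simp: pw_def indicator_def)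
      qed
      also have "\<dots> = (indicat_real (Y i) y * ?d) * (?F 1 - ?F 0)"
      proof -
        have "(LINT s|lborel. indicator {0..1} s *\<^sub>R ?F' s) = ?F 1 - ?F 0"
        proof (rule integral_FTC_atLeastAtMost)
          show "(?F has_vector_derivative ?F' s) (at s within {0..1})" for s
            using F[of s] by (simp add: has_real_derivative_iff_has_vector_derivative has_vector_derivative_at_within)
          show "continuous_on {0..1} ?F'"
            by (intro continuous_intros continuous_on_compose2[OF g]) auto
        qed simp
        then show ?thesis by (simp only: integral_mult_right_zero)
      qed
      also have "\<dots> = ?d * (indicat_real (Y i) y * f (\<Phi> i y))" by simp
      finally show "(LINT s|lborel. pw a i (y, s) * ?g (a + s *\<^sub>R ?v)) = ?d * (indicat_real (Y i) y * f (\<Phi> i y))" .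
    qed
    also have "\<dots> = ?d * (LINT y|lborel. indicat_real (Y i) y * f (\<Phi> i y))" by simp
    also have "(LINT y|lborel. indicat_real (Y i) y * f (\<Phi> i y)) = (LINT y:Y i|lebesgue. f (\<Phi> i y))"
    proof -
      have [measurable]: "Y i \<in> sets borel" by (rule Y_borel[OF i])
      have [measurable]: "(\<lambda>y. f (\<Phi> i y)) \<in> borel_measurable borel"
        by (intro borel_measurable_continuous_onI continuous_on_compose2[OF C1_continuous[OF f] continuous_\<Phi>[OF i]]) auto
      show ?thesis unfolding set_lebesgue_integral_def by (subst integral_completion) auto
    qed
    finally show ?thesis .
  qed
  then show ?thesis unfolding integral_polar[OF a g] by simp
qed

text \<open>The radial identity is affine in the apex. Subtracting its instances for two star
  centres that differ by a multiple of \<open>e\<close> isolates the constant field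
  \<open>e\<close>.\<close>

lemma divergence_theorem:
  assumes f: "C1 f"
  shows "(LINT x:D|lebesgue. e \<bullet> grad f x) = (\<Sum>i\<in>I. (e \<bullet> \<nu> i) * (LINT y:Y i|lebesgue. f (\<Phi> i y)))"
proof -
  \<comment> \<open>Keeps the second apex in the ball of star centres; the added 1 covers
    \<open>e = 0\<close>.\<close>
  define \<epsilon> where "\<epsilon> = \<rho> * h / (2 * (norm e + 1))"
  have ne: "norm e + 1 > 0" by (simp add: add_nonneg_pos)
  have \<epsilon>: "\<epsilon> > 0" using \<rho>_pos h_pos ne by (simp add: \<epsilon>_def)
  have a: "c + \<epsilon> *\<^sub>R e \<in> ball c (\<rho> * h)"
  proof -
    have "\<epsilon> * norm e < \<epsilon> * (2 * (norm e + 1))" using \<epsilon> ne by (intro mult_strict_left_mono) auto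
    also have "\<dots> = \<rho> * h" using ne by (simp add: \<epsilon>_def)
    finally show ?thesis using \<epsilon> by (simp add: dist_norm)
  qed
  let ?g = "\<lambda>a x. real CARD('n) * f x + (x - a) \<bullet> grad f x"
  have g: "set_integrable lebesgue D (?g a)" for a
    by (intro set_integrable_D continuous_intros C1_continuous C1_continuous_grad f)
  have "\<epsilon> * (LINT x:D|lebesgue. e \<bullet> grad f x) = (LINT x:D|lebesgue. ?g c x - ?g (c + \<epsilon> *\<^sub>R e) x)"
    by (simp add: inner_diff_left inner_add_left algebra_simps)
  also have "\<dots> = (LINT x:D|lebesgue. ?g c x) - (LINT x:D|lebesgue. ?g (c + \<epsilon> *\<^sub>R e) x)"
    by (rule set_integral_diff(2)) (rule g)+
  also have "\<dots> = (\<Sum>i\<in>I. ((P i - c) \<bullet> \<nu> i - (P i - (c + \<epsilon> *\<^sub>R e)) \<bullet> \<nu> i) * (LINT y:Y i|lebesgue. f (\<Phi> i y)))"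
    unfolding integral_radial[OF c_in_ball f] integral_radial[OF a f] by (simp add: sum_subtractf left_diff_distrib)
  also have "\<dots> = \<epsilon> * (\<Sum>i\<in>I. (e \<bullet> \<nu> i) * (LINT y:Y i|lebesgue. f (\<Phi> i y)))"
    unfolding sum_distrib_left by (intro sum.cong) (auto simp: inner_diff_left inner_add_left)
  finally show ?thesis using \<epsilon> by simp
qed

lemma bint_mono_nonneg: "(\<And>x. f x \<ge> 0) \<Longrightarrow> bint f \<ge> 0"
  unfolding bint_def set_lebesgue_integral_def by (intro sum_nonneg integral_nonneg_AE) auto

lemma two_le_card: "CARD('n) \<ge> 2" using dim_b DIM_positive[where 'a='b] by linarith

text \<open>The radial identity for \<open>f^2\<close>: heights are at most \<open>h\<close>, the
  cross term is split by Young's inequality, and dimension at least two leaves one full copy of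
  \<open>f^2\<close> on the left.\<close>

lemma poincare:
  assumes f: "C1 f"
  shows "(LINT x:D|lebesgue. (f x)^2) \<le> h * bint (\<lambda>x. (f x)^2) + h^2 * (LINT x:D|lebesgue. (norm (grad f x))^2)"
proof -
  have f2: "C1 (\<lambda>x. (f x)^2)" "grad (\<lambda>x. (f x)^2) = (\<lambda>x. (2 * f x) *\<^sub>R grad f x)"
    unfolding power2_eq_square using C1_mult[OF f f] by (auto simp: algebra_simps scaleR_2[symmetric])
  note ci = continuous_intros C1_continuous[OF f] C1_continuous_grad[OF f]
  have "(LINT x:D|lebesgue. 2 * (f x)^2 - ((f x)^2 + h^2 * (norm (grad f x))^2)) \<le> (LINT x:D|lebesgue. real CARD('n) * (f x)^2 + (x - c) \<bullet> grad (\<lambda>x. (f x)^2) x)"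
  proof (rule set_integral_mono)
    fix x assume x: "x \<in> D"
    have "\<bar>(x - c) \<bullet> grad f x\<bar> \<le> h * norm (grad f x)"
      using Cauchy_Schwarz_ineq2[of "x - c" "grad f x"] dist_c_le[OF x] mult_right_mono[of "norm (x-c)" h "norm (grad f x)"] by simp
    then have "\<bar>f x * ((x - c) \<bullet> grad f x)\<bar> \<le> \<bar>f x\<bar> * (h * norm (grad f x))" unfolding abs_mult by (intro mult_left_mono) auto
    moreover have "2 * (\<bar>f x\<bar> * (h * norm (grad f x))) \<le> (f x)^2 + h^2 * (norm (grad f x))^2"
      using sum_squares_bound[of "\<bar>f x\<bar>" "h * norm (grad f x)"] by (simp add: power_mult_distrib)
    ultimately have "- ((f x)^2 + h^2 * (norm (grad f x))^2) \<le> 2 * (f x * ((x - c) \<bullet> grad f x))" by linarith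
    moreover have "2 * (f x)^2 \<le> real CARD('n) * (f x)^2" using two_le_card by (intro mult_right_mono) auto
    ultimately show "2 * (f x)^2 - ((f x)^2 + h^2 * (norm (grad f x))^2) \<le> real CARD('n) * (f x)^2 + (x - c) \<bullet> grad (\<lambda>x. (f x)^2) x"
      unfolding f2 by simp
  next
    show "set_integrable lebesgue D (\<lambda>x. 2 * (f x)^2 - ((f x)^2 + h^2 * (norm (grad f x))^2))"
      by (intro set_integrable_D ci)
    show "set_integrable lebesgue D (\<lambda>x. real CARD('n) * (f x)^2 + (x - c) \<bullet> grad (\<lambda>x. (f x)^2) x)"
      unfolding f2 by (intro set_integrable_D ci)
  qed
  also have "\<dots> = (\<Sum>i\<in>I. (P i - c) \<bullet> \<nu> i * (LINT y:Y i|lebesgue. (f (\<Phi> i y))^2))"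
    by (rule integral_radial[OF c_in_ball f2(1)])
  also have "\<dots> \<le> (\<Sum>i\<in>I. h * (LINT y:Y i|lebesgue. (f (\<Phi> i y))^2))"
    by (intro sum_mono mult_right_mono height_le) (auto simp: set_lebesgue_integral_def intro!: integral_nonneg_AE)
  also have "\<dots> = h * bint (\<lambda>x. (f x)^2)" by (simp add: bint_def sum_distrib_left)
  also have "(LINT x:D|lebesgue. 2 * (f x)^2 - ((f x)^2 + h^2 * (norm (grad f x))^2)) = (LINT x:D|lebesgue. (f x)^2) - h^2 * (LINT x:D|lebesgue. (norm (grad f x))^2)"
  proof -
    have "(LINT x:D|lebesgue. 2 * (f x)^2 - ((f x)^2 + h^2 * (norm (grad f x))^2)) = (LINT x:D|lebesgue. (f x)^2 - h^2 * (norm (grad f x))^2)" by simp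
    also have "\<dots> = (LINT x:D|lebesgue. (f x)^2) - (LINT x:D|lebesgue. h^2 * (norm (grad f x))^2)"
      by (rule set_integral_diff(2)) (intro set_integrable_D ci)+
    finally show ?thesis by simp
  qed
  finally show ?thesis by simp
qed

end

lemma ennreal_set_integral:
  fixes g :: "'a::euclidean_space \<Rightarrow> real"
  assumes g: "continuous_on UNIV g" and g0: "\<And>x. g x \<ge> 0" and S: "bounded S" "S \<in> sets borel"
  shows "ennreal (LINT x:S|lebesgue. g x) = (\<integral>\<^sup>+x. indicator S x * ennreal (g x) \<partial>lborel)"
proof -
  have [measurable]: "g \<in> borel_measurable borel" "S \<in> sets borel" using g S by (auto intro: borel_measurable_continuous_onI)
  have i: "integrable lborel (\<lambda>x. indicat_real S x * g x)"
  proof -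
    have "set_integrable lebesgue S g" using S by (intro set_integrable_continuous[OF g]) auto
    then show ?thesis unfolding set_integrable_def by (subst (asm) integrable_completion) auto
  qed
  have "ennreal (LINT x:S|lebesgue. g x) = ennreal (LINT x|lborel. indicat_real S x * g x)"
    unfolding set_lebesgue_integral_def by (subst integral_completion) auto
  also have "\<dots> = (\<integral>\<^sup>+x. ennreal (indicat_real S x * g x) \<partial>lborel)"
    using g0 by (intro nn_integral_eq_integral[symmetric] i) auto
  also have "\<dots> = (\<integral>\<^sup>+x. indicator S x * ennreal (g x) \<partial>lborel)"
    by (intro nn_integral_cong) (auto simp: indicator_def)
  finally show ?thesis .
qed

text \<open>The value at radius \<open>s\<close> is the boundary value minus the integral of the
  radial derivative. Cauchy-Schwarz on the short interval yields one factor \<open>1 - t\<close>;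
  integrating over the layer later adds another.\<close>

lemma C1_radial_bound:
  assumes f: "C1 f" and t: "0 \<le> t" "t \<le> s" "s \<le> 1" and v: "norm v \<le> h"
  shows "(f (a + s *\<^sub>R v))^2 \<le> 2 * (f (a + v))^2 + 2 * (1 - t) * h^2 * (LINT \<sigma>:{t..1}|lborel. (norm (grad f (a + \<sigma> *\<^sub>R v)))^2)"
proof -
  let ?g = "\<lambda>\<sigma>. v \<bullet> grad f (a + \<sigma> *\<^sub>R v)" and ?\<psi> = "\<lambda>\<sigma>. (norm (grad f (a + \<sigma> *\<^sub>R v)))^2"
  have cg: "continuous_on S ?g" "continuous_on S ?\<psi>" for S
    by (intro continuous_intros continuous_on_compose2[OF C1_continuous_grad[OF f]]; auto)+
  define q where "q = (LINT \<sigma>:{s..1}|lborel. ?g \<sigma>)"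
  have "q = f (a + 1 *\<^sub>R v) - f (a + s *\<^sub>R v)"
    unfolding q_def set_lebesgue_integral_def
    by (rule integral_FTC_atLeastAtMost)
       (use t C1_along_line[OF f] cg in \<open>auto simp: has_real_derivative_iff_has_vector_derivative has_vector_derivative_at_within\<close>)
  then have fs: "f (a + s *\<^sub>R v) = f (a + v) - q" by simp
  have ig: "set_integrable lborel {x..y} ?\<psi>" for x y by (rule borel_integrable_atLeastAtMost'[OF cg(2)])
  have R0: "0 \<le> (LINT \<sigma>:{t..1}|lborel. ?\<psi> \<sigma>)" unfolding set_lebesgue_integral_def by (auto intro!: integral_nonneg_AE)
  have "q^2 \<le> (1 - s) * (LINT \<sigma>:{s..1}|lborel. (?g \<sigma>)^2)"
    unfolding q_def using t by (intro integral_Icc_Cauchy_Schwarz cg) auto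
  also have "\<dots> \<le> (1 - s) * (LINT \<sigma>:{s..1}|lborel. h^2 * ?\<psi> \<sigma>)"
  proof (intro mult_left_mono set_integral_mono)
    fix \<sigma>
    have "\<bar>?g \<sigma>\<bar> \<le> h * norm (grad f (a + \<sigma> *\<^sub>R v))"
      using Cauchy_Schwarz_ineq2[of v "grad f (a + \<sigma> *\<^sub>R v)"] mult_right_mono[OF v, of "norm (grad f (a + \<sigma> *\<^sub>R v))"] by simp
    then have "\<bar>?g \<sigma>\<bar>^2 \<le> (h * norm (grad f (a + \<sigma> *\<^sub>R v)))^2" by (rule power_mono) simp
    then show "(?g \<sigma>)^2 \<le> h^2 * ?\<psi> \<sigma>" by (simp add: power_mult_distrib)
  next
    show "set_integrable lborel {s..1} (\<lambda>\<sigma>. (?g \<sigma>)^2)"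
      by (rule borel_integrable_atLeastAtMost') (intro continuous_intros cg)
  qed (use t ig in auto)
  also have "\<dots> = (1 - s) * h^2 * (LINT \<sigma>:{s..1}|lborel. ?\<psi> \<sigma>)" by simp
  also have "\<dots> \<le> (1 - t) * h^2 * (LINT \<sigma>:{t..1}|lborel. ?\<psi> \<sigma>)"
  proof (intro mult_mono)
    show "(LINT \<sigma>:{s..1}|lborel. ?\<psi> \<sigma>) \<le> (LINT \<sigma>:{t..1}|lborel. ?\<psi> \<sigma>)"
      using ig t unfolding set_lebesgue_integral_def set_integrable_def by (intro integral_mono) (auto simp: indicator_def)
    show "0 \<le> (LINT \<sigma>:{s..1}|lborel. ?\<psi> \<sigma>)" unfolding set_lebesgue_integral_def by (auto intro!: integral_nonneg_AE)
  qed (use t in auto)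
  finally have "q^2 \<le> (1 - t) * h^2 * (LINT \<sigma>:{t..1}|lborel. ?\<psi> \<sigma>)" .
  moreover have "(f (a + v) - q)^2 \<le> 2 * (f (a + v))^2 + 2 * q^2"
    using zero_le_power2[of "f (a + v) + q"] by (simp add: power2_eq_square algebra_simps)
  ultimately show ?thesis unfolding fs by linarith
qed

context star_cell begin

definition shrink :: "real \<Rightarrow> (real,'n) vec set" where
  "shrink t = (\<lambda>x. c + t *\<^sub>R (x - c)) ` D"

lemma compact_shrink: "compact (shrink t)"
  unfolding shrink_def by (intro compact_continuous_image compact_D continuous_intros)

lemma shrink_iff:
  assumes i: "i \<in> I" and y: "y \<in> Y i" and s: "0 < s" and t: "0 < t"
  shows "c + s *\<^sub>R (\<Phi> i y - c) \<in> shrink t \<longleftrightarrow> s \<le> t"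
proof
  assume "s \<le> t"
  then have "c + (s / t) *\<^sub>R (\<Phi> i y - c) \<in> D"
    using s t by (intro star_point c_in_ball \<Phi>_in_D i y) auto
  moreover have "c + s *\<^sub>R (\<Phi> i y - c) = c + t *\<^sub>R ((c + (s / t) *\<^sub>R (\<Phi> i y - c)) - c)" using t by simp
  ultimately show "c + s *\<^sub>R (\<Phi> i y - c) \<in> shrink t" unfolding shrink_def by blast
next
  assume "c + s *\<^sub>R (\<Phi> i y - c) \<in> shrink t"
  then obtain x where x: "x \<in> D" "s *\<^sub>R (\<Phi> i y - c) = t *\<^sub>R (x - c)" by (auto simp: shrink_def)
  show "s \<le> t"
  proof (rule ccontr)
    assume "\<not> s \<le> t"
    then have "c + (t / s) *\<^sub>R (x - c) \<in> interior D" using x s t by (intro shrink_interior c_in_ball) auto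
    moreover have "c + (t / s) *\<^sub>R (x - c) = \<Phi> i y"
    proof -
      have "(t / s) *\<^sub>R (x - c) = (1 / s) *\<^sub>R (t *\<^sub>R (x - c))" by simp
      also have "\<dots> = \<Phi> i y - c" using s by (simp add: x(2)[symmetric])
      finally show ?thesis by simp
    qed
    ultimately show False using \<Phi>_in_frontier[OF i y] by (auto simp: frontier_def)
  qed
qed

text \<open>Because of \<open>1/2 \<le> t\<close> the Jacobian power of \<open>s\<close> lies
  between \<open>(1/2)^(n-1)\<close> and 1 throughout the layer, with \<open>n\<close> the dimension
  of the cell. Replacing it by one bound on the left and by the other on the right produces the
  constant \<open>2^n\<close>.\<close>

lemma layer_estimate_fibre:
  assumes f: "C1 f" and t: "1/2 \<le> t" "t < 1" and i: "i \<in> I" and y: "y \<in> Y i"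
  shows "(\<integral>\<^sup>+s. polar c i (\<lambda>x. indicator (- shrink t) x * ennreal ((f x)^2)) y s \<partial>lborel)
    \<le> ennreal (2 * (1 - t) * h) * ennreal ((f (\<Phi> i y))^2) + ennreal (2 ^ CARD('n) * (1 - t)^2 * h^2) *
      (\<integral>\<^sup>+s. polar c i (\<lambda>x. indicator (- shrink t) x * ennreal ((norm (grad f x))^2)) y s \<partial>lborel)"
    (is "?l \<le> _ + _ * ?r")
proof -
  define d where "d = (P i - c) \<bullet> \<nu> i"
  define v where "v = \<Phi> i y - c"
  have d: "0 \<le> d" "d \<le> h" using height_pos[OF i c_in_ball] height_le[OF i] by (auto simp: d_def)
  have v: "norm v \<le> h" using dist_c_le[OF \<Phi>_in_D[OF i y]] by (simp add: v_def)
  let ?\<psi> = "\<lambda>\<sigma>. (norm (grad f (c + \<sigma> *\<^sub>R v)))^2"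
  have c\<psi>: "continuous_on S ?\<psi>" for S
    by (intro continuous_intros continuous_on_compose2[OF C1_continuous_grad[OF f]]; auto)
  define R where "R = (LINT \<sigma>:{t..1}|lborel. ?\<psi> \<sigma>)"
  have R0: "R \<ge> 0" unfolding R_def set_lebesgue_integral_def by (auto intro!: integral_nonneg_AE)
  define K where "K = 2 * (f (\<Phi> i y))^2 + 2 * (1 - t) * h^2 * R"
  have K0: "K \<ge> 0" using R0 t by (simp add: K_def)
  have ind: "indicator (- shrink t) (c + s *\<^sub>R v) = (indicator {t<..} s :: ennreal)" if "0 < s" for s
    using shrink_iff[OF i y that, of t] t by (auto simp: v_def indicator_def)
  have "?l \<le> (\<integral>\<^sup>+s. ennreal (d * K) * indicator {t..1} s \<partial>lborel)"
    unfolding d_def[symmetric] v_def[symmetric]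
  proof (rule nn_integral_mono)
    fix s :: real
    show "indicator {0<..<1} s * (ennreal (d * s ^ DIM('b)) *
       (indicator (- shrink t) (c + s *\<^sub>R v) * ennreal ((f (c + s *\<^sub>R v))^2))) \<le> ennreal (d * K) * indicator {t..1} s"
    proof (cases "t < s \<and> s < 1")
      case True
      have "(f (c + s *\<^sub>R v))^2 \<le> K"
        using C1_radial_bound[OF f _ _ _ v, of t s c] True t by (simp add: K_def R_def v_def)
      moreover have "s ^ DIM('b) \<le> 1" using True t by (intro power_le_one) auto
      ultimately have "(d * s ^ DIM('b)) * (f (c + s *\<^sub>R v))^2 \<le> d * 1 * K"
        using d K0 True t by (intro mult_mono) auto
      then have "ennreal (d * s ^ DIM('b) * (f (c + s *\<^sub>R v))^2) \<le> ennreal (d * K)" by (intro ennreal_leI) simp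
      then show ?thesis using True t d by (simp add: ennreal_mult[symmetric] ind)
    next
      case False
      then have "indicator {0<..<1} s * (indicator (- shrink t) (c + s *\<^sub>R v)::ennreal) = 0"
        using ind[of s] by (cases "0 < s \<and> s < 1") (auto split: split_indicator)
      then have "indicator {0<..<1} s = (0::ennreal) \<or> (indicator (- shrink t) (c + s *\<^sub>R v)::ennreal) = 0" by simp
      then show ?thesis by (elim disjE) simp_all
    qed
  qed
  also have "\<dots> = ennreal (d * K) * ennreal (1 - t)"
    using t by (subst nn_integral_cmult_indicator) auto
  also have "\<dots> = ennreal (d * K * (1 - t))" using t d K0 by (simp add: ennreal_mult)
  also have "\<dots> \<le> ennreal ((2 * (1 - t) * h) * (f (\<Phi> i y))^2 + (2 * (1-t)^2 * h^2) * (d * R))"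
  proof (rule ennreal_leI)
    have "d * K * (1 - t) = (2 * (1 - t) * d) * (f (\<Phi> i y))^2 + (2 * (1-t)^2 * h^2) * (d * R)"
      by (simp add: K_def power2_eq_square algebra_simps)
    also have "\<dots> \<le> (2 * (1 - t) * h) * (f (\<Phi> i y))^2 + (2 * (1-t)^2 * h^2) * (d * R)"
      using d t by (intro add_right_mono mult_right_mono mult_left_mono) auto
    finally show "d * K * (1 - t) \<le> (2 * (1 - t) * h) * (f (\<Phi> i y))^2 + (2 * (1-t)^2 * h^2) * (d * R)" .
  qed
  also have "\<dots> = ennreal (2 * (1 - t) * h) * ennreal ((f (\<Phi> i y))^2) + ennreal (2 * (1-t)^2 * h^2) * ennreal (d * R)"
    using t h_pos d R0 by (simp add: ennreal_mult ennreal_plus)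
  also have "\<dots> \<le> ennreal (2 * (1 - t) * h) * ennreal ((f (\<Phi> i y))^2) + ennreal (2 ^ CARD('n) * (1 - t)^2 * h^2) * ?r"
  proof (rule add_left_mono)
    have "ennreal (d * (1/2)^DIM('b) * R) \<le> ?r"
    proof -
      have "ennreal (d * (1/2)^DIM('b) * R) = ennreal (LINT s:{t..1}|lebesgue. d * (1/2)^DIM('b) * ?\<psi> s)"
      proof -
        have "R = (LINT s:{t..1}|lebesgue. ?\<psi> s)" unfolding R_def set_lebesgue_integral_def
          by (rule integral_completion[symmetric]) (intro borel_measurable_scaleR borel_measurable_indicator; auto intro!: borel_measurable_continuous_onI c\<psi>)
        then show ?thesis by simp
      qed
      also have "\<dots> = (\<integral>\<^sup>+s. indicator {t..1} s * ennreal (d * (1/2)^DIM('b) * ?\<psi> s) \<partial>lborel)"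
        by (rule ennreal_set_integral) (use d in \<open>auto intro!: continuous_intros c\<psi>\<close>)
      also have "\<dots> \<le> ?r"
        unfolding d_def[symmetric] v_def[symmetric]
      proof (rule nn_integral_mono_AE)
        show "AE s in lborel. indicator {t..1} s * ennreal (d * (1/2)^DIM('b) * ?\<psi> s) \<le> indicator {0<..<1} s * (ennreal (d * s ^ DIM('b)) *
           (indicator (- shrink t) (c + s *\<^sub>R v) * ennreal (?\<psi> s)))"
          using AE_lborel_singleton[of t] AE_lborel_singleton[of "1::real"]
        proof eventually_elim
          case (elim s)
          show ?case
          proof (cases "s \<in> {t..1}")
            case True
            then have s: "t < s" "s < 1" using elim by auto
            have "(1/2) ^ DIM('b) \<le> s ^ DIM('b)" using s t by (intro power_mono) auto
            then have "d * (1/2)^DIM('b) * ?\<psi> s \<le> d * s ^ DIM('b) * ?\<psi> s" using d by (intro mult_right_mono mult_left_mono) auto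
            then show ?thesis using s t d by (simp add: ind ennreal_mult[symmetric])
          qed simp
        qed
      qed
      finally show ?thesis .
    qed
    then have "ennreal (2 ^ DIM('b) * (2 * (1 - t)^2 * h^2)) * ennreal (d * (1/2)^DIM('b) * R) \<le> ennreal (2 ^ DIM('b) * (2 * (1 - t)^2 * h^2)) * ?r"
      by (rule mult_left_mono) simp
    moreover have "ennreal (2 ^ DIM('b) * (2 * (1 - t)^2 * h^2)) * ennreal (d * (1/2)^DIM('b) * R) = ennreal (2 * (1-t)^2 * h^2) * ennreal (d * R)"
      using d R0 by (simp add: ennreal_mult[symmetric] power_one_over)
    moreover have "2 ^ DIM('b) * (2 * (1 - t)^2 * h^2) = 2 ^ CARD('n) * (1 - t)^2 * h^2"
      unfolding dim_b[symmetric] by simp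
    ultimately show "ennreal (2 * (1-t)^2 * h^2) * ennreal (d * R) \<le> ennreal (2 ^ CARD('n) * (1 - t)^2 * h^2) * ?r"
      by simp
  qed
  finally show ?thesis .
qed

text \<open>The gradient term carries the square of the layer width \<open>(1 - t) * h\<close>. This
  compensates a cut-off function whose gradient has order \<open>1 / ((1 - t) * h)\<close>; the
  boundary term disappears when C1 functions approximate a function of zero trace.\<close>

lemma layer_estimate:
  assumes f: "C1 f" and t: "1/2 \<le> t" "t < 1"
  shows "(LINT x:D - shrink t|lebesgue. (f x)^2) \<le> 2 * (1 - t) * h * bint (\<lambda>x. (f x)^2) +
    2 ^ CARD('n) * (1 - t)^2 * h^2 * (LINT x:D - shrink t|lebesgue. (norm (grad f x))^2)"
proof -
  have sm: "shrink t \<in> sets borel" by (rule borel_closed[OF compact_imp_closed[OF compact_shrink]])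
  have S: "bounded (D - shrink t)" "D - shrink t \<in> sets borel"
    using bounded_D bounded_subset[of D "D - shrink t"] D_borel sm by auto
  have [measurable]: "shrink t \<in> sets borel" by fact
  have c1: "continuous_on UNIV (\<lambda>x. (f x)^2)" and c2: "continuous_on UNIV (\<lambda>x. (norm (grad f x))^2)"
    by (intro continuous_intros C1_continuous[OF f] C1_continuous_grad[OF f])+
  have [measurable]: "(\<lambda>x. (f x)^2) \<in> borel_measurable borel" "(\<lambda>x. (norm (grad f x))^2) \<in> borel_measurable borel"
    using c1 c2 by (auto intro: borel_measurable_continuous_onI)
  have pol: "(\<integral>\<^sup>+x. indicator (D - shrink t) x * ennreal (g x) \<partial>lborel) = (\<Sum>i\<in>I. \<integral>\<^sup>+y. \<integral>\<^sup>+s. indicator (Y i) y * polar c i (\<lambda>x. indicator (- shrink t) x * ennreal (g x)) y s \<partial>lborel \<partial>lborel)"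
    if [measurable]: "g \<in> borel_measurable borel" for g
  proof -
    have "(\<integral>\<^sup>+x. indicator (D - shrink t) x * ennreal (g x) \<partial>lborel) = (\<integral>\<^sup>+x. indicator D x * (indicator (- shrink t) x * ennreal (g x)) \<partial>lborel)"
      by (intro nn_integral_cong) (auto simp: indicator_def)
    then show ?thesis by (simp only:) (rule nn_integral_polar[OF c_in_ball], measurable)
  qed
  let ?A = "ennreal (2 * (1 - t) * h)" and ?B = "ennreal (2 ^ CARD('n) * (1 - t)^2 * h^2)"
  let ?w = "\<lambda>i y s. polar c i (\<lambda>x. indicator (- shrink t) x * ennreal ((norm (grad f x))^2)) y s"
  have "ennreal (LINT x:D - shrink t|lebesgue. (f x)^2) = (\<Sum>i\<in>I. \<integral>\<^sup>+y. \<integral>\<^sup>+s. indicator (Y i) y * polar c i (\<lambda>x. indicator (- shrink t) x * ennreal ((f x)^2)) y s \<partial>lborel \<partial>lborel)"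
    by (subst ennreal_set_integral[OF c1 _ S]) (auto intro!: pol)
  also have "\<dots> \<le> (\<Sum>i\<in>I. \<integral>\<^sup>+y. ?A * (indicator (Y i) y * ennreal ((f (\<Phi> i y))^2)) + ?B * (\<integral>\<^sup>+s. indicator (Y i) y * ?w i y s \<partial>lborel) \<partial>lborel)"
  proof (intro sum_mono nn_integral_mono)
    fix i y assume i: "i \<in> I"
    show "(\<integral>\<^sup>+s. indicator (Y i) y * polar c i (\<lambda>x. indicator (- shrink t) x * ennreal ((f x)^2)) y s \<partial>lborel)
      \<le> ?A * (indicator (Y i) y * ennreal ((f (\<Phi> i y))^2)) + ?B * (\<integral>\<^sup>+s. indicator (Y i) y * ?w i y s \<partial>lborel)"
    proof (cases "y \<in> Y i")
      case True
      then show ?thesis using layer_estimate_fibre[OF f t i True] by simp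
    qed simp
  qed
  also have "\<dots> = (\<Sum>i\<in>I. ?A * ennreal (LINT y:Y i|lebesgue. (f (\<Phi> i y))^2) + ?B * (\<integral>\<^sup>+y. \<integral>\<^sup>+s. indicator (Y i) y * ?w i y s \<partial>lborel \<partial>lborel))"
  proof (rule sum.cong[OF refl])
    fix i assume i: "i \<in> I"
    have [measurable]: "Y i \<in> sets borel" "\<Phi> i \<in> borel_measurable borel" using Y_borel[OF i] measurable_\<Phi>[OF i] by auto
    have "continuous_on UNIV (\<lambda>y. (f (\<Phi> i y))^2)"
      by (intro continuous_on_compose2[OF c1 continuous_\<Phi>[OF i]]) auto
    moreover have "bounded (Y i)" by (rule compact_imp_bounded[OF compact_Y[OF i]])
    ultimately have "ennreal (LINT y:Y i|lebesgue. (f (\<Phi> i y))^2) = (\<integral>\<^sup>+y. indicator (Y i) y * ennreal ((f (\<Phi> i y))^2) \<partial>lborel)"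
      by (intro ennreal_set_integral) auto
    moreover have "(\<lambda>y. \<integral>\<^sup>+s. indicator (Y i) y * ?w i y s \<partial>lborel) \<in> borel_measurable lborel"
      by measurable
    moreover have "(\<lambda>y. indicator (Y i) y * ennreal ((f (\<Phi> i y))^2)) \<in> borel_measurable lborel" by measurable
    ultimately show "(\<integral>\<^sup>+y. ?A * (indicator (Y i) y * ennreal ((f (\<Phi> i y))^2)) + ?B * (\<integral>\<^sup>+s. indicator (Y i) y * ?w i y s \<partial>lborel) \<partial>lborel) =
       ?A * ennreal (LINT y:Y i|lebesgue. (f (\<Phi> i y))^2) + ?B * (\<integral>\<^sup>+y. \<integral>\<^sup>+s. indicator (Y i) y * ?w i y s \<partial>lborel \<partial>lborel)"
      by (simp add: nn_integral_add nn_integral_cmult)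
  qed
  also have "\<dots> = ?A * ennreal (bint (\<lambda>x. (f x)^2)) + ?B * ennreal (LINT x:D - shrink t|lebesgue. (norm (grad f x))^2)"
  proof -
    have 1: "ennreal (bint (\<lambda>x. (f x)^2)) = (\<Sum>i\<in>I. ennreal (LINT y:Y i|lebesgue. (f (\<Phi> i y))^2))"
      unfolding bint_def by (rule sum_ennreal[symmetric]) (auto simp: set_lebesgue_integral_def intro!: integral_nonneg_AE)
    have 2: "ennreal (LINT x:D - shrink t|lebesgue. (norm (grad f x))^2) = (\<Sum>i\<in>I. \<integral>\<^sup>+y. \<integral>\<^sup>+s. indicator (Y i) y * ?w i y s \<partial>lborel \<partial>lborel)"
      by (subst ennreal_set_integral[OF c2 _ S]) (auto intro!: pol)
    show ?thesis unfolding 1 2 by (simp add: sum.distrib sum_distrib_left)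
  qed
  finally have le: "ennreal (LINT x:D - shrink t|lebesgue. (f x)^2) \<le>
    ?A * ennreal (bint (\<lambda>x. (f x)^2)) + ?B * ennreal (LINT x:D - shrink t|lebesgue. (norm (grad f x))^2)" .
  have "bint (\<lambda>x. (f x)^2) \<ge> 0" by (rule bint_mono_nonneg) simp
  moreover have "(LINT x:D - shrink t|lebesgue. (norm (grad f x))^2) \<ge> 0"
    unfolding set_lebesgue_integral_def by (auto intro!: integral_nonneg_AE)
  ultimately show ?thesis using le t h_pos by (simp add: ennreal_mult[symmetric] ennreal_plus[symmetric] del: ennreal_plus)
qed

lemma measure_D_le: "measure lebesgue D \<le> measure lebesgue (ball (0::(real,'n) vec) 1) * h ^ CARD('n)"
proof -
  have "measure lebesgue D \<le> measure lebesgue (cball c h)"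
    using D_subset D_borel by (intro measure_mono_fmeasurable) auto
  also have "\<dots> = measure lebesgue (ball (0::(real,'n) vec) 1) * h ^ CARD('n)"
    using content_cball_conv_ball[of c h] content_ball_conv_unit_ball[of h c] h_pos by simp
  finally show ?thesis .
qed

text \<open>The radial identity for the constant 1 says that the areas of the pieces weighted by
  their heights sum to \<open>n\<close> times the volume; each height is at least
  \<open>\<rho> * h\<close>.\<close>

lemma perimeter_le: "bint (\<lambda>_. 1) * \<rho> \<le> real CARD('n) * measure lebesgue (ball (0::(real,'n) vec) 1) * h ^ (CARD('n) - 1)"
proof -
  have "bint (\<lambda>_. 1) * \<rho> * h = (\<Sum>i\<in>I. (\<rho> * h) * (LINT y:Y i|lebesgue. 1))"
    by (simp add: bint_def sum_distrib_left sum_distrib_right mult_ac)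
  also have "\<dots> \<le> (\<Sum>i\<in>I. (P i - c) \<bullet> \<nu> i * (LINT y:Y i|lebesgue. 1))"
    by (intro sum_mono mult_right_mono \<nu>(3)) (auto simp: set_lebesgue_integral_def intro!: integral_nonneg_AE)
  also have "\<dots> = (LINT x:D|lebesgue. real CARD('n) * 1 + (x - c) \<bullet> grad (\<lambda>_. 1) x)"
    using integral_radial[OF c_in_ball C1_const(1)[of 1]] by simp
  also have "\<dots> = real CARD('n) * measure lebesgue D" by (simp add: C1_const set_lebesgue_integral_def)
  also have "\<dots> \<le> real CARD('n) * (measure lebesgue (ball (0::(real,'n) vec) 1) * h ^ CARD('n))"
    by (intro mult_left_mono measure_D_le) auto
  also have "h ^ CARD('n) = h ^ (CARD('n) - 1) * h" using two_le_card by (metis Suc_diff_1 le_trans less_le_trans one_le_numeral pos2 power_Suc2 zero_less_card_finite)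
  finally show ?thesis using h_pos by (simp add: mult.assoc[symmetric])
qed

end

section \<open>Energy estimate\<close>

definition l2 :: "'a measure \<Rightarrow> ('a \<Rightarrow> real) \<Rightarrow> bool" where
  "l2 M f \<longleftrightarrow> f \<in> borel_measurable M \<and> integrable M (\<lambda>x. (f x)^2)"

definition l2n :: "'a measure \<Rightarrow> ('a \<Rightarrow> real) \<Rightarrow> real" where
  "l2n M f = sqrt (LINT x|M. (f x)^2)"

lemma l2n_sq: "(l2n M f)^2 = (LINT x|M. (f x)^2)"
  unfolding l2n_def by (rule real_sqrt_pow2) (auto intro!: integral_nonneg_AE)

lemma l2n_nonneg: "l2n M f \<ge> 0"
  unfolding l2n_def by (auto intro!: integral_nonneg_AE)

lemma l2_measurable: "l2 M f \<Longrightarrow> f \<in> borel_measurable M" by (simp add: l2_def)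

lemma l2_CS: assumes "l2 M f" "l2 M g"
  shows "integrable M (\<lambda>x. f x * g x)" "\<bar>LINT x|M. f x * g x\<bar> \<le> l2n M f * l2n M g"
  using integral_Cauchy_Schwarz[of f M g] assms unfolding l2_def l2n_def by auto

lemma l2_mono:
  assumes f: "f \<in> borel_measurable M" and g: "l2 M g" and le: "AE x in M. \<bar>f x\<bar> \<le> \<bar>g x\<bar>"
  shows "l2 M f" "l2n M f \<le> l2n M g"
proof -
  have sq: "AE x in M. (f x)^2 \<le> (g x)^2" using le by eventually_elim (simp add: abs_le_square_iff)
  have gi: "integrable M (\<lambda>x. (g x)^2)" using g by (simp add: l2_def)
  have i: "integrable M (\<lambda>x. (f x)^2)"
  proof (rule Bochner_Integration.integrable_bound[OF gi])
    show "(\<lambda>x. (f x)^2) \<in> borel_measurable M" using f by measurable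
    show "AE x in M. norm ((f x)^2) \<le> norm ((g x)^2)" using sq by eventually_elim simp
  qed
  then show "l2 M f" using f by (simp add: l2_def)
  show "l2n M f \<le> l2n M g" unfolding l2n_def by (intro real_sqrt_le_mono integral_mono_AE i gi sq)
qed

lemma l2_cmult: assumes "l2 M f" shows "l2 M (\<lambda>x. k * f x)" "l2n M (\<lambda>x. k * f x) = \<bar>k\<bar> * l2n M f"
  using assms by (auto simp: l2_def l2n_def power_mult_distrib real_sqrt_mult)

lemma l2_abs: "l2 M f \<Longrightarrow> l2 M (\<lambda>x. \<bar>f x\<bar>)" "l2n M (\<lambda>x. \<bar>f x\<bar>) = l2n M f"
  by (auto simp: l2_def l2n_def)

lemma l2_add: assumes f: "l2 M f" and g: "l2 M g" shows "l2 M (\<lambda>x. f x + g x)" "l2n M (\<lambda>x. f x + g x) \<le> l2n M f + l2n M g"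
proof -
  have eq: "(f x + g x)^2 = (f x)^2 + (2 * (f x * g x) + (g x)^2)" for x by (simp add: power2_eq_square algebra_simps)
  have i: "integrable M (\<lambda>x. (f x)^2)" "integrable M (\<lambda>x. (g x)^2)" "integrable M (\<lambda>x. 2 * (f x * g x))"
    using f g l2_CS(1)[OF f g] by (auto simp: l2_def)
  show "l2 M (\<lambda>x. f x + g x)" using f g i unfolding l2_def eq by auto
  have "(l2n M (\<lambda>x. f x + g x))^2 = (l2n M f)^2 + (2 * (LINT x|M. f x * g x) + (l2n M g)^2)"
    unfolding l2n_sq eq using i by simp
  also have "\<dots> \<le> (l2n M f)^2 + (2 * (l2n M f * l2n M g) + (l2n M g)^2)"
    using l2_CS(2)[OF f g] by simp
  also have "\<dots> = (l2n M f + l2n M g)^2" by (simp add: power2_eq_square algebra_simps)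
  finally show "l2n M (\<lambda>x. f x + g x) \<le> l2n M f + l2n M g"
    by (rule power2_le_imp_le) (simp add: l2n_nonneg)
qed

lemma l2_diff: assumes f: "l2 M f" and g: "l2 M g" shows "l2 M (\<lambda>x. f x - g x)" "l2n M (\<lambda>x. f x - g x) \<le> l2n M f + l2n M g"
  using l2_add[OF f l2_cmult(1)[OF g, of "-1"]] l2_cmult(2)[OF g, of "-1"] by auto

lemma l2_tendsto_norm:
  assumes f: "\<And>n. l2 M (f n)" and g: "l2 M g" and lim: "(\<lambda>n. l2n M (\<lambda>x. f n x - g x)) \<longlonglongrightarrow> 0"
  shows "(\<lambda>n. l2n M (f n)) \<longlonglongrightarrow> l2n M g"
proof -
  have bd: "norm (l2n M (f n) - l2n M g) \<le> l2n M (\<lambda>x. f n x - g x)" for n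
  proof -
    have "l2n M (\<lambda>x. (f n x - g x) + g x) \<le> l2n M (\<lambda>x. f n x - g x) + l2n M g"
      by (rule l2_add(2)[OF l2_diff(1)[OF f g] g])
    moreover have "l2n M (\<lambda>x. f n x - (f n x - g x)) \<le> l2n M (f n) + l2n M (\<lambda>x. f n x - g x)"
      by (rule l2_diff(2)[OF f l2_diff(1)[OF f g]])
    moreover have "l2n M g \<le> l2n M (\<lambda>x. f n x - g x) + l2n M (f n)"
      using calculation(2) by simp
    ultimately show ?thesis by simp
  qed
  have "(\<lambda>n. l2n M (f n) - l2n M g) \<longlonglongrightarrow> 0"
    by (rule Lim_null_comparison[OF always_eventually[OF allI[OF bd]] lim])
  then show ?thesis by (simp add: LIM_zero_iff)
qed

lemma l2_tendsto_inner:
  assumes f: "\<And>n. l2 M (f n)" and g: "l2 M g" and lim: "(\<lambda>n. l2n M (\<lambda>x. f n x - g x)) \<longlonglongrightarrow> 0" and k: "l2 M k"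
  shows "(\<lambda>n. LINT x|M. k x * f n x) \<longlonglongrightarrow> (LINT x|M. k x * g x)"
proof -
  have bd: "norm ((LINT x|M. k x * f n x) - (LINT x|M. k x * g x)) \<le> l2n M k * l2n M (\<lambda>x. f n x - g x)" for n
  proof -
    have "(LINT x|M. k x * f n x) - (LINT x|M. k x * g x) = (LINT x|M. k x * (f n x - g x))"
      unfolding right_diff_distrib by (rule Bochner_Integration.integral_diff[symmetric]) (rule l2_CS(1)[OF k f] l2_CS(1)[OF k g])+
    then show ?thesis using l2_CS(2)[OF k l2_diff(1)[OF f[of n] g]] by simp
  qed
  have "(\<lambda>n. l2n M k * l2n M (\<lambda>x. f n x - g x)) \<longlonglongrightarrow> 0" using tendsto_mult_left[OF lim, of "l2n M k"] by simp
  then have "(\<lambda>n. (LINT x|M. k x * f n x) - (LINT x|M. k x * g x)) \<longlonglongrightarrow> 0"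
    by (rule Lim_null_comparison[OF always_eventually[OF allI[OF bd]]])
  then show ?thesis by (simp add: LIM_zero_iff)
qed

context star_cell begin

text \<open>By \<open>shrink_ball\<close> the shrunk cell keeps distance
  \<open>(1 - t) * \<rho> * h\<close> from the complement of the cell. The transition takes half of
  that distance, which leaves a compact support in the interior and doubles the constant 96 of
  \<open>cutoff_exists\<close>.\<close>

lemma cutoff:
  assumes t: "0 \<le> t" "t < 1"
  obtains \<eta> where "C1 \<eta>" "\<And>x. 0 \<le> \<eta> x" "\<And>x. \<eta> x \<le> 1" "\<And>x. x \<in> shrink t \<Longrightarrow> \<eta> x = 1" "\<And>x. x \<in> shrink t \<Longrightarrow> grad \<eta> x = 0"
    "\<exists>K. compact K \<and> K \<subseteq> interior D \<and> (\<forall>x. x \<notin> K \<longrightarrow> \<eta> x = 0)"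
    "\<And>x. norm (grad \<eta> x) \<le> 192 * 5 ^ CARD('n) / (\<rho> * h) / (1 - t)"
proof -
  define \<delta> where "\<delta> = (1 - t) * (\<rho> * h) / 2"
  have \<delta>: "\<delta> > 0" using t \<rho>_pos h_pos by (simp add: \<delta>_def)
  define K where "K = {x + y |x y. x \<in> shrink t \<and> y \<in> cball 0 \<delta>}"
  have cK: "compact K" unfolding K_def by (intro compact_sums compact_shrink compact_cball)
  obtain \<eta> where \<eta>: "C1 \<eta>" "\<And>x. 0 \<le> \<eta> x" "\<And>x. \<eta> x \<le> 1" "\<And>x. x \<in> shrink t \<Longrightarrow> \<eta> x = 1"
    "\<And>x. ball x \<delta> \<inter> shrink t = {} \<Longrightarrow> \<eta> x = 0" "\<And>x. norm (grad \<eta> x) \<le> 96 * 5 ^ DIM((real,'n) vec) / \<delta>"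
    using cutoff_exists[OF compact_imp_bounded[OF compact_shrink] \<delta>] by metis
  have KU: "K \<subseteq> interior D"
  proof
    fix z assume "z \<in> K"
    then obtain x y where xy: "x \<in> D" "z = c + t *\<^sub>R (x - c) + y" "norm y \<le> \<delta>" by (auto simp: K_def shrink_def)
    have "(1 - t) * (\<rho> * h) = 2 * \<delta>" by (simp add: \<delta>_def)
    then have "z \<in> ball (c + t *\<^sub>R (x - c)) ((1 - t) * (\<rho> * h - dist c c))" using xy \<delta> by (simp add: dist_norm)
    then show "z \<in> interior D"
      using shrink_ball[OF c_in_ball xy(1) t] interior_maximal open_ball by blast
  qed
  have zero: "\<eta> x = 0" if "x \<notin> K" for x
  proof (rule \<eta>(5), rule ccontr)
    assume "ball x \<delta> \<inter> shrink t \<noteq> {}"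
    then obtain a where a: "a \<in> shrink t" "dist x a < \<delta>" by auto
    then have "x = a + (x - a)" "x - a \<in> cball 0 \<delta>" by (auto simp: dist_norm norm_minus_commute)
    then have "x \<in> K" unfolding K_def using a(1) by blast
    then show False using that by simp
  qed
  show ?thesis
  proof (rule that[OF \<eta>(1-4)])
    show "\<exists>K. compact K \<and> K \<subseteq> interior D \<and> (\<forall>x. x \<notin> K \<longrightarrow> \<eta> x = 0)" using cK KU zero by blast
    show "norm (grad \<eta> x) \<le> 192 * 5 ^ CARD('n) / (\<rho> * h) / (1 - t)" for x
      using \<eta>(6)[of x] t by (simp add: \<delta>_def field_simps)
    show "grad \<eta> x = 0" if "x \<in> shrink t" for x
    proof -
      \<comment> \<open>\<open>\<eta>\<close> attains its maximum 1 on the shrunk cell, so its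
        gradient vanishes there even at boundary points of that set.\<close>
      have "(\<lambda>b. b \<bullet> grad \<eta> x) = (\<lambda>b. 0)"
        by (rule differential_zero_maxmin[of x UNIV \<eta>])
           (use C1_GDERIV[OF \<eta>(1), of x] \<eta>(3) \<eta>(4)[OF that] in \<open>auto simp: gderiv_def\<close>)
      then have "grad \<eta> x \<bullet> grad \<eta> x = 0" by meson
      then show ?thesis by simp
    qed
  qed auto
qed

definition M :: "(real,'n) vec measure" where "M = lebesgue_on (interior D)"

lemma interior_lebesgue: "interior D \<inter> space lebesgue \<in> sets lebesgue" by simp

lemma integral_M: "(LINT x|M. f x) = (LINT x:interior D|lebesgue. (f x::'c::euclidean_space))"
  unfolding M_def set_lebesgue_integral_def by (rule integral_restrict_space[OF interior_lebesgue])

lemma integrable_M: "integrable M f \<longleftrightarrow> set_integrable lebesgue (interior D) (f::_ \<Rightarrow> 'c::euclidean_space)"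
  unfolding M_def set_integrable_def by (rule integrable_restrict_space[OF interior_lebesgue])

lemma measurable_M: "f \<in> borel_measurable M \<longleftrightarrow> set_borel_measurable lebesgue (interior D) (f::_ \<Rightarrow> 'c::euclidean_space)"
  unfolding M_def set_borel_measurable_def by (rule borel_measurable_restrict_space_iff[OF interior_lebesgue])

lemma measurable_M_borel: "f \<in> borel_measurable borel \<Longrightarrow> f \<in> borel_measurable M"
  unfolding M_def by (rule measurable_restrict_space1, rule measurable_completion) simp

lemma measurable_M_continuous: "continuous_on UNIV f \<Longrightarrow> f \<in> borel_measurable M"
  by (intro measurable_M_borel borel_measurable_continuous_onI)

lemma space_M: "space M = interior D" by (simp add: M_def space_restrict_space)

lemma AE_D_interior: "AE x in lebesgue. indicat_real D x = indicat_real (interior D) x"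
proof -
  have "AE x in lebesgue. x \<notin> frontier D" using negligible_frontier by (simp add: negligible_iff_null_sets AE_not_in)
  then show ?thesis
    by eventually_elim (use closed_D interior_subset[of D] in \<open>auto simp: indicator_def frontier_def\<close>)
qed

text \<open>No measurability is assumed: the two integrands agree almost everywhere, so either both
  are measurable or both integrals take the default value 0.\<close>

lemma integral_D_eq_M: "(LINT x:D|lebesgue. f x) = (LINT x|M. (f x::'c::euclidean_space))"
proof -
  let ?f = "\<lambda>x. indicat_real D x *\<^sub>R f x" and ?g = "\<lambda>x. indicat_real (interior D) x *\<^sub>R f x"
  have ae: "AE x in lebesgue. ?f x = ?g x" using AE_D_interior by eventually_elim simp
  have iff: "?f \<in> borel_measurable lebesgue \<longleftrightarrow> ?g \<in> borel_measurable lebesgue"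
  proof
    assume "?f \<in> borel_measurable lebesgue"
    then show "?g \<in> borel_measurable lebesgue" using ae by (rule borel_measurable_AE)
  next
    have ae': "AE x in lebesgue. ?g x = ?f x" using ae by eventually_elim (rule sym)
    assume "?g \<in> borel_measurable lebesgue"
    then show "?f \<in> borel_measurable lebesgue" using ae' by (rule borel_measurable_AE)
  qed
  have "integral\<^sup>L lebesgue ?f = integral\<^sup>L lebesgue ?g"
  proof (cases "?f \<in> borel_measurable lebesgue")
    case True
    then show ?thesis using iff ae by (intro integral_cong_AE) auto
  next
    case False
    then have "\<not> integrable lebesgue ?f" "\<not> integrable lebesgue ?g" using iff borel_measurable_integrable by blast+
    then show ?thesis by (metis not_integrable_integral_eq)
  qed
  then show ?thesis unfolding integral_M set_lebesgue_integral_def .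
qed

lemma integrable_M_continuous: "continuous_on UNIV f \<Longrightarrow> integrable M (f :: _ \<Rightarrow> 'c::euclidean_space)"
  unfolding integrable_M using bounded_D bounded_subset[of D "interior D"] interior_subset[of D]
  by (intro set_integrable_continuous) auto

lemma l2_continuous: "continuous_on UNIV f \<Longrightarrow> l2 M f"
  unfolding l2_def by (auto intro!: measurable_M_continuous integrable_M_continuous continuous_intros)

lemma layer_null:
  assumes g: "integrable M g"
  shows "(\<lambda>j. LINT x|M. indicat_real (- shrink (1 - 1 / real (j + 2))) x * g x) \<longlonglongrightarrow> 0"
proof -
  \<comment> \<open>Starting at 1/2 keeps the layer estimate applicable along the whole
    sequence.\<close>
  let ?t = "\<lambda>j. 1 - 1 / real (j + 2)"
  have sm: "- shrink t \<in> sets borel" for t using compact_imp_closed[OF compact_shrink, of t] by (auto simp: open_closed[symmetric])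
  have "(\<lambda>j. LINT x|M. indicat_real (- shrink (?t j)) x * g x) \<longlonglongrightarrow> (LINT x|M. 0)"
  proof (rule integral_dominated_convergence)
    show "integrable M (\<lambda>x. norm (g x))" using g by simp
    show "AE x in M. (\<lambda>j. indicat_real (- shrink (?t j)) x * g x) \<longlonglongrightarrow> 0"
    proof (rule AE_I2)
      fix x assume "x \<in> space M"
      then have x: "x \<in> interior D" by (simp add: space_M)
      obtain e where e: "e > 0" "ball x e \<subseteq> D" using x by (meson mem_interior)
      have "(\<lambda>j. c + (1 / ?t j) *\<^sub>R (x - c)) \<longlonglongrightarrow> c + (1 / (1 - 0)) *\<^sub>R (x - c)"
      proof (intro tendsto_intros)
        have "(\<lambda>j. 1 / real (j + 2)) \<longlonglongrightarrow> 0" using LIMSEQ_ignore_initial_segment[OF lim_1_over_n, of 2] by simp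
        then show "(\<lambda>j. 1 / real (j + 2)) \<longlonglongrightarrow> 0" .
      qed simp
      then have "(\<lambda>j. c + (1 / ?t j) *\<^sub>R (x - c)) \<longlonglongrightarrow> x" by simp
      then have "\<forall>\<^sub>F j in sequentially. c + (1 / ?t j) *\<^sub>R (x - c) \<in> ball x e"
        using e(1) by (auto dest!: topological_tendstoD[of _ _ _ "ball x e"])
      then have "\<forall>\<^sub>F j in sequentially. indicat_real (- shrink (?t j)) x * g x = 0"
      proof eventually_elim
        case (elim j)
        have "?t j > 0" by (simp add: field_simps)
        then have "x = c + ?t j *\<^sub>R ((c + (1 / ?t j) *\<^sub>R (x - c)) - c)" by simp
        then have "x \<in> shrink (?t j)" unfolding shrink_def using elim e by blast
        then show ?case by simp
      qed
      then show "(\<lambda>j. indicat_real (- shrink (?t j)) x * g x) \<longlonglongrightarrow> 0" by (rule tendsto_eventually)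
    qed
    show "(\<lambda>x. indicat_real (- shrink (?t j)) x * g x) \<in> borel_measurable M" for j
      by (intro borel_measurable_times measurable_M_borel borel_measurable_indicator sm borel_measurable_integrable[OF g])
    show "AE x in M. norm (indicat_real (- shrink (?t j)) x * g x) \<le> norm (g x)" for j
      by (auto simp: indicator_def)
  qed simp
  then show ?thesis by simp
qed

end

lemma Lipschitz_of_deriv:
  fixes T :: "real \<Rightarrow> real"
  assumes "\<And>s. (T has_real_derivative T' s) (at s)" "\<And>s. 0 \<le> T' s" "\<And>s. T' s \<le> 1"
  shows "\<bar>T a - T b\<bar> \<le> \<bar>a - b\<bar>"
proof -
  have "norm (T a - T b) \<le> 1 * norm (a - b)"
    by (rule field_differentiable_bound[of UNIV T T']) (use assms in \<open>auto simp: has_field_derivative_at_within\<close>)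
  then show ?thesis by simp
qed

context star_cell begin

lemma integrable_Y_continuous:
  assumes i: "i \<in> I" and w: "continuous_on (frontier D) w"
  shows "set_integrable lebesgue (Y i) (\<lambda>y. (w (\<Phi> i y)::real))"
proof -
  have "continuous_on (Y i) (\<lambda>y. w (\<Phi> i y))"
    by (rule continuous_on_compose2[OF w continuous_\<Phi>[OF i]]) (use \<Phi>_in_frontier[OF i] in auto)
  then have "integrable lborel (\<lambda>y. indicator (Y i) y *\<^sub>R w (\<Phi> i y))"
    by (rule borel_integrable_compact[OF compact_Y[OF i]])
  then show ?thesis unfolding set_integrable_def
    using integrable_completion borel_measurable_integrable by blast
qed

lemma bint_mono_AE:
  assumes f: "continuous_on (frontier D) f" and g: "continuous_on (frontier D) g"
    and le: "\<And>i. i \<in> I \<Longrightarrow> AE y in lebesgue. y \<in> Y i \<longrightarrow> f (\<Phi> i y) \<le> g (\<Phi> i y)"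
  shows "bint f \<le> bint g"
  unfolding bint_def
proof (rule sum_mono)
  fix i assume i: "i \<in> I"
  show "(LINT y:Y i|lebesgue. f (\<Phi> i y)) \<le> (LINT y:Y i|lebesgue. g (\<Phi> i y))"
    unfolding set_lebesgue_integral_def
  proof (rule integral_mono_AE)
    show "AE y in lebesgue. indicat_real (Y i) y *\<^sub>R f (\<Phi> i y) \<le> indicat_real (Y i) y *\<^sub>R g (\<Phi> i y)"
      using le[OF i] by eventually_elim (auto simp: indicator_def)
  qed (use integrable_Y_continuous[OF i f] integrable_Y_continuous[OF i g] in \<open>auto simp: set_integrable_def\<close>)
qed

lemma integral_layer:
  assumes "f \<in> borel_measurable borel"
  shows "(LINT x:D - shrink t|lebesgue. f x) = (LINT x|M. indicat_real (- shrink t) x * f x)"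
proof -
  have "(LINT x:D - shrink t|lebesgue. f x) = (LINT x:D|lebesgue. indicat_real (- shrink t) x * f x)"
    unfolding set_lebesgue_integral_def by (intro Bochner_Integration.integral_cong) (auto simp: indicator_def)
  then show ?thesis by (simp add: integral_D_eq_M)
qed

text \<open>The test function is \<open>T \<circ> u n\<close> multiplied by a cut-off function of a dilated copy of the cell;
  the layer estimate makes the contribution of the gradient of the cut-off function harmless.\<close>

lemma energy_step:
  assumes u: "C1 u" and v: "continuous_on (frontier D) v"
    and G: "G \<in> borel_measurable M" "l2 M (\<lambda>x. norm (G x))"
    and lap: "\<And>\<phi>. test_function (interior D) \<phi> \<Longrightarrow> (LINT x|M. G x \<bullet> grad \<phi> x) = - (LINT x|M. r x * \<phi> x)"
    and T: "\<And>s. (T has_real_derivative T' s) (at s)" "continuous_on UNIV T'" "\<And>s. 0 \<le> T' s" "\<And>s. T' s \<le> 1"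
    and Tv: "\<And>i. i \<in> I \<Longrightarrow> AE y in lebesgue. y \<in> Y i \<longrightarrow> T (v (\<Phi> i y)) = 0"
    and t: "1/2 \<le> t" "t < 1"
    and \<eta>: "C1 \<eta>" "\<And>x. 0 \<le> \<eta> x" "\<And>x. \<eta> x \<le> 1" "\<And>x. x \<in> shrink t \<Longrightarrow> \<eta> x = 1" "\<And>x. x \<in> shrink t \<Longrightarrow> grad \<eta> x = 0"
    "\<exists>K. compact K \<and> K \<subseteq> interior D \<and> (\<forall>x. x \<notin> K \<longrightarrow> \<eta> x = 0)"
    "\<And>x. norm (grad \<eta> x) \<le> \<kappa>"
    and a_def: "a = l2n M (\<lambda>x. norm (grad u x - G x))"
    and b_def: "b = bint (\<lambda>x. (u x - v x)^2)"
    and \<gamma>_def: "\<gamma> = l2n M (\<lambda>x. indicat_real (- shrink t) x * norm (G x))"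
    and \<Gamma>_def: "\<Gamma> = l2n M (\<lambda>x. norm (G x))"
    and \<kappa>_def: "\<kappa> = 192 * 5 ^ CARD('n) / (\<rho> * h) / (1 - t)"
    and B_def: "B = 192 * 5 ^ CARD('n) * sqrt (2 ^ CARD('n)) / \<rho>"
  shows "(l2n M (\<lambda>x. T (u x)))^2 \<le> h * b + h^2 * ((\<Gamma> + a) * a - (LINT x|M. r x * \<eta> x * T (u x)) +
     \<gamma> * (\<kappa> * sqrt (2 * (1 - t) * h * b) + B * (\<Gamma> + a)) + \<gamma> * (\<Gamma> + a))"
proof -
  define z where "z x = T (u x)" for x
  have z: "C1 z" "grad z = (\<lambda>x. T' (u x) *\<^sub>R grad u x)" unfolding z_def[abs_def] by (rule C1_compose[OF u T(1,2)])+
  have Lip: "\<bar>T p - T q\<bar> \<le> \<bar>p - q\<bar>" for p q by (rule Lipschitz_of_deriv[OF T(1,3,4)])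
  have contT: "continuous_on S T" for S using T(1) by (meson DERIV_isCont continuous_at_imp_continuous_on)
  have \<kappa>: "\<kappa> > 0" using \<rho>_pos h_pos t by (simp add: \<kappa>_def)
  define ind where "ind = indicat_real (- shrink t)"
  have indm: "ind \<in> borel_measurable M" unfolding ind_def
    by (intro measurable_M_borel borel_measurable_indicator) (use compact_imp_closed[OF compact_shrink, of t] in auto)
  have ind01: "\<bar>ind x\<bar> \<le> 1" "ind x * ind x = ind x" "ind x \<ge> 0" for x by (auto simp: ind_def indicator_def)
  have frD: "continuous_on (frontier D) f" if "continuous_on UNIV f" for f :: "(real,'n) vec \<Rightarrow> real" using that continuous_on_subset by blast
  have b0: "b \<ge> 0" unfolding b_def by (rule bint_mono_nonneg) simp
  have bz: "bint (\<lambda>x. (z x)^2) \<le> b" unfolding b_def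
  proof (rule bint_mono_AE)
    show "continuous_on (frontier D) (\<lambda>x. (z x)^2)" by (intro frD continuous_intros C1_continuous z)
    show "continuous_on (frontier D) (\<lambda>x. (u x - v x)^2)" by (intro continuous_intros v frD C1_continuous u)
    fix i assume "i \<in> I"
    from Tv[OF this] show "AE y in lebesgue. y \<in> Y i \<longrightarrow> (z (\<Phi> i y))^2 \<le> (u (\<Phi> i y) - v (\<Phi> i y))^2"
    proof eventually_elim
      case (elim y)
      then show ?case using Lip[of "u (\<Phi> i y)" "v (\<Phi> i y)"] by (auto simp: z_def abs_le_square_iff[symmetric])
    qed
  qed
  note cu = C1_continuous[OF u] C1_continuous_grad[OF u] C1_continuous[OF z(1)] C1_continuous_grad[OF z(1)] C1_continuous[OF \<eta>(1)] C1_continuous_grad[OF \<eta>(1)]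
  have gum: "grad u \<in> borel_measurable M" by (intro measurable_M_continuous cu)
  have l2gu: "l2 M (\<lambda>x. norm (grad u x))" by (intro l2_continuous continuous_intros cu)
  have l2gz: "l2 M (\<lambda>x. norm (grad z x))" by (intro l2_continuous continuous_intros cu)
  have l2z: "l2 M z" by (intro l2_continuous cu)
  have l2d: "l2 M (\<lambda>x. norm (grad u x - G x))"
    by (rule l2_mono(1)[OF _ l2_add(1)[OF l2gu G(2)]]) (use gum G(1) norm_triangle_ineq4 in \<open>auto intro!: AE_I2\<close>)
  have gule: "l2n M (\<lambda>x. norm (grad u x)) \<le> \<Gamma> + a"
  proof -
    have "l2n M (\<lambda>x. norm (grad u x)) \<le> l2n M (\<lambda>x. norm (G x) + norm (grad u x - G x))"
    proof (rule l2_mono(2)[OF _ l2_add(1)[OF G(2) l2d]])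
      show "AE x in M. \<bar>norm (grad u x)\<bar> \<le> \<bar>norm (G x) + norm (grad u x - G x)\<bar>"
      proof (rule AE_I2)
        fix x have "norm (G x + (grad u x - G x)) \<le> norm (G x) + norm (grad u x - G x)" by (rule norm_triangle_ineq)
        then show "\<bar>norm (grad u x)\<bar> \<le> \<bar>norm (G x) + norm (grad u x - G x)\<bar>" by simp
      qed
    qed (use gum in measurable)
    also have "\<dots> \<le> \<Gamma> + a" unfolding \<Gamma>_def a_def by (rule l2_add(2)[OF G(2) l2d])
    finally show ?thesis .
  qed
  have gz_le: "norm (grad z x) \<le> norm (grad u x)" for x
    using T(3)[of "u x"] T(4)[of "u x"] by (simp add: z mult_left_le_one_le)
  have gzn: "l2n M (\<lambda>x. norm (grad z x)) \<le> \<Gamma> + a"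
    by (rule order_trans[OF l2_mono(2)[OF l2_measurable[OF l2gz] l2gu] gule]) (simp add: gz_le)
  have l2iG: "l2 M (\<lambda>x. ind x * norm (G x))"
    by (rule l2_mono(1)[OF _ G(2)]) (use indm G(1) ind01(1) in \<open>auto intro!: AE_I2 mult_left_le_one_le simp: abs_mult\<close>)
  have l2iz: "l2 M (\<lambda>x. ind x * \<bar>z x\<bar>)"
    by (rule l2_mono(1)[OF _ l2z]) (use indm l2_measurable[OF l2z] ind01(1) in \<open>auto intro!: AE_I2 mult_left_le_one_le simp: abs_mult\<close>)
  \<comment> \<open>\<open>\<kappa>\<close> has order \<open>1 / ((1 - t) * h)\<close> and the root
    of the gradient part of the layer estimate has order \<open>(1 - t) * h\<close>, so their
    product \<open>B\<close> is free of \<open>t\<close>. The boundary part keeps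
    \<open>\<kappa>\<close>, but together with the root of \<open>b\<close>, which tends to 0 while
    \<open>t\<close> is fixed.\<close>
  have iznorm: "\<kappa> * l2n M (\<lambda>x. ind x * \<bar>z x\<bar>) \<le> \<kappa> * sqrt (2 * (1 - t) * h * b) + B * (\<Gamma> + a)"
  proof -
    have sqz: "(ind x * \<bar>z x\<bar>)^2 = ind x * (z x)^2" for x by (auto simp: ind_def indicator_def)
    have "(l2n M (\<lambda>x. ind x * \<bar>z x\<bar>))^2 = (LINT x:D - shrink t|lebesgue. (z x)^2)"
      unfolding l2n_sq sqz unfolding ind_def by (rule integral_layer[symmetric]) (intro borel_measurable_continuous_onI continuous_intros cu)
    also have "\<dots> \<le> 2 * (1 - t) * h * bint (\<lambda>x. (z x)^2) + 2 ^ CARD('n) * (1 - t)^2 * h^2 * (LINT x:D - shrink t|lebesgue. (norm (grad z x))^2)"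
      by (rule layer_estimate[OF z(1) t])
    also have "\<dots> \<le> 2 * (1 - t) * h * b + 2 ^ CARD('n) * (1 - t)^2 * h^2 * (\<Gamma> + a)^2"
    proof (intro add_mono mult_left_mono bz)
      have "(LINT x:D - shrink t|lebesgue. (norm (grad z x))^2) = (LINT x|M. ind x * (norm (grad z x))^2)"
        unfolding ind_def by (rule integral_layer) (intro borel_measurable_continuous_onI continuous_intros cu)
      also have "\<dots> \<le> (LINT x|M. (norm (grad z x))^2)"
      proof (rule integral_mono)
        show "integrable M (\<lambda>x. (norm (grad z x))^2)" using l2gz by (simp add: l2_def)
        then show "integrable M (\<lambda>x. ind x * (norm (grad z x))^2)"
          by (rule Bochner_Integration.integrable_bound)
             (use indm l2_measurable[OF l2gz] ind01(1) in \<open>auto intro!: AE_I2 mult_left_le_one_le simp: abs_mult\<close>)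
        show "ind x * (norm (grad z x))^2 \<le> (norm (grad z x))^2" for x
          using ind01(1)[of x] by (intro mult_left_le_one_le) (auto simp: ind01(3))
      qed
      also have "\<dots> = (l2n M (\<lambda>x. norm (grad z x)))^2" by (simp add: l2n_sq)
      also have "\<dots> \<le> (\<Gamma> + a)^2" by (intro power_mono gzn l2n_nonneg)
      finally show "(LINT x:D - shrink t|lebesgue. (norm (grad z x))^2) \<le> (\<Gamma> + a)^2" .
    qed (use t h_pos in auto)
    finally have "l2n M (\<lambda>x. ind x * \<bar>z x\<bar>) \<le> sqrt (2 * (1 - t) * h * b + 2 ^ CARD('n) * (1 - t)^2 * h^2 * (\<Gamma> + a)^2)"
      by (rule real_le_rsqrt)
    also have "\<dots> \<le> sqrt (2 * (1 - t) * h * b) + sqrt (2 ^ CARD('n) * (1 - t)^2 * h^2 * (\<Gamma> + a)^2)"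
      using b0 t h_pos by (intro sqrt_add_le_add_sqrt) auto
    also have "sqrt (2 ^ CARD('n) * (1 - t)^2 * h^2 * (\<Gamma> + a)^2) = sqrt (2 ^ CARD('n)) * (1 - t) * h * (\<Gamma> + a)"
      using t h_pos l2n_nonneg[of M] by (simp add: real_sqrt_mult \<Gamma>_def a_def)
    finally have "\<kappa> * l2n M (\<lambda>x. ind x * \<bar>z x\<bar>) \<le> \<kappa> * (sqrt (2 * (1 - t) * h * b) + sqrt (2 ^ CARD('n)) * (1 - t) * h * (\<Gamma> + a))"
      using \<kappa> by (intro mult_left_mono) auto
    also have "\<dots> = \<kappa> * sqrt (2 * (1 - t) * h * b) + (\<kappa> * (1 - t) * h) * sqrt (2 ^ CARD('n)) * (\<Gamma> + a)"
      by (simp add: algebra_simps)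
    also have "\<kappa> * (1 - t) * h = 192 * 5 ^ CARD('n) / \<rho>" using t h_pos \<rho>_pos by (simp add: \<kappa>_def)
    finally show ?thesis by (simp add: B_def)
  qed
  define \<phi> where "\<phi> x = z x * \<eta> x" for x
  have \<phi>: "C1 \<phi>" "grad \<phi> = (\<lambda>x. z x *\<^sub>R grad \<eta> x + \<eta> x *\<^sub>R grad z x)" unfolding \<phi>_def[abs_def] by (rule C1_mult[OF z(1) \<eta>(1)])+
  have "test_function (interior D) \<phi>"
    unfolding test_function_def using \<phi>(1) \<eta>(6) by (auto simp: \<phi>_def)
  then have weak: "(LINT x|M. G x \<bullet> grad \<phi> x) = - (LINT x|M. r x * \<phi> x)" by (rule lap)
  have l2g\<phi>: "l2 M (\<lambda>x. norm (grad \<phi> x))" unfolding \<phi> by (intro l2_continuous continuous_intros cu)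
  have g\<phi>m: "grad \<phi> \<in> borel_measurable M" unfolding \<phi> by (intro measurable_M_continuous continuous_intros cu)
  have iG\<phi>: "integrable M (\<lambda>x. G x \<bullet> grad \<phi> x)"
    by (rule Bochner_Integration.integrable_bound[OF l2_CS(1)[OF G(2) l2g\<phi>]]) (use G(1) g\<phi>m Cauchy_Schwarz_ineq2 in \<open>auto intro!: AE_I2 simp: abs_mult\<close>)
  \<comment> \<open>The slope of \<open>T\<close> lies between 0 and 1, so its square is at most the
    slope itself, and one factor \<open>grad u\<close> may be exchanged for \<open>G\<close> up to
    the approximation error. What remains is the weak equation tested with \<open>\<phi>\<close>,
    plus two terms living in the layer, outside of which both \<open>grad \<eta>\<close> and
    \<open>1 - \<eta>\<close> vanish.\<close>
  have pt: "(norm (grad z x))^2 \<le> norm (grad u x) * norm (grad u x - G x) + (G x \<bullet> grad \<phi> x + (\<kappa> * ((ind x * \<bar>z x\<bar>) * (ind x * norm (G x))) + norm (grad u x) * (ind x * norm (G x))))" for x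
  proof -
    define s where "s = T' (u x)"
    have s: "0 \<le> s" "s \<le> 1" using T by (auto simp: s_def)
    have gz: "grad z x = s *\<^sub>R grad u x" by (simp add: z s_def)
    have "(norm (grad z x))^2 = s * s * (grad u x \<bullet> grad u x)" unfolding power2_norm_eq_inner gz by (simp add: mult.assoc)
    also have "\<dots> \<le> s * (grad u x \<bullet> grad u x)" using s by (intro mult_right_mono mult_left_le_one_le) auto
    also have "\<dots> = s * (grad u x \<bullet> (grad u x - G x)) + grad z x \<bullet> G x" by (simp add: gz inner_diff_right algebra_simps)
    finally have k0: "(norm (grad z x))^2 \<le> s * (grad u x \<bullet> (grad u x - G x)) + grad z x \<bullet> G x" .
    have k1: "s * (grad u x \<bullet> (grad u x - G x)) \<le> norm (grad u x) * norm (grad u x - G x)"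
    proof -
      have "s * (grad u x \<bullet> (grad u x - G x)) \<le> s * (norm (grad u x) * norm (grad u x - G x))"
        using s by (intro mult_left_mono norm_cauchy_schwarz) auto
      also have "\<dots> \<le> norm (grad u x) * norm (grad u x - G x)" using s by (intro mult_left_le_one_le) auto
      finally show ?thesis .
    qed
    have k2: "grad z x \<bullet> G x = G x \<bullet> grad \<phi> x - z x * (G x \<bullet> grad \<eta> x) + (1 - \<eta> x) * (grad z x \<bullet> G x)"
      by (simp add: \<phi> inner_add_right inner_commute algebra_simps)
    have k3: "- (z x * (G x \<bullet> grad \<eta> x)) \<le> \<kappa> * ((ind x * \<bar>z x\<bar>) * (ind x * norm (G x)))"
    proof (cases "x \<in> shrink t")
      case True then show ?thesis using \<eta>(5)[OF True] by (simp add: ind_def)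
    next
      case False
      have "- (z x * (G x \<bullet> grad \<eta> x)) \<le> \<bar>z x\<bar> * \<bar>G x \<bullet> grad \<eta> x\<bar>" by (simp add: abs_mult[symmetric])
      also have "\<dots> \<le> \<bar>z x\<bar> * (norm (G x) * norm (grad \<eta> x))" by (intro mult_left_mono Cauchy_Schwarz_ineq2) auto
      also have "\<dots> \<le> \<bar>z x\<bar> * (norm (G x) * \<kappa>)" by (intro mult_left_mono \<eta>(7)) auto
      finally show ?thesis using False by (simp add: ind_def algebra_simps)
    qed
    have k4: "(1 - \<eta> x) * (grad z x \<bullet> G x) \<le> norm (grad u x) * (ind x * norm (G x))"
    proof (cases "x \<in> shrink t")
      case True then show ?thesis using \<eta>(4)[OF True] by (simp add: ind_def)
    next
      case False
      have "(1 - \<eta> x) * (grad z x \<bullet> G x) \<le> (1 - \<eta> x) * (norm (grad z x) * norm (G x))"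
        using \<eta>(3) by (intro mult_left_mono norm_cauchy_schwarz) auto
      also have "\<dots> \<le> norm (grad z x) * norm (G x)" using \<eta>(2,3)[of x] by (intro mult_left_le_one_le) auto
      also have "\<dots> \<le> norm (grad u x) * norm (G x)" by (intro mult_right_mono gz_le) auto
      finally show ?thesis using False by (simp add: ind_def)
    qed
    show ?thesis using k0 k1 k2 k3 k4 by linarith
  qed
  have E: "(l2n M (\<lambda>x. norm (grad z x)))^2 \<le> (\<Gamma> + a) * a - (LINT x|M. r x * \<eta> x * T (u x)) + \<gamma> * (\<kappa> * sqrt (2 * (1 - t) * h * b) + B * (\<Gamma> + a)) + \<gamma> * (\<Gamma> + a)"
  proof -
    note i1 = l2_CS[OF l2gu l2d] and i2 = l2_CS[OF l2iz l2iG] and i3 = l2_CS[OF l2gu l2iG]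
    have "(l2n M (\<lambda>x. norm (grad z x)))^2 \<le> (LINT x|M. norm (grad u x) * norm (grad u x - G x) + (G x \<bullet> grad \<phi> x + (\<kappa> * ((ind x * \<bar>z x\<bar>) * (ind x * norm (G x))) + norm (grad u x) * (ind x * norm (G x)))))"
      unfolding l2n_sq
    proof (rule integral_mono[OF _ _ pt])
      show "integrable M (\<lambda>x. (norm (grad z x))^2)" using l2gz by (simp add: l2_def)
      show "integrable M (\<lambda>x. norm (grad u x) * norm (grad u x - G x) + (G x \<bullet> grad \<phi> x + (\<kappa> * ((ind x * \<bar>z x\<bar>) * (ind x * norm (G x))) + norm (grad u x) * (ind x * norm (G x)))))"
        by (intro Bochner_Integration.integrable_add integrable_mult_right i1 i2 i3 iG\<phi>)
    qed
    also have "\<dots> = (LINT x|M. norm (grad u x) * norm (grad u x - G x)) + ((LINT x|M. G x \<bullet> grad \<phi> x) + (\<kappa> * (LINT x|M. (ind x * \<bar>z x\<bar>) * (ind x * norm (G x))) + (LINT x|M. norm (grad u x) * (ind x * norm (G x)))))"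
      using i1(1) i2(1) i3(1) iG\<phi> integrable_mult_right[OF i2(1), of \<kappa>]
      by (simp only: Bochner_Integration.integral_add Bochner_Integration.integrable_add integral_mult_right_zero)
    also have "\<dots> \<le> (\<Gamma> + a) * a + (- (LINT x|M. r x * \<eta> x * T (u x)) + (\<gamma> * (\<kappa> * sqrt (2 * (1 - t) * h * b) + B * (\<Gamma> + a)) + \<gamma> * (\<Gamma> + a)))"
    proof (intro add_mono)
      have "(LINT x|M. norm (grad u x) * norm (grad u x - G x)) \<le> l2n M (\<lambda>x. norm (grad u x)) * a"
        using i1(2) by (simp add: a_def)
      also have "\<dots> \<le> (\<Gamma> + a) * a" by (intro mult_right_mono gule) (simp add: a_def l2n_nonneg)
      finally show "(LINT x|M. norm (grad u x) * norm (grad u x - G x)) \<le> (\<Gamma> + a) * a" .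
      show "(LINT x|M. G x \<bullet> grad \<phi> x) \<le> - (LINT x|M. r x * \<eta> x * T (u x))"
        unfolding weak by (simp add: \<phi>_def z_def mult_ac)
      have "\<kappa> * (LINT x|M. (ind x * \<bar>z x\<bar>) * (ind x * norm (G x))) \<le> \<kappa> * (l2n M (\<lambda>x. ind x * \<bar>z x\<bar>) * \<gamma>)"
        using i2(2) \<kappa> by (intro mult_left_mono) (auto simp: \<gamma>_def ind_def)
      also have "\<dots> = (\<kappa> * l2n M (\<lambda>x. ind x * \<bar>z x\<bar>)) * \<gamma>" by simp
      also have "\<dots> \<le> (\<kappa> * sqrt (2 * (1 - t) * h * b) + B * (\<Gamma> + a)) * \<gamma>"
        by (intro mult_right_mono iznorm) (simp add: \<gamma>_def l2n_nonneg)
      finally show "\<kappa> * (LINT x|M. (ind x * \<bar>z x\<bar>) * (ind x * norm (G x))) \<le> \<gamma> * (\<kappa> * sqrt (2 * (1 - t) * h * b) + B * (\<Gamma> + a))"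
        by (simp only: mult.commute)
      have "(LINT x|M. norm (grad u x) * (ind x * norm (G x))) \<le> l2n M (\<lambda>x. norm (grad u x)) * \<gamma>"
        using i3(2) by (simp add: \<gamma>_def ind_def)
      also have "\<dots> \<le> (\<Gamma> + a) * \<gamma>" by (intro mult_right_mono gule) (simp add: \<gamma>_def l2n_nonneg)
      finally show "(LINT x|M. norm (grad u x) * (ind x * norm (G x))) \<le> \<gamma> * (\<Gamma> + a)" by (simp only: mult.commute)
    qed
    finally show ?thesis by simp
  qed
  have "(l2n M (\<lambda>x. T (u x)))^2 = (LINT x:D|lebesgue. (z x)^2)" by (simp add: l2n_sq z_def integral_D_eq_M)
  also have "\<dots> \<le> h * bint (\<lambda>x. (z x)^2) + h^2 * (LINT x:D|lebesgue. (norm (grad z x))^2)" by (rule poincare[OF z(1)])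
  also have "(LINT x:D|lebesgue. (norm (grad z x))^2) = (l2n M (\<lambda>x. norm (grad z x)))^2" by (simp add: l2n_sq integral_D_eq_M)
  also have "h * bint (\<lambda>x. (z x)^2) + h^2 * (l2n M (\<lambda>x. norm (grad z x)))^2 \<le> h * b + h^2 * ((\<Gamma> + a) * a - (LINT x|M. r x * \<eta> x * T (u x)) + \<gamma> * (\<kappa> * sqrt (2 * (1 - t) * h * b) + B * (\<Gamma> + a)) + \<gamma> * (\<Gamma> + a))"
    using h_pos by (intro add_mono mult_left_mono bz E) auto
  finally show ?thesis .
qed

end

context star_cell begin

lemma l2n_tendsto_iff:
  assumes "\<And>n. f n \<in> borel_measurable M"
  shows "(\<lambda>n. LINT x|M. (f n x)^2) \<longlonglongrightarrow> 0 \<Longrightarrow> (\<lambda>n. l2n M (f n)) \<longlonglongrightarrow> 0"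
  unfolding l2n_def using tendsto_real_sqrt[of "\<lambda>n. LINT x|M. (f n x)^2" 0 sequentially] by simp

text \<open>The order of the two limits is essential. For a fixed cut-off function first
  \<open>n\<close> tends to infinity, which removes the errors \<open>a n\<close> and
  \<open>b n\<close> however large the gradient of the cut-off is; only then does the layer shrink,
  so that \<open>\<gamma> j\<close> tends to 0. The result is the equation tested with
  \<open>T (v x)\<close>, combined with the Poincare inequality.\<close>

theorem energy:
  assumes u: "\<And>n. C1 (u n)" and v: "l2 M v" "continuous_on (frontier D) v"
    and G: "G \<in> borel_measurable M" "l2 M (\<lambda>x. norm (G x))"
    and uv: "(\<lambda>n. LINT x|M. (u n x - v x)^2) \<longlonglongrightarrow> 0"
    and uG: "(\<lambda>n. LINT x|M. (norm (grad (u n) x - G x))^2) \<longlonglongrightarrow> 0"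
    and ub: "(\<lambda>n. bint (\<lambda>x. (u n x - v x)^2)) \<longlonglongrightarrow> 0"
    and lap: "\<And>\<phi>. test_function (interior D) \<phi> \<Longrightarrow> (LINT x|M. G x \<bullet> grad \<phi> x) = - (LINT x|M. r x * \<phi> x)"
    and r: "continuous_on UNIV r"
    and T: "\<And>s. (T has_real_derivative T' s) (at s)" "continuous_on UNIV T'" "\<And>s. 0 \<le> T' s" "\<And>s. T' s \<le> 1"
    and Tv: "\<And>i. i \<in> I \<Longrightarrow> AE y in lebesgue. y \<in> Y i \<longrightarrow> T (v (\<Phi> i y)) = 0"
  shows "l2 M (\<lambda>x. T (v x))" "(LINT x|M. (T (v x))^2) \<le> - (h^2 * (LINT x|M. r x * T (v x)))"
proof -
  have Lip: "\<bar>T p - T q\<bar> \<le> \<bar>p - q\<bar>" for p q by (rule Lipschitz_of_deriv[OF T(1,3,4)])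
  have contT: "continuous_on UNIV T" using T(1) by (meson DERIV_isCont continuous_at_imp_continuous_on)
  have Tm: "T \<in> borel_measurable borel" using contT by (rule borel_measurable_continuous_onI)
  have l2u: "l2 M (u n)" for n by (intro l2_continuous C1_continuous u)
  have l2uv: "l2 M (\<lambda>x. u n x - v x)" for n by (rule l2_diff(1)[OF l2u v(1)])
  have Tvm: "(\<lambda>x. T (v x)) \<in> borel_measurable M" using l2_measurable[OF v(1)] Tm by (rule measurable_compose)
  show l2Tv: "l2 M (\<lambda>x. T (v x))"
  proof (rule l2_mono(1)[OF Tvm l2_add(1)[OF l2_abs(1)[OF v(1)] l2_continuous[of "\<lambda>_. \<bar>T 0\<bar>"]]])
    show "AE x in M. \<bar>T (v x)\<bar> \<le> \<bar>\<bar>v x\<bar> + \<bar>T 0\<bar>\<bar>"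
    proof (rule AE_I2)
      fix x show "\<bar>T (v x)\<bar> \<le> \<bar>\<bar>v x\<bar> + \<bar>T 0\<bar>\<bar>" using Lip[of "v x" 0] by linarith
    qed
  qed simp
  define z where "z n x = T (u n x)" for n x
  have l2z: "l2 M (z n)" for n unfolding z_def
    by (intro l2_continuous continuous_on_compose2[OF contT] C1_continuous u) auto
  have zlim: "(\<lambda>n. l2n M (\<lambda>x. z n x - T (v x))) \<longlonglongrightarrow> 0"
  proof (rule tendsto_sandwich[OF _ _ tendsto_const])
    show "(\<lambda>n. l2n M (\<lambda>x. u n x - v x)) \<longlonglongrightarrow> 0" by (rule l2n_tendsto_iff[OF l2_measurable[OF l2uv] uv])
    show "\<forall>\<^sub>F n in sequentially. l2n M (\<lambda>x. z n x - T (v x)) \<le> l2n M (\<lambda>x. u n x - v x)"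
      by (intro always_eventually allI l2_mono(2)[OF l2_measurable[OF l2_diff(1)[OF l2z l2Tv]] l2uv] AE_I2) (simp add: z_def Lip)
  qed (simp add: l2n_nonneg)
  define a where "a n = l2n M (\<lambda>x. norm (grad (u n) x - G x))" for n
  define b where "b n = bint (\<lambda>x. (u n x - v x)^2)" for n
  define \<Gamma> where "\<Gamma> = l2n M (\<lambda>x. norm (G x))"
  have a0: "a \<longlonglongrightarrow> 0" unfolding a_def
  proof (rule l2n_tendsto_iff[OF _ uG])
    have "grad (u n) \<in> borel_measurable M" for n by (intro measurable_M_continuous C1_continuous_grad u)
    then show "(\<lambda>x. norm (grad (u n) x - G x)) \<in> borel_measurable M" for n using G(1) by measurable
  qed
  have b0: "b \<longlonglongrightarrow> 0" using ub unfolding b_def .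
  define t where "t j = 1 - 1 / real (j + 2)" for j
  have t: "1/2 \<le> t j" "t j < 1" "0 \<le> t j" for j by (auto simp: t_def field_simps)
  have "\<exists>\<eta>. C1 \<eta> \<and> (\<forall>x. 0 \<le> \<eta> x) \<and> (\<forall>x. \<eta> x \<le> 1) \<and> (\<forall>x\<in>shrink (t j). \<eta> x = 1) \<and> (\<forall>x\<in>shrink (t j). grad \<eta> x = 0) \<and>
    (\<exists>K. compact K \<and> K \<subseteq> interior D \<and> (\<forall>x. x \<notin> K \<longrightarrow> \<eta> x = 0)) \<and>
    (\<forall>x. norm (grad \<eta> x) \<le> 192 * 5 ^ CARD('n) / (\<rho> * h) / (1 - t j))" for j
    by (rule cutoff[OF t(3)[of j] t(2)[of j]]) blast
  then obtain \<eta> where \<eta>': "\<forall>j. C1 (\<eta> j) \<and> (\<forall>x. 0 \<le> \<eta> j x) \<and> (\<forall>x. \<eta> j x \<le> 1) \<and> (\<forall>x\<in>shrink (t j). \<eta> j x = 1) \<and> (\<forall>x\<in>shrink (t j). grad (\<eta> j) x = 0) \<and>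
    (\<exists>K. compact K \<and> K \<subseteq> interior D \<and> (\<forall>x. x \<notin> K \<longrightarrow> \<eta> j x = 0)) \<and>
    (\<forall>x. norm (grad (\<eta> j) x) \<le> 192 * 5 ^ CARD('n) / (\<rho> * h) / (1 - t j))" by (metis (mono_tags, lifting))
  then have \<eta>: "C1 (\<eta> j)" "0 \<le> \<eta> j x" "\<eta> j x \<le> 1" "x \<in> shrink (t j) \<Longrightarrow> \<eta> j x = 1" "x \<in> shrink (t j) \<Longrightarrow> grad (\<eta> j) x = 0"
    "\<exists>K. compact K \<and> K \<subseteq> interior D \<and> (\<forall>x. x \<notin> K \<longrightarrow> \<eta> j x = 0)"
    "norm (grad (\<eta> j) x) \<le> 192 * 5 ^ CARD('n) / (\<rho> * h) / (1 - t j)" for j x by auto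
  define \<gamma> where "\<gamma> j = l2n M (\<lambda>x. indicat_real (- shrink (t j)) x * norm (G x))" for j
  have \<gamma>0: "\<gamma> \<longlonglongrightarrow> 0"
  proof -
    have "(indicat_real (- shrink (t j)) x * norm (G x))^2 = indicat_real (- shrink (t j)) x * (norm (G x))^2" for j x
      by (auto simp: indicator_def)
    moreover have "(\<lambda>j. LINT x|M. indicat_real (- shrink (t j)) x * (norm (G x))^2) \<longlonglongrightarrow> 0"
      unfolding t_def by (rule layer_null) (use G in \<open>auto simp: l2_def\<close>)
    ultimately have "(\<lambda>j. LINT x|M. (indicat_real (- shrink (t j)) x * norm (G x))^2) \<longlonglongrightarrow> 0" by (simp only:)
    then show ?thesis unfolding \<gamma>_def l2n_def using tendsto_real_sqrt by fastforce
  qed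
  define B where "B = 192 * 5 ^ CARD('n) * sqrt (2 ^ CARD('n)) / \<rho>"
  have l2r\<eta>: "l2 M (\<lambda>x. r x * \<eta> j x)" for j by (intro l2_continuous continuous_intros r C1_continuous \<eta>)
  have l2r: "l2 M r" by (intro l2_continuous r)
  have step: "(l2n M (\<lambda>x. T (v x)))^2 \<le> h^2 * (\<gamma> j * (B * \<Gamma>) + \<gamma> j * \<Gamma> - (LINT x|M. r x * \<eta> j x * T (v x)))" for j
  proof (rule LIMSEQ_le)
    show "(\<lambda>n. (l2n M (z n))^2) \<longlonglongrightarrow> (l2n M (\<lambda>x. T (v x)))^2"
      by (intro tendsto_power l2_tendsto_norm[OF l2z l2Tv zlim])
    define \<kappa> where "\<kappa> = 192 * 5 ^ CARD('n) / (\<rho> * h) / (1 - t j)"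
    let ?R = "\<lambda>n. h * b n + h^2 * ((\<Gamma> + a n) * a n - (LINT x|M. r x * \<eta> j x * z n x) +
     \<gamma> j * (\<kappa> * sqrt (2 * (1 - t j) * h * b n) + B * (\<Gamma> + a n)) + \<gamma> j * (\<Gamma> + a n))"
    have "?R \<longlonglongrightarrow> h * 0 + h^2 * ((\<Gamma> + 0) * 0 - (LINT x|M. r x * \<eta> j x * T (v x)) +
     \<gamma> j * (\<kappa> * sqrt (2 * (1 - t j) * h * 0) + B * (\<Gamma> + 0)) + \<gamma> j * (\<Gamma> + 0))"
      by (intro tendsto_intros a0 b0 l2_tendsto_inner[OF l2z l2Tv zlim l2r\<eta>])
    then show "?R \<longlonglongrightarrow> h^2 * (\<gamma> j * (B * \<Gamma>) + \<gamma> j * \<Gamma> - (LINT x|M. r x * \<eta> j x * T (v x)))"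
      by (simp add: algebra_simps)
    show "\<exists>N. \<forall>n\<ge>N. (l2n M (z n))^2 \<le> ?R n"
      unfolding z_def[abs_def] \<kappa>_def B_def
      by (intro exI[of _ 0] allI impI energy_step[OF u v(2) G lap T Tv t(1,2) \<eta> a_def b_def \<gamma>_def \<Gamma>_def refl refl]) assumption
  qed
  have lim: "(\<lambda>j. LINT x|M. r x * \<eta> j x * T (v x)) \<longlonglongrightarrow> (LINT x|M. r x * T (v x))"
  proof -
    have irT: "integrable M (\<lambda>x. r x * T (v x))" by (rule l2_CS(1)[OF l2r l2Tv])
    have ir\<eta>T: "integrable M (\<lambda>x. r x * \<eta> j x * T (v x))" for j by (rule l2_CS(1)[OF l2r\<eta> l2Tv])
    have nl: "(\<lambda>j. LINT x|M. indicat_real (- shrink (t j)) x * norm (r x * T (v x))) \<longlonglongrightarrow> 0"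
      unfolding t_def by (rule layer_null) (use irT in auto)
    have "norm ((LINT x|M. r x * \<eta> j x * T (v x)) - (LINT x|M. r x * T (v x))) \<le> (LINT x|M. indicat_real (- shrink (t j)) x * norm (r x * T (v x)))" for j
    proof -
      have "(LINT x|M. r x * \<eta> j x * T (v x)) - (LINT x|M. r x * T (v x)) = (LINT x|M. r x * \<eta> j x * T (v x) - r x * T (v x))"
        by (rule Bochner_Integration.integral_diff[symmetric]) (rule ir\<eta>T irT)+
      also have "norm \<dots> \<le> (LINT x|M. norm (r x * \<eta> j x * T (v x) - r x * T (v x)))" by (rule integral_norm_bound)
      also have "\<dots> \<le> (LINT x|M. indicat_real (- shrink (t j)) x * norm (r x * T (v x)))"
      proof (rule integral_mono)
        show "integrable M (\<lambda>x. norm (r x * \<eta> j x * T (v x) - r x * T (v x)))"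
          by (intro integrable_norm Bochner_Integration.integrable_diff ir\<eta>T irT)
        have sm: "- shrink (t j) \<in> sets borel" using compact_imp_closed[OF compact_shrink, of "t j"] by auto
        show "integrable M (\<lambda>x. indicat_real (- shrink (t j)) x * norm (r x * T (v x)))"
        proof (rule Bochner_Integration.integrable_bound[OF irT])
          show "(\<lambda>x. indicat_real (- shrink (t j)) x * norm (r x * T (v x))) \<in> borel_measurable M"
            by (rule borel_measurable_times[OF measurable_M_borel[OF borel_measurable_indicator[OF sm]]
                  borel_measurable_integrable[OF integrable_norm[OF irT]]])
          show "AE x in M. norm (indicat_real (- shrink (t j)) x * norm (r x * T (v x))) \<le> norm (r x * T (v x))"
            by (auto simp: indicator_def)
        qed
        fix x
        have "r x * \<eta> j x * T (v x) - r x * T (v x) = (\<eta> j x - 1) * (r x * T (v x))" by (simp add: algebra_simps)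
        moreover have "norm ((\<eta> j x - 1) * (r x * T (v x))) \<le> indicat_real (- shrink (t j)) x * norm (r x * T (v x))"
        proof (cases "x \<in> shrink (t j)")
          case True then show ?thesis using \<eta>(4)[OF True] by simp
        next
          case False
          have "\<bar>\<eta> j x - 1\<bar> * norm (r x * T (v x)) \<le> 1 * norm (r x * T (v x))"
            using \<eta>(2,3)[of j x] by (intro mult_right_mono) auto
          then show ?thesis using False unfolding norm_mult[of "\<eta> j x - 1"] by simp
        qed
        ultimately show "norm (r x * \<eta> j x * T (v x) - r x * T (v x)) \<le> indicat_real (- shrink (t j)) x * norm (r x * T (v x))" by simp
      qed
      finally show ?thesis .
    qed
    then have "(\<lambda>j. (LINT x|M. r x * \<eta> j x * T (v x)) - (LINT x|M. r x * T (v x))) \<longlonglongrightarrow> 0"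
      by (rule Lim_null_comparison[OF always_eventually[OF allI] nl])
    then show ?thesis by (simp add: LIM_zero_iff)
  qed
  have "(l2n M (\<lambda>x. T (v x)))^2 \<le> h^2 * (0 * (B * \<Gamma>) + 0 * \<Gamma> - (LINT x|M. r x * T (v x)))"
  proof (rule LIMSEQ_le_const)
    show "(\<lambda>j. h^2 * (\<gamma> j * (B * \<Gamma>) + \<gamma> j * \<Gamma> - (LINT x|M. r x * \<eta> j x * T (v x))))
      \<longlonglongrightarrow> h^2 * (0 * (B * \<Gamma>) + 0 * \<Gamma> - (LINT x|M. r x * T (v x)))"
      by (intro tendsto_intros \<gamma>0 lim)
  qed (use step in auto)
  then show "(LINT x|M. (T (v x))^2) \<le> - (h^2 * (LINT x|M. r x * T (v x)))" by (simp add: l2n_sq)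
qed

end

section \<open>Maximum principle\<close>

definition laplacian :: "(real^'n::finite \<Rightarrow> real) \<Rightarrow> real^'n \<Rightarrow> real" where
  "laplacian q x = (\<Sum>j\<in>UNIV. grad (\<lambda>x. grad q x $ j) x $ j)"

lemma Polys_0_grad: "q \<in> Polys 0 \<Longrightarrow> grad q = (\<lambda>x. 0)"
proof -
  assume "q \<in> Polys 0"
  then obtain c where c: "q = (\<lambda>x. \<Sum>\<alpha> | mdegree \<alpha> \<le> 0. c \<alpha> * monomial \<alpha> x)" by (auto simp: Polys_def)
  have "monomial \<alpha> x = 1" if "mdegree \<alpha> \<le> 0" for \<alpha> and x :: "real^'a"
    using that by (simp add: mdegree_def monomial_def)
  then have "q = (\<lambda>x. \<Sum>\<alpha> | mdegree \<alpha> \<le> 0. c \<alpha>)" unfolding c by (intro ext sum.cong) auto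
  then show ?thesis using C1_const(2) by simp
qed

text \<open>With natural subtraction, degree \<open>k - 2\<close> would still allow constants when
  \<open>k \<le> 1\<close>. The second claim excludes them, since for such \<open>k\<close> there
  are no moments among the degrees of freedom that could control them.\<close>

lemma Polys_laplacian: assumes "q \<in> Polys k" shows "laplacian q \<in> Polys (k - 2)" "k \<le> 1 \<Longrightarrow> laplacian q = (\<lambda>x. 0)"
proof -
  have "(\<lambda>x. \<Sum>j\<in>UNIV. grad (\<lambda>x. grad q x $ j) x $ j) \<in> Polys (k - 1 - 1)"
    by (intro Polys_sum Polys_GDERIV(2) assms) auto
  then show "laplacian q \<in> Polys (k - 2)" unfolding laplacian_def[abs_def] diff_diff_left one_add_one .
  assume "k \<le> 1"
  then have "(\<lambda>x. grad q x $ j) \<in> Polys 0" for j using Polys_GDERIV(2)[OF assms, of j] by (cases k) auto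
  from Polys_0_grad[OF this] show "laplacian q = (\<lambda>x. 0)" by (simp add: laplacian_def[abs_def])
qed

context star_cell begin

definition smooth_approx :: "(nat \<Rightarrow> (real,'n) vec \<Rightarrow> real) \<Rightarrow> ((real,'n) vec \<Rightarrow> real) \<Rightarrow> ((real,'n) vec \<Rightarrow> (real,'n) vec) \<Rightarrow> bool" where
  "smooth_approx u v G \<longleftrightarrow> (\<forall>n. C1 (u n)) \<and> (\<lambda>n. LINT x|M. (u n x - v x)^2) \<longlonglongrightarrow> 0 \<and>
    (\<lambda>n. LINT x|M. (norm (grad (u n) x - G x))^2) \<longlonglongrightarrow> 0 \<and> (\<lambda>n. bint (\<lambda>x. (u n x - v x)^2)) \<longlonglongrightarrow> 0"

lemma smooth_approxD:
  assumes "smooth_approx u v G"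
  shows "C1 (u n)" "(\<lambda>n. LINT x|M. (u n x - v x)^2) \<longlonglongrightarrow> 0"
    "(\<lambda>n. LINT x|M. (norm (grad (u n) x - G x))^2) \<longlonglongrightarrow> 0" "(\<lambda>n. bint (\<lambda>x. (u n x - v x)^2)) \<longlonglongrightarrow> 0"
  using assms unfolding smooth_approx_def by auto

text \<open>The link between \<open>v\<close> on the boundary and \<open>v\<close> inside is the
  existence of an approximating C1 sequence, a form that passes to differences of solutions by
  subtracting the sequences.\<close>

definition weak_solution :: "((real,'n) vec \<Rightarrow> real) \<Rightarrow> ((real,'n) vec \<Rightarrow> (real,'n) vec) \<Rightarrow> ((real,'n) vec \<Rightarrow> real) \<Rightarrow> bool" where
  "weak_solution v G r \<longleftrightarrow> l2 M v \<and> continuous_on (frontier D) v \<and> G \<in> borel_measurable M \<and> l2 M (\<lambda>x. norm (G x)) \<and> continuous_on UNIV r \<and>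
    (\<forall>\<phi>. test_function (interior D) \<phi> \<longrightarrow> (LINT x|M. G x \<bullet> grad \<phi> x) = - (LINT x|M. r x * \<phi> x)) \<and> (\<exists>u. smooth_approx u v G)"

lemma weak_solutionD:
  assumes "weak_solution v G r"
  shows "l2 M v" "continuous_on (frontier D) v" "G \<in> borel_measurable M" "l2 M (\<lambda>x. norm (G x))" "continuous_on UNIV r"
    "test_function (interior D) \<phi> \<Longrightarrow> (LINT x|M. G x \<bullet> grad \<phi> x) = - (LINT x|M. r x * \<phi> x)" "\<exists>u. smooth_approx u v G"
  using assms unfolding weak_solution_def by auto

lemma weak_energy:
  assumes "weak_solution v G r"
    and T: "\<And>s. (T has_real_derivative T' s) (at s)" "continuous_on UNIV T'" "\<And>s. 0 \<le> T' s" "\<And>s. T' s \<le> 1"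
    and Tv: "\<And>i. i \<in> I \<Longrightarrow> AE y in lebesgue. y \<in> Y i \<longrightarrow> T (v (\<Phi> i y)) = 0"
  shows "l2 M (\<lambda>x. T (v x))" "(LINT x|M. (T (v x))^2) \<le> - (h^2 * (LINT x|M. r x * T (v x)))"
proof -
  note w = weak_solutionD[OF assms(1)]
  obtain u where "smooth_approx u v G" using w(7) ..
  note u = smooth_approxD[OF this]
  show "l2 M (\<lambda>x. T (v x))" "(LINT x|M. (T (v x))^2) \<le> - (h^2 * (LINT x|M. r x * T (v x)))"
    by (rule energy[OF u(1) w(1-4) u(2-4) w(6) w(5) T Tv]; assumption)+
qed

lemma integrable_M_inner:
  fixes G :: "(real,'n) vec \<Rightarrow> (real,'n) vec"
  assumes G: "G \<in> borel_measurable M" "l2 M (\<lambda>x. norm (G x))" and g: "continuous_on UNIV g"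
  shows "integrable M (\<lambda>x. G x \<bullet> g x)"
proof (rule Bochner_Integration.integrable_bound)
  show "integrable M (\<lambda>x. norm (G x) * norm (g x))"
    by (intro l2_CS(1)[OF G(2)] l2_continuous continuous_intros g)
  have "g \<in> borel_measurable M" by (intro measurable_M_continuous g)
  then show "(\<lambda>x. G x \<bullet> g x) \<in> borel_measurable M" by (rule borel_measurable_inner[OF G(1)])
  show "AE x in M. norm (G x \<bullet> g x) \<le> norm (norm (G x) * norm (g x))"
    by (rule AE_I2) (simp add: abs_mult Cauchy_Schwarz_ineq2)
qed

lemma bint_add_le:
  assumes f: "continuous_on (frontier D) f" and g: "continuous_on (frontier D) g"
  shows "bint (\<lambda>x. (f x - g x)^2) \<le> 2 * bint (\<lambda>x. (f x)^2) + 2 * bint (\<lambda>x. (g x)^2)"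
proof -
  have "(LINT y:Y i|lebesgue. 2 * (f (\<Phi> i y))^2 + 2 * (g (\<Phi> i y))^2) =
      2 * (LINT y:Y i|lebesgue. (f (\<Phi> i y))^2) + 2 * (LINT y:Y i|lebesgue. (g (\<Phi> i y))^2)" if i: "i \<in> I" for i
    by (subst set_integral_add(2))
       (auto intro!: set_integrable_mult_right integrable_Y_continuous[OF i, of "\<lambda>x. (f x)^2"] integrable_Y_continuous[OF i, of "\<lambda>x. (g x)^2"] continuous_intros f g)
  then have "bint (\<lambda>x. 2 * (f x)^2 + 2 * (g x)^2) = 2 * bint (\<lambda>x. (f x)^2) + 2 * bint (\<lambda>x. (g x)^2)"
    unfolding bint_def by (simp add: sum.distrib sum_distrib_left)
  moreover have "bint (\<lambda>x. (f x - g x)^2) \<le> bint (\<lambda>x. 2 * (f x)^2 + 2 * (g x)^2)"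
  proof (rule bint_mono_AE)
    have "(a - b)^2 \<le> 2 * a^2 + 2 * b^2" for a b :: real using zero_le_power2[of "a + b"] by (simp add: power2_eq_square algebra_simps)
    then show "AE y in lebesgue. y \<in> Y i \<longrightarrow> (f (\<Phi> i y) - g (\<Phi> i y))^2 \<le> 2 * (f (\<Phi> i y))^2 + 2 * (g (\<Phi> i y))^2" for i by simp
  qed (intro continuous_intros f g)+
  ultimately show ?thesis by simp
qed

lemma L2_limit_diff:
  fixes f g :: "nat \<Rightarrow> _ \<Rightarrow> _::euclidean_space"
  assumes f: "\<And>n. f n \<in> borel_measurable N" "\<And>n. integrable N (\<lambda>x. (norm (f n x))^2)" "(\<lambda>n. LINT x|N. (norm (f n x))^2) \<longlonglongrightarrow> 0"
    and g: "\<And>n. g n \<in> borel_measurable N" "\<And>n. integrable N (\<lambda>x. (norm (g n x))^2)" "(\<lambda>n. LINT x|N. (norm (g n x))^2) \<longlonglongrightarrow> 0"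
  shows "(\<lambda>n. LINT x|N. (norm (f n x - g n x))^2) \<longlonglongrightarrow> 0"
proof (rule Lim_null_comparison[OF always_eventually[OF allI]])
  fix n
  have i: "integrable N (\<lambda>x. 2 * (norm (f n x))^2 + 2 * (norm (g n x))^2)" using f(2) g(2) by auto
  have le: "(norm (f n x - g n x))^2 \<le> 2 * (norm (f n x))^2 + 2 * (norm (g n x))^2" for x
  proof -
    have "(norm (f n x - g n x))^2 \<le> (norm (f n x) + norm (g n x))^2" by (intro power_mono norm_triangle_ineq4) auto
    also have "\<dots> \<le> 2 * (norm (f n x))^2 + 2 * (norm (g n x))^2"
      using zero_le_power2[of "norm (f n x) - norm (g n x)"] by (simp add: power2_eq_square algebra_simps)
    finally show ?thesis .
  qed
  have "(LINT x|N. (norm (f n x - g n x))^2) \<le> (LINT x|N. 2 * (norm (f n x))^2 + 2 * (norm (g n x))^2)"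
  proof (rule integral_mono[OF Bochner_Integration.integrable_bound[OF i] i le])
    show "(\<lambda>x. (norm (f n x - g n x))^2) \<in> borel_measurable N" using f(1) g(1) by measurable
  qed (use le in auto)
  then show "norm (LINT x|N. (norm (f n x - g n x))^2) \<le> 2 * (LINT x|N. (norm (f n x))^2) + 2 * (LINT x|N. (norm (g n x))^2)"
    using f(2) g(2) by simp
qed (use f(3) g(3) in \<open>auto intro!: tendsto_eq_intros\<close>)

lemma weak_solution_diff:
  assumes "weak_solution v G r" "weak_solution v' G' r'"
  shows "weak_solution (\<lambda>x. v x - v' x) (\<lambda>x. G x - G' x) (\<lambda>x. r x - r' x)"
proof -
  note w = weak_solutionD[OF assms(1)] and w' = weak_solutionD[OF assms(2)]
  obtain u u' where "smooth_approx u v G" "smooth_approx u' v' G'" using w(7) w'(7) by blast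
  note u = smooth_approxD[OF this(1)] and u' = smooth_approxD[OF this(2)]
  have gu: "C1 (\<lambda>x. u n x - u' n x)" "grad (\<lambda>x. u n x - u' n x) x = grad (u n) x - grad (u' n) x" for n x
    using C1_diff[OF u(1)[of n] u'(1)[of n]] by auto
  have d: "l2 M (\<lambda>x. u n x - v x)" "l2 M (\<lambda>x. u' n x - v' x)" for n
    by (intro l2_diff l2_continuous C1_continuous u u' w w')+
  have gm: "(\<lambda>x. grad (u n) x - G x) \<in> borel_measurable M" "(\<lambda>x. grad (u' n) x - G' x) \<in> borel_measurable M" for n
    by (intro borel_measurable_diff measurable_M_continuous C1_continuous_grad u u' w w')+
  have gi: "l2 M (\<lambda>x. norm (g x - H x))" if "continuous_on UNIV g" "H \<in> borel_measurable M" "l2 M (\<lambda>x. norm (H x))" for g H :: "(real,'n) vec \<Rightarrow> (real,'n) vec"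
  proof (rule l2_mono(1)[OF _ l2_add(1)[OF _ that(3), of "\<lambda>x. norm (g x)"]])
    show "(\<lambda>x. norm (g x - H x)) \<in> borel_measurable M"
      by (rule measurable_compose[OF borel_measurable_diff[OF measurable_M_continuous[OF that(1)] that(2)] borel_measurable_norm])
    show "l2 M (\<lambda>x. norm (g x))" by (intro l2_continuous continuous_intros that)
  qed (simp add: norm_triangle_ineq4)
  have 1: "(\<lambda>n. LINT x|M. (u n x - u' n x - (v x - v' x))^2) \<longlonglongrightarrow> 0"
    using L2_limit_diff[of "\<lambda>n x. u n x - v x" M "\<lambda>n x. u' n x - v' x"] d u(2) u'(2) unfolding l2_def
    by (simp add: algebra_simps)
  have 2: "(\<lambda>n. LINT x|M. (norm (grad (\<lambda>x. u n x - u' n x) x - (G x - G' x)))^2) \<longlonglongrightarrow> 0"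
  proof -
    have "integrable M (\<lambda>x. (norm (grad (u n) x - G x))^2)" "integrable M (\<lambda>x. (norm (grad (u' n) x - G' x))^2)" for n
      using gi[OF C1_continuous_grad[OF u(1)] w(3,4)] gi[OF C1_continuous_grad[OF u'(1)] w'(3,4)] unfolding l2_def by auto
    from L2_limit_diff[OF gm(1) this(1) u(3) gm(2) this(2) u'(3)] show ?thesis
      unfolding gu(2) by (simp add: algebra_simps)
  qed
  have 3: "(\<lambda>n. bint (\<lambda>x. (u n x - u' n x - (v x - v' x))^2)) \<longlonglongrightarrow> 0"
  proof (rule Lim_null_comparison[OF always_eventually[OF allI]])
    fix n
    have c: "continuous_on (frontier D) (\<lambda>x. u n x - v x)" "continuous_on (frontier D) (\<lambda>x. u' n x - v' x)"
      by (intro continuous_intros w w' continuous_on_subset[OF C1_continuous[OF u(1)] subset_UNIV] continuous_on_subset[OF C1_continuous[OF u'(1)] subset_UNIV])+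
    have "bint (\<lambda>x. (u n x - u' n x - (v x - v' x))^2) \<ge> 0" by (rule bint_mono_nonneg) simp
    then show "norm (bint (\<lambda>x. (u n x - u' n x - (v x - v' x))^2)) \<le> 2 * bint (\<lambda>x. (u n x - v x)^2) + 2 * bint (\<lambda>x. (u' n x - v' x)^2)"
      using bint_add_le[OF c] by (simp add: algebra_simps)
  qed (use u(4) u'(4) in \<open>auto intro!: tendsto_eq_intros\<close>)
  have 4: "(LINT x|M. (G x - G' x) \<bullet> grad \<phi> x) = - (LINT x|M. (r x - r' x) * \<phi> x)" if t: "test_function (interior D) \<phi>" for \<phi>
  proof -
    have \<phi>: "continuous_on UNIV \<phi>" "continuous_on UNIV (grad \<phi>)" using t unfolding test_function_def by (auto intro: C1_continuous C1_continuous_grad)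
    have "integrable M (\<lambda>x. r x * \<phi> x)" "integrable M (\<lambda>x. r' x * \<phi> x)"
      by (intro integrable_M_continuous continuous_intros w w' \<phi>)+
    with w(6)[OF t] w'(6)[OF t] integrable_M_inner[OF w(3,4) \<phi>(2)] integrable_M_inner[OF w'(3,4) \<phi>(2)] show ?thesis
      by (simp add: inner_diff_left left_diff_distrib)
  qed
  have "l2 M (\<lambda>x. norm (G x - G' x))"
    by (rule l2_mono(1)[OF _ l2_add(1)[OF w(4) w'(4)]]) (use w(3) w'(3) in \<open>auto simp: norm_triangle_ineq4\<close>)
  moreover have "smooth_approx (\<lambda>n x. u n x - u' n x) (\<lambda>x. v x - v' x) (\<lambda>x. G x - G' x)"
    unfolding smooth_approx_def using 1 2 3 gu(1) by blast
  ultimately show ?thesis unfolding weak_solution_def using 4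
    by (auto intro!: l2_diff w w' continuous_intros borel_measurable_diff)
qed

text \<open>The weak equation is \<open>integral_radial\<close> for the test function, whose
  boundary integrals vanish because its support stays in the interior.\<close>

lemma weak_solution_quadratic:
  "weak_solution (\<lambda>x. \<kappa> * (norm (x - c))^2) (\<lambda>x. (2 * \<kappa>) *\<^sub>R (x - c)) (\<lambda>x. 2 * \<kappa> * real CARD('n))"
proof -
  let ?q = "\<lambda>x. \<kappa> * (norm (x - c))^2" and ?g = "\<lambda>x. (2 * \<kappa>) *\<^sub>R (x - c)"
  have q: "C1 ?q" "grad ?q = ?g" using C1_cmult[OF C1_sq_dist(1)[of c], of \<kappa>] by (auto simp: C1_sq_dist(2))
  have lap: "(LINT x|M. ?g x \<bullet> grad \<phi> x) = - (LINT x|M. 2 * \<kappa> * real CARD('n) * \<phi> x)" if \<phi>: "test_function (interior D) \<phi>" for \<phi>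
  proof -
    have C: "C1 \<phi>" using \<phi> by (simp add: test_function_def)
    obtain K where K: "K \<subseteq> interior D" "\<And>x. x \<notin> K \<Longrightarrow> \<phi> x = 0" using \<phi> unfolding test_function_def by blast
    have z: "\<phi> (\<Phi> i y) = 0" if "i \<in> I" "y \<in> Y i" for i y
      using \<Phi>_in_frontier[OF that] K by (auto simp: frontier_def)
    have z': "(LINT y:Y i|lebesgue. \<phi> (\<Phi> i y)) = 0" if "i \<in> I" for i
    proof -
      have "indicat_real (Y i) y *\<^sub>R \<phi> (\<Phi> i y) = 0" for y using z[OF that, of y] by (auto simp: indicator_def)
      then show ?thesis unfolding set_lebesgue_integral_def by (simp only:) simp
    qed
    have i1: "integrable M (\<lambda>x. real CARD('n) * \<phi> x)" "integrable M (\<lambda>x. (x - c) \<bullet> grad \<phi> x)"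
      by (intro integrable_M_continuous continuous_intros C1_continuous C1_continuous_grad C)+
    have "(LINT x|M. real CARD('n) * \<phi> x) + (LINT x|M. (x - c) \<bullet> grad \<phi> x) = 0"
      using integral_radial[OF c_in_ball C] i1 by (simp add: integral_D_eq_M z' Bochner_Integration.integral_add)
    then show ?thesis by (simp add: eq_neg_iff_add_eq_0[symmetric])
  qed
  have "smooth_approx (\<lambda>_. ?q) ?q ?g" using q by (simp add: smooth_approx_def bint_def set_lebesgue_integral_def)
  then show ?thesis unfolding weak_solution_def using lap
    by (auto intro!: l2_continuous measurable_M_continuous continuous_intros)
qed

lemma weak_solution_uminus: "weak_solution v G r \<Longrightarrow> weak_solution (\<lambda>x. - v x) (\<lambda>x. - G x) (\<lambda>x. - r x)"
  using weak_solution_diff[OF weak_solution_quadratic[of 0]] by simp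

lemma weak_solution_add_quadratic: "weak_solution v G r \<Longrightarrow>
   weak_solution (\<lambda>x. v x + \<kappa> * (norm (x - c))^2) (\<lambda>x. G x + (2 * \<kappa>) *\<^sub>R (x - c)) (\<lambda>x. r x + 2 * \<kappa> * real CARD('n))"
  using weak_solution_diff[OF _ weak_solution_quadratic[of "- \<kappa>"]] by simp

text \<open>Adding the quadratic makes the Laplacian nonnegative on the cell. The energy inequality
  for the smooth positive part above the level \<open>m2\<close> then bounds an integral of squares
  by a nonpositive number, so this part vanishes almost everywhere.\<close>

lemma max_principle_upper:
  assumes w: "weak_solution v G r" and R: "\<And>x. x \<in> D \<Longrightarrow> \<bar>r x\<bar> \<le> R" and R0: "0 \<le> R"
    and bd: "\<And>i. i \<in> I \<Longrightarrow> AE y in lebesgue. y \<in> Y i \<longrightarrow> v (\<Phi> i y) \<le> m"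
  shows "AE x in M. v x \<le> m + R * h^2"
proof -
  \<comment> \<open>Chosen so that the Laplacian of the quadratic equals \<open>R\<close>; on the
    cell the quadratic itself is at most \<open>R * h^2\<close>.\<close>
  define \<kappa> where "\<kappa> = R / (2 * real CARD('n))"
  have \<kappa>: "0 \<le> \<kappa>" "\<kappa> \<le> R" "2 * \<kappa> * real CARD('n) = R"
  proof -
    have "R * 1 \<le> R * (2 * real CARD('n))" using R0 two_le_card by (intro mult_left_mono) auto
    then show "\<kappa> \<le> R" by (simp add: \<kappa>_def divide_le_eq)
  qed (use R0 in \<open>auto simp: \<kappa>_def\<close>)
  define m2 where "m2 = m + R * h^2"
  let ?w = "\<lambda>x. v x + \<kappa> * (norm (x - c))^2"
  have q: "\<kappa> * (norm (x - c))^2 \<le> R * h^2" if "x \<in> D" for x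
    using \<kappa> R0 dist_c_le[OF that] by (intro mult_mono power_mono) auto
  define T where "T s = soft 1 (s - m2)" for s
  define T' where "T' s = soft' 1 (s - m2)" for s
  have T: "(T has_real_derivative T' s) (at s)" "0 \<le> T' s" "T' s \<le> 1" "0 \<le> T s" for s
  proof -
    show "(T has_real_derivative T' s) (at s)"
    proof -
      have "((\<lambda>s. soft 1 (s - m2)) has_real_derivative soft' 1 (s - m2) * 1) (at s)"
        by (rule DERIV_chain2[OF soft_DERIV]) (auto intro!: derivative_eq_intros)
      then show ?thesis unfolding T_def[abs_def] T'_def by simp
    qed
    show "0 \<le> T' s" "T' s \<le> 1" unfolding T'_def using soft'_bounds[of 1 "s - m2"] by auto
    show "0 \<le> T s" unfolding T_def using soft_bounds(3)[of 1 "s - m2"] soft_nonpos(1)[of 1 "s - m2"] by (cases "s \<ge> m2") auto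
  qed
  have cT': "continuous_on UNIV T'" unfolding T'_def[abs_def] by (intro continuous_on_compose2[OF soft_cont[of 1]] continuous_intros) auto
  have bd': "AE y in lebesgue. y \<in> Y i \<longrightarrow> T (?w (\<Phi> i y)) = 0" if i: "i \<in> I" for i
    using bd[OF i]
  proof eventually_elim
    case (elim y)
    show ?case
    proof
      assume y: "y \<in> Y i"
      have "?w (\<Phi> i y) \<le> m2" using elim y q[OF \<Phi>_in_D[OF i y]] by (simp add: m2_def)
      then show "T (?w (\<Phi> i y)) = 0" by (simp add: T_def)
    qed
  qed
  note en = weak_energy[OF weak_solution_add_quadratic[OF w, of \<kappa>] T(1) cT' T(2,3) bd', unfolded \<kappa>(3)]
  have "0 \<le> (LINT x|M. (r x + R) * T (?w x))"
  proof (rule integral_nonneg_AE, rule AE_I2)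
    fix x assume "x \<in> space M"
    then have "x \<in> D" using interior_subset by (auto simp: space_M)
    then show "0 \<le> (r x + R) * T (?w x)" using R[of x] T(4) by (intro mult_nonneg_nonneg) auto
  qed
  then have "(LINT x|M. (T (?w x))^2) \<le> 0" using en(2) h_pos by (smt (verit) mult_nonneg_nonneg zero_le_power2)
  then have "(LINT x|M. (T (?w x))^2) = 0" by (intro antisym integral_nonneg_AE) auto
  then have "AE x in M. (T (?w x))^2 = 0"
    using integral_nonneg_eq_0_iff_AE[of M "\<lambda>x. (T (?w x))^2"] en(1) by (auto simp: l2_def)
  then show ?thesis
  proof eventually_elim
    case (elim x)
    then have "?w x \<le> m2" using soft_eq_0[of 1 "?w x - m2"] by (simp add: T_def)
    moreover have "0 \<le> \<kappa> * (norm (x - c))^2" using \<kappa> by simp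
    ultimately show ?case by (simp add: m2_def)
  qed
qed

lemma max_principle:
  assumes w: "weak_solution v G r" and R: "\<And>x. x \<in> D \<Longrightarrow> \<bar>r x\<bar> \<le> R" and R0: "0 \<le> R"
    and bd: "\<And>i. i \<in> I \<Longrightarrow> AE y in lebesgue. y \<in> Y i \<longrightarrow> \<bar>v (\<Phi> i y)\<bar> \<le> m"
  shows "AE x in M. \<bar>v x\<bar> \<le> m + R * h^2"
proof -
  have "AE x in M. v x \<le> m + R * h^2"
  proof (rule max_principle_upper[OF w R R0])
    fix i assume "i \<in> I" from bd[OF this] show "AE y in lebesgue. y \<in> Y i \<longrightarrow> v (\<Phi> i y) \<le> m" by eventually_elim auto
  qed
  moreover have "AE x in M. - v x \<le> m + R * h^2"
  proof (rule max_principle_upper[OF weak_solution_uminus[OF w] _ R0])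
    fix i assume "i \<in> I" from bd[OF this] show "AE y in lebesgue. y \<in> Y i \<longrightarrow> - v (\<Phi> i y) \<le> m" by eventually_elim auto
  qed (use R in auto)
  ultimately show ?thesis by eventually_elim auto
qed

end

section \<open>Polynomial data and bumps\<close>

lemma bump3_set_integrable:
  fixes q :: "'a::euclidean_space \<Rightarrow> real"
  assumes q: "continuous_on UNIV q" and s: "s > 0"
  shows "integrable lebesgue (\<lambda>x. q x * bump3 ((1/s) *\<^sub>R (x - p)))"
proof -
  have "continuous_on UNIV (\<lambda>x. q x * bump3 ((1/s) *\<^sub>R (x - p)))"
    by (intro continuous_intros q C1_continuous C1_affine_arg C1_bump3)
  then have "set_integrable lebesgue (cball p s) (\<lambda>x. q x * bump3 ((1/s) *\<^sub>R (x - p)))"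
    by (rule set_integrable_continuous) auto
  moreover have "indicat_real (cball p s) x *\<^sub>R (q x * bump3 ((1/s) *\<^sub>R (x - p))) = q x * bump3 ((1/s) *\<^sub>R (x - p))" for x
  proof (cases "x \<in> cball p s")
    case False
    then show ?thesis by (simp add: bump3_outside[OF s])
  qed simp
  ultimately show ?thesis by (simp only: set_integrable_def)
qed

text \<open>Integrate the extrapolation formula for \<open>z\<close> against a bump at
  \<open>c\<close>. After a homothety with centre \<open>z\<close> and ratio \<open>i\<close>, each
  term is an integral of \<open>q\<close> against a bump with a moved centre and radius
  \<open>i * s0\<close>. The hypothesis speaks of bumps only, because integrals against bumps are
  what the weak equation controls for the Laplacian.\<close>

lemma Polys_bound_by_bumps:
  fixes \<rho> m :: real
  assumes "0 < \<rho>" "0 \<le> m"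
  shows "\<exists>C>0. \<forall>q\<in>Polys k. \<forall>c z::real^'n::finite. \<forall>h>0. \<forall>B. dist c z \<le> m * h \<longrightarrow>
     (\<forall>p s. cball p s \<subseteq> ball c (\<rho> * h) \<longrightarrow> \<rho> * h / 8 \<le> s \<longrightarrow> \<bar>LINT x|lebesgue. q x * bump3 ((1/s) *\<^sub>R (x - p))\<bar> \<le> B) \<longrightarrow>
     \<bar>q z\<bar> * h ^ CARD('n) \<le> C * B"
proof -
  \<comment> \<open>A homothety of ratio above \<open>1 - \<delta>\<close> moves \<open>c\<close> by
    at most \<open>\<delta> * m * h\<close>, hence by at most half of the radius
    \<open>\<rho> * h\<close>; moreover the ratios stay above 1/2.\<close>
  define \<delta> where "\<delta> = \<rho> / (2 * (\<rho> + m))"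
  have \<delta>: "0 < \<delta>" "\<delta> \<le> 1/2" using assms by (auto simp: \<delta>_def field_simps)
  have \<delta>m: "\<delta> * m \<le> \<rho> / 2"
  proof -
    have "\<delta> * m \<le> \<delta> * (\<rho> + m)" using \<delta> assms by (intro mult_left_mono) auto
    also have "\<dots> = \<rho> / 2" using assms unfolding \<delta>_def by (simp add: field_simps)
    finally show ?thesis .
  qed
  obtain I :: "real set" and cf where I: "finite I" "I \<subseteq> {1-\<delta><..1}"
    and ex: "\<And>(q::real^'n \<Rightarrow> real) z y. q \<in> Polys k \<Longrightarrow> q z = (\<Sum>i\<in>I. cf i * q (z + i *\<^sub>R (y - z)))"
    using Polys_extrapolate[OF \<delta>(1), of k] by metis
  define \<Lambda> where "\<Lambda> = 1 + (\<Sum>i\<in>I. \<bar>cf i\<bar> * 2 ^ CARD('n))"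
  have \<Lambda>: "\<Lambda> > 0" unfolding \<Lambda>_def by (intro add_pos_nonneg sum_nonneg) auto
  define \<omega> where "\<omega> = measure lebesgue (ball (0::real^'n) 1) * (\<rho>/8)^CARD('n) / 8"
  have \<omega>: "\<omega> > 0" using assms content_ball_pos[of 1 "0::real^'n"] by (simp add: \<omega>_def)
  have main: "\<bar>q z\<bar> * (\<omega> * h ^ CARD('n)) \<le> \<Lambda> * B"
    if q: "q \<in> Polys k" and h: "h > 0" and z: "dist c z \<le> m * h"
    and B: "\<And>p s. cball p s \<subseteq> ball c (\<rho> * h) \<Longrightarrow> \<rho> * h / 8 \<le> s \<Longrightarrow> \<bar>LINT x|lebesgue. q x * bump3 ((1/s) *\<^sub>R (x - p))\<bar> \<le> B"
    for q and c z :: "real^'n" and h B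
  proof -
    \<comment> \<open>A quarter of the radius: centres move by at most one half, so the moved bumps
      still fit. Ratios of at least 1/2 keep their radii above
      \<open>\<rho> * h / 8\<close>.\<close>
    define s0 where "s0 = \<rho> * h / 4"
    have s0: "s0 > 0" using assms h by (simp add: s0_def)
    define \<beta> where "\<beta> y = bump3 ((1/s0) *\<^sub>R (y - c))" for y
    have i\<beta>: "integrable lebesgue \<beta>" using bump3_set_integrable[of "\<lambda>_. 1" s0 c] s0 by (simp add: \<beta>_def[abs_def])
    have \<beta>0: "\<beta> y \<ge> 0" for y by (simp add: \<beta>_def bump3_nonneg)
    have contq: "continuous_on UNIV (\<lambda>y. q (z + i *\<^sub>R (y - z)))" for i
      by (intro continuous_on_compose2[OF continuous_on_Polys[OF q]] continuous_intros) auto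
    have low: "\<omega> * h ^ CARD('n) \<le> (LINT y|lebesgue. \<beta> y)"
    proof -
      have "\<omega> * h ^ CARD('n) = (1/8) * measure lebesgue (ball c (s0/2))"
        using content_ball_conv_unit_ball[of "s0/2" c] s0 by (simp add: \<omega>_def s0_def power_mult_distrib power_divide mult_ac)
      also have "\<dots> = (LINT y:ball c (s0/2)|lebesgue. 1/8)" by (simp add: set_lebesgue_integral_def)
      also have "\<dots> \<le> (LINT y|lebesgue. \<beta> y)"
        unfolding set_lebesgue_integral_def
      proof (rule integral_mono[OF _ i\<beta>])
        show "integrable lebesgue (\<lambda>y. indicat_real (ball c (s0/2)) y *\<^sub>R (1/8::real))"
          using set_integrable_continuous[of "\<lambda>_. 1/8::real" "ball c (s0/2)"] by (simp add: set_integrable_def)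
        fix y
        show "indicat_real (ball c (s0/2)) y *\<^sub>R (1/8::real) \<le> \<beta> y"
        proof (cases "y \<in> ball c (s0/2)")
          case True
          have "norm ((1/s0) *\<^sub>R (y - c)) = dist c y / s0" unfolding norm_scaleR using s0 by (simp add: dist_norm norm_minus_commute)
          also have "\<dots> \<le> 1/2" using True s0 by (simp add: divide_le_eq)
          finally have "1/8 \<le> \<beta> y" unfolding \<beta>_def by (rule bump3_ge)
          then show ?thesis using True by simp
        qed (simp add: \<beta>0)
      qed
      finally show ?thesis .
    qed
    have B0: "B \<ge> 0"
    proof -
      have "s0 < \<rho> * h" using s0 by (simp add: s0_def)
      then have "cball c s0 \<subseteq> ball c (\<rho> * h)" by auto
      moreover have "\<rho> * h / 8 \<le> s0" using s0 by (simp add: s0_def)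
      ultimately show ?thesis using order_trans[OF abs_ge_zero B] by blast
    qed
    have bi: "\<bar>LINT y|lebesgue. q (z + i *\<^sub>R (y - z)) * \<beta> y\<bar> \<le> 2 ^ CARD('n) * B" if i: "i \<in> I" for i
    proof -
      have i0: "1/2 \<le> i" "i \<le> 1" "1 - \<delta> < i" using I i \<delta> by auto
      define p where "p = z + i *\<^sub>R (c - z)"
      define f where "f x = q x * bump3 ((1/(i * s0)) *\<^sub>R (x - p))" for x
      have fm: "f \<in> borel_measurable borel" unfolding f_def[abs_def]
        by (intro borel_measurable_continuous_onI continuous_intros continuous_on_Polys[OF q] C1_continuous C1_affine_arg C1_bump3)
      have "q (z + i *\<^sub>R (y - z)) * \<beta> y = f ((1-i) *\<^sub>R z + i *\<^sub>R y)" for y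
      proof -
        have "(1-i) *\<^sub>R z + i *\<^sub>R y - p = i *\<^sub>R (y - c)" by (simp add: p_def algebra_simps)
        then have "(1/(i * s0)) *\<^sub>R ((1-i) *\<^sub>R z + i *\<^sub>R y - p) = (1/s0) *\<^sub>R (y - c)" using i0 by simp
        moreover have "z + i *\<^sub>R (y - z) = (1-i) *\<^sub>R z + i *\<^sub>R y" by (simp add: algebra_simps)
        ultimately show ?thesis by (simp add: f_def \<beta>_def)
      qed
      then have "(LINT y|lebesgue. q (z + i *\<^sub>R (y - z)) * \<beta> y) = (1 / i ^ CARD('n)) * (LINT x|lebesgue. f x)"
        using integral_lebesgue_affine[OF fm, of i "(1-i) *\<^sub>R z"] i0 by simp
      moreover have "\<bar>LINT x|lebesgue. f x\<bar> \<le> B"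
        unfolding f_def
      proof (rule B)
        show "cball p (i * s0) \<subseteq> ball c (\<rho> * h)"
        proof
          fix x assume "x \<in> cball p (i * s0)"
          then have "dist p x \<le> i * s0" by simp
          also have "i * s0 \<le> s0" using i0 s0 by (simp add: mult_left_le_one_le)
          finally have px: "dist p x \<le> s0" .
          have "c - p = (1 - i) *\<^sub>R (c - z)" by (simp add: p_def algebra_simps)
          then have "dist c p = (1 - i) * dist c z" using i0 by (simp add: dist_norm)
          also have "\<dots> \<le> \<delta> * (m * h)" using i0 z \<delta> by (intro mult_mono) auto
          also have "\<delta> * (m * h) = (\<delta> * m) * h" by simp
          also have "\<dots> \<le> (\<rho> / 2) * h" using \<delta>m h by (intro mult_right_mono) auto
          also have "(\<rho> / 2) * h = \<rho> * h / 2" by simp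
          finally have "dist c p \<le> \<rho> * h / 2" .
          moreover have "dist p x \<le> \<rho> * h / 4" using px by (simp add: s0_def)
          moreover have "\<rho> * h > 0" using assms h by simp
          ultimately have "dist c x < \<rho> * h" using dist_triangle[of c x p] by linarith
          then show "x \<in> ball c (\<rho> * h)" by simp
        qed
        have "1/2 * s0 \<le> i * s0" using i0 s0 by (intro mult_right_mono) auto
        then show "\<rho> * h / 8 \<le> i * s0" by (simp add: s0_def)
      qed
      moreover have "1 / i ^ CARD('n) \<le> 2 ^ CARD('n)"
      proof -
        have "(1/2) ^ CARD('n) \<le> i ^ CARD('n)" using i0 by (intro power_mono) auto
        then show ?thesis using i0 by (simp add: field_simps power_one_over)
      qed
      moreover have "\<bar>(1 / i ^ CARD('n)) * (LINT x|lebesgue. f x)\<bar> = (1 / i ^ CARD('n)) * \<bar>LINT x|lebesgue. f x\<bar>"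
        using i0 by (simp add: abs_mult)
      ultimately show ?thesis using i0 by (simp only:) (intro mult_mono, auto)
    qed
    have iq: "integrable lebesgue (\<lambda>y. cf i * (q (z + i *\<^sub>R (y - z)) * \<beta> y))" for i
      unfolding \<beta>_def by (intro integrable_mult_right bump3_set_integrable contq s0)
    have "\<bar>q z\<bar> * (\<omega> * h ^ CARD('n)) \<le> \<bar>q z\<bar> * (LINT y|lebesgue. \<beta> y)"
      by (intro mult_left_mono low) auto
    also have "\<dots> = \<bar>LINT y|lebesgue. q z * \<beta> y\<bar>"
    proof -
      have "0 \<le> (LINT y|lebesgue. \<beta> y)" by (intro integral_nonneg_AE AE_I2 \<beta>0)
      then show ?thesis by (simp add: abs_mult)
    qed
    also have "(LINT y|lebesgue. q z * \<beta> y) = (LINT y|lebesgue. (\<Sum>i\<in>I. cf i * (q (z + i *\<^sub>R (y - z)) * \<beta> y)))"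
    proof (rule Bochner_Integration.integral_cong[OF refl])
      fix y
      show "q z * \<beta> y = (\<Sum>i\<in>I. cf i * (q (z + i *\<^sub>R (y - z)) * \<beta> y))"
        by (subst ex[OF q, of z y]) (simp add: sum_distrib_right mult.assoc)
    qed
    also have "\<dots> = (\<Sum>i\<in>I. cf i * (LINT y|lebesgue. q (z + i *\<^sub>R (y - z)) * \<beta> y))"
      by (simp only: Bochner_Integration.integral_sum[OF iq] integral_mult_right_zero)
    also have "\<bar>\<dots>\<bar> \<le> (\<Sum>i\<in>I. \<bar>cf i\<bar> * (2 ^ CARD('n) * B))"
      by (rule order_trans[OF sum_abs]) (auto intro!: sum_mono mult_left_mono bi simp: abs_mult)
    also have "\<dots> = (\<Sum>i\<in>I. \<bar>cf i\<bar> * 2 ^ CARD('n)) * B" by (simp add: sum_distrib_right mult.assoc)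
    also have "\<dots> \<le> \<Lambda> * B" unfolding \<Lambda>_def using B0 by (intro mult_right_mono) auto
    finally show ?thesis .
  qed
  show ?thesis
  proof (intro exI[of _ "\<Lambda>/\<omega>"] conjI ballI allI impI)
    fix q :: "real^'n \<Rightarrow> real" and c z :: "real^'n" and h B :: real
    assume a: "q \<in> Polys k" "h > 0" "dist c z \<le> m * h"
      "\<forall>p s. cball p s \<subseteq> ball c (\<rho> * h) \<longrightarrow> \<rho> * h / 8 \<le> s \<longrightarrow> \<bar>LINT x|lebesgue. q x * bump3 ((1/s) *\<^sub>R (x - p))\<bar> \<le> B"
    have "\<bar>q z\<bar> * (\<omega> * h ^ CARD('n)) \<le> \<Lambda> * B" by (rule main[OF a(1-3)]) (use a(4) in blast)
    then show "\<bar>q z\<bar> * h ^ CARD('n) \<le> \<Lambda>/\<omega> * B"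
      using \<omega> by (simp add: field_simps)
  qed (use \<Lambda> \<omega> in auto)
qed

context star_cell begin

text \<open>The divergence theorem in each axis direction \<open>j\<close>, applied to the product
  of \<open>u\<close> and the \<open>j\<close>-th partial derivative of \<open>q\<close>, summed
  over \<open>j\<close>.\<close>

lemma green_identity:
  assumes u: "C1 u" and q: "q \<in> Polys k"
  shows "(LINT x|M. u x * laplacian q x) + (LINT x|M. grad u x \<bullet> grad q x) = (\<Sum>i\<in>I. LINT y:Y i|lebesgue. u (\<Phi> i y) * (grad q (\<Phi> i y) \<bullet> \<nu> i))"
proof -
  have qj: "(\<lambda>x. grad q x $ j) \<in> Polys (k - 1)" for j by (rule Polys_GDERIV(2)[OF q])
  note cj = C1_continuous_grad[OF Polys_C1[OF qj]] C1_continuous[OF Polys_C1[OF qj]] C1_continuous[OF u] C1_continuous_grad[OF u] C1_continuous_grad[OF Polys_C1[OF q]]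
  have comp: "axis j 1 \<bullet> grad (\<lambda>x. u x * (grad q x $ j)) x = u x * (grad (\<lambda>x. grad q x $ j) x $ j) + (grad q x $ j) * (grad u x $ j)" for j x
    by (subst C1_mult(2)[OF u Polys_C1[OF qj]]) (simp add: inner_axis')
  have int1: "set_integrable lebesgue D (\<lambda>x. u x * (grad (\<lambda>x. grad q x $ j) x $ j) + (grad q x $ j) * (grad u x $ j))" for j
    by (intro set_integrable_D continuous_intros cj)
  have "(LINT x|M. u x * laplacian q x) + (LINT x|M. grad u x \<bullet> grad q x) = (LINT x|M. u x * laplacian q x + grad u x \<bullet> grad q x)"
    unfolding laplacian_def
    by (rule Bochner_Integration.integral_add[symmetric]) (intro integrable_M_continuous continuous_intros cj)+
  also have "\<dots> = (LINT x:D|lebesgue. u x * laplacian q x + grad u x \<bullet> grad q x)" by (simp add: integral_D_eq_M)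
  also have "\<dots> = (LINT x:D|lebesgue. (\<Sum>j\<in>UNIV. u x * (grad (\<lambda>x. grad q x $ j) x $ j) + (grad q x $ j) * (grad u x $ j)))"
    by (simp add: laplacian_def sum.distrib sum_distrib_left inner_vec_def mult.commute)
  also have "\<dots> = (\<Sum>j\<in>UNIV. LINT x:D|lebesgue. u x * (grad (\<lambda>x. grad q x $ j) x $ j) + (grad q x $ j) * (grad u x $ j))"
    using int1 unfolding set_lebesgue_integral_def set_integrable_def
    by (simp only: scaleR_sum_right) (rule Bochner_Integration.integral_sum, simp)
  also have "\<dots> = (\<Sum>j\<in>UNIV. \<Sum>i\<in>I. (axis j 1 \<bullet> \<nu> i) * (LINT y:Y i|lebesgue. u (\<Phi> i y) * (grad q (\<Phi> i y) $ j)))"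
    unfolding comp[symmetric] by (intro sum.cong refl divergence_theorem C1_mult u Polys_C1[OF qj])
  also have "\<dots> = (\<Sum>i\<in>I. \<Sum>j\<in>UNIV. LINT y:Y i|lebesgue. (\<nu> i $ j) * (u (\<Phi> i y) * (grad q (\<Phi> i y) $ j)))"
    by (subst sum.swap) (simp add: inner_axis')
  also have "\<dots> = (\<Sum>i\<in>I. LINT y:Y i|lebesgue. u (\<Phi> i y) * (grad q (\<Phi> i y) \<bullet> \<nu> i))"
  proof (rule sum.cong[OF refl])
    fix i assume i: "i \<in> I"
    have "set_integrable lebesgue (Y i) (\<lambda>y. (\<nu> i $ j) * (u (\<Phi> i y) * (grad q (\<Phi> i y) $ j)))" for j
      by (rule set_integrable_Y[OF _ i, of "\<lambda>x. (\<nu> i $ j) * (u x * (grad q x $ j))"]) (intro continuous_intros cj)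
    then have "(\<Sum>j\<in>UNIV. LINT y:Y i|lebesgue. (\<nu> i $ j) * (u (\<Phi> i y) * (grad q (\<Phi> i y) $ j))) = (LINT y:Y i|lebesgue. \<Sum>j\<in>UNIV. (\<nu> i $ j) * (u (\<Phi> i y) * (grad q (\<Phi> i y) $ j)))"
      unfolding set_lebesgue_integral_def set_integrable_def
      by (simp only: scaleR_sum_right) (rule Bochner_Integration.integral_sum[symmetric], simp)
    also have "\<dots> = (LINT y:Y i|lebesgue. u (\<Phi> i y) * (grad q (\<Phi> i y) \<bullet> \<nu> i))"
      by (simp add: inner_vec_def sum_distrib_left mult_ac)
    finally show "(\<Sum>j\<in>UNIV. LINT y:Y i|lebesgue. (\<nu> i $ j) * (u (\<Phi> i y) * (grad q (\<Phi> i y) $ j))) = (LINT y:Y i|lebesgue. u (\<Phi> i y) * (grad q (\<Phi> i y) \<bullet> \<nu> i))" .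
  qed
  finally show ?thesis .
qed

text \<open>Green's identity for the C1 approximations, passed to the limit. Their boundary values
  converge to those of \<open>v\<close> only in the mean square, whereas the boundary term needs a
  first power.\<close>

lemma weak_green_bound:
  assumes w: "weak_solution v G r" and q: "q \<in> Polys k" and K: "\<And>x. x \<in> D \<Longrightarrow> norm (grad q x) \<le> K" and m: "m > 0"
    and bd: "\<And>i. i \<in> I \<Longrightarrow> AE y in lebesgue. y \<in> Y i \<longrightarrow> \<bar>v (\<Phi> i y)\<bar> \<le> m"
  shows "\<bar>(LINT x|M. v x * laplacian q x) + (LINT x|M. G x \<bullet> grad q x)\<bar> \<le> 2 * m * K * bint (\<lambda>_. 1)"
proof -
  note ws = weak_solutionD[OF w]
  obtain u where "smooth_approx u v G" using ws(7) ..
  note u = smooth_approxD[OF this]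
  have l2u: "l2 M (u n)" for n by (intro l2_continuous C1_continuous u)
  have cq: "continuous_on UNIV (grad q)" by (rule Polys_GDERIV(3)[OF q])
  have cl: "continuous_on UNIV (laplacian q)" by (rule continuous_on_Polys[OF Polys_laplacian(1)[OF q]])
  have guc: "continuous_on UNIV (grad (u n))" for n by (rule C1_continuous_grad[OF u(1)])
  obtain x0 where "x0 \<in> D" using ball_subset c_in_ball by blast
  then have K0: "K \<ge> 0" using K norm_ge_zero order_trans by blast
  have lim1: "(\<lambda>n. LINT x|M. laplacian q x * u n x) \<longlonglongrightarrow> (LINT x|M. laplacian q x * v x)"
    by (rule l2_tendsto_inner[OF l2u ws(1) l2n_tendsto_iff[OF l2_measurable[OF l2_diff(1)[OF l2u ws(1)]] u(2)] l2_continuous[OF cl]])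
  have lim2: "(\<lambda>n. LINT x|M. grad (u n) x \<bullet> grad q x) \<longlonglongrightarrow> (LINT x|M. G x \<bullet> grad q x)"
  proof -
    have gm: "grad (u n) \<in> borel_measurable M" for n by (intro measurable_M_continuous guc)
    have dm: "(\<lambda>x. grad (u n) x - G x) \<in> borel_measurable M" for n using gm ws(3) by (rule borel_measurable_diff)
    have l2d: "l2 M (\<lambda>x. norm (grad (u n) x - G x))" for n
    proof (rule l2_mono(1)[OF _ l2_add(1)[OF l2_continuous[of "\<lambda>x. norm (grad (u n) x)"] ws(4)]])
      show "AE x in M. \<bar>norm (grad (u n) x - G x)\<bar> \<le> \<bar>norm (grad (u n) x) + norm (G x)\<bar>"
        by (rule AE_I2) (metis abs_norm_cancel order_trans[OF norm_triangle_ineq4 abs_ge_self])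
    qed (use dm in \<open>auto intro!: continuous_intros guc\<close>)
    have lq: "l2 M (\<lambda>x. norm (grad q x))" by (intro l2_continuous continuous_intros cq)
    have dist: "norm ((LINT x|M. grad (u n) x \<bullet> grad q x) - (LINT x|M. G x \<bullet> grad q x)) \<le> l2n M (\<lambda>x. norm (grad (u n) x - G x)) * l2n M (\<lambda>x. norm (grad q x))" for n
    proof -
      have "(LINT x|M. grad (u n) x \<bullet> grad q x) - (LINT x|M. G x \<bullet> grad q x) = (LINT x|M. (grad (u n) x - G x) \<bullet> grad q x)"
        unfolding inner_diff_left
        by (rule Bochner_Integration.integral_diff[symmetric]) (intro integrable_M_continuous continuous_intros guc cq, rule integrable_M_inner[OF ws(3,4) cq])
      also have "norm \<dots> \<le> (LINT x|M. norm ((grad (u n) x - G x) \<bullet> grad q x))" by (rule integral_norm_bound)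
      also have "\<dots> \<le> (LINT x|M. norm (grad (u n) x - G x) * norm (grad q x))"
      proof (rule integral_mono)
        show "integrable M (\<lambda>x. norm ((grad (u n) x - G x) \<bullet> grad q x))" by (intro integrable_norm integrable_M_inner dm l2d cq)
        show "integrable M (\<lambda>x. norm (grad (u n) x - G x) * norm (grad q x))" by (rule l2_CS(1)[OF l2d lq])
      qed (simp add: Cauchy_Schwarz_ineq2)
      also have "\<dots> \<le> l2n M (\<lambda>x. norm (grad (u n) x - G x)) * l2n M (\<lambda>x. norm (grad q x))"
        using l2_CS(2)[OF l2d lq] by (rule order_trans[OF abs_ge_self])
      finally show ?thesis .
    qed
    have "(\<lambda>n. l2n M (\<lambda>x. norm (grad (u n) x - G x)) * l2n M (\<lambda>x. norm (grad q x))) \<longlonglongrightarrow> 0 * l2n M (\<lambda>x. norm (grad q x))"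
      by (intro tendsto_intros l2n_tendsto_iff[OF l2_measurable[OF l2d] u(3)])
    then have lim0: "(\<lambda>n. l2n M (\<lambda>x. norm (grad (u n) x - G x)) * l2n M (\<lambda>x. norm (grad q x))) \<longlonglongrightarrow> 0" by simp
    have "(\<lambda>n. (LINT x|M. grad (u n) x \<bullet> grad q x) - (LINT x|M. G x \<bullet> grad q x)) \<longlonglongrightarrow> 0"
      by (rule Lim_null_comparison[OF always_eventually[OF allI[OF dist]] lim0])
    then show ?thesis by (simp add: LIM_zero_iff)
  qed
  have one: "bint (\<lambda>x. k1 * f x) = k1 * bint f" for k1 f by (simp add: bint_def sum_distrib_left)
  have B: "\<bar>(LINT x|M. laplacian q x * u n x) + (LINT x|M. grad (u n) x \<bullet> grad q x)\<bar> \<le> K * (3/2 * m * bint (\<lambda>_. 1) + 1/(2*m) * bint (\<lambda>x. (u n x - v x)^2))" for n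
  proof -
    have "(LINT x|M. laplacian q x * u n x) + (LINT x|M. grad (u n) x \<bullet> grad q x) = (\<Sum>i\<in>I. LINT y:Y i|lebesgue. u n (\<Phi> i y) * (grad q (\<Phi> i y) \<bullet> \<nu> i))"
      using green_identity[OF u(1) q, of n] by (simp add: mult.commute)
    also have "\<bar>\<dots>\<bar> \<le> (\<Sum>i\<in>I. K * (LINT y:Y i|lebesgue. \<bar>u n (\<Phi> i y)\<bar>))"
    proof (rule order_trans[OF sum_abs sum_mono])
      fix i assume i: "i \<in> I"
      have s1: "set_integrable lebesgue (Y i) (\<lambda>y. u n (\<Phi> i y) * (grad q (\<Phi> i y) \<bullet> \<nu> i))"
        by (rule set_integrable_Y[OF _ i, of "\<lambda>x. u n x * (grad q x \<bullet> \<nu> i)"]) (intro continuous_intros C1_continuous u cq)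
      have s2: "set_integrable lebesgue (Y i) (\<lambda>y. K * \<bar>u n (\<Phi> i y)\<bar>)"
        by (rule set_integrable_Y[OF _ i, of "\<lambda>x. K * \<bar>u n x\<bar>"]) (intro continuous_intros C1_continuous u)
      have "\<bar>LINT y:Y i|lebesgue. u n (\<Phi> i y) * (grad q (\<Phi> i y) \<bullet> \<nu> i)\<bar> \<le> (LINT y:Y i|lebesgue. \<bar>u n (\<Phi> i y) * (grad q (\<Phi> i y) \<bullet> \<nu> i)\<bar>)"
        using set_integral_norm_bound[OF s1] by simp
      also have "\<dots> \<le> (LINT y:Y i|lebesgue. K * \<bar>u n (\<Phi> i y)\<bar>)"
      proof (rule set_integral_mono[OF set_integrable_abs[OF s1] s2])
        fix y assume y: "y \<in> Y i"
        have "\<bar>grad q (\<Phi> i y) \<bullet> \<nu> i\<bar> \<le> norm (grad q (\<Phi> i y)) * norm (\<nu> i)" by (rule Cauchy_Schwarz_ineq2)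
        also have "\<dots> \<le> K" using K[OF \<Phi>_in_D[OF i y]] \<nu>(1)[OF i] by simp
        finally show "\<bar>u n (\<Phi> i y) * (grad q (\<Phi> i y) \<bullet> \<nu> i)\<bar> \<le> K * \<bar>u n (\<Phi> i y)\<bar>"
          unfolding abs_mult by (subst mult.commute) (rule mult_right_mono, auto)
      qed
      finally show "\<bar>LINT y:Y i|lebesgue. u n (\<Phi> i y) * (grad q (\<Phi> i y) \<bullet> \<nu> i)\<bar> \<le> K * (LINT y:Y i|lebesgue. \<bar>u n (\<Phi> i y)\<bar>)" by simp
    qed
    also have "\<dots> = K * bint (\<lambda>x. \<bar>u n x\<bar>)" by (simp add: bint_def sum_distrib_left)
    also have "bint (\<lambda>x. \<bar>u n x\<bar>) \<le> bint (\<lambda>x. 3/2 * m * 1 + 1/(2*m) * (u n x - v x)^2)"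
    proof (rule bint_mono_AE)
      have cu: "continuous_on (frontier D) (u n)" by (rule C1_continuous[OF u(1)])
      show "continuous_on (frontier D) (\<lambda>x. \<bar>u n x\<bar>)" "continuous_on (frontier D) (\<lambda>x. 3/2 * m * 1 + 1/(2*m) * (u n x - v x)^2)"
        by (intro continuous_intros cu ws)+
      fix i assume "i \<in> I"
      from bd[OF this] show "AE y in lebesgue. y \<in> Y i \<longrightarrow> \<bar>u n (\<Phi> i y)\<bar> \<le> 3/2 * m * 1 + 1/(2*m) * (u n (\<Phi> i y) - v (\<Phi> i y))^2"
      proof eventually_elim
        case (elim y)
        define e where "e = u n (\<Phi> i y) - v (\<Phi> i y)"
        \<comment> \<open>Young's inequality with weight \<open>m\<close> turns the trace error into
          its square, whose boundary integral tends to 0, at the price of an additional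
          \<open>m / 2\<close>. The resulting factor 3/2 is rounded up to 2 at the end.\<close>
        have "2 * m * \<bar>e\<bar> \<le> m^2 + e^2" using sum_squares_bound[of m "\<bar>e\<bar>"] by simp
        then have "2 * m * \<bar>e\<bar> / (2 * m) \<le> (m^2 + e^2) / (2 * m)" using m by (intro divide_right_mono) auto
        then have "\<bar>e\<bar> \<le> m / 2 + 1/(2*m) * e^2" using m by (simp add: add_divide_distrib power2_eq_square)
        moreover have "\<bar>u n (\<Phi> i y)\<bar> \<le> \<bar>v (\<Phi> i y)\<bar> + \<bar>e\<bar>" by (simp add: e_def)
        ultimately show ?case using elim unfolding e_def[symmetric] by auto
      qed
    qed
    also have "\<dots> = 3/2 * m * bint (\<lambda>_. 1) + 1/(2*m) * bint (\<lambda>x. (u n x - v x)^2)"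
    proof -
      have cu: "continuous_on (frontier D) (u n)" by (rule C1_continuous[OF u(1)])
      have "bint (\<lambda>x. 3/2 * m * 1 + 1/(2*m) * (u n x - v x)^2) = bint (\<lambda>x. 3/2 * m * 1) + bint (\<lambda>x. 1/(2*m) * (u n x - v x)^2)"
        unfolding bint_def sum.distrib[symmetric]
        by (intro sum.cong refl set_integral_add integrable_Y_continuous) (use m in \<open>auto intro!: continuous_intros cu ws\<close>)
      then show ?thesis by (simp only: one)
    qed
    finally show ?thesis using K0 by (simp add: mult_left_mono)
  qed
  have "\<bar>(LINT x|M. laplacian q x * v x) + (LINT x|M. G x \<bullet> grad q x)\<bar> \<le> K * (3/2 * m * bint (\<lambda>_. 1) + 1/(2*m) * 0)"
  proof (rule LIMSEQ_le)
    show "(\<lambda>n. \<bar>(LINT x|M. laplacian q x * u n x) + (LINT x|M. grad (u n) x \<bullet> grad q x)\<bar>) \<longlonglongrightarrow> \<bar>(LINT x|M. laplacian q x * v x) + (LINT x|M. G x \<bullet> grad q x)\<bar>"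
      by (intro tendsto_intros lim1 lim2)
    show "(\<lambda>n. K * (3/2 * m * bint (\<lambda>_. 1) + 1/(2*m) * bint (\<lambda>x. (u n x - v x)^2))) \<longlonglongrightarrow> K * (3/2 * m * bint (\<lambda>_. 1) + 1/(2*m) * 0)"
      by (intro tendsto_intros u(4))
    show "\<exists>N. \<forall>n\<ge>N. \<bar>(LINT x|M. laplacian q x * u n x) + (LINT x|M. grad (u n) x \<bullet> grad q x)\<bar> \<le> K * (3/2 * m * bint (\<lambda>_. 1) + 1/(2*m) * bint (\<lambda>x. (u n x - v x)^2))"
      using B by blast
  qed
  also have "\<dots> = (3/2) * (m * K * bint (\<lambda>_. 1))" by simp
  also have "\<dots> \<le> 2 * (m * K * bint (\<lambda>_. 1))"
    using m K0 bint_mono_nonneg[of "\<lambda>_. 1"] by (intro mult_right_mono) auto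
  finally show ?thesis by (simp add: mult.commute mult.assoc)
qed

end

lemma Polys_bound_by_L1:
  fixes \<rho> m :: real
  assumes "0 < \<rho>" "0 \<le> m"
  shows "\<exists>C>0. \<forall>q\<in>Polys k. \<forall>c z::real^'n::finite. \<forall>h>0. dist c z \<le> m * h \<longrightarrow>
     \<bar>q z\<bar> * h ^ CARD('n) \<le> C * (LINT x:ball c (\<rho> * h)|lebesgue. \<bar>q x\<bar>)"
proof -
  obtain C where C: "C > 0" "\<And>q (c::real^'n) z h B. q \<in> Polys k \<Longrightarrow> h > 0 \<Longrightarrow> dist c z \<le> m * h \<Longrightarrow>
     (\<And>p s. cball p s \<subseteq> ball c (\<rho> * h) \<Longrightarrow> \<rho> * h / 8 \<le> s \<Longrightarrow> \<bar>LINT x|lebesgue. q x * bump3 ((1/s) *\<^sub>R (x - p))\<bar> \<le> B) \<Longrightarrow>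
     \<bar>q z\<bar> * h ^ CARD('n) \<le> C * B"
    using Polys_bound_by_bumps[OF assms, of k, where 'n='n] by meson
  show ?thesis
  proof (intro exI[of _ C] conjI C(1) ballI allI impI, rule C(2))
    fix q :: "real^'n \<Rightarrow> real" and c z :: "real^'n" and h p s
    assume q: "q \<in> Polys k" and h: "h > 0" and ps: "cball p s \<subseteq> ball c (\<rho> * h)" "\<rho> * h / 8 \<le> s"
    have s: "s > 0" using ps(2) h assms(1) by (smt (verit) mult_pos_pos divide_pos_pos)
    have cq: "continuous_on UNIV q" by (rule continuous_on_Polys[OF q])
    show "\<bar>LINT x|lebesgue. q x * bump3 ((1/s) *\<^sub>R (x - p))\<bar> \<le> (LINT x:ball c (\<rho> * h)|lebesgue. \<bar>q x\<bar>)"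
      unfolding set_lebesgue_integral_def
    proof (rule order_trans[OF integral_abs_bound integral_mono])
      show "integrable lebesgue (\<lambda>x. \<bar>q x * bump3 ((1/s) *\<^sub>R (x - p))\<bar>)" by (intro integrable_abs bump3_set_integrable cq s)
      show "integrable lebesgue (\<lambda>x. indicat_real (ball c (\<rho> * h)) x *\<^sub>R \<bar>q x\<bar>)"
        using set_integrable_continuous[of "\<lambda>x. \<bar>q x\<bar>" "ball c (\<rho> * h)"] by (simp add: set_integrable_def continuous_on_rabs cq)
      fix x
      have 1: "\<bar>q x\<bar> * bump3 ((1/s) *\<^sub>R (x - p)) \<le> \<bar>q x\<bar> * 1" by (intro mult_left_mono bump3_le_1) simp
      show "\<bar>q x * bump3 ((1/s) *\<^sub>R (x - p))\<bar> \<le> indicat_real (ball c (\<rho> * h)) x *\<^sub>R \<bar>q x\<bar>"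
      proof (cases "x \<in> cball p s")
        case True
        then have "x \<in> ball c (\<rho> * h)" using ps(1) by blast
        then show ?thesis using 1 by (simp add: abs_mult bump3_nonneg)
      next
        case False
        then show ?thesis by (simp add: bump3_outside[OF s])
      qed
    qed
  qed
qed

text \<open>Cauchy-Schwarz on the ball and squaring turn the L1 bound into one with
  \<open>h^(2n)\<close> on the left and the volume of the ball on the right; one factor
  \<open>h^n\<close> cancels.\<close>

lemma Polys_bound_by_L2:
  fixes \<rho> m :: real
  assumes "0 < \<rho>" "0 \<le> m"
  shows "\<exists>C>0. \<forall>q\<in>Polys k. \<forall>c z::real^'n::finite. \<forall>h>0. dist c z \<le> m * h \<longrightarrow>
     (q z)^2 * h ^ CARD('n) \<le> C * (LINT x:ball c (\<rho> * h)|lebesgue. (q x)^2)"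
proof -
  obtain C where C: "C > 0" "\<And>q (c::real^'n) z h. q \<in> Polys k \<Longrightarrow> h > 0 \<Longrightarrow> dist c z \<le> m * h \<Longrightarrow>
     \<bar>q z\<bar> * h ^ CARD('n) \<le> C * (LINT x:ball c (\<rho> * h)|lebesgue. \<bar>q x\<bar>)"
    using Polys_bound_by_L1[OF assms, of k, where 'n='n] by blast
  define \<omega> where "\<omega> = measure lebesgue (ball (0::real^'n) 1) * \<rho> ^ CARD('n)"
  have \<omega>: "\<omega> > 0" using assms content_ball_pos[of 1 "0::real^'n"] by (simp add: \<omega>_def)
  show ?thesis
  proof (intro exI[of _ "C^2 * \<omega>"] conjI ballI allI impI)
    fix q :: "real^'n \<Rightarrow> real" and c z :: "real^'n" and h :: real
    assume q: "q \<in> Polys k" and h: "h > 0" and z: "dist c z \<le> m * h"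
    let ?B = "ball c (\<rho> * h)" and ?M = "lebesgue_on (ball c (\<rho> * h))"
    have mB: "measure lebesgue ?B = \<omega> * h ^ CARD('n)"
      using content_ball_conv_unit_ball[of "\<rho> * h" c] assms h by (simp add: \<omega>_def power_mult_distrib)
    have cq: "continuous_on UNIV q" by (rule continuous_on_Polys[OF q])
    have sB: "?B \<inter> space lebesgue \<in> sets lebesgue" by simp
    have toM: "(LINT x:?B|lebesgue. f x) = (LINT x|?M. f x)" for f :: "real^'n \<Rightarrow> real"
      unfolding set_lebesgue_integral_def by (rule integral_restrict_space[OF sB, symmetric])
    have l2c: "l2 ?M f" if f: "continuous_on UNIV f" for f :: "real^'n \<Rightarrow> real"
      unfolding l2_def
    proof
      have "f \<in> borel_measurable lborel" using borel_measurable_continuous_onI[OF f] by simp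
      then show "f \<in> borel_measurable ?M" by (intro measurable_restrict_space1 measurable_completion)
      have "set_integrable lebesgue ?B (\<lambda>x. (f x)^2)" by (intro set_integrable_continuous continuous_intros f) auto
      then show "integrable ?M (\<lambda>x. (f x)^2)" unfolding set_integrable_def by (subst integrable_restrict_space[OF sB])
    qed
    have "(LINT x:?B|lebesgue. \<bar>q x\<bar>) \<le> l2n ?M (\<lambda>x. \<bar>q x\<bar>) * l2n ?M (\<lambda>x. 1)"
    proof -
      have "\<bar>LINT x|?M. \<bar>q x\<bar> * 1\<bar> \<le> l2n ?M (\<lambda>x. \<bar>q x\<bar>) * l2n ?M (\<lambda>x. 1)"
        by (rule l2_CS(2)) (intro l2c continuous_intros cq)+
      then show ?thesis unfolding toM by simp
    qed
    then have "\<bar>q z\<bar> * h ^ CARD('n) \<le> C * (l2n ?M (\<lambda>x. \<bar>q x\<bar>) * l2n ?M (\<lambda>x. 1))"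
      using C(2)[OF q h z] C(1) by (meson mult_left_mono less_imp_le order_trans)
    then have "(\<bar>q z\<bar> * h ^ CARD('n))^2 \<le> (C * (l2n ?M (\<lambda>x. \<bar>q x\<bar>) * l2n ?M (\<lambda>x. 1)))^2"
      using h by (intro power_mono) auto
    also have "\<dots> = C^2 * ((LINT x:?B|lebesgue. (q x)^2) * (LINT x:?B|lebesgue. 1))"
      by (simp add: power_mult_distrib l2n_sq toM)
    also have "(LINT x:?B|lebesgue. 1) = \<omega> * h ^ CARD('n)" using mB by (simp add: set_lebesgue_integral_def)
    finally have "((q z)^2 * h ^ CARD('n)) * h ^ CARD('n) \<le> (C^2 * \<omega> * (LINT x:?B|lebesgue. (q x)^2)) * h ^ CARD('n)"
      by (simp add: power_mult_distrib power2_eq_square mult_ac)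
    then show "(q z)^2 * h ^ CARD('n) \<le> C^2 * \<omega> * (LINT x:?B|lebesgue. (q x)^2)"
      using h by (simp add: mult_le_cancel_right)
  qed (use C \<omega> in auto)
qed

text \<open>A nonconvex set need not contain its centroid, but \<open>x\<close> minus the centroid
  is the mean of \<open>x - y\<close> over \<open>y\<close> in the set, and these differences have
  length at most the diameter.\<close>

lemma norm_centroid_le:
  fixes D :: "(real^'n::finite) set"
  assumes D: "compact D" and pos: "measure lebesgue D > 0" and x: "x \<in> D"
  shows "norm (x - centroid D) \<le> diameter D"
proof -
  have Db: "D \<in> sets lebesgue" "bounded D" using D borel_closed[OF compact_imp_closed[OF D]] compact_imp_bounded[OF D] by auto
  have "x - centroid D = (1 / measure lebesgue D) *\<^sub>R (LINT y:D|lebesgue. x - y)"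
  proof -
    have "(LINT y:D|lebesgue. x - y) = (LINT y:D|lebesgue. x) - (LINT y:D|lebesgue. y)"
      by (rule set_integral_diff(2)) (intro set_integrable_continuous continuous_intros Db)+
    also have "(LINT y:D|lebesgue. x) = measure lebesgue D *\<^sub>R x"
    proof -
      have "D \<in> lmeasurable" using D lmeasurable_compact by blast
      then have "integrable lebesgue (indicat_real D)" by (simp add: lmeasurable_iff_integrable)
      then show ?thesis unfolding set_lebesgue_integral_def by simp
    qed
    finally show ?thesis using pos by (simp add: centroid_def scaleR_diff_right)
  qed
  also have "norm \<dots> = (1 / measure lebesgue D) * norm (LINT y:D|lebesgue. x - y)" using pos by simp
  also have "\<dots> \<le> (1 / measure lebesgue D) * (LINT y:D|lebesgue. diameter D)"
  proof (intro mult_left_mono order_trans[OF set_integral_norm_bound set_integral_mono])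
    show "set_integrable lebesgue D (\<lambda>y. x - y)" by (intro set_integrable_continuous continuous_intros Db)
    show "set_integrable lebesgue D (\<lambda>y. norm (x - y))" by (intro set_integrable_continuous continuous_intros Db)
    show "set_integrable lebesgue D (\<lambda>y. diameter D)" by (intro set_integrable_continuous continuous_intros Db)
    show "norm (x - y) \<le> diameter D" if "y \<in> D" for y
      using diameter_bounded_bound[OF Db(2) x that] by (simp add: dist_norm)
  qed simp
  also have "\<dots> = diameter D" using pos D lmeasurable_compact by (simp add: set_lebesgue_integral_def)
  finally show ?thesis .
qed

lemma abs_monomial_le: assumes "\<And>i. \<bar>z $ i\<bar> \<le> 1" shows "\<bar>monomial \<alpha> z\<bar> \<le> 1"
proof -
  have "\<bar>monomial \<alpha> z\<bar> = (\<Prod>i\<in>UNIV. \<bar>z $ i\<bar> ^ \<alpha> i)" by (simp add: monomial_def abs_prod power_abs)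
  also have "\<dots> \<le> 1" using assms by (intro prod_le_1) (auto intro: power_le_one)
  finally show ?thesis .
qed

lemma abs_scaled_monomial_le:
  fixes D :: "(real^'n::finite) set"
  assumes D: "compact D" and pos: "measure lebesgue D > 0" and x: "x \<in> D" and diam: "diameter D > 0"
  shows "\<bar>scaled_monomial D \<alpha> x\<bar> \<le> 1"
  unfolding scaled_monomial_def
proof (rule abs_monomial_le)
  fix i
  have "\<bar>((1 / diameter D) *\<^sub>R (x - centroid D)) $ i\<bar> \<le> norm ((1 / diameter D) *\<^sub>R (x - centroid D))" by (rule component_le_norm_cart)
  also have "\<dots> \<le> 1" unfolding norm_scaleR using norm_centroid_le[OF D pos x] diam by (simp add: divide_le_eq)
  finally show "\<bar>((1 / diameter D) *\<^sub>R (x - centroid D)) $ i\<bar> \<le> 1" .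
qed

lemma continuous_scaled_monomial [continuous_intros]: "continuous_on S (scaled_monomial D \<alpha>)"
  unfolding scaled_monomial_def[abs_def]
  by (intro continuous_on_compose2[OF continuous_on_monomial[of UNIV]] continuous_intros) auto

context star_cell begin

lemma measure_D_pos: "measure lebesgue D > 0"
proof -
  have "0 < measure lebesgue (ball c (\<rho> * h))" using \<rho>_pos h_pos content_ball_pos[of "\<rho> * h" c] by simp
  also have "\<dots> \<le> measure lebesgue D"
    using ball_subset compact_D by (intro measure_mono_fmeasurable) (auto intro: lmeasurable_compact)
  finally show ?thesis .
qed

lemma bint_1_pos: "bint (\<lambda>_. 1) > 0"
proof -
  have "real CARD('n) * measure lebesgue D = (LINT x:D|lebesgue. real CARD('n) * 1 + (x - c) \<bullet> grad (\<lambda>_. 1) x)"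
    by (simp add: C1_const set_lebesgue_integral_def)
  also have "\<dots> = (\<Sum>i\<in>I. (P i - c) \<bullet> \<nu> i * (LINT y:Y i|lebesgue. 1))"
    using integral_radial[OF c_in_ball C1_const(1)[of 1]] by simp
  also have "\<dots> \<le> (\<Sum>i\<in>I. h * (LINT y:Y i|lebesgue. 1))"
    by (intro sum_mono mult_right_mono height_le) (auto simp: set_lebesgue_integral_def intro!: integral_nonneg_AE)
  also have "\<dots> = h * bint (\<lambda>_. 1)" by (simp add: bint_def sum_distrib_left)
  finally have "0 < h * bint (\<lambda>_. 1)" using measure_D_pos by (smt (verit) mult_pos_pos of_nat_0_less_iff zero_less_card_finite)
  then show ?thesis using h_pos by (simp add: zero_less_mult_iff)
qed

lemma integrable_M_abs: "l2 M v \<Longrightarrow> integrable M v"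
  using l2_CS(1)[of M v "\<lambda>_. 1", OF _ l2_continuous] by simp

text \<open>Two integrations by parts move the Laplacian from \<open>v\<close> to the bump: one is
  the weak equation tested with the bump, the other the definition of the weak gradient tested with
  the partial derivatives \<open>\<psi> j\<close> of the bump. Two derivatives at scale
  \<open>s\<close> cost the factor \<open>s^(-2)\<close>.\<close>

lemma bump_weak_bound:
  assumes w: "weak_solution v G r"
    and ibp: "\<And>\<phi>. test_function (interior D) \<phi> \<Longrightarrow> (LINT x|M. v x *\<^sub>R grad \<phi> x) = - (LINT x|M. \<phi> x *\<^sub>R G x)"
    and p: "cball p s \<subseteq> interior D" and s: "s > 0"
  shows "\<bar>LINT x|lebesgue. r x * bump3 ((1/s) *\<^sub>R (x - p))\<bar> \<le> 6 * (4 + real CARD('n)) / s^2 * (LINT x|M. \<bar>v x\<bar>)"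
proof -
  note ws = weak_solutionD[OF w]
  let ?z = "\<lambda>x. (1/s) *\<^sub>R (x - p)"
  have z3: "bump3 (?z x) = 0" and zb: "bump (?z x) = 0" if "x \<notin> cball p s" for x
    by (rule bump3_outside[OF s that], rule bump_eq_0[OF norm_scaled_ge_1[OF s that]])
  define \<beta> where "\<beta> x = bump3 (?z x)" for x
  have \<beta>: "C1 \<beta>" "grad \<beta> = (\<lambda>x. (1/s) *\<^sub>R ((- 6 * bump (?z x)) *\<^sub>R ?z x))"
    unfolding \<beta>_def[abs_def] using C1_affine_arg[OF C1_bump3(1), of "1/s" p] by (auto simp: C1_bump3(2))
  have t\<beta>: "test_function (interior D) \<beta>"
    unfolding test_function_def using \<beta>(1) p z3 by (intro conjI exI[of _ "cball p s"]) (simp_all only: \<beta>_def compact_cball, simp)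
  define bj where "bj j z = bump z * (z \<bullet> axis j 1)" for j and z :: "(real,'n) vec"
  have bj: "C1 (bj j)" "grad (bj j) = (\<lambda>z. bump z *\<^sub>R axis j 1 + (z $ j) *\<^sub>R bump_grad z)" for j
  proof -
    show "C1 (bj j)" unfolding bj_def[abs_def] by (rule C1_mult(1)[OF C1_bump(1) C1_coord(1)])
    show "grad (bj j) = (\<lambda>z. bump z *\<^sub>R axis j 1 + (z $ j) *\<^sub>R bump_grad z)"
      unfolding bj_def[abs_def] C1_mult(2)[OF C1_bump(1) C1_coord(1)] C1_bump(2) C1_coord(2) by (simp add: inner_axis)
  qed
  define \<psi> where "\<psi> j x = (- 6 / s) * bj j (?z x)" for j x
  have \<psi>: "C1 (\<psi> j)" "grad (\<psi> j) = (\<lambda>x. (- 6 / s) *\<^sub>R ((1/s) *\<^sub>R (bump (?z x) *\<^sub>R axis j 1 + (?z x $ j) *\<^sub>R bump_grad (?z x))))" for j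
    unfolding \<psi>_def[abs_def] using C1_cmult[OF C1_affine_arg(1)[OF bj(1)[of j], of "1/s" p], of "- 6 / s"]
    by (simp_all only: C1_affine_arg(2)[OF bj(1)] bj(2))
  have t\<psi>: "test_function (interior D) (\<psi> j)" for j
    unfolding test_function_def using \<psi>(1) p zb by (intro conjI exI[of _ "cball p s"]) (simp_all only: \<psi>_def bj_def compact_cball, simp)
  have g\<beta>: "grad \<beta> x $ j = \<psi> j x" for x j
    unfolding \<beta>(2) \<psi>_def bj_def by (simp add: inner_axis)
  let ?lap = "\<lambda>x. \<Sum>j\<in>UNIV. grad (\<psi> j) x $ j"
  \<comment> \<open>The product rule for \<open>bump\<close> times the position. With
    \<open>bump\<close> at most 1 and its gradient at most 4 in norm, this gives the constant
    \<open>6 * (4 + n)\<close>.\<close>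
  have lap: "?lap x = (- 6 / s^2) * (real CARD('n) * bump (?z x) + ?z x \<bullet> bump_grad (?z x))" for x
  proof -
    have "?lap x = (\<Sum>j\<in>UNIV. (- 6 / s^2) * (bump (?z x) + (?z x $ j) * (bump_grad (?z x) $ j)))"
      unfolding \<psi>(2) by (intro sum.cong) (auto simp: axis_def power2_eq_square)
    then show ?thesis by (simp only: sum_distrib_left[symmetric] sum.distrib sum_constant inner_vec_def inner_real_def)
  qed
  have lapb: "\<bar>?lap x\<bar> \<le> 6 * (4 + real CARD('n)) / s^2" for x
  proof -
    have "\<bar>?z x \<bullet> bump_grad (?z x)\<bar> \<le> norm (?z x) * norm (bump_grad (?z x))" by (rule Cauchy_Schwarz_ineq2)
    also have "\<dots> \<le> 4"
    proof (cases "norm (?z x) < 1")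
      case True
      have "norm (bump_grad (?z x)) \<le> 4" by (rule order_trans[OF norm_bump_grad]) (simp add: indicator_def)
      then have "norm (?z x) * norm (bump_grad (?z x)) \<le> 1 * 4" using True by (intro mult_mono) auto
      then show ?thesis by simp
    next
      case False
      have "?z x \<notin> ball 0 1" using False by simp
      then have "indicat_real (ball 0 1) (?z x) = 0" by (rule indicator_simps(2))
      from norm_bump_grad[of "?z x", unfolded this] show ?thesis by simp
    qed
    finally have 1: "\<bar>?z x \<bullet> bump_grad (?z x)\<bar> \<le> 4" .
    have "bump (?z x) \<le> 1" unfolding bump_def by (rule power_le_one) auto
    then have 2: "real CARD('n) * bump (?z x) \<le> real CARD('n)" by (intro mult_left_le) auto
    have 3: "0 \<le> real CARD('n) * bump (?z x)" by (simp add: bump_nonneg)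
    have "\<bar>real CARD('n) * bump (?z x) + ?z x \<bullet> bump_grad (?z x)\<bar> \<le> 4 + real CARD('n)" using 1 2 3 by linarith
    then have "(6 / s^2) * \<bar>real CARD('n) * bump (?z x) + ?z x \<bullet> bump_grad (?z x)\<bar> \<le> (6 / s^2) * (4 + real CARD('n))"
      by (rule mult_left_mono) simp
    then show ?thesis unfolding lap abs_mult by simp
  qed
  note cc = C1_continuous_grad[OF \<psi>(1)] C1_continuous[OF \<psi>(1)]
  have iv: "integrable M v" by (rule integrable_M_abs[OF ws(1)])
  have iv\<psi>: "integrable M (\<lambda>x. v x *\<^sub>R grad (\<psi> j) x)" for j
  proof (rule Bochner_Integration.integrable_bound)
    show "integrable M (\<lambda>x. v x * norm (grad (\<psi> j) x))" by (intro l2_CS(1)[OF ws(1)] l2_continuous continuous_intros cc)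
    have "grad (\<psi> j) \<in> borel_measurable M" by (intro measurable_M_continuous cc)
    then show "(\<lambda>x. v x *\<^sub>R grad (\<psi> j) x) \<in> borel_measurable M" using l2_measurable[OF ws(1)] by (intro borel_measurable_scaleR)
  qed (simp add: abs_mult)
  have iG\<psi>: "integrable M (\<lambda>x. \<psi> j x *\<^sub>R G x)" for j
  proof (rule Bochner_Integration.integrable_bound)
    show "integrable M (\<lambda>x. \<psi> j x * norm (G x))" by (intro l2_CS(1)[OF _ ws(4)] l2_continuous cc)
    have "\<psi> j \<in> borel_measurable M" by (intro measurable_M_continuous cc)
    then show "(\<lambda>x. \<psi> j x *\<^sub>R G x) \<in> borel_measurable M" using ws(3) by (intro borel_measurable_scaleR)
  qed (simp add: abs_mult)
  have j: "(LINT x|M. v x * (grad (\<psi> j) x $ j)) = - (LINT x|M. \<psi> j x * (G x $ j))" for j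
  proof -
    have "(LINT x|M. (v x *\<^sub>R grad (\<psi> j) x) \<bullet> axis j 1) = - (LINT x|M. (\<psi> j x *\<^sub>R G x) \<bullet> axis j 1)"
      using arg_cong[OF ibp[OF t\<psi>[of j]], of "\<lambda>w. w \<bullet> axis j 1"]
      by (subst integral_inner_left[OF iv\<psi>], subst integral_inner_left[OF iG\<psi>]) simp
    then show ?thesis by (simp add: inner_axis)
  qed
  have ij1: "integrable M (\<lambda>x. v x * (grad (\<psi> j) x $ j))" for j
    using integrable_inner_left[OF iv\<psi>[of j], of "axis j 1"] by (simp add: inner_axis)
  have ij2: "integrable M (\<lambda>x. \<psi> j x * (G x $ j))" for j
    using integrable_inner_left[OF iG\<psi>[of j], of "axis j 1"] by (simp add: inner_axis)
  have "(LINT x|M. v x * ?lap x) = (\<Sum>j\<in>UNIV. (LINT x|M. v x * (grad (\<psi> j) x $ j)))"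
    unfolding sum_distrib_left by (rule Bochner_Integration.integral_sum) (rule ij1)
  also have "\<dots> = - (\<Sum>j\<in>UNIV. (LINT x|M. \<psi> j x * (G x $ j)))" by (simp add: j sum_negf)
  also have "(\<Sum>j\<in>UNIV. (LINT x|M. \<psi> j x * (G x $ j))) = (LINT x|M. (\<Sum>j\<in>UNIV. \<psi> j x * (G x $ j)))"
    by (rule Bochner_Integration.integral_sum[symmetric]) (rule ij2)
  also have "\<dots> = (LINT x|M. G x \<bullet> grad \<beta> x)" by (simp add: inner_vec_def g\<beta> mult.commute)
  also have "\<dots> = - (LINT x|M. r x * \<beta> x)" by (rule ws(6)[OF t\<beta>])
  finally have eq: "(LINT x|M. r x * \<beta> x) = (LINT x|M. v x * ?lap x)" by simp
  have "(LINT x|lebesgue. r x * bump3 (?z x)) = (LINT x|M. r x * \<beta> x)"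
  proof -
    have ind: "indicat_real (interior D) x *\<^sub>R (r x * \<beta> x) = r x * bump3 (?z x)" for x
    proof (cases "x \<in> interior D")
      case False
      then have "bump3 (?z x) = 0" using p z3 by blast
      then show ?thesis by (simp add: \<beta>_def)
    qed (simp add: \<beta>_def)
    show ?thesis unfolding integral_M set_lebesgue_integral_def ind ..
  qed
  also have "\<bar>\<dots>\<bar> \<le> (LINT x|M. \<bar>v x * ?lap x\<bar>)" unfolding eq by (rule integral_abs_bound)
  also have "\<dots> \<le> (LINT x|M. 6 * (4 + real CARD('n)) / s^2 * \<bar>v x\<bar>)"
  proof (rule integral_mono)
    show "integrable M (\<lambda>x. \<bar>v x * ?lap x\<bar>)" unfolding sum_distrib_left by (intro integrable_abs Bochner_Integration.integrable_sum ij1)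
    show "integrable M (\<lambda>x. 6 * (4 + real CARD('n)) / s^2 * \<bar>v x\<bar>)" by (intro integrable_mult_right integrable_abs iv)
    show "\<bar>v x * ?lap x\<bar> \<le> 6 * (4 + real CARD('n)) / s^2 * \<bar>v x\<bar>" for x
      unfolding abs_mult by (subst mult.commute) (intro mult_right_mono lapb, simp)
  qed
  finally show ?thesis by simp
qed

end

section \<open>Stability on a cell\<close>

context star_cell begin

text \<open>Weak gradient, Laplacian and projection are carried as witnesses, so that the data of a
  difference of two virtual functions are the differences of their data.\<close>

definition vem_data :: "nat \<Rightarrow> ((real,'n) vec \<Rightarrow> real) \<Rightarrow> ((real,'n) vec \<Rightarrow> (real,'n) vec) \<Rightarrow> ((real,'n) vec \<Rightarrow> real) \<Rightarrow>
    ((real,'n) vec \<Rightarrow> real) \<Rightarrow> bool" where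
  "vem_data k v G r p \<longleftrightarrow> weak_solution v G r \<and> r \<in> Polys k \<and> p \<in> Polys k \<and>
     (\<forall>\<phi>. test_function (interior D) \<phi> \<longrightarrow> (LINT x|M. v x *\<^sub>R grad \<phi> x) = - (LINT x|M. \<phi> x *\<^sub>R G x)) \<and>
     (\<forall>q\<in>Polys k. (LINT x|M. (G x - grad p x) \<bullet> grad q x) = 0) \<and> bint (\<lambda>x. v x - p x) = 0 \<and>
     (\<forall>\<alpha>. k < mdegree \<alpha> + 2 \<and> mdegree \<alpha> \<le> k \<longrightarrow> (LINT x|M. (v x - p x) * scaled_monomial D \<alpha> x) = 0)"

definition vem_bounded :: "nat \<Rightarrow> ((real,'n) vec \<Rightarrow> real) \<Rightarrow> ((real,'n) vec \<Rightarrow> (real,'n) vec) \<Rightarrow> ((real,'n) vec \<Rightarrow> real) \<Rightarrow>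
    ((real,'n) vec \<Rightarrow> real) \<Rightarrow> real \<Rightarrow> bool" where
  "vem_bounded k v G r p m \<longleftrightarrow> vem_data k v G r p \<and> 0 < m \<and> h = diameter D \<and>
     (\<forall>\<alpha>. mdegree \<alpha> + 2 \<le> k \<longrightarrow> \<bar>LINT x|M. v x * scaled_monomial D \<alpha> x\<bar> \<le> m * measure lebesgue D) \<and>
     (\<forall>i\<in>I. AE y in lebesgue. y \<in> Y i \<longrightarrow> \<bar>v (\<Phi> i y)\<bar> \<le> m)"

lemma norm_centroid_c: "h = diameter D \<Longrightarrow> dist c (centroid D) \<le> h"
  using norm_centroid_le[OF compact_D measure_D_pos, of c] ball_subset h_pos \<rho>_pos by (auto simp: dist_norm subset_iff)

lemma cube_subset:
  assumes "h = diameter D" "\<forall>i. \<bar>x $ i - centroid D $ i\<bar> \<le> h"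
  shows "dist c x \<le> (real CARD('n) + 1) * h"
proof -
  have "dist (centroid D) x = norm (x - centroid D)" by (simp add: dist_norm norm_minus_commute)
  also have "\<dots> \<le> (\<Sum>i\<in>UNIV. \<bar>(x - centroid D) $ i\<bar>)" by (rule norm_le_l1_cart)
  also have "\<dots> \<le> (\<Sum>i\<in>(UNIV::'n set). h)" using assms(2) by (intro sum_mono) auto
  also have "\<dots> = real CARD('n) * h" by simp
  finally show ?thesis using norm_centroid_c[OF assms(1)] dist_triangle[of c x "centroid D"] by (simp add: algebra_simps)
qed

text \<open>Expands \<open>q\<close> in scaled monomials with controlled coefficients. The radius
  \<open>(n + 1) * h\<close> around \<open>c\<close> suffices because the centroid has distance at
  most \<open>h\<close> from \<open>c\<close>, and the cube of half-width \<open>h\<close> around it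
  lies within \<open>n * h\<close> of the centroid.\<close>

lemma moment_expansion_bound:
  assumes v: "l2 M v" and hd: "h = diameter D"
    and q: "q \<in> Polys k" and Cc: "C > 0"
    "\<forall>q\<in>Polys k. coeff_bounded k C (q :: (real,'n) vec \<Rightarrow> real)"
    and Q: "\<And>x. dist c x \<le> (real CARD('n) + 1) * h \<Longrightarrow> \<bar>q x\<bar> \<le> Q"
    and mom: "\<And>\<alpha>. mdegree \<alpha> \<le> k \<Longrightarrow> \<bar>LINT x|M. v x * scaled_monomial D \<alpha> x\<bar> \<le> B"
  shows "\<bar>LINT x|M. v x * q x\<bar> \<le> real (card {\<alpha>::'n \<Rightarrow> nat. mdegree \<alpha> \<le> k}) * (C * Q * B)"
proof -
  obtain cf where cf: "\<And>x. q x = (\<Sum>\<alpha> | mdegree \<alpha> \<le> k. cf \<alpha> * monomial \<alpha> ((1/h) *\<^sub>R (x - centroid D)))"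
    "\<And>\<alpha>. mdegree \<alpha> \<le> k \<Longrightarrow> \<bar>cf \<alpha>\<bar> \<le> C * Q"
    using Cc(2)[unfolded coeff_bounded_def, rule_format, OF q h_pos, of "centroid D" Q] Q cube_subset[OF hd] by blast
  have qs: "q x = (\<Sum>\<alpha> | mdegree \<alpha> \<le> k. cf \<alpha> * scaled_monomial D \<alpha> x)" for x
    unfolding cf(1) scaled_monomial_def hd by simp
  have i: "integrable M (\<lambda>x. cf \<alpha> * (v x * scaled_monomial D \<alpha> x))" for \<alpha>
    by (intro integrable_mult_right l2_CS(1)[OF v] l2_continuous continuous_intros)
  have "(LINT x|M. v x * q x) = (LINT x|M. (\<Sum>\<alpha> | mdegree \<alpha> \<le> k. cf \<alpha> * (v x * scaled_monomial D \<alpha> x)))"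
    unfolding qs by (simp add: sum_distrib_left mult.left_commute)
  also have "\<dots> = (\<Sum>\<alpha> | mdegree \<alpha> \<le> k. cf \<alpha> * (LINT x|M. v x * scaled_monomial D \<alpha> x))"
    by (simp only: Bochner_Integration.integral_sum[OF i] integral_mult_right_zero)
  also have "\<bar>\<dots>\<bar> \<le> (\<Sum>\<alpha>\<in>{\<alpha>::'n \<Rightarrow> nat. mdegree \<alpha> \<le> k}. C * Q * B)"
  proof (rule order_trans[OF sum_abs sum_mono])
    fix \<alpha> :: "'n \<Rightarrow> nat" assume "\<alpha> \<in> {\<alpha>. mdegree \<alpha> \<le> k}"
    then have a: "mdegree \<alpha> \<le> k" by simp
    have "0 \<le> C * Q" using order_trans[OF abs_ge_zero cf(2)[OF a]] .
    then show "\<bar>cf \<alpha> * (LINT x|M. v x * scaled_monomial D \<alpha> x)\<bar> \<le> C * Q * B"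
      unfolding abs_mult by (intro mult_mono cf(2) mom a) auto
  qed
  finally show ?thesis by simp
qed

end

text \<open>The integral of the squared gradient of \<open>p\<close> equals that of \<open>G\<close>
  against \<open>grad p\<close>, which Green's identity turns into a boundary term and a moment of
  \<open>v\<close> against the Laplacian of \<open>p\<close>; the latter has degree at most
  \<open>k - 2\<close>, so degrees of freedom suffice. The right side is linear in
  \<open>grad p\<close> and the left side quadratic, so \<open>grad p\<close> is at most a multiple
  of \<open>m / h\<close>. The vanishing boundary mean of \<open>v - p\<close> then fixes the
  additive constant.\<close>

lemma nabla_projection_bound:
  fixes \<rho> :: real
  assumes \<rho>: "0 < \<rho>"
  shows "\<exists>C>0. \<forall>(D::(real,'n::{finite,wellorder}) vec set) c h (I::'i set) (Y::'i \<Rightarrow> 'b::euclidean_space set) P L v G r p m.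
    star_cell D c h \<rho> I Y P L \<longrightarrow> star_cell.vem_bounded D h I Y P L k v G r p m \<longrightarrow> (\<forall>x\<in>D. \<bar>p x\<bar> \<le> C * m)"
proof -
  define N where "N = real CARD('n)"
  define \<omega> where "\<omega> = measure lebesgue (ball (0::(real,'n) vec) 1)"
  have N: "N \<ge> 1" unfolding N_def by (simp add: Suc_leI)
  have \<omega>: "\<omega> > 0" using content_ball_pos[of 1 "0::(real,'n) vec"] by (simp add: \<omega>_def)
  have "0 \<le> N + 3" using N by simp
  then obtain C2 where C2: "C2 > 0" and C2b: "\<And>q (c::(real,'n) vec) z h. q \<in> Polys k \<Longrightarrow> h > 0 \<Longrightarrow> dist c z \<le> (N + 3) * h \<Longrightarrow>
     (q z)^2 * h ^ CARD('n) \<le> C2 * (LINT x:ball c (\<rho> * h)|lebesgue. (q x)^2)"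
    using Polys_bound_by_L2[OF \<rho>, of "N + 3" k, where 'n='n] by blast
  obtain Cg where Cg: "Cg > 0" and Cgb: "\<And>q (z::(real,'n) vec) h S. q \<in> Polys k \<Longrightarrow> h > 0 \<Longrightarrow> (\<forall>x\<in>cball z h. \<bar>q x\<bar> \<le> S) \<Longrightarrow> norm (grad q z) * h \<le> Cg * S"
    using Polys_grad_bound[of k, where 'n='n] by blast
  obtain Cc where Cc: "Cc > 0" and Ccb: "\<forall>q\<in>Polys (k - 2). coeff_bounded (k - 2) Cc (q :: (real,'n) vec \<Rightarrow> real)"
    using Polys_coeff_bound[of "k - 2", where 'n='n] by blast
  define A where "A = real (card {\<alpha>::'n \<Rightarrow> nat. mdegree \<alpha> \<le> k - 2})"
  have A: "A \<ge> 0" by (simp add: A_def)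
  define X1 where "X1 = A * (Cc * (N * Cg) * \<omega>) + 2 * N * \<omega> / \<rho>"
  have X1: "X1 > 0" unfolding X1_def using A Cc Cg N \<omega> \<rho> by (intro add_nonneg_pos) auto
  define X2 where "X2 = C2 * X1"
  have X2: "X2 > 0" using C2 X1 by (simp add: X2_def)
  show ?thesis
  proof (intro exI[of _ "2 * X2 + 1"] conjI allI impI ballI)
    fix D :: "(real,'n) vec set" and c h and I :: "'i set" and Y :: "'i \<Rightarrow> 'b set" and P L v G r p m
    assume "star_cell D c h \<rho> I Y P L"
    then interpret star_cell D c h \<rho> I Y P L .
    assume vb: "vem_bounded k v G r p m"
    have w: "weak_solution v G r" and p: "p \<in> Polys k" and m: "0 < m" and hd: "h = diameter D"
      and proj: "(LINT x|M. (G x - grad p x) \<bullet> grad p x) = 0" "bint (\<lambda>x. v x - p x) = 0"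
      and mom: "\<And>\<alpha>. mdegree \<alpha> + 2 \<le> k \<Longrightarrow> \<bar>LINT x|M. v x * scaled_monomial D \<alpha> x\<bar> \<le> m * measure lebesgue D"
      and bd: "\<And>i. i \<in> I \<Longrightarrow> AE y in lebesgue. y \<in> Y i \<longrightarrow> \<bar>v (\<Phi> i y)\<bar> \<le> m"
      using vb unfolding vem_bounded_def vem_data_def by auto
    note ws = weak_solutionD[OF w]
    have hN: "h ^ CARD('n) = h ^ (CARD('n) - 1) * h" by (metis One_nat_def Suc_pred power_Suc2 zero_less_card_finite)
    let ?g = "\<lambda>j x. grad p x $ j"
    have gP: "?g j \<in> Polys k" for j using Polys_mono[OF Polys_GDERIV(2)[OF p]] by simp
    have cgp: "continuous_on UNIV (grad p)" by (rule Polys_GDERIV(3)[OF p])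
    define S2 where "S2 = (LINT x|M. grad p x \<bullet> grad p x)"
    have S2: "S2 \<ge> 0" unfolding S2_def by (intro integral_nonneg_AE AE_I2) simp
    \<comment> \<open>Normalised so that \<open>K^2 * h^n\<close> is \<open>C2\<close> times the
      energy; by the L2 bound \<open>K\<close> then dominates the gradient pointwise. The radius
      \<open>(N + 3) * h\<close> leaves room for estimating second derivatives on balls of radius
      \<open>h\<close>.\<close>
    define K where "K = sqrt (C2 * S2 / h ^ CARD('n))"
    have K0: "K \<ge> 0" using S2 C2 h_pos by (simp add: K_def)
    have K2: "K^2 * h ^ CARD('n) = C2 * S2" using S2 C2 h_pos by (simp add: K_def)
    have Kb: "norm (grad p z) \<le> K" if z: "dist c z \<le> (N + 3) * h" for z
    proof -
      have "(norm (grad p z))^2 * h ^ CARD('n) = (\<Sum>j\<in>UNIV. (?g j z)^2 * h ^ CARD('n))"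
        unfolding power2_norm_eq_inner inner_vec_def by (simp add: sum_distrib_right power2_eq_square)
      also have "\<dots> \<le> (\<Sum>j\<in>UNIV. C2 * (LINT x:ball c (\<rho> * h)|lebesgue. (?g j x)^2))"
        by (intro sum_mono C2b gP h_pos z)
      also have "\<dots> = C2 * (LINT x:ball c (\<rho> * h)|lebesgue. (\<Sum>j\<in>UNIV. (?g j x)^2))"
      proof -
        have "set_integrable lebesgue (ball c (\<rho> * h)) (\<lambda>x. (?g j x)^2)" for j
          by (intro set_integrable_continuous continuous_intros continuous_on_Polys[OF gP]) auto
        then have "(LINT x:ball c (\<rho> * h)|lebesgue. (\<Sum>j\<in>UNIV. (?g j x)^2)) = (\<Sum>j\<in>UNIV. LINT x:ball c (\<rho> * h)|lebesgue. (?g j x)^2)"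
          unfolding set_lebesgue_integral_def set_integrable_def
          by (simp only: scaleR_sum_right) (rule Bochner_Integration.integral_sum, simp)
        then show ?thesis by (simp add: sum_distrib_left)
      qed
      also have "(LINT x:ball c (\<rho> * h)|lebesgue. (\<Sum>j\<in>UNIV. (?g j x)^2)) \<le> S2"
      proof -
        have ci: "continuous_on UNIV (\<lambda>x. grad p x \<bullet> grad p x)" by (intro continuous_intros cgp)
        have "(LINT x:ball c (\<rho> * h)|lebesgue. (\<Sum>j\<in>UNIV. (?g j x)^2)) = (LINT x:ball c (\<rho> * h)|lebesgue. grad p x \<bullet> grad p x)"
          by (simp add: inner_vec_def power2_eq_square)
        also have "\<dots> \<le> (LINT x:interior D|lebesgue. grad p x \<bullet> grad p x)"
          unfolding set_lebesgue_integral_def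
        proof (rule integral_mono)
          show "integrable lebesgue (\<lambda>x. indicat_real (ball c (\<rho> * h)) x *\<^sub>R (grad p x \<bullet> grad p x))"
            using set_integrable_continuous[OF ci, of "ball c (\<rho> * h)"] by (simp add: set_integrable_def)
          show "integrable lebesgue (\<lambda>x. indicat_real (interior D) x *\<^sub>R (grad p x \<bullet> grad p x))"
            using integrable_M_continuous[OF ci] by (simp only: integrable_M set_integrable_def)
          show "indicat_real (ball c (\<rho> * h)) x *\<^sub>R (grad p x \<bullet> grad p x) \<le> indicat_real (interior D) x *\<^sub>R (grad p x \<bullet> grad p x)" for x
            using ball_interior by (auto simp: indicator_def)
        qed
        finally show ?thesis by (simp add: S2_def integral_M)
      qed
      finally have "(norm (grad p z))^2 * h ^ CARD('n) \<le> K^2 * h ^ CARD('n)" using C2 by (simp add: K2)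
      then have "(norm (grad p z))^2 \<le> K^2" using h_pos by simp
      then show ?thesis using K0 by (rule power2_le_imp_le)
    qed
    have Lb: "\<bar>laplacian p z\<bar> \<le> N * Cg * (K / h)" if z: "dist c z \<le> (N + 1) * h" for z
    proof -
      have "\<bar>grad (?g j) z $ j\<bar> \<le> Cg * (K / h)" for j
      proof -
        have "norm (grad (?g j) z) * h \<le> Cg * K"
        proof (rule Cgb[OF gP h_pos], rule ballI)
          fix x assume "x \<in> cball z h"
          then have "dist c x \<le> (N + 1) * h + h" using dist_triangle[of c x z] z by simp
          also have "\<dots> \<le> (N + 3) * h" using h_pos by (simp add: algebra_simps)
          finally have "norm (grad p x) \<le> K" by (rule Kb)
          then show "\<bar>?g j x\<bar> \<le> K" using component_le_norm_cart[of "grad p x" j] by linarith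
        qed
        then have "norm (grad (?g j) z) \<le> Cg * (K / h)" using h_pos by (simp add: field_simps)
        then show ?thesis using component_le_norm_cart[of "grad (?g j) z" j] by linarith
      qed
      then have "\<bar>laplacian p z\<bar> \<le> (\<Sum>j\<in>(UNIV::'n set). Cg * (K / h))"
        unfolding laplacian_def by (intro order_trans[OF sum_abs] sum_mono)
      then show ?thesis by (simp add: N_def)
    qed
    have vl: "\<bar>LINT x|M. v x * laplacian p x\<bar> \<le> A * (Cc * (N * Cg) * \<omega>) * (K * m * h ^ (CARD('n) - 1))"
    proof (cases "k \<le> 1")
      case True
      then have "laplacian p = (\<lambda>x. 0)" using Polys_laplacian(2)[OF p] by simp
      then show ?thesis using A Cc N Cg \<omega> K0 m h_pos by simp
    next
      case False
      have "\<bar>LINT x|M. v x * laplacian p x\<bar> \<le> A * (Cc * (N * Cg * (K / h)) * (m * measure lebesgue D))"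
        unfolding A_def
      proof (rule moment_expansion_bound[OF ws(1) hd Polys_laplacian(1)[OF p] Cc Ccb])
        fix x assume "dist c x \<le> (real CARD('n) + 1) * h"
        then show "\<bar>laplacian p x\<bar> \<le> N * Cg * (K / h)" by (intro Lb) (simp add: N_def)
      next
        fix \<alpha> :: "'n \<Rightarrow> nat" assume "mdegree \<alpha> \<le> k - 2"
        then show "\<bar>LINT x|M. v x * scaled_monomial D \<alpha> x\<bar> \<le> m * measure lebesgue D" using False by (intro mom) simp
      qed
      also have "\<dots> \<le> A * (Cc * (N * Cg * (K / h)) * (m * (\<omega> * h ^ CARD('n))))"
        using measure_D_le A Cc N Cg K0 m h_pos unfolding \<omega>_def by (intro mult_left_mono mult_nonneg_nonneg) auto
      also have "\<dots> = A * (Cc * (N * Cg) * \<omega>) * (K * m * h ^ (CARD('n) - 1))"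
        unfolding hN using h_pos by simp
      finally show ?thesis .
    qed
    have "S2 = (LINT x|M. G x \<bullet> grad p x)"
    proof -
      have "(LINT x|M. G x \<bullet> grad p x) - S2 = (LINT x|M. (G x - grad p x) \<bullet> grad p x)"
        unfolding S2_def inner_diff_left
        by (rule Bochner_Integration.integral_diff[symmetric]) (rule integrable_M_inner[OF ws(3,4) cgp], intro integrable_M_continuous continuous_intros cgp)
      then show ?thesis using proj by simp
    qed
    also have "\<dots> \<le> \<bar>LINT x|M. v x * laplacian p x\<bar> + 2 * m * K * bint (\<lambda>_. 1)"
    proof -
      have "norm (grad p x) \<le> K" if "x \<in> D" for x
      proof (rule Kb)
        have "dist c x \<le> 1 * h" using D_subset that by auto
        also have "\<dots> \<le> (N + 3) * h" using N h_pos by (intro mult_right_mono) auto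
        finally show "dist c x \<le> (N + 3) * h" .
      qed
      from weak_green_bound[OF w p this m bd] show ?thesis by linarith
    qed
    also have "\<dots> \<le> X1 * (K * m * h ^ (CARD('n) - 1))"
    proof -
      have "bint (\<lambda>_. 1) \<le> N * \<omega> * h ^ (CARD('n) - 1) / \<rho>"
        using perimeter_le \<rho> by (simp add: N_def \<omega>_def field_simps)
      then have "2 * m * K * bint (\<lambda>_. 1) \<le> 2 * m * K * (N * \<omega> * h ^ (CARD('n) - 1) / \<rho>)"
        using m K0 by (intro mult_left_mono) auto
      also have "\<dots> = 2 * N * \<omega> / \<rho> * (K * m * h ^ (CARD('n) - 1))" by simp
      finally show ?thesis using vl unfolding X1_def distrib_right by linarith
    qed
    finally have S2le: "S2 \<le> X1 * (K * m * h ^ (CARD('n) - 1))" .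
    \<comment> \<open>For positive \<open>K\<close> the quadratic bound is divided by
      \<open>K * h^(n-1)\<close>.\<close>
    have Kh: "K * h \<le> X2 * m"
    proof (cases "K = 0")
      case False
      then have K: "K > 0" using K0 by simp
      have "K^2 * h ^ CARD('n) \<le> C2 * (X1 * (K * m * h ^ (CARD('n) - 1)))"
        unfolding K2 using S2le C2 by (intro mult_left_mono) auto
      then have "(K * h ^ (CARD('n) - 1)) * (K * h) \<le> (K * h ^ (CARD('n) - 1)) * (X2 * m)"
        unfolding hN X2_def by (simp add: power2_eq_square mult_ac)
      then show ?thesis using K h_pos by simp
    qed (use X2 m in simp)
    fix z assume z: "z \<in> D"
    have cz: "z \<in> cball c h" using D_subset z by blast
    have diff: "\<bar>p z - p x\<bar> \<le> 2 * X2 * m" if x: "x \<in> cball c h" for x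
    proof -
      have "norm (p z - p x) \<le> K * norm (z - x)"
      proof (rule differentiable_bound[OF convex_cball, where f' = "\<lambda>x b. b \<bullet> grad p x"])
        fix y assume y: "y \<in> cball c h"
        show "(p has_derivative (\<lambda>b. b \<bullet> grad p y)) (at y within cball c h)"
          using Polys_GDERIV(1)[OF p, of y] unfolding gderiv_def by (rule has_derivative_at_withinI)
        have "dist c y \<le> 1 * h" using y by auto
        also have "\<dots> \<le> (N + 3) * h" using N h_pos by (intro mult_right_mono) auto
        finally have "norm (grad p y) \<le> K" by (rule Kb)
        then show "onorm (\<lambda>b. b \<bullet> grad p y) \<le> K"
          by (intro onorm_le) (metis Cauchy_Schwarz_ineq2 mult.commute mult_right_mono norm_ge_zero order_trans real_norm_def)
      qed (use cz x in auto)
      also have "\<dots> \<le> K * (2 * h)"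
      proof (rule mult_left_mono[OF _ K0])
        have "dist z x \<le> dist c z + dist c x" using dist_triangle[of z x c] by (simp add: dist_commute)
        then show "norm (z - x) \<le> 2 * h" using cz x by (simp add: dist_norm)
      qed
      also have "\<dots> \<le> 2 * X2 * m" using Kh by simp
      finally show ?thesis by simp
    qed
    have fr: "x \<in> cball c h" if "x \<in> frontier D" for x using that D_subset frontier_subset by blast
    have cvp: "continuous_on (frontier D) (\<lambda>x. v x - p x)" by (intro continuous_intros ws continuous_on_Polys[OF p])
    have konst: "bint (\<lambda>_. a) = a * bint (\<lambda>_. 1)" for a
    proof -
      have "(LINT y:Y i|lebesgue. a) = a * (LINT y:Y i|lebesgue. 1)" for i
        using set_integral_mult_right[of lebesgue "Y i" a "\<lambda>_. 1"] by simp
      then show ?thesis by (simp add: bint_def sum_distrib_left)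
    qed
    \<comment> \<open>For a larger value, the small oscillation of \<open>p\<close> would make
      \<open>v - p\<close> negative almost everywhere on the boundary, contrary to its vanishing
      mean.\<close>
    have "p z \<le> 2 * X2 * m + m"
    proof -
      have "bint (\<lambda>x. v x - p x) \<le> bint (\<lambda>_. m - p z + 2 * X2 * m)"
      proof (rule bint_mono_AE[OF cvp])
        fix i assume i: "i \<in> I"
        from bd[OF i] show "AE y in lebesgue. y \<in> Y i \<longrightarrow> v (\<Phi> i y) - p (\<Phi> i y) \<le> m - p z + 2 * X2 * m"
        proof eventually_elim
          case (elim y)
          then show ?case using diff[OF fr[OF \<Phi>_in_frontier[OF i, of y]]] by auto
        qed
      qed auto
      then have "0 \<le> (m - p z + 2 * X2 * m) * bint (\<lambda>_. 1)" unfolding proj konst[of "m - p z + 2 * X2 * m"] .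
      then have "0 \<le> m - p z + 2 * X2 * m" using bint_1_pos by (simp add: zero_le_mult_iff)
      then show ?thesis by simp
    qed
    moreover have "- (2 * X2 * m + m) \<le> p z"
    proof -
      have "bint (\<lambda>_. - m - p z - 2 * X2 * m) \<le> bint (\<lambda>x. v x - p x)"
      proof (rule bint_mono_AE[OF _ cvp])
        fix i assume i: "i \<in> I"
        from bd[OF i] show "AE y in lebesgue. y \<in> Y i \<longrightarrow> - m - p z - 2 * X2 * m \<le> v (\<Phi> i y) - p (\<Phi> i y)"
        proof eventually_elim
          case (elim y)
          then show ?case using diff[OF fr[OF \<Phi>_in_frontier[OF i, of y]]] by auto
        qed
      qed auto
      then have "(- m - p z - 2 * X2 * m) * bint (\<lambda>_. 1) \<le> 0" unfolding proj konst[of "- m - p z - 2 * X2 * m"] .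
      then have "- m - p z - 2 * X2 * m \<le> 0" using bint_1_pos by (simp add: mult_le_0_iff)
      then show ?thesis by simp
    qed
    ultimately show "\<bar>p z\<bar> \<le> (2 * X2 + 1) * m" by (simp add: abs_le_iff algebra_simps)
  qed (use X2 in simp)
qed

text \<open>Let \<open>W = R * h^2\<close> measure the Laplacian. Bumps bound \<open>W\<close> by a
  multiple of the scaled L1 norm of \<open>v\<close>; this norm is at most that of the truncation
  plus a multiple of \<open>m\<close>; and the energy inequality bounds the squared L2 norm of the
  truncation by a multiple of \<open>m * W\<close>. So \<open>W\<close> is at most a multiple of
  \<open>sqrt (m * W) + m\<close>, which forces a multiple of \<open>m\<close> whatever the
  constants are.\<close>

theorem vem_stability:
  fixes \<rho> :: real
  assumes \<rho>: "0 < \<rho>"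
  shows "\<exists>C>0. \<forall>(D::(real,'n::{finite,wellorder}) vec set) c h (I::'i set) (Y::'i \<Rightarrow> 'b::euclidean_space set) P L v G r p m.
    star_cell D c h \<rho> I Y P L \<longrightarrow> star_cell.vem_bounded D h I Y P L k v G r p m \<longrightarrow>
    (AE x in lebesgue_on (interior D). \<bar>v x\<bar> \<le> C * m)"
proof -
  define N where "N = real CARD('n)"
  define \<omega> where "\<omega> = measure lebesgue (ball (0::(real,'n) vec) 1)"
  define A where "A = real (card {\<alpha>::'n \<Rightarrow> nat. mdegree \<alpha> \<le> k})"
  have N: "N \<ge> 1" unfolding N_def by (simp add: Suc_leI)
  have \<omega>: "\<omega> > 0" using content_ball_pos[of 1 "0::(real,'n) vec"] by (simp add: \<omega>_def)
  have "0 \<le> N + 2" using N by simp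
  then obtain Cb where Cb: "Cb > 0" and Cbb: "\<And>q (c::(real,'n) vec) z h B. q \<in> Polys k \<Longrightarrow> h > 0 \<Longrightarrow> dist c z \<le> (N + 2) * h \<Longrightarrow>
     (\<And>p s. cball p s \<subseteq> ball c (\<rho> * h) \<Longrightarrow> \<rho> * h / 8 \<le> s \<Longrightarrow> \<bar>LINT x|lebesgue. q x * bump3 ((1/s) *\<^sub>R (x - p))\<bar> \<le> B) \<Longrightarrow>
     \<bar>q z\<bar> * h ^ CARD('n) \<le> Cb * B"
    using Polys_bound_by_bumps[OF \<rho>, of "N + 2" k, where 'n='n] by meson
  obtain Cc where Cc: "Cc > 0" and Ccb: "\<forall>q\<in>Polys k. coeff_bounded k Cc (q :: (real,'n) vec \<Rightarrow> real)"
    using Polys_coeff_bound[of k, where 'n='n] by blast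
  obtain X where X: "X > 0" and Xb: "\<And>(D::(real,'n) vec set) c h (I::'i set) (Y::'i \<Rightarrow> 'b set) P L v G r p m.
    star_cell D c h \<rho> I Y P L \<Longrightarrow> star_cell.vem_bounded D h I Y P L k v G r p m \<Longrightarrow> (\<forall>x\<in>D. \<bar>p x\<bar> \<le> X * m)"
    using nabla_projection_bound[OF \<rho>, of k, where 'n='n and 'i='i and 'b='b] by blast
  define B1 where "B1 = Cb * (6 * (4 + N) * 64 / \<rho>^2)"
  have B1: "B1 > 0" using Cb N \<rho> by (simp add: B1_def)
  define Z where "Z = A * Cc * (1 + X) * \<omega> + 2 * \<omega>"
  have Z: "Z > 0" using \<omega> Cc X by (auto simp: Z_def A_def intro!: add_nonneg_pos)
  show ?thesis
  proof (intro exI[of _ "1 + (B1^2 * (Z * \<omega>) + 4 * B1 * \<omega>)"] conjI allI impI)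
    fix D :: "(real,'n) vec set" and c h and I :: "'i set" and Y :: "'i \<Rightarrow> 'b set" and P L v G r p m
    assume sc: "star_cell D c h \<rho> I Y P L"
    then interpret star_cell D c h \<rho> I Y P L .
    assume vb: "vem_bounded k v G r p m"
    have w: "weak_solution v G r" and r: "r \<in> Polys k" and p: "p \<in> Polys k" and m: "0 < m" and hd: "h = diameter D"
      and ibp: "\<And>\<phi>. test_function (interior D) \<phi> \<Longrightarrow> (LINT x|M. v x *\<^sub>R grad \<phi> x) = - (LINT x|M. \<phi> x *\<^sub>R G x)"
      and en: "\<And>\<alpha>. k < mdegree \<alpha> + 2 \<Longrightarrow> mdegree \<alpha> \<le> k \<Longrightarrow> (LINT x|M. (v x - p x) * scaled_monomial D \<alpha> x) = 0"
      and mom: "\<And>\<alpha>. mdegree \<alpha> + 2 \<le> k \<Longrightarrow> \<bar>LINT x|M. v x * scaled_monomial D \<alpha> x\<bar> \<le> m * measure lebesgue D"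
      and bd: "\<And>i. i \<in> I \<Longrightarrow> AE y in lebesgue. y \<in> Y i \<longrightarrow> \<bar>v (\<Phi> i y)\<bar> \<le> m"
      using vb unfolding vem_bounded_def vem_data_def by auto
    note v2 = weak_solutionD(1)[OF w]
    have pX: "\<bar>p x\<bar> \<le> X * m" if "x \<in> D" for x using Xb[OF sc vb] that by blast
    have cont: "continuous_on UNIV p" "continuous_on UNIV r" using p r by (auto intro: continuous_on_Polys)
    have hN: "h ^ CARD('n) > 0" using h_pos by simp
    have V: "measure lebesgue D \<le> \<omega> * h ^ CARD('n)" using measure_D_le by (simp add: \<omega>_def)
    have const: "(LINT x|M. a) \<le> a * (\<omega> * h ^ CARD('n))" if "a \<ge> 0" for a :: real
    proof -
      have "measure lebesgue (interior D) \<le> measure lebesgue D"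
        using compact_D interior_subset by (intro measure_mono_fmeasurable) (auto intro: lmeasurable_compact)
      then have "measure lebesgue (interior D) \<le> \<omega> * h ^ CARD('n)" using V by linarith
      then show ?thesis using that unfolding integral_M set_lebesgue_integral_def
        by (simp add: mult.commute[of _ a] mult_left_mono)
    qed
    have intD: "x \<in> D" if "x \<in> space M" for x using that interior_subset by (auto simp: space_M)
    \<comment> \<open>Moments up to order \<open>k - 2\<close> are bounded by hypothesis. In the two
      remaining orders the enhancement condition replaces \<open>v\<close> by its projection, for
      which a pointwise bound is already known.\<close>
    have "\<bar>LINT x|M. v x * scaled_monomial D \<alpha> x\<bar> \<le> (1 + X) * m * (\<omega> * h ^ CARD('n))" if \<alpha>: "mdegree \<alpha> \<le> k" for \<alpha>
    proof (cases "mdegree \<alpha> + 2 \<le> k")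
      case True
      have "m * measure lebesgue D \<le> ((1 + X) * m) * (\<omega> * h ^ CARD('n))" using V m X by (intro mult_mono) auto
      with mom[OF True] show ?thesis by linarith
    next
      case False
      have i: "integrable M (\<lambda>x. v x * scaled_monomial D \<alpha> x)" "integrable M (\<lambda>x. p x * scaled_monomial D \<alpha> x)"
        by (intro l2_CS(1)[OF v2] l2_continuous continuous_intros) (intro integrable_M_continuous continuous_intros cont)
      have "(LINT x|M. v x * scaled_monomial D \<alpha> x) - (LINT x|M. p x * scaled_monomial D \<alpha> x) = (LINT x|M. (v x - p x) * scaled_monomial D \<alpha> x)"
        unfolding left_diff_distrib by (rule Bochner_Integration.integral_diff[symmetric, OF i])
      then have "(LINT x|M. v x * scaled_monomial D \<alpha> x) = (LINT x|M. p x * scaled_monomial D \<alpha> x)"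
        using en[of \<alpha>] False \<alpha> by simp
      also have "\<bar>\<dots>\<bar> \<le> (LINT x|M. \<bar>p x * scaled_monomial D \<alpha> x\<bar>)" by (rule integral_abs_bound)
      also have "\<dots> \<le> (LINT x|M. X * m)"
      proof (rule integral_mono)
        fix x assume x: "x \<in> space M"
        have "\<bar>scaled_monomial D \<alpha> x\<bar> \<le> 1"
          using abs_scaled_monomial_le[OF compact_D measure_D_pos intD[OF x]] h_pos hd by simp
        then have "\<bar>p x\<bar> * \<bar>scaled_monomial D \<alpha> x\<bar> \<le> (X * m) * 1"
          using pX[OF intD[OF x]] by (intro mult_mono) auto
        then show "\<bar>p x * scaled_monomial D \<alpha> x\<bar> \<le> X * m" by (simp add: abs_mult)
      qed (use i in \<open>auto intro: integrable_M_continuous\<close>)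
      also have "\<dots> \<le> X * m * (\<omega> * h ^ CARD('n))" using X m by (intro const) auto
      also have "\<dots> \<le> (1 + X) * m * (\<omega> * h ^ CARD('n))" using m \<omega> hN X by (intro mult_right_mono) auto
      finally show ?thesis .
    qed
    note mexp = moment_expansion_bound[OF v2 hd _ Cc Ccb _ this]
    define V1 where "V1 = (LINT x|M. \<bar>v x\<bar>)"
    have V10: "V1 \<ge> 0" unfolding V1_def by (rule Bochner_Integration.integral_nonneg) simp
    define R where "R = B1 * V1 / (h^2 * h ^ CARD('n))"
    have R0: "R \<ge> 0" using B1 V10 hN by (simp add: R_def)
    \<comment> \<open>The bound has to hold beyond the cell, because expanding \<open>r\<close> in
      scaled monomials evaluates it on a cube around the centroid.\<close>
    have Rb: "\<bar>r z\<bar> \<le> R" if z: "dist c z \<le> (N + 2) * h" for z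
    proof -
      have "\<bar>r z\<bar> * h ^ CARD('n) \<le> Cb * (6 * (4 + N) * 64 / (\<rho> * h)^2 * V1)"
      proof (rule Cbb[OF r h_pos z])
        fix p s assume ps: "cball p s \<subseteq> ball c (\<rho> * h)" "\<rho> * h / 8 \<le> s"
        have s: "s > 0" using ps(2) h_pos \<rho> by (smt (verit) mult_pos_pos divide_pos_pos)
        have "cball p s \<subseteq> interior D" using ps(1) ball_interior by blast
        from bump_weak_bound[OF w ibp this s]
        have "\<bar>LINT x|lebesgue. r x * bump3 ((1 / s) *\<^sub>R (x - p))\<bar> \<le> 6 * (4 + N) / s^2 * V1" by (simp add: N_def V1_def)
        also have "\<dots> \<le> 6 * (4 + N) / (\<rho> * h / 8)^2 * V1"
          using ps(2) s h_pos \<rho> N V10 by (intro mult_right_mono divide_left_mono power_mono mult_pos_pos zero_less_power) auto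
        also have "\<dots> = 6 * (4 + N) * 64 / (\<rho> * h)^2 * V1" by (simp add: power_divide)
        finally show "\<bar>LINT x|lebesgue. r x * bump3 ((1 / s) *\<^sub>R (x - p))\<bar> \<le> 6 * (4 + N) * 64 / (\<rho> * h)^2 * V1" .
      qed
      also have "\<dots> = R * h ^ CARD('n)" using hN by (simp add: R_def B1_def power_mult_distrib)
      finally show ?thesis using hN by simp
    qed
    have RD: "\<bar>r x\<bar> \<le> R" if "x \<in> D" for x
    proof (rule Rb)
      have "dist c x \<le> 1 * h" using D_subset that by auto
      also have "\<dots> \<le> (N + 2) * h" using N h_pos by (intro mult_right_mono) auto
      finally show "dist c x \<le> (N + 2) * h" .
    qed
    let ?T = "trunc m"
    note T = trunc_props[OF m]
    have en: "l2 M (\<lambda>x. ?T (v x))" "(LINT x|M. (?T (v x))^2) \<le> - (h^2 * (LINT x|M. r x * ?T (v x)))"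
    proof -
      have b: "AE y in lebesgue. y \<in> Y i \<longrightarrow> ?T (v (\<Phi> i y)) = 0" if i: "i \<in> I" for i
        using bd[OF i] by eventually_elim (simp add: T(4))
      show "l2 M (\<lambda>x. ?T (v x))" "(LINT x|M. (?T (v x))^2) \<le> - (h^2 * (LINT x|M. r x * ?T (v x)))"
        using weak_energy[OF w trunc_DERIV[OF m] T(1,2,3) b] by auto
    qed
    define d where "d = \<omega> * h ^ CARD('n)"
    have d: "d > 0" using \<omega> hN by (simp add: d_def)
    have l2r: "l2 M r" by (rule l2_continuous[OF cont(2)])
    have ir: "integrable M (\<lambda>x. r x * v x)" "integrable M (\<lambda>x. r x * ?T (v x))"
      by (rule l2_CS(1)[OF l2r v2], rule l2_CS(1)[OF l2r en(1)])
    \<comment> \<open>The moments of the truncated function are unknown. It is split into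
      \<open>v\<close>, whose integral against the polynomial \<open>r\<close> is a combination of
      known moments, and a remainder of size at most \<open>2 * m\<close>.\<close>
    have "- (LINT x|M. r x * ?T (v x)) = (LINT x|M. r x * (v x - ?T (v x))) - (LINT x|M. r x * v x)"
      unfolding right_diff_distrib by (subst Bochner_Integration.integral_diff[OF ir]) simp
    also have "\<dots> \<le> 2 * m * R * d + A * (Cc * R * ((1 + X) * m * d))"
    proof -
      have "(LINT x|M. r x * (v x - ?T (v x))) \<le> (LINT x|M. R * (2 * m))"
      proof (rule integral_mono)
        fix x assume x: "x \<in> space M"
        have "\<bar>r x * (v x - ?T (v x))\<bar> \<le> R * (2 * m)" unfolding abs_mult
          by (intro mult_mono RD intD x T(5)) (use R0 in auto)
        then show "r x * (v x - ?T (v x)) \<le> R * (2 * m)" by linarith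
      next
        show "integrable M (\<lambda>x. r x * (v x - ?T (v x)))" unfolding right_diff_distrib by (rule Bochner_Integration.integrable_diff[OF ir])
      qed (intro integrable_M_continuous continuous_intros)
      also have "\<dots> \<le> R * (2 * m) * d" unfolding d_def using R0 m by (intro const) auto
      finally have 1: "(LINT x|M. r x * (v x - ?T (v x))) \<le> 2 * m * R * d" by (simp add: mult_ac)
      have "\<bar>LINT x|M. v x * r x\<bar> \<le> A * (Cc * R * ((1 + X) * m * d))" unfolding A_def d_def
      proof (rule mexp[OF r])
        fix x assume "dist c x \<le> (real CARD('n) + 1) * h"
        also have "\<dots> \<le> (N + 2) * h" using h_pos by (intro mult_right_mono) (auto simp: N_def)
        finally show "\<bar>r x\<bar> \<le> R" by (rule Rb)
      qed
      with 1 show ?thesis by (simp add: mult.commute)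
    qed
    also have "\<dots> = Z * m * R * h ^ CARD('n)" by (simp add: Z_def d_def algebra_simps)
    finally have "h^2 * (- (LINT x|M. r x * ?T (v x))) \<le> h^2 * (Z * m * R * h ^ CARD('n))"
      by (rule mult_left_mono) simp
    with en(2) have X2: "(LINT x|M. (?T (v x))^2) \<le> Z * m * (R * h^2) * h ^ CARD('n)" by (simp add: mult_ac)
    define W where "W = R * h^2"
    have W0: "W \<ge> 0" using R0 by (simp add: W_def)
    have "V1 \<le> (LINT x|M. \<bar>?T (v x)\<bar> + 2 * m)" unfolding V1_def
    proof (rule integral_mono)
      show "\<bar>v x\<bar> \<le> \<bar>?T (v x)\<bar> + 2 * m" for x using T(5)[of "v x"] by linarith
    qed (intro Bochner_Integration.integrable_add integrable_abs integrable_M_abs v2 en(1) integrable_M_continuous continuous_intros)+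
    also have "\<dots> = (LINT x|M. \<bar>?T (v x)\<bar>) + (LINT x|M. 2 * m)"
      by (intro Bochner_Integration.integral_add integrable_abs integrable_M_abs en(1) integrable_M_continuous continuous_intros)
    also have "\<dots> \<le> h ^ CARD('n) * sqrt (Z * \<omega> * (m * W)) + 2 * m * d"
    proof -
      have "(LINT x|M. \<bar>?T (v x)\<bar>) = (LINT x|M. 1 * \<bar>?T (v x)\<bar>)" by simp
      also have "\<bar>\<dots>\<bar> \<le> sqrt (LINT x|M. 1^2) * sqrt (LINT x|M. \<bar>?T (v x)\<bar>^2)"
        by (rule l2_CS(2)[OF l2_continuous[OF continuous_on_const] l2_abs(1)[OF en(1)], unfolded l2n_def])
      also have "\<dots> \<le> sqrt d * sqrt (Z * m * (R * h^2) * h ^ CARD('n))"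
        using const[of 1] X2 d by (intro mult_mono) (auto simp: d_def)
      also have "\<dots> = sqrt ((h ^ CARD('n))^2 * (Z * \<omega> * (m * W)))" by (simp add: real_sqrt_mult[symmetric] d_def W_def power2_eq_square mult_ac)
      also have "\<dots> = h ^ CARD('n) * sqrt (Z * \<omega> * (m * W))" using hN by (simp add: real_sqrt_mult)
      finally have "(LINT x|M. \<bar>?T (v x)\<bar>) \<le> h ^ CARD('n) * sqrt (Z * \<omega> * (m * W))" by linarith
      moreover have "(LINT x|M. 2 * m) \<le> 2 * m * d" unfolding d_def using m by (intro const) auto
      ultimately show ?thesis by linarith
    qed
    finally have "V1 / h ^ CARD('n) \<le> sqrt (Z * \<omega> * (m * W)) + 2 * m * \<omega>"
      using hN by (simp add: d_def field_simps)
    then have "B1 * (V1 / h ^ CARD('n)) \<le> B1 * (sqrt (Z * \<omega> * (m * W)) + 2 * m * \<omega>)" using B1 by (intro mult_left_mono) auto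
    moreover have "W = B1 * (V1 / h ^ CARD('n))" using h_pos by (simp add: W_def R_def)
    ultimately have "W \<le> B1 * (sqrt (Z * \<omega> * (m * W)) + 2 * m * \<omega>)" by (simp only:)
    \<comment> \<open>The arithmetic-geometric mean inequality leaves half of \<open>W\<close> on
      the right, which the left side absorbs.\<close>
    also have "B1 * sqrt (Z * \<omega> * (m * W)) = sqrt ((B1^2 * (Z * \<omega>) * m) * W)"
      using B1 by (simp add: real_sqrt_mult)
    then have "B1 * (sqrt (Z * \<omega> * (m * W)) + 2 * m * \<omega>) \<le> (B1^2 * (Z * \<omega>) * m + W) / 2 + 2 * B1 * m * \<omega>"
      using arith_geo_mean_sqrt[of "B1^2 * (Z * \<omega>) * m" W] Z \<omega> m W0 by (simp add: distrib_left)
    finally have "W \<le> (B1^2 * (Z * \<omega>) + 4 * B1 * \<omega>) * m" by (simp add: field_simps)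
    moreover have "AE x in M. \<bar>v x\<bar> \<le> m + R * h^2" by (rule max_principle[OF w RD R0 bd])
    ultimately show "AE x in lebesgue_on (interior D). \<bar>v x\<bar> \<le> (1 + (B1^2 * (Z * \<omega>) + 4 * B1 * \<omega>)) * m"
      unfolding W_def distrib_right M_def by (auto elim!: eventually_mono)
  qed (use B1 Z \<omega> in \<open>simp add: add_pos_pos\<close>)
qed

context star_cell begin

lemma enhanced_vem_data:
  assumes "enhanced_vem k D bint fc v"
  obtains G r p where "vem_data k v G r p"
proof -
  from assms obtain G r p where *: "continuous_on (frontier D) v" "H1 (interior D) v G" "boundary_values_are_trace D bint v G"
    "r \<in> Polys k" "weak_laplacian (interior D) G r" "is_nabla_projection k D bint v G p"
    "\<And>\<alpha>. k < mdegree \<alpha> + 2 \<and> mdegree \<alpha> \<le> k \<longrightarrow> (LINT x:D|lebesgue. (v x - p x) * scaled_monomial D \<alpha> x) = 0"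
    unfolding enhanced_vem_def by blast
  have m: "v \<in> borel_measurable M" "G \<in> borel_measurable M" "integrable M (\<lambda>x. (v x)^2)" "integrable M (\<lambda>x. (norm (G x))^2)"
    using *(2) unfolding H1_def L2_def measurable_M integrable_M by (auto simp: real_norm_def)
  have "l2 M v" "l2 M (\<lambda>x. norm (G x))" using m unfolding l2_def by auto
  moreover have "continuous_on UNIV r" by (rule continuous_on_Polys[OF *(4)])
  ultimately have "weak_solution v G r"
    using *(1,3,5) m(2) unfolding weak_solution_def smooth_approx_def boundary_values_are_trace_def weak_laplacian_def integral_M by auto
  moreover have "p \<in> Polys k" "\<forall>q\<in>Polys k. (LINT x|M. (G x - grad p x) \<bullet> grad q x) = 0" "bint (\<lambda>x. v x - p x) = 0"
    using *(6) unfolding is_nabla_projection_def integral_M by auto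
  moreover have "\<forall>\<phi>. test_function (interior D) \<phi> \<longrightarrow> (LINT x|M. v x *\<^sub>R grad \<phi> x) = - (LINT x|M. \<phi> x *\<^sub>R G x)"
    using *(2) unfolding H1_def integral_M by blast
  ultimately have "vem_data k v G r p" using *(4,7) unfolding vem_data_def integral_D_eq_M by blast
  then show ?thesis by (rule that)
qed

lemma bint_diff:
  assumes f: "continuous_on (frontier D) f" and g: "continuous_on (frontier D) g"
  shows "bint (\<lambda>x. f x - g x) = bint f - bint g"
  unfolding bint_def sum_subtractf[symmetric]
  by (intro sum.cong refl set_integral_diff(2) integrable_Y_continuous f g)

lemma vem_data_diff:
  assumes "vem_data k v G r p" "vem_data k v' G' r' p'"
  shows "vem_data k (\<lambda>x. v x - v' x) (\<lambda>x. G x - G' x) (\<lambda>x. r x - r' x) (\<lambda>x. p x - p' x)"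
proof -
  have w: "weak_solution v G r" "weak_solution v' G' r'" using assms unfolding vem_data_def by auto
  have l: "l2 M v" "l2 M v'" "continuous_on (frontier D) v" "continuous_on (frontier D) v'" "G \<in> borel_measurable M" "G' \<in> borel_measurable M"
    "l2 M (\<lambda>x. norm (G x))" "l2 M (\<lambda>x. norm (G' x))"
    using weak_solutionD[OF w(1)] weak_solutionD[OF w(2)] by auto
  have p: "p \<in> Polys k" "p' \<in> Polys k" using assms unfolding vem_data_def by auto
  note c = continuous_on_Polys[OF p(1)] continuous_on_Polys[OF p(2)]
  have gp: "grad (\<lambda>x. p x - p' x) x = grad p x - grad p' x" for x using C1_diff[OF Polys_C1[OF p(1)] Polys_C1[OF p(2)]] by auto
  have 1: "(LINT x|M. (v x - v' x) *\<^sub>R grad \<phi> x) = - (LINT x|M. \<phi> x *\<^sub>R (G x - G' x))" if t: "test_function (interior D) \<phi>" for \<phi>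
  proof -
    have \<phi>: "continuous_on UNIV \<phi>" "continuous_on UNIV (grad \<phi>)" using t unfolding test_function_def by (auto intro: C1_continuous C1_continuous_grad)
    have i: "integrable M (\<lambda>x. f x *\<^sub>R F x)" if "l2 M f" "F \<in> borel_measurable M" "l2 M (\<lambda>x. norm (F x))" for f and F :: "(real,'n) vec \<Rightarrow> (real,'n) vec"
      by (rule Bochner_Integration.integrable_bound[OF l2_CS(1)[OF that(1,3)]])
         (use that(2) l2_measurable[OF that(1)] in \<open>auto simp: abs_mult\<close>)
    have gm: "grad \<phi> \<in> borel_measurable M" by (intro measurable_M_continuous \<phi>)
    have ln: "l2 M (\<lambda>x. norm (grad \<phi> x))" by (intro l2_continuous continuous_intros \<phi>)
    have "(LINT x|M. v x *\<^sub>R grad \<phi> x) = - (LINT x|M. \<phi> x *\<^sub>R G x)" "(LINT x|M. v' x *\<^sub>R grad \<phi> x) = - (LINT x|M. \<phi> x *\<^sub>R G' x)"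
      using assms t unfolding vem_data_def by auto
    with i[OF l(1) gm ln] i[OF l(2) gm ln] i[OF l2_continuous[OF \<phi>(1)] l(5,7)] i[OF l2_continuous[OF \<phi>(1)] l(6,8)] show ?thesis
      by (simp add: scaleR_diff_left scaleR_diff_right)
  qed
  have 2: "(LINT x|M. (G x - G' x - grad (\<lambda>x. p x - p' x) x) \<bullet> grad q x) = 0" if q: "q \<in> Polys k" for q
  proof -
    have gq: "continuous_on UNIV (grad q)" by (rule Polys_GDERIV(3)[OF q])
    have i: "integrable M (\<lambda>x. grad p x \<bullet> grad q x)" "integrable M (\<lambda>x. grad p' x \<bullet> grad q x)"
      by (intro integrable_M_continuous continuous_intros gq Polys_GDERIV(3)[OF p(1)] Polys_GDERIV(3)[OF p(2)])+
    have "(LINT x|M. (G x - grad p x) \<bullet> grad q x) = 0" "(LINT x|M. (G' x - grad p' x) \<bullet> grad q x) = 0"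
      using assms q unfolding vem_data_def by auto
    with i integrable_M_inner[OF l(5,7) gq] integrable_M_inner[OF l(6,8) gq] show ?thesis
      unfolding gp by (simp add: inner_diff_left)
  qed
  have 3: "bint (\<lambda>x. v x - v' x - (p x - p' x)) = 0"
  proof -
    have "bint (\<lambda>x. (v x - p x) - (v' x - p' x)) = bint (\<lambda>x. v x - p x) - bint (\<lambda>x. v' x - p' x)"
      by (intro bint_diff continuous_intros l continuous_on_subset[OF c(1) subset_UNIV] continuous_on_subset[OF c(2) subset_UNIV])
    then show ?thesis using assms unfolding vem_data_def by (simp add: algebra_simps)
  qed
  have 4: "(LINT x|M. (v x - v' x - (p x - p' x)) * scaled_monomial D \<alpha> x) = 0" if "k < mdegree \<alpha> + 2 \<and> mdegree \<alpha> \<le> k" for \<alpha>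
  proof -
    have "integrable M (\<lambda>x. (v x - p x) * scaled_monomial D \<alpha> x)" "integrable M (\<lambda>x. (v' x - p' x) * scaled_monomial D \<alpha> x)"
      by (intro l2_CS(1) l2_diff l l2_continuous c continuous_intros)+
    moreover have "(v x - v' x - (p x - p' x)) * s = (v x - p x) * s - (v' x - p' x) * s" for x s by (simp add: algebra_simps)
    ultimately show ?thesis using assms that unfolding vem_data_def by simp
  qed
  show ?thesis unfolding vem_data_def using weak_solution_diff[OF w] 1 2 3 4 assms
    by (auto simp: vem_data_def intro: Polys_diff)
qed

end

text \<open>Stated for a pair of functions, each in a virtual space of its own; linearity is dealt
  with at the level of \<open>vem_data\<close>. The facet conditions \<open>fa\<close> and
  \<open>fb\<close> are arbitrary, so that one statement serves the edge conditions of faces as well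
  as the face conditions of elements.\<close>

definition vem_stable :: "real \<Rightarrow> nat \<Rightarrow> (real,'n::finite) vec set \<Rightarrow> 'i set \<Rightarrow> ('i \<Rightarrow> 'b::euclidean_space set) \<Rightarrow> ('i \<Rightarrow> (real,'n) vec) \<Rightarrow>
    ('i \<Rightarrow> 'b \<Rightarrow> (real,'n) vec) \<Rightarrow> bool" where
  "vem_stable C k D I Y P L \<longleftrightarrow> (\<forall>fa fb v w m. 0 < m \<longrightarrow>
    enhanced_vem k D (\<lambda>f. \<Sum>i\<in>I. LINT y:Y i|lebesgue. f (P i + L i y)) fa v \<longrightarrow>
    enhanced_vem k D (\<lambda>f. \<Sum>i\<in>I. LINT y:Y i|lebesgue. f (P i + L i y)) fb w \<longrightarrow>
    (\<forall>\<alpha>. mdegree \<alpha> + 2 \<le> k \<longrightarrow> \<bar>(LINT x:D|lebesgue. v x * scaled_monomial D \<alpha> x) / measure lebesgue D -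
         (LINT x:D|lebesgue. w x * scaled_monomial D \<alpha> x) / measure lebesgue D\<bar> \<le> m) \<longrightarrow>
    (\<forall>i\<in>I. AE y in lebesgue. y \<in> Y i \<longrightarrow> \<bar>v (P i + L i y) - w (P i + L i y)\<bar> \<le> m) \<longrightarrow>
    (AE x in lebesgue. x \<in> D \<longrightarrow> \<bar>v x - w x\<bar> \<le> C * m))"

theorem enhanced_vem_stability:
  fixes \<rho> :: real
  assumes \<rho>: "0 < \<rho>"
  shows "\<exists>C>0. \<forall>(D::(real,'n::{finite,wellorder}) vec set) c (I::'i set) (Y::'i \<Rightarrow> 'b::euclidean_space set) P L.
    star_cell D c (diameter D) \<rho> I Y P L \<longrightarrow> vem_stable C k D I Y P L"
proof -
  obtain C where C: "C > 0" "\<And>(D::(real,'n) vec set) c h (I::'i set) (Y::'i \<Rightarrow> 'b set) P L v G r p m.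
    star_cell D c h \<rho> I Y P L \<Longrightarrow> star_cell.vem_bounded D h I Y P L k v G r p m \<Longrightarrow>
    (AE x in lebesgue_on (interior D). \<bar>v x\<bar> \<le> C * m)"
    using vem_stability[OF \<rho>, of k, where 'n='n and 'i='i and 'b='b] by blast
  show ?thesis unfolding vem_stable_def
  proof (intro exI[of _ C] conjI C(1) allI impI)
    fix D :: "(real,'n) vec set" and c and I :: "'i set" and Y :: "'i \<Rightarrow> 'b set" and P L fa fb v w m
    assume sc: "star_cell D c (diameter D) \<rho> I Y P L" and m: "0 < m"
      and vw: "enhanced_vem k D (\<lambda>f. \<Sum>i\<in>I. LINT y:Y i|lebesgue. f (P i + L i y)) fa v"
        "enhanced_vem k D (\<lambda>f. \<Sum>i\<in>I. LINT y:Y i|lebesgue. f (P i + L i y)) fb w"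
      and mom: "\<forall>\<alpha>. mdegree \<alpha> + 2 \<le> k \<longrightarrow> \<bar>(LINT x:D|lebesgue. v x * scaled_monomial D \<alpha> x) / measure lebesgue D -
         (LINT x:D|lebesgue. w x * scaled_monomial D \<alpha> x) / measure lebesgue D\<bar> \<le> m"
      and bd: "\<forall>i\<in>I. AE y in lebesgue. y \<in> Y i \<longrightarrow> \<bar>v (P i + L i y) - w (P i + L i y)\<bar> \<le> m"
    interpret star_cell D c "diameter D" \<rho> I Y P L by (rule sc)
    have J: "(\<lambda>f. \<Sum>i\<in>I. LINT y:Y i|lebesgue. f (P i + L i y)) = bint" by (rule ext) (simp add: bint_def \<Phi>_def)
    obtain G r p where a: "vem_data k v G r p" using enhanced_vem_data[OF vw(1)[unfolded J]] .
    obtain G' r' p' where b: "vem_data k w G' r' p'" using enhanced_vem_data[OF vw(2)[unfolded J]] .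
    have l: "l2 M v" "l2 M w" using a b unfolding vem_data_def weak_solution_def by auto
    have "\<bar>LINT x|M. (v x - w x) * scaled_monomial D \<alpha> x\<bar> \<le> m * measure lebesgue D" if \<alpha>: "mdegree \<alpha> + 2 \<le> k" for \<alpha>
    proof -
      have "(LINT x|M. (v x - w x) * scaled_monomial D \<alpha> x) = (LINT x|M. v x * scaled_monomial D \<alpha> x) - (LINT x|M. w x * scaled_monomial D \<alpha> x)"
        unfolding left_diff_distrib by (intro Bochner_Integration.integral_diff l2_CS(1) l l2_continuous continuous_intros)
      then have "\<bar>LINT x|M. (v x - w x) * scaled_monomial D \<alpha> x\<bar> / measure lebesgue D \<le> m"
        using mom[rule_format, OF \<alpha>] measure_D_pos unfolding integral_D_eq_M by (simp add: diff_divide_distrib[symmetric] abs_divide)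
      then show ?thesis using measure_D_pos by (simp add: field_simps)
    qed
    then have "vem_bounded k (\<lambda>x. v x - w x) (\<lambda>x. G x - G' x) (\<lambda>x. r x - r' x) (\<lambda>x. p x - p' x) m"
      using vem_data_diff[OF a b] m bd unfolding vem_bounded_def \<Phi>_def by auto
    from C(2)[OF sc this] have "AE x in lebesgue. x \<in> interior D \<longrightarrow> \<bar>v x - w x\<bar> \<le> C * m"
      by (subst (asm) AE_restrict_space_iff) auto
    then show "AE x in lebesgue. x \<in> D \<longrightarrow> \<bar>v x - w x\<bar> \<le> C * m"
      using AE_D_interior by eventually_elim (auto simp: indicator_def split: if_splits)
  qed
qed

section \<open>Faces and elements as cells\<close>

definition isom :: "('b::euclidean_space \<Rightarrow> 'a::euclidean_space) \<Rightarrow> bool" where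
  "isom \<phi> \<longleftrightarrow> (\<exists>c L. linear L \<and> (\<forall>x. norm (L x) = norm x) \<and> \<phi> = (\<lambda>x. c + L x))"

text \<open>The choice in \<open>chart\<close> has a witness: the direction space of the affine hull
  has the dimension of the coordinate type, hence is isometric to it.\<close>

lemma chart_spec:
  fixes S :: "'a::euclidean_space set"
  assumes "aff_dim S = int DIM('b::euclidean_space)"
  shows "isom (chart S :: 'b \<Rightarrow> 'a)" "range (chart S :: 'b \<Rightarrow> 'a) = affine hull S"
proof -
  have "S \<noteq> {}" using assms by auto
  then obtain a where a: "a \<in> S" by blast
  define T where "T = (\<lambda>x. x - a) ` (affine hull S)"
  have T: "subspace T" unfolding T_def using affine_diffs_subspace_subtract[of "affine hull S" a] a by (simp add: hull_inc affine_affine_hull)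
  have "aff_dim S = int (dim T)"
  proof -
    have "aff_dim (affine hull S) = aff_dim T"
      unfolding T_def using aff_dim_translation_eq[of "- a" "affine hull S"] by simp
    then show ?thesis using T by (simp add: aff_dim_subspace)
  qed
  then have "dim (UNIV :: 'b set) = dim T" using assms by simp
  then obtain f :: "'b \<Rightarrow> 'a" and g where f: "linear f" "f ` UNIV = T" "\<And>x. x \<in> UNIV \<Longrightarrow> norm (f x) = norm x"
    using isometries_subspaces[OF subspace_UNIV T] by metis
  have "range (\<lambda>x. a + f x) = (\<lambda>x. a + x) ` T" using f(2) by auto
  also have "\<dots> = affine hull S" by (auto simp: T_def image_image)
  finally have "\<exists>\<phi>::'b \<Rightarrow> 'a. (\<exists>c L. linear L \<and> (\<forall>x. norm (L x) = norm x) \<and> \<phi> = (\<lambda>x. c + L x)) \<and> range \<phi> = affine hull S"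
    using f by (intro exI[of _ "\<lambda>x. a + f x"]) auto
  from someI_ex[OF this] show "isom (chart S :: 'b \<Rightarrow> 'a)" "range (chart S :: 'b \<Rightarrow> 'a) = affine hull S"
    unfolding chart_def isom_def by blast+
qed

context fixes \<phi> :: "'b::euclidean_space \<Rightarrow> 'a::euclidean_space" assumes \<phi>: "isom \<phi>" begin

lemma isom_linear: "linear (\<lambda>y. \<phi> y - \<phi> 0)" "norm (\<phi> y - \<phi> 0) = norm y"
  using \<phi> by (auto simp: isom_def linear_0)

lemma isom_dist: "dist (\<phi> x) (\<phi> y) = dist x y"
  using isom_linear(2)[of "x - y"] linear_diff[OF isom_linear(1), of x y] by (simp add: dist_norm)

lemma isom_inj: "inj \<phi>" by (metis isom_dist dist_eq_0_iff injI)

lemma isom_continuous: "continuous_on S \<phi>"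
  unfolding continuous_on_iff using isom_dist by metis

lemma isom_affine: "\<phi> ((1 - t) *\<^sub>R x + t *\<^sub>R y) = (1 - t) *\<^sub>R \<phi> x + t *\<^sub>R \<phi> y"
proof -
  obtain c L where "linear L" "\<phi> = (\<lambda>x. c + L x)" using \<phi> unfolding isom_def by blast
  then show ?thesis by (simp add: linear_add linear_scale scaleR_add_right)
qed

lemma isom_segment: "\<phi> ` closed_segment x y = closed_segment (\<phi> x) (\<phi> y)"
  unfolding closed_segment_def by (force simp: isom_affine image_iff)

lemma isom_compact_vimage: assumes "compact S" shows "compact (\<phi> -` S)"
proof (cases "\<phi> -` S = {}")
  case False
  then obtain a where a: "\<phi> a \<in> S" by blast
  have "closed (\<phi> -` S)" by (rule continuous_closed_vimage[OF compact_imp_closed[OF assms]]) (use isom_continuous[of UNIV] in \<open>simp add: continuous_on_eq_continuous_within\<close>)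
  moreover have "bounded (\<phi> -` S)"
  proof -
    obtain B where "\<And>x. x \<in> S \<Longrightarrow> dist (\<phi> a) x \<le> B" using compact_imp_bounded[OF assms] bounded_any_center by blast
    then show ?thesis unfolding bounded_def using isom_dist[of a] by (metis vimageE)
  qed
  ultimately show ?thesis by (simp add: compact_eq_bounded_closed)
qed simp

lemma isom_aff_dim_vimage: assumes "S \<subseteq> range \<phi>" shows "aff_dim (\<phi> -` S) = aff_dim S"
proof -
  let ?L = "\<lambda>y. \<phi> y - \<phi> 0"
  have "inj ?L" using isom_inj by (auto simp: inj_def)
  then have "aff_dim (\<phi> -` S) = aff_dim (?L ` (\<phi> -` S))" by (rule aff_dim_injective_linear_image[OF isom_linear(1), symmetric])
  also have "\<dots> = aff_dim ((+) (\<phi> 0) ` (?L ` (\<phi> -` S)))" by (rule aff_dim_translation_eq[symmetric])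
  also have "(+) (\<phi> 0) ` (?L ` (\<phi> -` S)) = S" using assms by (auto simp: image_image)
  finally show ?thesis .
qed

lemma isom_negligible_vimage:
  assumes "aff_dim S < int DIM('b)" shows "negligible (\<phi> -` S)"
proof -
  have "aff_dim (\<phi> -` S) = aff_dim (S \<inter> range \<phi>)" using isom_aff_dim_vimage[of "S \<inter> range \<phi>"] by (simp add: vimage_def)
  also have "\<dots> \<le> aff_dim S" by (rule aff_dim_subset) simp
  finally obtain a b where "a \<noteq> 0" "\<phi> -` S \<subseteq> {x. a \<bullet> x = b}"
    using assms aff_lowdim_subset_hyperplane[of "\<phi> -` S"] by auto
  then show ?thesis using negligible_subset[OF negligible_hyperplane] by blast
qed

lemma isom_interior_vimage:
  assumes "affine hull S = range \<phi>" shows "interior (\<phi> -` S) = \<phi> -` rel_interior S"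
proof -
  have "ball (\<phi> x) e \<inter> range \<phi> \<subseteq> S \<longleftrightarrow> ball x e \<subseteq> \<phi> -` S" for x e
    by (auto simp: subset_iff isom_dist)
  moreover have "\<phi> x \<in> S" if "ball x e \<subseteq> \<phi> -` S" "e > 0" for x e using that centre_in_ball by blast
  ultimately show ?thesis unfolding set_eq_iff mem_interior vimage_eq rel_interior_ball assms by blast
qed

lemma isom_frontier_vimage:
  assumes "affine hull S = range \<phi>" "closed S" shows "frontier (\<phi> -` S) = \<phi> -` rel_frontier S"
proof -
  have "closed (\<phi> -` S)" by (rule continuous_closed_vimage[OF assms(2)]) (use isom_continuous[of UNIV] in \<open>simp add: continuous_on_eq_continuous_within\<close>)
  then show ?thesis unfolding frontier_def rel_frontier_def using isom_interior_vimage[OF assms(1)] assms(2) by auto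
qed

lemma isom_diameter_vimage: assumes "S \<subseteq> range \<phi>" shows "diameter (\<phi> -` S) = diameter S"
proof -
  have "S = \<phi> ` (\<phi> -` S)" using assms by auto
  then have "(\<lambda>(x,y). dist x y) ` (S \<times> S) = (\<lambda>(x,y). dist x y) ` (\<phi> ` (\<phi> -` S) \<times> \<phi> ` (\<phi> -` S))" by simp
  also have "\<dots> = (\<lambda>(x,y). dist x y) ` ((\<phi> -` S) \<times> (\<phi> -` S))"
    by (force simp: image_iff isom_dist)
  finally have "(\<lambda>(x,y). dist x y) ` (S \<times> S) = (\<lambda>(x,y). dist x y) ` ((\<phi> -` S) \<times> (\<phi> -` S))" .
  moreover have "S = {} \<longleftrightarrow> \<phi> -` S = {}" using assms by auto
  ultimately show ?thesis unfolding diameter_def by (simp add: case_prod_beta')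
qed

lemma isom_star_shaped_vimage:
  assumes "affine hull S = range \<phi>" "star_shaped_wrt_ball S r" "0 < r"
  shows "\<exists>c. ball c r \<subseteq> \<phi> -` S \<and> (\<forall>b\<in>ball c r. \<forall>x\<in>\<phi> -` S. closed_segment x b \<subseteq> \<phi> -` S)"
proof -
  obtain c where c: "ball (\<phi> c) r \<inter> range \<phi> \<subseteq> S" "\<And>y x. y \<in> ball (\<phi> c) r \<inter> range \<phi> \<Longrightarrow> x \<in> S \<Longrightarrow> closed_segment x y \<subseteq> S"
    using assms(2) unfolding star_shaped_wrt_ball_def assms(1) by auto
  have "closed_segment x b \<subseteq> \<phi> -` S" if "b \<in> ball c r" "\<phi> x \<in> S" for x b
  proof -
    have "\<phi> ` closed_segment x b \<subseteq> S" unfolding isom_segment using that by (intro c(2)) (auto simp: isom_dist)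
    then show ?thesis by auto
  qed
  moreover have "ball c r \<subseteq> \<phi> -` S" using c(1) by (auto simp: subset_iff isom_dist)
  ultimately show ?thesis by blast
qed

end

lemma isom_id: "isom (\<lambda>x. x)" unfolding isom_def by (rule exI[of _ 0], rule exI[of _ "\<lambda>x. x"]) (auto simp: linear_ident)

lemma diameter_pos_interior:
  fixes D :: "'a::euclidean_space set"
  assumes "bounded D" "interior D \<noteq> {}" shows "diameter D > 0"
proof -
  obtain x e where e: "e > 0" "cball x e \<subseteq> D" using assms(2) by (metis ex_in_conv mem_interior_cball)
  have "diameter (cball x e) \<le> diameter D" using e assms(1) by (intro diameter_subset)
  then show ?thesis using e by (simp add: diameter_cball)
qed

lemma star_cell_intro:
  fixes D :: "(real^'n::{finite,wellorder}) set" and \<psi> :: "'i \<Rightarrow> 'b::euclidean_space \<Rightarrow> (real,'n) vec"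
  assumes D: "compact D" and r: "\<rho> * diameter D \<le> r" "0 < \<rho>" "\<rho> \<le> 1"
    and c: "ball c r \<subseteq> D" "\<And>b x. b \<in> ball c r \<Longrightarrow> x \<in> D \<Longrightarrow> closed_segment x b \<subseteq> D" and ne: "interior D \<noteq> {}"
    and I: "finite I" "frontier D = (\<Union>i\<in>I. S i)" and dim: "DIM('b) + 1 = CARD('n)"
    and \<psi>: "\<And>i. i \<in> I \<Longrightarrow> isom (\<psi> i)" "\<And>i. i \<in> I \<Longrightarrow> S i \<subseteq> range (\<psi> i)" "\<And>i. i \<in> I \<Longrightarrow> compact (S i)" "\<And>i. i \<in> I \<Longrightarrow> interior (\<psi> i -` S i) \<noteq> {}"
    and ov: "\<And>i j. i \<in> I \<Longrightarrow> j \<in> I \<Longrightarrow> i \<noteq> j \<Longrightarrow> negligible (\<psi> i -` (S i \<inter> S j))"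
  shows "star_cell D c (diameter D) \<rho> I (\<lambda>i. \<psi> i -` S i) (\<lambda>i. \<psi> i 0) (\<lambda>i y. \<psi> i y - \<psi> i 0)"
proof -
  have pos: "diameter D > 0" by (rule diameter_pos_interior[OF compact_imp_bounded[OF D] ne])
  have r0: "r > 0" using r pos by (smt (verit) mult_pos_pos)
  have cD: "c \<in> D" using c r0 by auto
  show ?thesis
  proof (rule star_cell.intro)
    show "D \<subseteq> cball c (diameter D)" using diameter_bounded_bound[OF compact_imp_bounded[OF D] cD] by auto
    show "ball c (\<rho> * diameter D) \<subseteq> D" using c(1) r(1) by (meson subset_ball order_trans)
    show "closed_segment x b \<subseteq> D" if "b \<in> ball c (\<rho> * diameter D)" "x \<in> D" for x b using c(2) r(1) that by (meson subset_ball subsetD)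
    show "frontier D = (\<Union>i\<in>I. (\<lambda>y. \<psi> i 0 + (\<psi> i y - \<psi> i 0)) ` (\<psi> i -` S i))" unfolding I(2) using \<psi>(2) by fastforce
    show "compact (\<psi> i -` S i)" if "i \<in> I" for i by (rule isom_compact_vimage[OF \<psi>(1,3)[OF that]])
    show "linear (\<lambda>y. \<psi> i y - \<psi> i 0)" if "i \<in> I" for i by (rule isom_linear[OF \<psi>(1)[OF that]])
    show "norm (\<psi> i y - \<psi> i 0) = norm y" if "i \<in> I" for i y by (rule isom_linear[OF \<psi>(1)[OF that]])
    show "negligible {y \<in> \<psi> i -` S i. \<psi> i 0 + (\<psi> i y - \<psi> i 0) \<in> (\<lambda>y. \<psi> j 0 + (\<psi> j y - \<psi> j 0)) ` (\<psi> j -` S j)}"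
      if "i \<in> I" "j \<in> I" "i \<noteq> j" for i j
      by (rule negligible_subset[OF ov[OF that]]) auto
  qed (use assms pos in auto)
qed

text \<open>Edges are charted inside the coordinates of the face, as in the definition of
  \<open>V_face\<close>, where edge integrals are taken over \<open>flat F e\<close>.\<close>

abbreviation edge_chart :: "(real^3) set \<Rightarrow> (real^3) set \<Rightarrow> real \<Rightarrow> real^2" where
  "edge_chart F e \<equiv> chart (flat F e)"

abbreviation face_cell :: "mesh \<Rightarrow> real \<Rightarrow> (real^3) set \<Rightarrow> real^2 \<Rightarrow> bool" where
  "face_cell T \<rho> F c \<equiv> star_cell (flat F F) c (diameter (flat F F)) \<rho> (edges_of T F)
     (\<lambda>e. edge_chart F e -` flat F e) (\<lambda>e. edge_chart F e 0) (\<lambda>e y. edge_chart F e y - edge_chart F e 0)"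

abbreviation elem_cell :: "mesh \<Rightarrow> real \<Rightarrow> (real^3) set \<Rightarrow> real^3 \<Rightarrow> bool" where
  "elem_cell T \<rho> E c \<equiv> star_cell E c (diameter E) \<rho> (faces_of T E)
     (\<lambda>F. flat F F) (\<lambda>F. face_chart F 0) (\<lambda>F y. face_chart F y - face_chart F 0)"

section \<open>Cells of a conforming mesh\<close>

locale conforming =
  fixes \<Omega> :: "(real^3) set" and T :: mesh
  assumes conf: "conforming_mesh \<Omega> T"
begin

lemma finite_cells: "finite (verts T)" "finite (edges T)" "finite (faces T)" "finite (elems T)"
  using conf unfolding conforming_mesh_def by auto

lemma finite_of: "finite (edges_of T F)" "finite (faces_of T E)"
  using finite_cells by (auto simp: edges_of_def faces_of_def)

lemma edge_segment:
  assumes "e \<in> edges T" obtains a b where "a \<in> verts T" "b \<in> verts T" "a \<noteq> b" "e = closed_segment a b"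
  using conf assms unfolding conforming_mesh_def by meson

lemma face_props:
  assumes "F \<in> faces T"
  shows "compact F" "aff_dim F = 2" "connected (rel_interior F)" "closure (rel_interior F) = F" "rel_frontier F = \<Union>(edges_of T F)"
  using conf assms unfolding conforming_mesh_def by auto

lemma elem_props:
  assumes "E \<in> elems T"
  shows "compact E" "E \<noteq> {}" "connected (interior E)" "closure (interior E) = E" "frontier E = \<Union>(faces_of T E)"
  using conf assms unfolding conforming_mesh_def by auto

lemma cells_cover: "\<Union>(elems T) = closure \<Omega>"
  using conf unfolding conforming_mesh_def by auto

lemma cells_disjoint:
  assumes "X \<in> (\<lambda>x. {x}) ` verts T \<union> edges T \<union> faces T \<union> elems T" "Y \<in> (\<lambda>x. {x}) ` verts T \<union> edges T \<union> faces T \<union> elems T" "X \<noteq> Y"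
  shows "rel_interior X \<inter> rel_interior Y = {}"
proof -
  have "pairwise (\<lambda>X Y. rel_interior X \<inter> rel_interior Y = {}) ((\<lambda>x. {x}) ` verts T \<union> edges T \<union> faces T \<union> elems T)"
    using conf unfolding conforming_mesh_def by blast
  then show ?thesis using assms by (rule pairwiseD)
qed

lemma of_cells: "e \<in> edges_of T F \<Longrightarrow> e \<in> edges T" "F \<in> faces_of T E \<Longrightarrow> F \<in> faces T"
  by (auto simp: edges_of_def faces_of_def)

lemma edges_of_subset: "F \<in> faces T \<Longrightarrow> e \<in> edges_of T F \<Longrightarrow> e \<subseteq> F"
  using closure_closed[OF compact_imp_closed[OF face_props(1)[of F]]] unfolding edges_of_def rel_frontier_def by auto

lemma faces_of_subset: "E \<in> elems T \<Longrightarrow> F \<in> faces_of T E \<Longrightarrow> F \<subseteq> E"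
  using elem_props(1)[of E] frontier_subset_closed unfolding faces_of_def by (auto dest: compact_imp_closed)

lemma edge_props:
  assumes "e \<in> edges T" shows "compact e" "aff_dim e = 1" "convex e" "e \<noteq> {}" "finite (e - rel_interior e)" "e - rel_interior e \<subseteq> verts T"
proof -
  obtain a b where ab: "a \<in> verts T" "b \<in> verts T" "a \<noteq> b" "e = closed_segment a b" using edge_segment[OF assms] .
  have "aff_dim (closed_segment a b) = aff_dim {a, b}" by (metis aff_dim_convex_hull segment_convex_hull)
  then show "aff_dim e = 1" using ab by (simp add: aff_dim_2)
  show "compact e" "convex e" "e \<noteq> {}" using ab by auto
  have "e - rel_interior e \<subseteq> {a, b}" using ab by (auto simp: rel_interior_closed_segment open_segment_def)
  then show "finite (e - rel_interior e)" "e - rel_interior e \<subseteq> verts T" using ab by (auto intro: finite_subset)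
qed

lemma face_chart_spec:
  assumes "F \<in> faces T" shows "isom (face_chart F)" "range (face_chart F) = affine hull F" "F \<subseteq> range (face_chart F)"
proof -
  have "aff_dim F = int DIM(real^2)" using face_props(2)[OF assms] by simp
  from chart_spec[OF this] show "isom (face_chart F)" "range (face_chart F) = affine hull F" .
  then show "F \<subseteq> range (face_chart F)" by (simp add: hull_subset)
qed

lemma flat_facts:
  assumes F: "F \<in> faces T"
  shows "compact (flat F F)" "diameter (flat F F) = diameter F" "interior (flat F F) \<noteq> {}"
    "frontier (flat F F) = (\<Union>e\<in>edges_of T F. flat F e)"
proof -
  note ch = face_chart_spec[OF F] and fp = face_props[OF F]
  show "compact (flat F F)" unfolding flat_def by (rule isom_compact_vimage[OF ch(1) fp(1)])
  show "diameter (flat F F) = diameter F" unfolding flat_def by (rule isom_diameter_vimage[OF ch(1,3)])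
  have "F \<noteq> {}" using fp(2) by auto
  then have "rel_interior F \<noteq> {}" using fp(4) by auto
  then show "interior (flat F F) \<noteq> {}"
    unfolding flat_def isom_interior_vimage[OF ch(1) ch(2)[symmetric]] using rel_interior_subset[of F] ch(3) by blast
  show "frontier (flat F F) = (\<Union>e\<in>edges_of T F. flat F e)"
    unfolding flat_def isom_frontier_vimage[OF ch(1) ch(2)[symmetric] compact_imp_closed[OF fp(1)]] fp(5) by auto
qed

lemma flat_edge:
  assumes F: "F \<in> faces T" and e: "e \<in> edges_of T F"
  shows "isom (edge_chart F e)" "flat F e \<subseteq> range (edge_chart F e)"
    "compact (flat F e)" "interior (edge_chart F e -` flat F e) \<noteq> {}"
proof -
  note ch = face_chart_spec[OF F]
  have eF: "e \<subseteq> range (face_chart F)" using edges_of_subset[OF F e] ch(3) by blast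
  have eT: "e \<in> edges T" by (rule of_cells(1)[OF e])
  have ad: "aff_dim (flat F e) = int DIM(real)"
    unfolding flat_def using isom_aff_dim_vimage[OF ch(1) eF] edge_props[OF eT] by simp
  note ce = chart_spec[OF ad]
  show "isom (edge_chart F e)" by (rule ce)
  show r: "flat F e \<subseteq> range (edge_chart F e)" unfolding ce(2) by (rule hull_subset)
  show "compact (flat F e)" unfolding flat_def by (rule isom_compact_vimage[OF ch(1) edge_props(1)[OF eT]])
  obtain a b where ab: "a \<noteq> b" "e = closed_segment a b" using edge_segment[OF eT] by metis
  obtain a' b' where ab': "a = face_chart F a'" "b = face_chart F b'" using eF ab by (metis ends_in_segment subsetD imageE)
  have "flat F e = face_chart F -` (face_chart F ` closed_segment a' b')"
    unfolding flat_def isom_segment[OF ch(1)] ab ab'[symmetric] ..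
  then have "flat F e = closed_segment a' b'" by (simp add: inj_vimage_image_eq isom_inj[OF ch(1)])
  then have "rel_interior (flat F e) \<noteq> {}" by (simp add: rel_interior_eq_empty)
  then show "interior (edge_chart F e -` flat F e) \<noteq> {}"
    unfolding isom_interior_vimage[OF ce(1) ce(2)[symmetric]] using r rel_interior_subset[of "flat F e"] by blast
qed

lemma edge_Int_finite:
  assumes "e \<in> edges T" "e' \<in> edges T" "e \<noteq> e'" shows "finite (e \<inter> e')"
proof -
  have "rel_interior e \<inter> rel_interior e' = {}" using assms by (intro cells_disjoint) auto
  then have "e \<inter> e' \<subseteq> (e - rel_interior e) \<union> (e' - rel_interior e')" by blast
  then show ?thesis using edge_props(5) assms by (meson finite_UnI finite_subset)
qed

text \<open>In the coordinates of the plane, the disc of star centres becomes a ball. Two edges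
  share only endpoints, so their overlaps are finite and thus null in the chart.\<close>

lemma face_star_cell:
  assumes F: "F \<in> faces T" and r: "star_shaped_wrt_ball F r" "\<rho> * diameter F \<le> r" "0 < \<rho>" "\<rho> \<le> 1"
  shows "\<exists>c. face_cell T \<rho> F c"
proof -
  note ch = face_chart_spec[OF F] and ff = flat_facts[OF F]
  have "diameter F > 0" using diameter_pos_interior[OF compact_imp_bounded[OF ff(1)] ff(3)] ff(2) by simp
  then have "0 < r" using r by (smt (verit) mult_pos_pos)
  from isom_star_shaped_vimage[OF ch(1) ch(2)[symmetric] r(1) this]
  obtain c where c: "ball c r \<subseteq> flat F F" "\<And>b x. b \<in> ball c r \<Longrightarrow> x \<in> flat F F \<Longrightarrow> closed_segment x b \<subseteq> flat F F"
    unfolding flat_def by blast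
  show ?thesis
  proof (rule exI, rule star_cell_intro[OF ff(1) _ r(3,4) c ff(3) finite_of(1) ff(4)])
    show "\<rho> * diameter (flat F F) \<le> r" using r(2) ff(2) by simp
    show "negligible (edge_chart F e -` (flat F e \<inter> flat F e'))" if "e \<in> edges_of T F" "e' \<in> edges_of T F" "e \<noteq> e'" for e e'
    proof (rule negligible_finite)
      have "finite (flat F e \<inter> flat F e')"
        using finite_vimageI[OF edge_Int_finite isom_inj[OF ch(1)], of e e'] that of_cells(1) unfolding flat_def vimage_Int by blast
      then show "finite (edge_chart F e -` (flat F e \<inter> flat F e'))"
        by (rule finite_vimageI[OF _ isom_inj[OF flat_edge(1)[OF F that(1)]]])
    qed
  qed (use flat_edge[OF F] in auto)
qed

text \<open>Relative interiors are disjoint, so a common point lies on the relative boundary of one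
  of the faces. This also covers coplanar neighbours, where comparing the two planes would say
  nothing.\<close>

lemma face_Int_subset:
  assumes "F \<in> faces T" "F' \<in> faces T" "F \<noteq> F'" shows "F \<inter> F' \<subseteq> \<Union>(edges_of T F \<union> edges_of T F')"
proof -
  have "rel_interior F \<inter> rel_interior F' = {}" using assms by (intro cells_disjoint) auto
  moreover have "F \<subseteq> rel_interior F \<union> \<Union>(edges_of T F)" if "F \<in> faces T" for F
    using face_props(5)[OF that] closure_subset[of F] by (auto simp: rel_frontier_def)
  ultimately show ?thesis using assms by blast
qed

lemma negligible_chart_edges:
  assumes "F \<in> faces T" "finite A" "A \<subseteq> edges T" shows "negligible (face_chart F -` \<Union>A)"
  unfolding vimage_Union
proof (rule negligible_Union)
  show "negligible S" if S: "S \<in> (-`) (face_chart F) ` A" for S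
  proof -
    obtain e where e: "e \<in> edges T" "S = face_chart F -` e" using S assms(3) by blast
    then show ?thesis using isom_negligible_vimage[OF face_chart_spec(1)[OF assms(1)], of e] edge_props(2)[OF e(1)] by simp
  qed
qed (use assms(2) in simp)

lemma elem_star_cell:
  assumes E: "E \<in> elems T" and r: "star_shaped_wrt_ball E r" "\<rho> * diameter E \<le> r" "0 < \<rho>" "\<rho> \<le> 1"
  shows "\<exists>c. elem_cell T \<rho> E c"
proof -
  note ep = elem_props[OF E]
  have ne: "interior E \<noteq> {}" using ep by auto
  then have aff: "affine hull E = range (\<lambda>x. x)" using affine_hull_nonempty_interior by simp
  have "diameter E > 0" by (rule diameter_pos_interior[OF compact_imp_bounded[OF ep(1)] ne])
  then have "0 < r" using r by (smt (verit) mult_pos_pos)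
  from isom_star_shaped_vimage[OF isom_id aff r(1) this]
  obtain c where c: "ball c r \<subseteq> E" "\<And>b x. b \<in> ball c r \<Longrightarrow> x \<in> E \<Longrightarrow> closed_segment x b \<subseteq> E" by auto
  have fr: "frontier E = (\<Union>F\<in>faces_of T E. F)" using ep(5) by simp
  show ?thesis unfolding flat_def
  proof (rule exI, rule star_cell_intro[OF ep(1) r(2-4) c ne finite_of(2) fr])
    fix F assume F: "F \<in> faces_of T E"
    note Ff = of_cells(2)[OF F]
    show "isom (face_chart F)" "F \<subseteq> range (face_chart F)" using face_chart_spec[OF Ff] by auto
    show "compact F" by (rule face_props[OF Ff])
    show "interior (face_chart F -` F) \<noteq> {}" using flat_facts(3)[OF Ff] unfolding flat_def .
    fix F' assume F': "F' \<in> faces_of T E" "F \<noteq> F'"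
    have "F \<inter> F' \<subseteq> \<Union>(edges_of T F \<union> edges_of T F')" by (rule face_Int_subset[OF Ff of_cells(2)[OF F'(1)] F'(2)])
    then have "face_chart F -` (F \<inter> F') \<subseteq> face_chart F -` \<Union>(edges_of T F \<union> edges_of T F')" by (rule vimage_mono)
    then show "negligible (face_chart F -` (F \<inter> F'))"
      by (rule negligible_subset[OF negligible_chart_edges[OF Ff, of "edges_of T F \<union> edges_of T F'"], rotated 2]) (auto simp: of_cells finite_of)
  qed (simp_all add: DIM_cart)
qed

end

text \<open>On edges the difference is controlled at every point, since traces there are
  polynomials; on the face only almost everywhere. The latter is the form in which
  \<open>elem_stable\<close> takes its boundary bounds.\<close>

definition face_stable :: "real \<Rightarrow> nat \<Rightarrow> mesh \<Rightarrow> (real^3) set \<Rightarrow> bool" where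
  "face_stable C k T F \<longleftrightarrow> (\<forall>u w m. u \<in> V_face k T F \<longrightarrow> w \<in> V_face k T F \<longrightarrow> 0 < m \<longrightarrow>
     (\<forall>\<alpha>. mdegree \<alpha> + 2 \<le> k \<longrightarrow> \<bar>(LINT x:flat F F|lebesgue. u x * scaled_monomial (flat F F) \<alpha> x) / measure lebesgue (flat F F) -
         (LINT x:flat F F|lebesgue. w x * scaled_monomial (flat F F) \<alpha> x) / measure lebesgue (flat F F)\<bar> \<le> m) \<longrightarrow>
     (\<forall>e\<in>edges_of T F. \<forall>y\<in>flat F e. \<bar>u y - w y\<bar> \<le> m) \<longrightarrow>
     (AE y in lebesgue. y \<in> flat F F \<longrightarrow> \<bar>u y - w y\<bar> \<le> C * m))"

lemma face_stability:
  assumes "0 < \<rho>" "\<rho> \<le> 1"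
  shows "\<exists>C>0. \<forall>\<Omega> T F r. conforming_mesh \<Omega> T \<longrightarrow> F \<in> faces T \<longrightarrow> star_shaped_wrt_ball F r \<longrightarrow> \<rho> * diameter F \<le> r \<longrightarrow> face_stable C k T F"
proof -
  obtain C where C: "C > 0" and Cb: "\<And>D c (I::(real^3) set set) (Y::_ \<Rightarrow> real set) P L.
    star_cell D c (diameter D) \<rho> I Y P L \<Longrightarrow> vem_stable C k (D::(real^2) set) I Y P L"
    using enhanced_vem_stability[OF assms(1), of k, where 'n=2 and 'b=real and 'i="(real^3) set"] by blast
  show ?thesis unfolding face_stable_def
  proof (intro exI[of _ C] conjI C allI impI)
    fix \<Omega> T F r u w m
    assume "conforming_mesh \<Omega> T" and F: "F \<in> faces T" and r: "star_shaped_wrt_ball F r" "\<rho> * diameter F \<le> r"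
      and uw: "u \<in> V_face k T F" "w \<in> V_face k T F" and m: "0 < m" "\<forall>\<alpha>. mdegree \<alpha> + 2 \<le> k \<longrightarrow> \<bar>(LINT x:flat F F|lebesgue. u x * scaled_monomial (flat F F) \<alpha> x) / measure lebesgue (flat F F) -
         (LINT x:flat F F|lebesgue. w x * scaled_monomial (flat F F) \<alpha> x) / measure lebesgue (flat F F)\<bar> \<le> m"
        "\<forall>e\<in>edges_of T F. \<forall>y\<in>flat F e. \<bar>u y - w y\<bar> \<le> m"
    then interpret conforming \<Omega> T by unfold_locales
    obtain c where c: "face_cell T \<rho> F c" using face_star_cell[OF F r assms] by blast
    show "AE y in lebesgue. y \<in> flat F F \<longrightarrow> \<bar>u y - w y\<bar> \<le> C * m"
      by (rule Cb[OF c, unfolded vem_stable_def, THEN spec, THEN spec, THEN spec, THEN spec, THEN spec, THEN mp, THEN mp, THEN mp, THEN mp, THEN mp, OF m(1) _ _ m(2)])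
        (use uw m(3) in \<open>auto simp: V_face_def edge_integral_def Let_def\<close>)
  qed
qed

definition elem_stable :: "real \<Rightarrow> nat \<Rightarrow> mesh \<Rightarrow> (real^3) set \<Rightarrow> bool" where
  "elem_stable C k T E \<longleftrightarrow> (\<forall>u w m. u \<in> V_elem k T E \<longrightarrow> w \<in> V_elem k T E \<longrightarrow> 0 < m \<longrightarrow>
     (\<forall>\<alpha>. mdegree \<alpha> + 2 \<le> k \<longrightarrow> \<bar>dof_value (Elem_Moment E \<alpha>) u - dof_value (Elem_Moment E \<alpha>) w\<bar> \<le> m) \<longrightarrow>
     (\<forall>F\<in>faces_of T E. AE y in lebesgue. y \<in> flat F F \<longrightarrow> \<bar>u (face_chart F y) - w (face_chart F y)\<bar> \<le> m) \<longrightarrow>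
     (AE x in lebesgue. x \<in> E \<longrightarrow> \<bar>u x - w x\<bar> \<le> C * m))"

lemma elem_stability:
  assumes "0 < \<rho>" "\<rho> \<le> 1"
  shows "\<exists>C>0. \<forall>\<Omega> T E r. conforming_mesh \<Omega> T \<longrightarrow> E \<in> elems T \<longrightarrow> star_shaped_wrt_ball E r \<longrightarrow> \<rho> * diameter E \<le> r \<longrightarrow> elem_stable C k T E"
proof -
  obtain C where C: "C > 0" and Cb: "\<And>D c (I::(real^3) set set) (Y::_ \<Rightarrow> (real^2) set) P L.
    star_cell D c (diameter D) \<rho> I Y P L \<Longrightarrow> vem_stable C k (D::(real^3) set) I Y P L"
    using enhanced_vem_stability[OF assms(1), of k, where 'n=3 and 'b="real^2" and 'i="(real^3) set"] by blast
  show ?thesis unfolding elem_stable_def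
  proof (intro exI[of _ C] conjI C allI impI)
    fix \<Omega> T E r u w m
    assume "conforming_mesh \<Omega> T" and E: "E \<in> elems T" and r: "star_shaped_wrt_ball E r" "\<rho> * diameter E \<le> r"
      and uw: "u \<in> V_elem k T E" "w \<in> V_elem k T E" and m: "0 < m"
        "\<forall>\<alpha>. mdegree \<alpha> + 2 \<le> k \<longrightarrow> \<bar>dof_value (Elem_Moment E \<alpha>) u - dof_value (Elem_Moment E \<alpha>) w\<bar> \<le> m"
        "\<forall>F\<in>faces_of T E. AE y in lebesgue. y \<in> flat F F \<longrightarrow> \<bar>u (face_chart F y) - w (face_chart F y)\<bar> \<le> m"
    then interpret conforming \<Omega> T by unfold_locales
    obtain c where c: "elem_cell T \<rho> E c" using elem_star_cell[OF E r assms] by blast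
    show "AE x in lebesgue. x \<in> E \<longrightarrow> \<bar>u x - w x\<bar> \<le> C * m"
      by (rule Cb[OF c, unfolded vem_stable_def, THEN spec, THEN spec, THEN spec, THEN spec, THEN spec, THEN mp, THEN mp, THEN mp, THEN mp, THEN mp, OF m(1) _ _ m(2)[unfolded dof_value.simps]])
        (use uw m(3) in \<open>auto simp: V_elem_def face_integral_def\<close>)
  qed
qed

section \<open>Elements at a point\<close>

lemma connected_closed_meet:
  assumes "connected S" "closed A" "closed B" "S \<subseteq> A \<union> B" "A \<inter> S \<noteq> {}" "B \<inter> S \<noteq> {}"
  obtains y where "y \<in> S" "y \<in> A" "y \<in> B"
  using assms unfolding connected_closed by blast

context conforming begin

lemma interior_nonempty: "E \<in> elems T \<Longrightarrow> interior E \<noteq> {}" using elem_props[of E] by auto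

lemma interior_disjoint:
  assumes "K \<in> elems T" "L \<in> elems T" "K \<noteq> L" shows "interior K \<inter> L = {}"
proof -
  have "interior K \<inter> interior L = {}"
    using cells_disjoint[of K L] assms interior_nonempty by (simp add: rel_interior_nonempty_interior)
  then have "interior K \<inter> closure (interior L) = {}" by (simp add: open_Int_closure_eq_empty)
  then show ?thesis using elem_props(4)[OF assms(2)] by simp
qed

lemma edge_vertex_disjoint: assumes "e \<in> edges T" "x \<in> verts T" shows "x \<notin> rel_interior e"
proof -
  have "e \<noteq> {x}" using edge_props(2)[OF assms(1)] by auto
  then have "rel_interior e \<inter> rel_interior {x} = {}" using assms by (intro cells_disjoint) auto
  then show ?thesis by simp
qed

lemma edge_edge_disjoint: "e \<in> edges T \<Longrightarrow> e' \<in> edges T \<Longrightarrow> e \<noteq> e' \<Longrightarrow> x \<in> rel_interior e \<Longrightarrow> x \<notin> e'"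
  using cells_disjoint[of e e'] edge_props(6)[of e'] edge_vertex_disjoint[of e x] by blast

lemma face_edge_disjoint:
  assumes "F \<in> faces T" "e \<in> edges T" "x \<in> rel_interior F" shows "x \<notin> e"
proof -
  have "F \<noteq> e" "\<And>x. F \<noteq> {x}" using face_props(2)[OF assms(1)] edge_props(2)[OF assms(2)] by auto
  have "rel_interior F \<inter> rel_interior e = {}" by (rule cells_disjoint) (use assms \<open>F \<noteq> e\<close> in auto)
  moreover have "rel_interior F \<inter> rel_interior {x} = {}" if "x \<in> verts T" for x
    by (rule cells_disjoint) (use assms that \<open>\<And>x. F \<noteq> {x}\<close> in auto)
  ultimately show ?thesis using edge_props(6)[OF assms(2)] assms(3) by auto
qed

lemma face_cases: "F \<in> faces T \<Longrightarrow> x \<in> F \<Longrightarrow> x \<in> rel_interior F \<or> (\<exists>e\<in>edges_of T F. x \<in> e)"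
  using face_props(5)[of F] closure_subset[of F] by (auto simp: rel_frontier_def)

lemma face_face_disjoint:
  assumes "F \<in> faces T" "F' \<in> faces T" "F \<noteq> F'" "x \<in> rel_interior F" shows "x \<notin> F'"
  using face_cases[OF assms(2), of x] cells_disjoint[of F F'] face_edge_disjoint[OF assms(1) _ assms(4)] of_cells(1) assms by blast

text \<open>A relative interior point of the edge is not interior to the element, so it lies on a
  face, not in the relative interior of that face, and therefore on an edge of it, which can only be
  \<open>e\<close>. As a consequence, elements that share an inner node of an edge share its
  vertices.\<close>

lemma edge_subset_elem:
  assumes e: "e \<in> edges T" and K: "K \<in> elems T" and x: "x \<in> rel_interior e" "x \<in> K" shows "e \<subseteq> K"
proof -
  have "aff_dim K = 3" using interior_nonempty[OF K] aff_dim_nonempty_interior by fastforce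
  then have "e \<noteq> K" using edge_props(2)[OF e] by auto
  then have "rel_interior e \<inter> interior K = {}"
    using cells_disjoint[of e K] e K interior_nonempty[OF K] by (simp add: rel_interior_nonempty_interior)
  then have "x \<in> frontier K" using x closure_subset[of K] by (auto simp: frontier_def)
  then obtain F where F: "F \<in> faces_of T K" "x \<in> F" using elem_props(5)[OF K] by blast
  have Ff: "F \<in> faces T" by (rule of_cells(2)[OF F(1)])
  have "x \<notin> rel_interior F" using face_edge_disjoint[OF Ff e] x rel_interior_subset by blast
  then obtain e' where e': "e' \<in> edges_of T F" "x \<in> e'" using face_cases[OF Ff F(2)] by blast
  then have "e' = e" using edge_edge_disjoint[OF e of_cells(1)[OF e'(1)]] x by blast
  then show ?thesis using edges_of_subset[OF Ff e'(1)] faces_of_subset[OF K F(1)] by blast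
qed

lemma face_nonempty: "F \<in> faces T \<Longrightarrow> rel_interior F \<noteq> {}"
  using face_props(2,4)[of F] by (metis aff_dim_empty_eq closure_empty neg_equal_0_iff_equal numeral_eq_neg_one_iff numeral_neq_neg_one)

text \<open>The two half balls at a point of the relative interior of a face lie in elements, so three elements there would overlap.\<close>

lemma face_two_elems:
  assumes F: "F \<in> faces T" and K: "K1 \<in> elems T" "K2 \<in> elems T" "K3 \<in> elems T" "F \<in> faces_of T K1" "F \<in> faces_of T K2" "F \<in> faces_of T K3"
    and ne: "K1 \<noteq> K2"
  shows "K3 = K1 \<or> K3 = K2"
proof -
  obtain y where y: "y \<in> rel_interior F" using face_nonempty[OF F] by blast
  obtain a \<beta> where a: "a \<noteq> 0" "affine hull F = {x. a \<bullet> x = \<beta>}"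
    using aff_dim_eq_hyperplane[of F] face_props(2)[OF F] by auto
  have yF: "y \<in> F" using y rel_interior_subset by blast
  have cl: "closed (\<Union>(faces T - {F}))" using finite_cells face_props(1) by (intro closed_Union) (auto intro: compact_imp_closed)
  have "y \<in> - \<Union>(faces T - {F})" using face_face_disjoint[OF F _ _ y] by blast
  then obtain \<epsilon> where \<epsilon>: "\<epsilon> > 0" "ball y \<epsilon> \<subseteq> - \<Union>(faces T - {F})"
    using open_contains_ball[THEN iffD1, rule_format, OF open_Compl[OF cl]] by blast
  \<comment> \<open>The halves of a ball that meets no face other than \<open>F\<close>. A half
    avoids the whole frontier of an element with face \<open>F\<close>, so by connectedness it lies
    inside as soon as it contains one interior point of that element.\<close>
  define H where "H = (\<lambda>s::bool. ball y \<epsilon> \<inter> (if s then {z. a \<bullet> z < \<beta>} else {z. a \<bullet> z > \<beta>}))"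
  have "\<exists>s. H s \<subseteq> interior K" if K: "K \<in> elems T" "F \<in> faces_of T K" for K
  proof -
    have "y \<in> closure (interior K)" using elem_props(4)[OF K(1)] faces_of_subset[OF K] yF by blast
    moreover have "y \<in> ball y \<epsilon>" using \<epsilon>(1) by simp
    ultimately have "interior K \<inter> ball y \<epsilon> \<noteq> {}" using open_Int_closure_eq_empty[OF open_ball, of y \<epsilon> "interior K"] by blast
    moreover have "open (interior K \<inter> ball y \<epsilon>)" by blast
    ultimately have "\<not> negligible (interior K \<inter> ball y \<epsilon>)" using open_not_negligible by blast
    then have "\<not> interior K \<inter> ball y \<epsilon> \<subseteq> {x. a \<bullet> x = \<beta>}" using negligible_subset[OF negligible_hyperplane] a(1) by blast
    then obtain z where z: "z \<in> interior K" "z \<in> ball y \<epsilon>" "a \<bullet> z \<noteq> \<beta>" by blast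
    define s where "s = (a \<bullet> z < \<beta>)"
    have zs: "z \<in> H s" using z by (auto simp: H_def s_def)
    have "connected (H s)" unfolding H_def
      by (intro convex_connected convex_Int convex_ball) (auto simp: convex_halfspace_lt convex_halfspace_gt)
    moreover have "H s \<inter> frontier K = {}"
    proof -
      have "H s \<inter> F = {}" using hull_subset[of F affine] by (auto simp: a(2) H_def)
      moreover have "H s \<inter> G = {}" if "G \<in> faces_of T K" "G \<noteq> F" for G using \<epsilon>(2) of_cells(2)[OF that(1)] that(2) unfolding H_def by blast
      ultimately show ?thesis unfolding elem_props(5)[OF K(1)] by blast
    qed
    ultimately have "H s \<subseteq> K" using connected_Int_frontier[of "H s" K] z(1) zs interior_subset by blast
    then have "H s \<subseteq> interior K" using \<open>H s \<inter> frontier K = {}\<close> closure_subset[of K] by (auto simp: frontier_def)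
    then show ?thesis ..
  qed
  from this[OF K(1,4)] this[OF K(2,5)] this[OF K(3,6)]
  obtain s1 s2 s3 where s: "H s1 \<subseteq> interior K1" "H s2 \<subseteq> interior K2" "H s3 \<subseteq> interior K3" by blast
  have "H s \<noteq> {}" for s
  proof -
    have eq: "a \<bullet> y = \<beta>" using yF hull_subset[of F affine] a(2) by blast
    define t where "t = \<epsilon> / (2 * norm a)"
    have t: "t > 0" "t * norm a < \<epsilon>" using a(1) \<epsilon>(1) by (auto simp: t_def)
    have "y + (if s then - t else t) *\<^sub>R a \<in> H s"
      using t a(1) eq by (auto simp: H_def dist_norm inner_add_right inner_diff_right)
    then show ?thesis by blast
  qed
  note ne_H = this
  have same: "K = L" if "H s \<subseteq> interior K" "H s \<subseteq> interior L" "K \<in> elems T" "L \<in> elems T" for K L s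
    using interior_disjoint[OF that(3,4)] that(1,2) ne_H[of s] interior_subset[of L] by blast
  have "s1 \<noteq> s2" using same[OF s(1) _ K(1,2)] s(2) ne by blast
  then have "s3 = s1 \<or> s3 = s2" by blast
  then show ?thesis using same[OF s(3) _ K(3,1)] same[OF s(3) _ K(3,2)] s(1,2) by blast
qed

text \<open>If the segment from \<open>a\<close> hits an edge, its endpoint lies in the affine hull
  of \<open>a\<close> and that edge, of dimension at most two. Finitely many such null sets cannot
  cover a nonempty open set.\<close>

lemma segment_avoiding_edges:
  assumes V: "open V" "V \<noteq> {}" and a: "a \<notin> \<Union>(edges T)"
  shows "\<exists>v\<in>V. closed_segment a v \<inter> \<Union>(edges T) = {}"
proof (rule ccontr)
  assume neg: "\<not> ?thesis"
  have "V \<subseteq> (\<Union>e\<in>edges T. affine hull (insert a e))"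
  proof
    fix v assume "v \<in> V"
    then obtain e z where e: "e \<in> edges T" "z \<in> e" "z \<in> closed_segment a v" using neg by blast
    then obtain t where t: "z = (1 - t) *\<^sub>R a + t *\<^sub>R v" by (auto simp: closed_segment_def)
    have "t \<noteq> 0" using t e a by auto
    then have "v = (1 - 1/t) *\<^sub>R a + (1/t) *\<^sub>R z" unfolding t by (simp add: algebra_simps)
    moreover have "a \<in> affine hull (insert a e)" "z \<in> affine hull (insert a e)" using e by (auto intro: hull_inc)
    ultimately have "v \<in> affine hull (insert a e)" using mem_affine[OF affine_affine_hull, of a _ z "1 - 1/t" "1/t"] by simp
    then show "v \<in> (\<Union>e\<in>edges T. affine hull (insert a e))" using e by blast
  qed
  moreover have "negligible (affine hull (insert a e))" if e: "e \<in> edges T" for e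
  proof -
    have "aff_dim (insert a e) \<le> 2" using edge_props(2)[OF e] by (simp add: aff_dim_insert)
    then have "aff_dim (affine hull (insert a e)) < int DIM(real^3)" by simp
    then obtain b \<beta> where "b \<noteq> 0" "affine hull (insert a e) \<subseteq> {x. b \<bullet> x = \<beta>}" using aff_lowdim_subset_hyperplane by metis
    then show ?thesis using negligible_subset[OF negligible_hyperplane] by blast
  qed
  ultimately have "negligible V" using finite_cells(2) by (intro negligible_subset[of "\<Union>e\<in>edges T. affine hull (insert a e)" V] negligible_Union) auto
  then show False using open_not_negligible V by blast
qed

definition elems_at :: "real^3 \<Rightarrow> (real^3) set set" where "elems_at x = {K \<in> elems T. x \<in> K}"

definition link :: "real^3 \<Rightarrow> ((real^3) set \<times> (real^3) set) set" where
  "link x = {(K, L). K \<in> elems_at x \<and> L \<in> elems_at x \<and> K \<noteq> L \<and> (\<exists>F\<in>faces T. x \<in> F \<and> F \<in> faces_of T K \<and> F \<in> faces_of T L)}"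

text \<open>Split the elements at \<open>x\<close> into those reachable from \<open>E\<close> and
  the rest. Local connectedness of the domain yields a point common to both unions, but it may lie
  on an edge. A segment in general position near that point, running from one group to the other,
  changes group in the relative interior of a face, and this face links two elements of different
  groups.\<close>

lemma elems_linked:
  assumes \<Omega>: "polyhedral_domain \<Omega>" and E: "E \<in> elems_at x" and K: "K \<in> elems_at x"
  shows "(E, K) \<in> (link x)\<^sup>*"
proof (rule ccontr)
  assume neg: "\<not> ?thesis"
  define A where "A = {L \<in> elems_at x. (E, L) \<in> (link x)\<^sup>*}"
  define B where "B = elems_at x - A"
  have fin: "finite (elems_at x)" using finite_cells by (simp add: elems_at_def)
  have comp: "compact X" if "X \<in> edges T \<union> faces T \<union> elems T" for X using that edge_props(1) face_props(1) elem_props(1) by auto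
  have cl: "closed (\<Union>{X \<in> faces T \<union> elems T. x \<notin> X})"
    using finite_cells comp by (intro closed_Union) (auto intro: compact_imp_closed)
  have "x \<in> - \<Union>{X \<in> faces T \<union> elems T. x \<notin> X}" by blast
  then obtain r1 where r1: "r1 > 0" "ball x r1 \<subseteq> - \<Union>{X \<in> faces T \<union> elems T. x \<notin> X}"
    using open_contains_ball[THEN iffD1, rule_format, OF open_Compl[OF cl]] by blast
  have r1': "x \<in> X" if "z \<in> ball x r1" "X \<in> faces T \<union> elems T" "z \<in> X" for z X using r1(2) that by blast
  have "x \<in> closure \<Omega>" using E cells_cover by (auto simp: elems_at_def)
  have op: "open \<Omega>" "interior (closure \<Omega>) = \<Omega>" using \<Omega> unfolding polyhedral_domain_def by auto
  \<comment> \<open>At boundary points this is the local connectedness contained in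
    \<open>polyhedral_domain\<close>; elements touching only at such a point would otherwise not be
    linked.\<close>
  obtain r where r: "0 < r" "r \<le> r1" "connected (\<Omega> \<inter> ball x r)"
  proof (cases "x \<in> \<Omega>")
    case True
    then obtain r0 where "r0 > 0" "ball x r0 \<subseteq> \<Omega>" using open_contains_ball[THEN iffD1, rule_format, OF op(1)] by blast
    then have "\<Omega> \<inter> ball x (min r0 r1) = ball x (min r0 r1)" by auto
    then show ?thesis using that[of "min r0 r1"] \<open>r0 > 0\<close> r1 by simp
  next
    case False
    then have "x \<in> frontier \<Omega>" using \<open>x \<in> closure \<Omega>\<close> op by (simp add: frontier_def interior_open)
    then obtain r0 where r0: "r0 > 0" "\<And>r. 0 < r \<Longrightarrow> r < r0 \<Longrightarrow> connected (\<Omega> \<inter> ball x r)" using \<Omega> unfolding polyhedral_domain_def by blast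
    then show ?thesis using that[of "min (r0/2) r1"] r1 by simp
  qed
  define U where "U = \<Omega> \<inter> ball x r"
  have "open U" using op by (auto simp: U_def)
  have cover: "U \<subseteq> \<Union>A \<union> \<Union>B"
  proof
    fix z assume z: "z \<in> U"
    then have "z \<in> \<Union>(elems T)" using cells_cover closure_subset by (auto simp: U_def)
    then obtain X where "X \<in> elems T" "z \<in> X" by blast
    then have "X \<in> elems_at x" using r1'[of z X] z r(2) by (auto simp: U_def elems_at_def)
    then show "z \<in> \<Union>A \<union> \<Union>B" using \<open>z \<in> X\<close> by (auto simp: B_def)
  qed
  have AB: "A \<subseteq> elems T" "B \<subseteq> elems T" "finite A" "finite B"
    using finite_subset[OF _ fin, of A] finite_subset[OF _ fin, of B] by (auto simp: A_def B_def elems_at_def)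
  have clA: "closed (\<Union>A)" and clB: "closed (\<Union>B)" using AB comp by (auto intro!: closed_Union intro: compact_imp_closed)
  have int_ne: "interior L \<inter> W \<noteq> {}" if "L \<in> elems T" "open W" "z \<in> W" "z \<in> L" for L W z
    using that elem_props(4)[OF that(1)] open_Int_closure_eq_empty[of W "interior L"] by blast
  have int_\<Omega>: "interior L \<subseteq> \<Omega>" if "L \<in> elems T" for L
    using interior_mono[of L "closure \<Omega>"] cells_cover that op(2) by blast
  have meet: "\<Union>C \<inter> U \<noteq> {}" if L: "L \<in> C" "L \<in> elems_at x" for C L
  proof -
    have "interior L \<inter> ball x r \<noteq> {}" using int_ne[of L "ball x r" x] L r by (auto simp: elems_at_def)
    then show ?thesis using int_\<Omega>[of L] L interior_subset[of L] by (auto simp: U_def elems_at_def)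
  qed
  have EA: "E \<in> A" using E by (simp add: A_def)
  have KB: "K \<in> B" using K neg by (simp add: A_def B_def)
  have "connected U" using r(3) by (simp add: U_def)
  then obtain z where z: "z \<in> U" "z \<in> \<Union>A" "z \<in> \<Union>B"
    by (rule connected_closed_meet[OF _ clA clB cover meet[OF EA E] meet[OF KB K]])
  obtain \<epsilon> where \<epsilon>: "\<epsilon> > 0" "ball z \<epsilon> \<subseteq> U" using open_contains_ball[THEN iffD1, rule_format, OF \<open>open U\<close> z(1)] by blast
  obtain KA KB where KA: "KA \<in> A" "z \<in> KA" and KB: "KB \<in> B" "z \<in> KB" using z by blast
  have "interior KA \<inter> ball z \<epsilon> \<noteq> {}" using int_ne[of KA "ball z \<epsilon>" z] KA AB \<epsilon> by auto
  moreover have "negligible (\<Union>(edges T))"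
  proof (rule negligible_Union)
    fix e assume e: "e \<in> edges T"
    have "aff_dim e < int DIM(real^3)" using edge_props(2)[OF e] by simp
    then obtain b \<beta> where "b \<noteq> 0" "e \<subseteq> {x. b \<bullet> x = \<beta>}" using aff_lowdim_subset_hyperplane by metis
    then show "negligible e" using negligible_subset[OF negligible_hyperplane] by blast
  qed (rule finite_cells)
  ultimately have "\<not> interior KA \<inter> ball z \<epsilon> \<subseteq> \<Union>(edges T)"
    using open_not_negligible[of "interior KA \<inter> ball z \<epsilon>"] negligible_subset by blast
  then obtain a where a: "a \<in> interior KA" "a \<in> ball z \<epsilon>" "a \<notin> \<Union>(edges T)" by blast
  have "interior KB \<inter> ball z \<epsilon> \<noteq> {}" using int_ne[of KB "ball z \<epsilon>" z] KB AB \<epsilon> by auto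
  from segment_avoiding_edges[OF open_Int[OF open_interior open_ball] this a(3)]
  obtain v where v: "v \<in> interior KB" "v \<in> ball z \<epsilon>" "closed_segment a v \<inter> \<Union>(edges T) = {}" by auto
  have sU: "closed_segment a v \<subseteq> U" using \<epsilon>(2) a(2) v(2) closed_segment_subset[OF a(2) v(2) convex_ball] by blast
  have "a \<in> \<Union>A" "v \<in> \<Union>B" using a v KA KB interior_subset by blast+
  then have "\<Union>A \<inter> closed_segment a v \<noteq> {}" "\<Union>B \<inter> closed_segment a v \<noteq> {}" using ends_in_segment[of a v] by blast+
  with connected_closed_meet[OF connected_segment(1) clA clB order_trans[OF sU cover]]
  obtain y where y: "y \<in> closed_segment a v" "y \<in> \<Union>A" "y \<in> \<Union>B" by metis
  then obtain L1 L2 where L: "L1 \<in> A" "y \<in> L1" "L2 \<in> B" "y \<in> L2" by blast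
  have ne: "L1 \<noteq> L2" using L by (auto simp: B_def)
  have LT: "L1 \<in> elems T" "L2 \<in> elems T" using L AB by auto
  have "y \<notin> interior L1" "y \<notin> interior L2" using interior_disjoint[OF LT ne] interior_disjoint[OF LT(2,1)] ne L by blast+
  then have "y \<in> frontier L1" "y \<in> frontier L2" using L closure_subset by (auto simp: frontier_def)
  then obtain F1 F2 where F: "F1 \<in> faces_of T L1" "y \<in> F1" "F2 \<in> faces_of T L2" "y \<in> F2" using LT elem_props(5) by blast
  have FT: "F1 \<in> faces T" "F2 \<in> faces T" using F of_cells(2) by auto
  have "y \<in> rel_interior F1" using face_cases[OF FT(1) F(2)] of_cells(1) v(3) y(1) by blast
  then have "F1 = F2" using face_face_disjoint[OF FT] F by blast
  moreover have "x \<in> F1" using r1'[of y F1] FT F y(1) sU r(2) by (auto simp: U_def)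
  ultimately have "(L1, L2) \<in> link x" using L ne F FT by (auto simp: link_def A_def B_def)
  then have "(E, L2) \<in> (link x)\<^sup>*" using L(1) by (auto simp: A_def)
  then show False using L(3) by (auto simp: A_def B_def)
qed

end

section \<open>Gauss-Lobatto nodes\<close>

text \<open>Rolle's theorem between neighbouring zeros. The induction removes the largest zero and
  shortens the interval to the next one, so that the zero gained last differs from the earlier
  ones.\<close>

lemma Rolle_card:
  fixes f :: "real poly"
  assumes "finite R" "card R = Suc m" "\<And>x. x \<in> R \<Longrightarrow> a \<le> x \<and> x \<le> b \<and> poly f x = 0"
  shows "\<exists>R'. finite R' \<and> card R' = m \<and> (\<forall>x\<in>R'. a < x \<and> x < b \<and> poly (pderiv f) x = 0)"
  using assms
proof (induction m arbitrary: R b)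
  case 0 then show ?case by (intro exI[of _ "{}"]) auto
next
  case (Suc m)
  define t where "t = Max R"
  have ne: "R \<noteq> {}" using Suc.prems by auto
  have t: "t \<in> R" unfolding t_def by (rule Max_in[OF Suc.prems(1) ne])
  define R0 where "R0 = R - {t}"
  have R0: "finite R0" "card R0 = Suc m" using Suc.prems t by (auto simp: R0_def)
  define s where "s = Max R0"
  have ne0: "R0 \<noteq> {}" using R0 by auto
  have s: "s \<in> R0" unfolding s_def by (rule Max_in[OF R0(1) ne0])
  have "s \<le> t" unfolding t_def using s Suc.prems(1) by (auto simp: R0_def)
  then have st: "s < t" using s by (auto simp: R0_def order.order_iff_strict)
  have "a \<le> x \<and> x \<le> s \<and> poly f x = 0" if "x \<in> R0" for x
    using that Suc.prems(3)[of x] Max_ge[OF R0(1) that] by (auto simp: R0_def s_def)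
  from Suc.IH[OF R0 this] obtain R' where R': "finite R'" "card R' = m" "\<forall>x\<in>R'. a < x \<and> x < s \<and> poly (pderiv f) x = 0" by blast
  have roots: "poly f s = 0" "poly f t = 0" "a \<le> s" "t \<le> b" using s t Suc.prems(3) by (auto simp: R0_def)
  then obtain x where x: "s < x" "x < t" "poly (pderiv f) x = 0" using poly_MVT[OF st, of f] st by auto
  have "\<forall>y\<in>insert x R'. a < y \<and> y < b \<and> poly (pderiv f) y = 0" using R'(3) x roots by auto
  moreover have "card (insert x R') = Suc m" using R' x by (subst card_insert_disjoint) auto
  ultimately show ?case using R'(1) by (intro exI[of _ "insert x R'"]) auto
qed

text \<open>By Rodrigues' formula: the derivative of order \<open>j < k\<close> of
  \<open>(t^2 - 1)^k\<close> still vanishes at both endpoints, so each differentiation gains an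
  inner zero. From order \<open>k\<close> to \<open>k + 1\<close> the endpoints no longer help and
  one zero is lost; the degree \<open>k - 1\<close> excludes any others.\<close>

lemma legendre_pderiv_roots:
  assumes "k \<ge> 1"
  shows "finite {t. poly (pderiv (legendre k)) t = 0}" "card {t. poly (pderiv (legendre k)) t = 0} = k - 1"
    "poly (pderiv (legendre k)) t = 0 \<Longrightarrow> -1 < t \<and> t < 1"
proof -
  define q where "q = [:-1, 0, 1::real:]"
  define D where "D j = (pderiv ^^ j) (q ^ k)" for j
  have D_Suc: "D (Suc j) = pderiv (D j)" for j by (simp add: D_def)
  have dvd: "j \<le> k \<Longrightarrow> q ^ (k - j) dvd D j" for j
  proof (induction j)
    case (Suc j)
    then obtain u where u: "D j = q ^ (k - j) * u" by (auto elim: dvdE)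
    obtain n where n: "k - j = Suc n" "k - Suc j = n" using Suc.prems by (metis Suc_diff_Suc Suc_le_lessD diff_Suc_eq_diff_pred)
    have "D (Suc j) = q ^ n * (smult (of_nat (Suc n)) (u * pderiv q) + q * pderiv u)"
      unfolding D_Suc u n(1) pderiv_mult pderiv_power_Suc by (simp add: algebra_simps)
    then show ?case unfolding n(2) by simp
  qed (simp add: D_def)
  have end_root: "poly (D j) t = 0" if "j < k" "t = 1 \<or> t = -1" for j t
  proof -
    have "poly (q ^ (k - j)) t = 0" using that by (auto simp: q_def poly_power)
    then show ?thesis using dvd[of j] that(1) by (auto elim!: dvdE)
  qed
  have inner: "j \<le> k \<Longrightarrow> \<exists>R. finite R \<and> card R = j \<and> (\<forall>x\<in>R. -1 < x \<and> x < 1 \<and> poly (D j) x = 0)" for j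
  proof (induction j)
    case (Suc j)
    then obtain R where R: "finite R" "card R = j" "\<forall>x\<in>R. -1 < x \<and> x < 1 \<and> poly (D j) x = 0" by auto
    have "card (insert 1 (insert (-1) R)) = Suc (Suc j)" using R by (subst card_insert_disjoint; (subst card_insert_disjoint)?) auto
    moreover have "-1 \<le> x \<and> x \<le> 1 \<and> poly (D j) x = 0" if "x \<in> insert 1 (insert (-1) R)" for x
      using that R(3) end_root[of j x] Suc.prems by fastforce
    ultimately show ?case unfolding D_Suc using R(1) by (intro Rolle_card) auto
  qed (auto intro: exI[of _ "{}"])
  have degD: "degree (D j) = 2 * k - j" for j
  proof (induction j)
    case 0 show ?case by (simp add: D_def degree_power_eq q_def)
  qed (simp add: D_Suc degree_pderiv)
  obtain R where R: "finite R" "card R = k" "\<forall>x\<in>R. -1 < x \<and> x < 1 \<and> poly (D k) x = 0" using inner[of k] by auto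
  obtain m where m: "k = Suc m" using assms by (metis Suc_le_D One_nat_def)
  have "\<And>x. x \<in> R \<Longrightarrow> -1 \<le> x \<and> x \<le> 1 \<and> poly (D k) x = 0" using R(3) by auto
  from Rolle_card[OF R(1) R(2)[unfolded m] this]
  obtain R' where R': "finite R'" "card R' = m" "\<forall>x\<in>R'. -1 < x \<and> x < 1 \<and> poly (D (Suc k)) x = 0" by (auto simp: D_Suc)
  have "\<And>x. x \<in> R' \<Longrightarrow> - 1 < x \<and> x < 1" using R' by auto
  define c where "c = (1 / (2 ^ k * fact k) :: real)"
  have c: "c \<noteq> 0" by (simp add: c_def)
  have P: "pderiv (legendre k) = smult c (D (Suc k))" by (simp add: legendre_def D_def q_def c_def pderiv_smult)
  have nz: "D (Suc k) \<noteq> 0"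
  proof
    assume "D (Suc k) = 0"
    then have "degree (D k) = 0" unfolding D_Suc by (simp add: pderiv_eq_0_iff)
    then show False using degD[of k] assms by simp
  qed
  have sub: "R' \<subseteq> {t. poly (D (Suc k)) t = 0}" using R' by auto
  have "card {t. poly (D (Suc k)) t = 0} \<le> m" using card_poly_roots_bound[OF nz] degD[of "Suc k"] m by simp
  then have eq: "R' = {t. poly (D (Suc k)) t = 0}"
    using card_seteq[OF poly_roots_finite[OF nz] sub] R'(2) by simp
  have Z: "{t. poly (pderiv (legendre k)) t = 0} = R'" unfolding P using c by (simp add: eq)
  show "finite {t. poly (pderiv (legendre k)) t = 0}" "card {t. poly (pderiv (legendre k)) t = 0} = k - 1"
    unfolding Z using R' m by auto
  show "-1 < t \<and> t < 1" if "poly (pderiv (legendre k)) t = 0" using Z that R'(3) by blast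
qed

text \<open>Endpoints and inner nodes are \<open>k + 1\<close> distinct points, so \<open>f\<close>
  is its own Lagrange interpolant; the basis polynomials are bounded on the compact interval, with
  bounds depending on \<open>k\<close> only.\<close>

lemma gauss_lobatto_bound:
  assumes k: "k \<ge> 1"
  shows "\<exists>C>0. \<forall>f m. degree f \<le> k \<longrightarrow> \<bar>poly f (-1)\<bar> \<le> m \<longrightarrow> \<bar>poly f 1\<bar> \<le> m \<longrightarrow>
     (\<forall>t. poly (pderiv (legendre k)) t = 0 \<longrightarrow> \<bar>poly f t\<bar> \<le> m) \<longrightarrow> (\<forall>t\<in>{-1..1}. \<bar>poly f t\<bar> \<le> C * m)"
proof -
  define I where "I = insert (-1) (insert 1 {t. poly (pderiv (legendre k)) t = 0})"
  note Z = legendre_pderiv_roots[OF k]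
  have fI: "finite I" using Z by (simp add: I_def)
  have "card I = Suc (Suc (k - 1))" unfolding I_def Z(2)[symmetric]
  proof -
    have "1 \<notin> {t. poly (pderiv (legendre k)) t = 0}" "-1 \<notin> insert 1 {t. poly (pderiv (legendre k)) t = 0}"
      using Z(3)[of 1] Z(3)[of "-1"] by auto
    then show "card (insert (-1) (insert 1 {t. poly (pderiv (legendre k)) t = 0})) = Suc (Suc (card {t. poly (pderiv (legendre k)) t = 0}))"
      using Z(1) by (metis card_insert_disjoint finite_insert)
  qed
  then have "card I = Suc k" using k by simp
  then obtain L where L: "\<And>f. degree f \<le> k \<Longrightarrow> f = (\<Sum>i\<in>I. smult (poly f i) (L i))"
    using lagrange_basis[OF fI] by metis
  have "\<exists>B>0. \<forall>t\<in>{-1..1}. \<bar>poly (L i) t\<bar> \<le> B" for i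
  proof -
    have "compact (poly (L i) ` {-1..1})" by (intro compact_continuous_image continuous_intros) auto
    then obtain B where "B > 0" "\<forall>x\<in>poly (L i) ` {-1..1}. norm x \<le> B" using compact_imp_bounded bounded_pos by blast
    then show ?thesis by auto
  qed
  then obtain B where B: "\<And>i. B i > 0" "\<And>i t. t \<in> {-1..1} \<Longrightarrow> \<bar>poly (L i) t\<bar> \<le> B i" by metis
  show ?thesis
  proof (intro exI[of _ "1 + (\<Sum>i\<in>I. B i)"] conjI allI impI ballI)
    show "0 < 1 + (\<Sum>i\<in>I. B i)" using B(1) by (intro add_pos_nonneg sum_nonneg) (auto intro: less_imp_le)
    fix f m t assume f: "degree f \<le> k" and m: "\<bar>poly f (-1)\<bar> \<le> m" "\<bar>poly f 1\<bar> \<le> m" "\<forall>t. poly (pderiv (legendre k)) t = 0 \<longrightarrow> \<bar>poly f t\<bar> \<le> m" and t: "t \<in> {-1..1::real}"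
    have "poly f t = (\<Sum>i\<in>I. poly f i * poly (L i) t)" using arg_cong[OF L[OF f], of "\<lambda>p. poly p t"] by (simp add: poly_sum)
    also have "\<bar>\<dots>\<bar> \<le> (\<Sum>i\<in>I. m * B i)"
    proof (rule order_trans[OF sum_abs sum_mono])
      fix i assume "i \<in> I"
      then have "\<bar>poly f i\<bar> \<le> m" using m by (auto simp: I_def)
      then show "\<bar>poly f i * poly (L i) t\<bar> \<le> m * B i" unfolding abs_mult using B(2)[OF t] by (intro mult_mono) auto
    qed
    also have "\<dots> \<le> (1 + (\<Sum>i\<in>I. B i)) * m" using m(1) by (simp add: sum_distrib_left[symmetric] algebra_simps)
    finally show "\<bar>poly f t\<bar> \<le> (1 + (\<Sum>i\<in>I. B i)) * m" .
  qed
qed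

section \<open>Jumps and degrees of freedom\<close>

lemma avg_diff_bound:
  fixes a :: "'a \<Rightarrow> real"
  assumes W: "finite W" "W \<noteq> {}" and h: "0 \<le> h" and a: "\<And>K. K \<in> W \<Longrightarrow> \<bar>a0 - a K\<bar> \<le> \<beta>"
  shows "\<bar>h * a0 - (\<Sum>K\<in>W. h * a K) / card W\<bar> \<le> h * \<beta>"
proof -
  have c: "real (card W) > 0" using W by (simp add: card_gt_0_iff)
  have "h * a0 - (\<Sum>K\<in>W. h * a K) / card W = (\<Sum>K\<in>W. h * (a0 - a K)) / card W"
    using c by (simp add: right_diff_distrib sum_subtractf field_simps)
  also have "\<bar>\<dots>\<bar> \<le> (\<Sum>K\<in>W. h * \<beta>) / card W"
    unfolding abs_divide using c h a by (intro divide_mono order_trans[OF sum_abs] sum_mono) (auto simp: abs_mult intro: mult_left_mono)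
  also have "\<dots> = h * \<beta>" using c by simp
  finally show ?thesis .
qed

lemma Polys_isom:
  fixes \<phi> :: "real^'m::finite \<Rightarrow> real^'n::finite"
  assumes "isom \<phi>" "q \<in> Polys k" shows "(\<lambda>y. q (\<phi> y)) \<in> Polys k"
  using Polys_affine[OF assms(2) isom_linear(1)[OF assms(1)], of "\<phi> 0"] by simp

definition face_sup_stable :: "real \<Rightarrow> nat \<Rightarrow> (real^3) set \<Rightarrow> bool" where
  "face_sup_stable C k F \<longleftrightarrow> (\<forall>q\<in>Polys k. \<forall>y\<in>flat F F. (q (face_chart F y))^2 * (diameter F)^2 \<le> C * (face_L2_norm F q)^2)"

text \<open>The L2 bound for polynomials in the plane of the face: all of the face lies within one
  diameter of the star centre, and dimension two gives the square of the diameter.\<close>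

lemma polyhedral_face_sup_bound:
  fixes \<rho> :: real
  assumes \<rho>: "0 < \<rho>" "\<rho> \<le> 1"
  shows "\<exists>C>0. \<forall>\<Omega> T F r. conforming_mesh \<Omega> T \<longrightarrow> F \<in> faces T \<longrightarrow> star_shaped_wrt_ball F r \<longrightarrow> \<rho> * diameter F \<le> r \<longrightarrow> face_sup_stable C k F"
proof -
  obtain C where C: "C > 0" and Cb: "\<And>q (c::real^2) z h. q \<in> Polys k \<Longrightarrow> h > 0 \<Longrightarrow> dist c z \<le> 1 * h \<Longrightarrow>
     (q z)^2 * h ^ CARD(2) \<le> C * (LINT x:ball c (\<rho> * h)|lebesgue. (q x)^2)"
    using Polys_bound_by_L2[OF \<rho>(1), of 1 k, where 'n=2] by auto
  show ?thesis unfolding face_sup_stable_def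
  proof (intro exI[of _ C] conjI C allI impI ballI)
    fix \<Omega> T F r y and q :: "real^3 \<Rightarrow> real"
    assume "conforming_mesh \<Omega> T" and F: "F \<in> faces T" and r: "star_shaped_wrt_ball F r" "\<rho> * diameter F \<le> r"
      and q: "q \<in> Polys k" and y: "y \<in> flat F F"
    then interpret conforming \<Omega> T by unfold_locales
    obtain c where c: "face_cell T \<rho> F c" using face_star_cell[OF F r \<rho>] by blast
    note sc = star_cell.compact_D[OF c] and sub = star_cell.D_subset[OF c] star_cell.ball_subset[OF c]
    note d = flat_facts(2)[OF F]
    let ?q = "\<lambda>y. q (face_chart F y)"
    have qP: "?q \<in> Polys k" by (rule Polys_isom[OF face_chart_spec(1)[OF F] q])
    have "dist c y \<le> 1 * diameter F" using sub(1) y d by auto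
    from Cb[OF qP star_cell.h_pos[OF c, unfolded d] this]
    have "(q (face_chart F y))^2 * (diameter F)^2 \<le> C * (LINT x:ball c (\<rho> * diameter F)|lebesgue. (?q x)^2)" by simp
    also have "(LINT x:ball c (\<rho> * diameter F)|lebesgue. (?q x)^2) \<le> (LINT x:flat F F|lebesgue. (?q x)^2)"
      unfolding set_lebesgue_integral_def
    proof (rule integral_mono)
      have c: "continuous_on UNIV (\<lambda>x. (?q x)^2)" by (intro continuous_intros continuous_on_Polys[OF qP])
      show "integrable lebesgue (\<lambda>x. indicat_real (ball c (\<rho> * diameter F)) x *\<^sub>R (?q x)^2)"
        using set_integrable_continuous[OF c, of "ball c (\<rho> * diameter F)"] by (simp add: set_integrable_def)
      show "integrable lebesgue (\<lambda>x. indicat_real (flat F F) x *\<^sub>R (?q x)^2)"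
        using set_integrable_continuous[OF c, of "flat F F"] sc lmeasurable_compact[OF sc]
        by (simp add: set_integrable_def compact_imp_bounded)
      show "indicat_real (ball c (\<rho> * diameter F)) x *\<^sub>R (?q x)^2 \<le> indicat_real (flat F F) x *\<^sub>R (?q x)^2" for x
        using sub(2) d by (auto simp: indicator_def)
    qed
    also have "(LINT x:flat F F|lebesgue. (?q x)^2) = (face_L2_norm F q)^2"
      unfolding face_L2_norm_def face_integral_def
      by (subst real_sqrt_pow2) (auto simp: set_lebesgue_integral_def intro!: integral_nonneg_AE)
    finally show "(q (face_chart F y))^2 * (diameter F)^2 \<le> C * (face_L2_norm F q)^2" using C by simp
  qed
qed

lemma rtrancl_bounded_relpow:
  assumes "finite R" "(x, y) \<in> R\<^sup>*" "card R \<le> N" obtains n where "n \<le> N" "(x, y) \<in> R ^^ n"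
  using assms rtrancl_finite_eq_relpow[OF assms(1)] by (auto intro: order_trans)

text \<open>The constants of the regularity assumption, frozen for one mesh. \<open>Nlink\<close>
  and \<open>\<kappa>\<close> below are functions of \<open>\<rho>\<close> and \<open>Cq\<close>
  alone, hence uniform over the family.\<close>

locale shape_regular_mesh = conforming +
  fixes \<rho> Cq :: real
  assumes domain: "polyhedral_domain \<Omega>" and \<rho>: "0 < \<rho>" "\<rho> \<le> 1" and Cq: "1 \<le> Cq"
    and star_elem: "\<And>K. K \<in> elems T \<Longrightarrow> \<exists>r\<ge>\<rho> * diameter K. star_shaped_wrt_ball K r"
    and star_face: "\<And>K F. K \<in> elems T \<Longrightarrow> F \<in> faces_of T K \<Longrightarrow> \<exists>r\<ge>\<rho> * diameter F. star_shaped_wrt_ball F r"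
    and face_diameter: "\<And>K F. K \<in> elems T \<Longrightarrow> F \<in> faces_of T K \<Longrightarrow> \<rho> * diameter K \<le> diameter F"
    and quasi_uniform: "\<And>K L. adjacent T K L \<Longrightarrow> diameter K \<le> Cq * diameter L"
begin

lemma diameter_pos: "K \<in> elems T \<Longrightarrow> diameter K > 0"
  using diameter_pos_interior[of K] interior_nonempty elem_props(1) by (auto intro: compact_imp_bounded)

text \<open>Shrinking the balls of the elements at \<open>x\<close> towards \<open>x\<close> gives disjoint balls of equal radius in a ball around \<open>x\<close>.\<close>

lemma card_elems_at: "real (card (elems_at x)) \<le> (2 / \<rho>) ^ 3"
proof (cases "elems_at x = {}")
  case False
  have fin: "finite (elems_at x)" using finite_cells by (simp add: elems_at_def)
  have WT: "K \<in> elems T" "x \<in> K" if "K \<in> elems_at x" for K using that by (auto simp: elems_at_def)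
  define \<delta> where "\<delta> = Min (diameter ` elems_at x)"
  have \<delta>le: "\<delta> \<le> diameter K" if "K \<in> elems_at x" for K unfolding \<delta>_def using fin that by (intro Min_le) auto
  have \<delta>: "\<delta> > 0" unfolding \<delta>_def using fin False diameter_pos WT by (subst Min_gr_iff) auto
  have "\<exists>z. ball z (\<rho> * \<delta>) \<subseteq> interior K \<and> ball z (\<rho> * \<delta>) \<subseteq> ball x (2 * \<delta>)" if K: "K \<in> elems_at x" for K
  proof -
    obtain r c where r: "star_shaped_wrt_ball K r" "\<rho> * diameter K \<le> r"
      using star_elem[OF WT(1)[OF K]] by blast
    obtain c where c: "elem_cell T \<rho> K c" using elem_star_cell[OF WT(1)[OF K] r \<rho>] by blast
    \<comment> \<open>The homothety with centre \<open>x\<close> and ratio \<open>t\<close> shrinks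
      the star ball of \<open>K\<close> to the common radius \<open>\<rho> * \<delta>\<close>; its
      image stays in \<open>K\<close> because \<open>K\<close> contains the segments from
      \<open>x\<close> to star centres.\<close>
    define t where "t = \<delta> / diameter K"
    have t: "0 < t" "t \<le> 1" "t * diameter K = \<delta>" using \<delta> \<delta>le[OF K] star_cell.h_pos[OF c] by (auto simp: t_def)
    define z where "z = x + t *\<^sub>R (c - x)"
    have "ball z (\<rho> * \<delta>) \<subseteq> K"
    proof
      fix w assume w: "w \<in> ball z (\<rho> * \<delta>)"
      define b where "b = x + (1 / t) *\<^sub>R (w - x)"
      have "t *\<^sub>R (b - c) = w - z" using t by (simp add: b_def z_def algebra_simps)
      then have "t * dist c b = dist z w" using t by (metis abs_of_pos dist_commute dist_norm norm_scaleR)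
      also have "\<dots> < t * (\<rho> * diameter K)" using w t by (simp add: mult.left_commute)
      finally have b: "b \<in> ball c (\<rho> * diameter K)" using t by simp
      have "w = (1 - t) *\<^sub>R x + t *\<^sub>R b" using t by (simp add: b_def algebra_simps)
      then have "w \<in> closed_segment x b" using t by (auto simp: closed_segment_def)
      then show "w \<in> K" using star_cell.star[OF c b WT(2)[OF K]] by blast
    qed
    moreover have "ball z (\<rho> * \<delta>) \<subseteq> ball x (2 * \<delta>)"
    proof
      fix w assume w: "w \<in> ball z (\<rho> * \<delta>)"
      have "dist c x \<le> diameter K" using star_cell.D_subset[OF c] WT(2)[OF K] by auto
      then have "dist x z \<le> \<delta>" using t mult_left_mono[of "dist c x" "diameter K" t] by (simp add: z_def dist_norm norm_minus_commute)
      moreover have "\<rho> * \<delta> \<le> 1 * \<delta>" using \<rho> \<delta> by (intro mult_right_mono) auto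
      then have "dist z w < \<delta>" using w by simp
      ultimately show "w \<in> ball x (2 * \<delta>)" using dist_triangle[of x w z] by simp
    qed
    ultimately show ?thesis by (meson interior_maximal open_ball)
  qed
  then obtain z where z: "\<And>K. K \<in> elems_at x \<Longrightarrow> ball (z K) (\<rho> * \<delta>) \<subseteq> interior K" "\<And>K. K \<in> elems_at x \<Longrightarrow> ball (z K) (\<rho> * \<delta>) \<subseteq> ball x (2 * \<delta>)"
    by metis
  have "real (card (elems_at x)) * (\<rho> * \<delta>) ^ DIM(real^3) \<le> (2 * \<delta>) ^ DIM(real^3)"
  proof (rule card_disjoint_balls[OF fin _ _ z(2)])
    show "ball (z K) (\<rho> * \<delta>) \<inter> ball (z L) (\<rho> * \<delta>) = {}" if "K \<in> elems_at x" "L \<in> elems_at x" "K \<noteq> L" for K L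
      using z(1)[OF that(1)] z(1)[OF that(2)] interior_disjoint[OF WT(1)[OF that(1)] WT(1)[OF that(2)] that(3)] interior_subset[of L] by blast
  qed (use \<rho> \<delta> in auto)
  then have "real (card (elems_at x)) * \<rho> ^ 3 \<le> 2 ^ 3" using \<delta> by (simp add: power_mult_distrib)
  then show ?thesis using \<rho> by (simp add: power_divide field_simps)
qed (use \<rho> in simp)

text \<open>Reachability in a finite relation needs at most as many steps as the relation has pairs,
  and \<open>link x\<close> has at most the square of the number of elements at
  \<open>x\<close>.\<close>

definition Nlink :: nat where "Nlink = nat \<lceil>((2 / \<rho>) ^ 3)^2\<rceil>"

definition \<kappa> :: real where "\<kappa> = Cq ^ Nlink"

lemma \<kappa>: "1 \<le> \<kappa>" using Cq by (simp add: \<kappa>_def)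

lemma link_chain:
  assumes "E \<in> elems_at x" "K \<in> elems_at x"
  obtains n where "n \<le> Nlink" "(E, K) \<in> link x ^^ n"
proof (rule rtrancl_bounded_relpow[OF _ elems_linked[OF domain assms]])
  have fin: "finite (elems_at x)" using finite_cells by (simp add: elems_at_def)
  have sub: "link x \<subseteq> elems_at x \<times> elems_at x" by (auto simp: link_def)
  show "finite (link x)" using finite_subset[OF sub] fin by simp
  have "card (link x) \<le> card (elems_at x) * card (elems_at x)"
    using card_mono[OF _ sub] fin by (simp add: card_cartesian_product)
  then have "real (card (link x)) \<le> (real (card (elems_at x)))^2" unfolding power2_eq_square of_nat_mult[symmetric] of_nat_le_iff .
  also have "\<dots> \<le> ((2 / \<rho>) ^ 3)^2" using card_elems_at by (intro power_mono) auto
  finally show "card (link x) \<le> Nlink" unfolding Nlink_def by linarith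
qed

lemma link_diameter:
  assumes "(E, K) \<in> link x ^^ n" shows "diameter E \<le> Cq ^ n * diameter K"
  using assms
proof (induction n arbitrary: K)
  case (Suc n)
  then obtain L where L: "(E, L) \<in> link x ^^ n" "(L, K) \<in> link x" by auto
  have "adjacent T L K" using L(2) by (auto simp: link_def adjacent_def elems_at_def)
  have "diameter E \<le> Cq ^ n * diameter L" by (rule Suc.IH[OF L(1)])
  also have "\<dots> \<le> Cq ^ n * (Cq * diameter K)" using quasi_uniform[OF \<open>adjacent T L K\<close>] Cq by (intro mult_left_mono) auto
  finally show ?case by (simp add: mult_ac)
qed simp

lemma diameter_comparable:
  assumes "E \<in> elems_at x" "K \<in> elems_at x" shows "diameter E \<le> \<kappa> * diameter K"
proof -
  obtain n where n: "n \<le> Nlink" "(E, K) \<in> link x ^^ n" using link_chain[OF assms] .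
  have "Cq ^ n \<le> \<kappa>" unfolding \<kappa>_def using Cq n(1) by (intro power_increasing) auto
  moreover have "diameter K \<ge> 0" using diameter_pos[of K] assms by (auto simp: elems_at_def)
  ultimately show ?thesis using link_diameter[OF n(2)] mult_right_mono by (metis order_trans)
qed

lemma link_chain_bound:
  fixes a :: "(real^3) set \<Rightarrow> real"
  assumes "E \<in> elems_at x" "K \<in> elems_at x" and B: "0 \<le> B" "\<And>K L. (K, L) \<in> link x \<Longrightarrow> \<bar>a K - a L\<bar> \<le> B"
  shows "\<bar>a E - a K\<bar> \<le> real Nlink * B"
proof -
  obtain n where n: "n \<le> Nlink" "(E, K) \<in> link x ^^ n" using link_chain[OF assms(1,2)] .
  from n(2) have "\<bar>a E - a K\<bar> \<le> real n * B"
  proof (induction n arbitrary: K)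
    case (Suc n)
    then obtain L where L: "(E, L) \<in> link x ^^ n" "(L, K) \<in> link x" by auto
    show ?case using Suc.IH[OF L(1)] B(2)[OF L(2)] by (simp add: algebra_simps)
  qed simp
  also have "\<dots> \<le> real Nlink * B" using n(1) B(1) by (intro mult_right_mono) auto
  finally show ?thesis .
qed

text \<open>\<open>face_sides\<close> is an arbitrary choice, but a face belongs to at most two
  elements, so only the sign of the jump is left open; the norms do not see it.\<close>

lemma jump_sides:
  assumes "F \<in> faces T" "K \<in> elems T" "L \<in> elems T" "K \<noteq> L" "F \<in> faces_of T K" "F \<in> faces_of T L"
  shows "jump T p F = (\<lambda>x. p K x - p L x) \<or> jump T p F = (\<lambda>x. p L x - p K x)"
proof -
  let ?Q = "\<lambda>(Ep, Em). Ep \<in> elems T \<and> Em \<in> elems T \<and> Ep \<noteq> Em \<and> F \<in> faces_of T Ep \<and> F \<in> faces_of T Em"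
  have "?Q (face_sides T F)" unfolding face_sides_def by (rule someI[of ?Q "(K, L)"]) (use assms in auto)
  then obtain Ep Em where s: "face_sides T F = (Ep, Em)" "Ep \<in> elems T" "Em \<in> elems T" "Ep \<noteq> Em" "F \<in> faces_of T Ep" "F \<in> faces_of T Em"
    by (cases "face_sides T F") auto
  have "Ep = K \<or> Ep = L" "Em = K \<or> Em = L" using face_two_elems[OF assms(1-3) _ assms(5,6) _ assms(4)] s by blast+
  then show ?thesis unfolding jump_def[abs_def] s(1) using s(4) by auto
qed

text \<open>A face is bounded in its plane, so it has a nonempty relative boundary, hence an edge
  and a vertex, and both elements contain that vertex.\<close>

lemma elem_patch_faces:
  assumes "K \<in> elems T" "L \<in> elems T" "F \<in> faces_of T K" "F \<in> faces_of T L"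
  shows "L \<in> elem_patch T K"
proof -
  have F: "F \<in> faces T" by (rule of_cells(2)[OF assms(3)])
  have "frontier (flat F F) \<noteq> {}"
    using flat_facts(1,3)[OF F] not_bounded_UNIV by (auto simp: frontier_eq_empty dest: compact_imp_bounded)
  then obtain e where e: "e \<in> edges_of T F" unfolding flat_facts(4)[OF F] by blast
  obtain a b where "a \<in> verts T" "e = closed_segment a b" using edge_segment[OF of_cells(1)[OF e]] by metis
  then show ?thesis using edges_of_subset[OF F e] faces_of_subset[OF assms(1,3)] faces_of_subset[OF assms(2,4)] assms(2)
    unfolding elem_patch_def by auto
qed

end

lemma gauss_lobatto_inner_param:
  assumes "k \<ge> 1" "x \<in> gauss_lobatto_inner k (closed_segment a b)" "a \<noteq> b"
  shows "x \<in> open_segment a b"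
proof -
  obtain a' b' t where x: "x = ((1 - t) / 2) *\<^sub>R a' + ((1 + t) / 2) *\<^sub>R b'" "closed_segment a b = closed_segment a' b'" "poly (pderiv (legendre k)) t = 0"
    using assms(2) unfolding gauss_lobatto_inner_def by blast
  have t: "-1 < t" "t < 1" using legendre_pderiv_roots(3)[OF assms(1) x(3)] by auto
  have ab: "{a', b'} = {a, b}" using x(2) closed_segment_eq[of a b a' b'] by metis
  then have "a' \<noteq> b'" using assms(3) by (metis doubleton_eq_iff insert_absorb2)
  then have "x \<in> open_segment a' b'" unfolding in_segment x(1) using t
    by (intro conjI exI[of _ "(1 + t) / 2"]) (auto simp: field_simps)
  moreover have "open_segment a' b' = open_segment a b" by (simp only: open_segment_def ab x(2))
  ultimately show ?thesis by simp
qed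

context conforming begin

lemma gauss_lobatto_rel_interior:
  assumes "k \<ge> 1" "e \<in> edges T" "x \<in> gauss_lobatto_inner k e" shows "x \<in> rel_interior e"
proof -
  obtain a b where "a \<noteq> b" "e = closed_segment a b" using edge_segment[OF assms(2)] by metis
  then show ?thesis using gauss_lobatto_inner_param[OF assms(1)] assms(3) by (simp add: rel_interior_closed_segment)
qed

text \<open>On the edge both functions agree with polynomials. Their difference, pulled back to the
  interval from -1 to 1, is governed by its values at the Gauss-Lobatto points, whose images are
  vertices or inner nodes of the edge.\<close>

lemma edge_polynomial_bound:
  assumes Cg: "\<And>f m. degree f \<le> k \<Longrightarrow> \<bar>poly f (-1)\<bar> \<le> m \<Longrightarrow> \<bar>poly f 1\<bar> \<le> m \<Longrightarrow>
     (\<And>t. poly (pderiv (legendre k)) t = 0 \<Longrightarrow> \<bar>poly f t\<bar> \<le> m) \<Longrightarrow> (\<forall>t\<in>{-1..1}. \<bar>poly f t\<bar> \<le> C * m)"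
    and k: "k \<ge> 1" and F: "F \<in> faces T" and e: "e \<in> edges_of T F"
    and q: "q1 \<in> Polys k" "q2 \<in> Polys k" "\<And>y. y \<in> flat F e \<Longrightarrow> u y = q1 y" "\<And>y. y \<in> flat F e \<Longrightarrow> w y = q2 y"
    and m: "\<And>y. y \<in> flat F e \<Longrightarrow> face_chart F y \<in> verts T \<or> face_chart F y \<in> gauss_lobatto_inner k e \<Longrightarrow> \<bar>u y - w y\<bar> \<le> m"
    and y: "y \<in> flat F e"
  shows "\<bar>u y - w y\<bar> \<le> C * m"
proof -
  note ch = face_chart_spec[OF F]
  have eT: "e \<in> edges T" by (rule of_cells(1)[OF e])
  obtain a b where ab: "a \<in> verts T" "b \<in> verts T" "a \<noteq> b" "e = closed_segment a b" using edge_segment[OF eT] .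
  have "a \<in> range (face_chart F)" "b \<in> range (face_chart F)" using edges_of_subset[OF F e] ch(3) ab by auto
  then obtain a' b' where ab': "a = face_chart F a'" "b = face_chart F b'" by blast
  \<comment> \<open>Maps -1 and 1 to the endpoints; written as a base point plus \<open>t\<close>
    times a direction in order to match \<open>Polys_line\<close>.\<close>
  define g where "g t = (1/2) *\<^sub>R (a' + b') + t *\<^sub>R ((1/2) *\<^sub>R (b' - a'))" for t :: real
  have g: "g t = (1 - (1 + t) / 2) *\<^sub>R a' + ((1 + t) / 2) *\<^sub>R b'" for t
    by (simp add: g_def vec_eq_iff field_simps)
  have \<phi>g: "face_chart F (g t) = ((1 - t) / 2) *\<^sub>R a + ((1 + t) / 2) *\<^sub>R b" for t
    unfolding g isom_affine[OF ch(1)] ab' by (simp add: field_simps)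
  have gF: "g t \<in> flat F e" if "t \<in> {-1..1}" for t
  proof -
    have "face_chart F (g t) \<in> closed_segment a b" unfolding g isom_affine[OF ch(1)] ab' closed_segment_def
      using that by (intro CollectI exI[of _ "(1 + t) / 2"]) auto
    then show ?thesis by (simp add: flat_def ab)
  qed
  obtain f where f: "degree f \<le> k" "\<And>t. q1 (g t) - q2 (g t) = poly f t"
    using Polys_line[OF Polys_diff[OF q(1,2)], of "(1/2) *\<^sub>R (a' + b')" "(1/2) *\<^sub>R (b' - a')"] unfolding g_def by metis
  have uw: "poly f t = u (g t) - w (g t)" if "t \<in> {-1..1}" for t using q(3,4)[OF gF[OF that]] f(2)[of t] by simp
  have bd: "\<forall>t\<in>{-1..1}. \<bar>poly f t\<bar> \<le> C * m"
  proof (rule Cg[OF f(1)])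
    show "\<bar>poly f (-1)\<bar> \<le> m" using uw[of "-1"] m[OF gF[of "-1"]] \<phi>g[of "-1"] ab(1) by simp
    show "\<bar>poly f 1\<bar> \<le> m" using uw[of 1] m[OF gF[of 1]] \<phi>g[of 1] ab(2) by simp
    fix t assume t: "poly (pderiv (legendre k)) t = 0"
    have t1: "t \<in> {-1..1}" using legendre_pderiv_roots(3)[OF k t] by simp
    have "face_chart F (g t) \<in> gauss_lobatto_inner k e" unfolding gauss_lobatto_inner_def \<phi>g using t ab(4) by blast
    then show "\<bar>poly f t\<bar> \<le> m" unfolding uw[OF t1] by (intro m[OF gF[OF t1]]) simp
  qed
  have "face_chart F y \<in> face_chart F ` closed_segment a' b'" using y unfolding isom_segment[OF ch(1)] by (simp add: flat_def ab ab')
  then have "y \<in> closed_segment a' b'" using isom_inj[OF ch(1)] by (simp add: inj_image_mem_iff)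
  then obtain s where s: "0 \<le> s" "s \<le> 1" "y = (1 - s) *\<^sub>R a' + s *\<^sub>R b'" by (auto simp: closed_segment_def)
  then have "y = g (2 * s - 1)" "2 * s - 1 \<in> {-1..1}" unfolding g by auto
  then show ?thesis using bd uw by metis
qed

end

context shape_regular_mesh begin

definition jump_sum :: "((real^3) set \<Rightarrow> real^3 \<Rightarrow> real) \<Rightarrow> (real^3) set \<Rightarrow> real" where
  "jump_sum p E = (\<Sum>F\<in>patch_faces T E. (diameter F)^2 * (face_L2_norm F (jump T p F))^2)"

lemma jump_sum_nonneg: "jump_sum p E \<ge> 0" unfolding jump_sum_def by (intro sum_nonneg) simp

lemma elem_patch_diameter:
  assumes "E \<in> elems T" "K \<in> elem_patch T E"
  shows "K \<in> elems T" "diameter E \<le> \<kappa> * diameter K" "diameter K \<le> \<kappa> * diameter E"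
proof -
  obtain x where x: "E \<in> elems_at x" "K \<in> elems_at x" using assms by (auto simp: elem_patch_def elems_at_def)
  show "K \<in> elems T" using assms(2) by (simp add: elem_patch_def)
  show "diameter E \<le> \<kappa> * diameter K" "diameter K \<le> \<kappa> * diameter E"
    by (rule diameter_comparable[OF x], rule diameter_comparable[OF x(2,1)])
qed

context
  fixes k :: nat and Cp :: real
  assumes k: "k \<ge> 1" and Cp: "Cp > 0"
    and sup_bound: "\<And>F r. F \<in> faces T \<Longrightarrow> star_shaped_wrt_ball F r \<Longrightarrow> \<rho> * diameter F \<le> r \<Longrightarrow> face_sup_stable Cp k F"
begin

text \<open>On a face, the modulus of the jump times \<open>h_F\<close> is at most
  \<open>sqrt Cp\<close> times its L2 norm. Multiplying by \<open>h_F\<close> once more makes the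
  squared right side a summand of \<open>jump_sum\<close>, and
  \<open>h_F \<ge> (\<rho> / \<kappa>) * h_E\<close> replaces the face diameter on the left.\<close>

definition jump_bound :: "((real^3) set \<Rightarrow> real^3 \<Rightarrow> real) \<Rightarrow> (real^3) set \<Rightarrow> real" where
  "jump_bound p E = sqrt (Cp * jump_sum p E) * (\<kappa> / \<rho>)^2 / (diameter E)^2"

lemma jump_bound_nonneg: "jump_bound p E \<ge> 0"
  unfolding jump_bound_def using Cp jump_sum_nonneg by simp

context
  fixes p :: "(real^3) set \<Rightarrow> real^3 \<Rightarrow> real" and E
  assumes p: "\<And>K. K \<in> elems T \<Longrightarrow> p K \<in> Polys k" and E: "E \<in> elems T"
begin

lemma face_jump_le:
  assumes K: "K \<in> elem_patch T E" "L \<in> elem_patch T E" "K \<noteq> L" and F: "F \<in> faces_of T K" "F \<in> faces_of T L" and y: "y \<in> F"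
  shows "\<bar>p K y - p L y\<bar> \<le> jump_bound p E"
proof -
  note KT = elem_patch_diameter[OF E K(1)] and LT = elem_patch_diameter(1)[OF E K(2)]
  have FT: "F \<in> faces T" by (rule of_cells(2)[OF F(1)])
  have FP: "F \<in> patch_faces T E" using FT K F unfolding patch_faces_def by blast
  obtain z where z: "y = face_chart F z" "z \<in> flat F F" using face_chart_spec(3)[OF FT] y by (auto simp: flat_def)
  let ?q = "\<lambda>x. p K x - p L x"
  obtain r where r: "\<rho> * diameter F \<le> r" "star_shaped_wrt_ball F r" using star_face[OF KT(1) F(1)] by blast
  have J: "face_L2_norm F (jump T p F) = face_L2_norm F ?q"
    using jump_sides[OF FT KT(1) LT K(3) F, of p] by (auto simp: face_L2_norm_def power2_commute)
  have "(?q y)^2 * (diameter F)^2 \<le> Cp * (face_L2_norm F ?q)^2"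
    unfolding z(1) by (rule sup_bound[OF FT r(2,1), unfolded face_sup_stable_def, rule_format, OF Polys_diff[OF p[OF KT(1)] p[OF LT]] z(2)])
  then have "(?q y)^2 * (diameter F)^2 * (diameter F)^2 \<le> Cp * (face_L2_norm F ?q)^2 * (diameter F)^2"
    by (rule mult_right_mono) simp
  also have "\<dots> = Cp * ((diameter F)^2 * (face_L2_norm F (jump T p F))^2)" by (simp add: J)
  also have "\<dots> \<le> Cp * jump_sum p E"
    unfolding jump_sum_def using FP finite_cells(3) Cp
    by (intro mult_left_mono member_le_sum[of F _ "\<lambda>F. (diameter F)^2 * (face_L2_norm F (jump T p F))^2"]) (auto simp: patch_faces_def)
  finally have "(\<bar>?q y\<bar> * (diameter F)^2)^2 \<le> Cp * jump_sum p E" by (simp add: power_mult_distrib power2_eq_square mult_ac)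
  then have 1: "\<bar>?q y\<bar> * (diameter F)^2 \<le> sqrt (Cp * jump_sum p E)" by (rule real_le_rsqrt)
  have hE: "diameter E > 0" by (rule diameter_pos[OF E])
  have "\<rho> * diameter E \<le> \<rho> * (\<kappa> * diameter K)" using KT(2) \<rho>(1) by (intro mult_left_mono) auto
  also have "\<dots> \<le> \<kappa> * diameter F" using face_diameter[OF KT(1) F(1)] \<kappa> by (simp add: mult.left_commute)
  finally have "(\<rho> * diameter E)^2 \<le> (\<kappa> * diameter F)^2" using \<rho> hE by (intro power_mono) auto
  then have "\<bar>?q y\<bar> * (\<rho> * diameter E)^2 \<le> \<bar>?q y\<bar> * (\<kappa> * diameter F)^2" by (rule mult_left_mono) simp
  also have "\<dots> = \<kappa>^2 * (\<bar>?q y\<bar> * (diameter F)^2)" by (simp add: power_mult_distrib)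
  also have "\<dots> \<le> \<kappa>^2 * sqrt (Cp * jump_sum p E)" using 1 by (rule mult_left_mono) simp
  finally show ?thesis unfolding jump_bound_def using \<rho> hE by (simp add: field_simps)
qed

text \<open>The difference telescopes along a chain of at most \<open>Nlink\<close> elements through
  \<open>x\<close>; the hypothesis that all elements at \<open>x\<close> belong to the patch makes
  every jump on the way a patch jump.\<close>

lemma point_value_le:
  assumes "x \<in> E" "\<And>K. K \<in> elems_at x \<Longrightarrow> K \<in> elem_patch T E" "K \<in> elems_at x"
  shows "\<bar>p E x - p K x\<bar> \<le> real Nlink * jump_bound p E"
proof (rule link_chain_bound[OF _ assms(3) jump_bound_nonneg])
  show "E \<in> elems_at x" using E assms(1) by (simp add: elems_at_def)
  show "\<bar>p K x - p L x\<bar> \<le> jump_bound p E" if "(K, L) \<in> link x" for K L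
    using that by (auto simp: link_def intro!: face_jump_le assms(2))
qed

text \<open>Scaled monomials are at most one in modulus on the face, so the normalised moment of the
  jump does not exceed its supremum.\<close>

lemma face_moment_le:
  assumes K: "K \<in> elems T" "F \<in> faces_of T E" "F \<in> faces_of T K"
  shows "\<bar>dof_value (Face_Moment F \<alpha>) (p E) - dof_value (Face_Moment F \<alpha>) (p K)\<bar> \<le> jump_bound p E"
proof -
  have FT: "F \<in> faces T" by (rule of_cells(2)[OF K(2)])
  obtain r where r: "\<rho> * diameter F \<le> r" "star_shaped_wrt_ball F r" using star_face[OF E K(2)] by blast
  obtain c where c: "face_cell T \<rho> F c" using face_star_cell[OF FT r(2,1) \<rho>] by blast
  have bd: "\<bar>p E x - p K x\<bar> \<le> jump_bound p E" if "x \<in> F" for x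
  proof (cases "K = E")
    case False
    have "E \<in> elem_patch T E" "K \<in> elem_patch T E"
      by (rule elem_patch_faces[OF E E K(2,2)], rule elem_patch_faces[OF E K(1-3)])
    then show ?thesis using face_jump_le[OF _ _ _ K(2,3) that] False by blast
  qed (simp add: jump_bound_nonneg)
  let ?s = "scaled_monomial (flat F F) \<alpha>"
  let ?f = "\<lambda>K y. p K (face_chart F y) * ?s y"
  have i: "set_integrable lebesgue (flat F F) (?f K)" if "K \<in> elems T" for K
    by (intro star_cell.set_integrable_D[OF c] continuous_intros continuous_on_Polys[OF Polys_isom[OF face_chart_spec(1)[OF FT] p[OF that]]])
  have "\<bar>(LINT y:flat F F|lebesgue. ?f E y) - (LINT y:flat F F|lebesgue. ?f K y)\<bar> = \<bar>LINT y:flat F F|lebesgue. ?f E y - ?f K y\<bar>"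
    by (subst set_integral_diff(2)[OF i[OF E] i[OF K(1)]]) simp
  also have "\<dots> \<le> (LINT y:flat F F|lebesgue. jump_bound p E)"
    unfolding set_lebesgue_integral_def
  proof (rule order_trans[OF integral_abs_bound integral_mono])
    show "integrable lebesgue (\<lambda>y. \<bar>indicat_real (flat F F) y *\<^sub>R (?f E y - ?f K y)\<bar>)"
      using set_integral_diff(1)[OF i[OF E] i[OF K(1)]] by (intro integrable_abs) (simp add: set_integrable_def)
    show "integrable lebesgue (\<lambda>y. indicat_real (flat F F) y *\<^sub>R jump_bound p E)"
      using star_cell.set_integrable_D[OF c, OF continuous_on_const[of _ "jump_bound p E"]] unfolding set_integrable_def .
    fix y
    show "\<bar>indicat_real (flat F F) y *\<^sub>R (?f E y - ?f K y)\<bar> \<le> indicat_real (flat F F) y *\<^sub>R jump_bound p E"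
    proof (cases "y \<in> flat F F")
      case True
      have "\<bar>p E (face_chart F y) - p K (face_chart F y)\<bar> * \<bar>?s y\<bar> \<le> jump_bound p E * 1"
        using True bd[of "face_chart F y"] abs_scaled_monomial_le[OF star_cell.compact_D[OF c] star_cell.measure_D_pos[OF c] True star_cell.h_pos[OF c], of \<alpha>]
        by (intro mult_mono jump_bound_nonneg) (auto simp: flat_def)
      then show ?thesis using True by (simp add: left_diff_distrib[symmetric] abs_mult)
    qed simp
  qed
  also have "\<dots> = jump_bound p E * measure lebesgue (flat F F)"
    using star_cell.D_borel[OF c] by (simp add: set_lebesgue_integral_def)
  finally show ?thesis using star_cell.measure_D_pos[OF c] by (simp add: diff_divide_distrib[symmetric] divide_le_eq)
qed

text \<open>The factor \<open>h_dof k T \<nu>\<close> is common to all elements that carry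
  \<open>\<nu>\<close>, so it comes out of the average and only differences of values of
  \<open>p\<close> remain. With a factor varying from element to element, a term without jumps would
  be left.\<close>

lemma dof_difference_le:
  assumes wt: "\<And>K \<nu>. K \<in> elems T \<Longrightarrow> \<nu> \<in> local_dofs k T K \<Longrightarrow> dof_value \<nu> (wt K) = h_dof k T \<nu> * dof_value \<nu> (p K)"
    and w: "\<And>K \<nu>. K \<in> elems T \<Longrightarrow> \<nu> \<in> local_dofs k T K \<Longrightarrow>
       dof_value \<nu> w = (\<Sum>K\<in>dof_patch k T \<nu>. dof_value \<nu> (wt K)) / card (dof_patch k T \<nu>)"
    and \<nu>: "\<nu> \<in> local_dofs k T E"
  shows "\<bar>dof_value \<nu> (wt E) - dof_value \<nu> w\<bar> \<le> \<kappa> * diameter E * ((real Nlink + 1) * jump_bound p E)"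
proof -
  let ?B = "(real Nlink + 1) * jump_bound p E" and ?W = "dof_patch k T \<nu>"
  have B: "real Nlink * jump_bound p E \<le> ?B" "jump_bound p E \<le> ?B" "0 \<le> ?B"
    using jump_bound_nonneg[of p E] by (auto simp: algebra_simps)
  have EW: "E \<in> ?W" using E \<nu> by (simp add: dof_patch_def)
  have fin: "finite ?W" using finite_cells by (simp add: dof_patch_def)
  have pt: "K \<in> elem_patch T E \<and> \<bar>dof_value \<nu> (p E) - dof_value \<nu> (p K)\<bar> \<le> ?B"
    if x: "\<nu> = Point_Value x" "x \<in> E" "\<And>K. K \<in> elems_at x \<Longrightarrow> K \<in> elem_patch T E" and K: "K \<in> ?W" for x K
  proof -
    have "x \<in> K" using K unfolding dof_patch_def local_dofs_def x(1)
      using gauss_lobatto_rel_interior[OF k] rel_interior_subset by blast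
    then have Kx: "K \<in> elems_at x" using K by (simp add: elems_at_def dof_patch_def)
    show ?thesis using x(3)[OF Kx] point_value_le[OF x(2,3) Kx] B(1) unfolding x(1) by simp
  qed
  have main: "K \<in> elem_patch T E \<and> \<bar>dof_value \<nu> (p E) - dof_value \<nu> (p K)\<bar> \<le> ?B" if K: "K \<in> ?W" for K
  proof -
    from \<nu> consider x where "\<nu> = Point_Value x" "x \<in> verts T" "x \<in> E"
      | x e where "\<nu> = Point_Value x" "e \<in> edges T" "e \<subseteq> E" "x \<in> gauss_lobatto_inner k e"
      | F \<alpha> where "\<nu> = Face_Moment F \<alpha>" "F \<in> faces_of T E" | \<alpha> where "\<nu> = Elem_Moment E \<alpha>"
      unfolding local_dofs_def by blast
    then show ?thesis
    proof cases
      case 1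
      show ?thesis by (rule pt[OF 1(1,3) _ K]) (use 1 in \<open>auto simp: elems_at_def elem_patch_def\<close>)
    next
      case 2
      \<comment> \<open>An element containing an inner node of an edge contains the whole edge, in
        particular its endpoint \<open>a\<close>, and so belongs to the patch of
        \<open>E\<close>.\<close>
      have ri: "x \<in> rel_interior e" by (rule gauss_lobatto_rel_interior[OF k 2(2,4)])
      obtain a b where a: "a \<in> verts T" "a \<in> e" using edge_segment[OF 2(2)] by (metis ends_in_segment(1))
      show ?thesis
      proof (rule pt[OF 2(1) _ _ K])
        show "x \<in> E" using ri rel_interior_subset 2(3) by blast
        show "L \<in> elem_patch T E" if "L \<in> elems_at x" for L
          using edge_subset_elem[OF 2(2) _ ri, of L] that a 2(3) by (auto simp: elem_patch_def elems_at_def)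
      qed
    next
      case 3
      have KF: "K \<in> elems T" "F \<in> faces_of T K" using K unfolding 3(1) dof_patch_def local_dofs_def by auto
      show ?thesis using elem_patch_faces[OF E KF(1) 3(2) KF(2)] face_moment_le[OF KF(1) 3(2) KF(2), of \<alpha>] B(2) unfolding 3(1) by simp
    next
      case 4
      \<comment> \<open>A volume moment is carried by a single element; averaging does not change
        it.\<close>
      then have "K = E" using K unfolding dof_patch_def local_dofs_def by auto
      moreover have "E \<in> elem_patch T E"
      proof -
        have "frontier E \<noteq> {}"
          using elem_props(1)[OF E] interior_nonempty[OF E] not_bounded_UNIV by (auto simp: frontier_eq_empty dest: compact_imp_bounded)
        then obtain F where "F \<in> faces_of T E" unfolding elem_props(5)[OF E] by blast
        then show ?thesis by (intro elem_patch_faces[OF E E])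
      qed
      ultimately show ?thesis using B(3) by simp
    qed
  qed
  have h: "0 \<le> h_dof k T \<nu>" "h_dof k T \<nu> \<le> \<kappa> * diameter E"
  proof -
    have c: "real (card ?W) > 0" using fin EW by (auto simp: card_gt_0_iff)
    show "0 \<le> h_dof k T \<nu>" unfolding h_dof_def using diameter_pos main elem_patch_diameter(1)[OF E]
      by (intro divide_nonneg_nonneg sum_nonneg) (auto intro: less_imp_le)
    have "(\<Sum>K\<in>?W. diameter K) \<le> (\<Sum>K\<in>?W. \<kappa> * diameter E)" using main elem_patch_diameter(3)[OF E] by (intro sum_mono) auto
    then show "h_dof k T \<nu> \<le> \<kappa> * diameter E" unfolding h_dof_def using c by (simp add: divide_le_eq mult.commute)
  qed
  have eq: "dof_value \<nu> w = (\<Sum>K\<in>?W. h_dof k T \<nu> * dof_value \<nu> (p K)) / card ?W"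
    unfolding w[OF E \<nu>] by (rule arg_cong[where f = "\<lambda>s. s / _"], rule sum.cong[OF refl], rule wt) (auto simp: dof_patch_def)
  have "\<bar>dof_value \<nu> (wt E) - dof_value \<nu> w\<bar> \<le> h_dof k T \<nu> * ?B"
    unfolding wt[OF E \<nu>] eq using main EW fin h(1) by (intro avg_diff_bound) auto
  also have "\<dots> \<le> \<kappa> * diameter E * ?B" using h(2) B(3) by (rule mult_right_mono)
  finally show ?thesis .
qed

end
end
end

lemma L2_norm_le_AE:
  assumes ae: "AE x in lebesgue. x \<in> D \<longrightarrow> \<bar>f x\<bar> \<le> b" and D: "compact D"
  shows "(L2_norm D f)^2 \<le> b^2 * measure lebesgue D"
proof -
  have fin: "D \<in> lmeasurable" by (rule lmeasurable_compact[OF D])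
  have "(L2_norm D f)^2 = (LINT x|lebesgue. indicat_real D x * (f x)^2)"
    unfolding L2_norm_def by (subst real_sqrt_pow2) (auto simp: set_lebesgue_integral_def intro!: integral_nonneg_AE)
  also have "\<dots> \<le> (LINT x|lebesgue. b^2 * indicat_real D x)"
  proof (rule integral_mono_AE')
    show "integrable lebesgue (\<lambda>x. b^2 * indicat_real D x)" using fin by (intro integrable_mult_right) (simp only: lmeasurable_iff_integrable)
    show "AE x in lebesgue. indicat_real D x * (f x)^2 \<le> b^2 * indicat_real D x"
      using ae by eventually_elim (auto simp: indicator_def abs_le_square_iff[symmetric])
  qed simp
  also have "\<dots> = b^2 * measure lebesgue D" by simp
  finally show ?thesis .
qed

theorem proposition3p4:
  fixes \<Omega> :: "(real^3) set" and \<T> :: "mesh set" and k :: nat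
  assumes "polyhedral_domain \<Omega>"
    and "\<And>T. T \<in> \<T> \<Longrightarrow> conforming_mesh \<Omega> T"
    and "assumption_A1 \<T>"
    and "k \<ge> 1"
  shows "\<exists>C>0. \<forall>T\<in>\<T>. \<forall>p wt w.
    (\<forall>E\<in>elems T. p E \<in> Polys k) \<and>
    (\<forall>E\<in>elems T. wt E \<in> V_elem k T E \<and>
       (\<forall>\<nu>\<in>local_dofs k T E. dof_value \<nu> (wt E) = h_dof k T \<nu> * dof_value \<nu> (p E))) \<and>
    is_oswald k \<Omega> T wt w \<longrightarrow>
    (\<forall>E\<in>elems T.
       (L2_norm E (\<lambda>x. wt E x - w x))\<^sup>2 \<le>
         C * diameter E *
           (\<Sum>F\<in>patch_faces T E. (diameter F)\<^sup>2 * (face_L2_norm F (jump T p F))\<^sup>2))"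
proof -
  obtain \<rho>0 Cq where A1: "\<rho>0 > 0" "Cq \<ge> 1"
    "\<And>T K. T \<in> \<T> \<Longrightarrow> K \<in> elems T \<Longrightarrow> \<exists>r\<ge>\<rho>0 * diameter K. star_shaped_wrt_ball K r"
    "\<And>T K F. T \<in> \<T> \<Longrightarrow> K \<in> elems T \<Longrightarrow> F \<in> faces_of T K \<Longrightarrow> \<exists>r\<ge>\<rho>0 * diameter F. star_shaped_wrt_ball F r"
    "\<And>T K F. T \<in> \<T> \<Longrightarrow> K \<in> elems T \<Longrightarrow> F \<in> faces_of T K \<Longrightarrow> \<rho>0 * diameter K \<le> diameter F"
    "\<And>T K L. T \<in> \<T> \<Longrightarrow> adjacent T K L \<Longrightarrow> diameter K \<le> Cq * diameter L"
    using assms(3) unfolding assumption_A1_def by auto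
  \<comment> \<open>The cell estimates are stated for \<open>\<rho> \<le> 1\<close>; lowering the
    parameter only weakens the shape conditions.\<close>
  define \<rho> where "\<rho> = min \<rho>0 1"
  have \<rho>: "0 < \<rho>" "\<rho> \<le> 1" using A1(1) by (auto simp: \<rho>_def)
  obtain Cp where Cp: "Cp > 0" "\<And>\<Omega> T F r. conforming_mesh \<Omega> T \<Longrightarrow> F \<in> faces T \<Longrightarrow> star_shaped_wrt_ball F r \<Longrightarrow> \<rho> * diameter F \<le> r \<Longrightarrow> face_sup_stable Cp k F"
    using polyhedral_face_sup_bound[OF \<rho>, of k] by blast
  obtain Cg where Cg: "Cg > 0" "\<And>f m. degree f \<le> k \<Longrightarrow> \<bar>poly f (-1)\<bar> \<le> m \<Longrightarrow> \<bar>poly f 1\<bar> \<le> m \<Longrightarrow>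
     (\<And>t. poly (pderiv (legendre k)) t = 0 \<Longrightarrow> \<bar>poly f t\<bar> \<le> m) \<Longrightarrow> (\<forall>t\<in>{-1..1}. \<bar>poly f t\<bar> \<le> Cg * m)"
    using gauss_lobatto_bound[OF assms(4)] by blast
  obtain Cf where Cf: "Cf > 0" "\<And>\<Omega> T F r. conforming_mesh \<Omega> T \<Longrightarrow> F \<in> faces T \<Longrightarrow> star_shaped_wrt_ball F r \<Longrightarrow> \<rho> * diameter F \<le> r \<Longrightarrow> face_stable Cf k T F"
    using face_stability[OF \<rho>, of k] by blast
  obtain Ce where Ce: "Ce > 0" "\<And>\<Omega> T E r. conforming_mesh \<Omega> T \<Longrightarrow> E \<in> elems T \<Longrightarrow> star_shaped_wrt_ball E r \<Longrightarrow> \<rho> * diameter E \<le> r \<Longrightarrow> elem_stable Ce k T E"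
    using elem_stability[OF \<rho>, of k] by blast
  define \<omega> where "\<omega> = measure lebesgue (ball (0::real^3) 1)"
  define ka where "ka = shape_regular_mesh.\<kappa> \<rho> Cq"
  define N where "N = real (shape_regular_mesh.Nlink \<rho>)"
  \<comment> \<open>Passage from degrees of freedom to pointwise values: edges, faces, element. The
    edge and face factors are enlarged by 1 so that each bound also dominates the bound of the level
    before, which holds for the moments.\<close>
  define Ct where "Ct = Ce * ((1 + Cf) * (1 + Cg))"
  define C where "C = Ct\<^sup>2 * \<omega> * (ka * (N + 1) * (ka / \<rho>)\<^sup>2)\<^sup>2 * Cp"
  have C0: "C \<ge> 0" using Cp(1) by (simp add: C_def \<omega>_def)
  show ?thesis
  proof (intro exI[of _ "C + 1"] conjI ballI allI impI, use C0 in simp)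
    fix T p wt w E
    assume T: "T \<in> \<T>" and E: "E \<in> elems T"
      and hyp: "(\<forall>E\<in>elems T. p E \<in> Polys k) \<and> (\<forall>E\<in>elems T. wt E \<in> V_elem k T E \<and>
       (\<forall>\<nu>\<in>local_dofs k T E. dof_value \<nu> (wt E) = h_dof k T \<nu> * dof_value \<nu> (p E))) \<and> is_oswald k \<Omega> T wt w"
    note conf = assms(2)[OF T]
    interpret c: conforming \<Omega> T by unfold_locales (rule conf)
    have le: "\<rho> * diameter K \<le> \<rho>0 * diameter K" if "compact K" for K :: "(real^3) set"
      unfolding \<rho>_def using diameter_ge_0[OF compact_imp_bounded[OF that]] by (intro mult_right_mono) auto
    interpret shape_regular_mesh \<Omega> T \<rho> Cq
    proof
      show "\<exists>r\<ge>\<rho> * diameter K. star_shaped_wrt_ball K r" if "K \<in> elems T" for K using A1(3)[OF T that] le[OF c.elem_props(1)[OF that]] by (meson order_trans)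
      show "\<exists>r\<ge>\<rho> * diameter F. star_shaped_wrt_ball F r" if "K \<in> elems T" "F \<in> faces_of T K" for K F using A1(4)[OF T that] le[OF c.face_props(1)[OF c.of_cells(2)[OF that(2)]]] by (meson order_trans)
      show "\<rho> * diameter K \<le> diameter F" if "K \<in> elems T" "F \<in> faces_of T K" for K F using A1(5)[OF T that] le[OF c.elem_props(1)[OF that(1)]] by linarith
      show "diameter K \<le> Cq * diameter L" if "adjacent T K L" for K L by (rule A1(6)[OF T that])
    qed (use assms(1) \<rho> A1(2) in auto)
    have wE: "w \<in> V_elem k T E" and wtE: "wt E \<in> V_elem k T E" using hyp E by (auto simp: is_oswald_def V_global_def)
    define S where "S = jump_sum p E"
    define m0 where "m0 = ka * diameter E * ((N + 1) * jump_bound Cp p E)"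
    have hE: "diameter E > 0" by (rule diameter_pos[OF E])
    have ka1: "ka \<ge> 1" unfolding ka_def by (rule \<kappa>)
    have "jump_bound Cp p E \<ge> 0" by (rule jump_bound_nonneg[OF assms(4) Cp(1)]) (rule Cp(2)[OF conf])
    then have m00: "m0 \<ge> 0" unfolding m0_def N_def using ka1 hE by (intro mult_nonneg_nonneg) auto
    have dd: "\<bar>dof_value \<nu> (wt E) - dof_value \<nu> w\<bar> \<le> m0" if \<nu>: "\<nu> \<in> local_dofs k T E" for \<nu>
      unfolding m0_def ka_def N_def
    proof (rule dof_difference_le[OF assms(4) Cp(1) _ _ E _ _ \<nu>])
      show "face_sup_stable Cp k F" if "F \<in> faces T" "star_shaped_wrt_ball F r" "\<rho> * diameter F \<le> r" for F r
        by (rule Cp(2)[OF conf that])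
    qed (use hyp in \<open>auto simp: is_oswald_def\<close>)
    \<comment> \<open>The stability results ask for a positive bound, whereas \<open>m0\<close> is
      zero when all jumps vanish; hence the estimate is proved for every \<open>m > m0\<close> and
      \<open>m\<close> tends to \<open>m0\<close> afterwards.\<close>
    have bd: "(L2_norm E (\<lambda>x. wt E x - w x))\<^sup>2 \<le> (Ct * m)\<^sup>2 * measure lebesgue E" if m: "m > m0" for m
    proof (rule L2_norm_le_AE[OF _ c.elem_props(1)[OF E]])
      have mp: "m > 0" using m m00 by linarith
      \<comment> \<open>The bound grows with the dimension: \<open>m\<close> for degrees of freedom,
        \<open>m1\<close> on edges and for face moments, \<open>m2\<close> on faces and for volume
        moments.\<close>
      define m1 where "m1 = (1 + Cg) * m"
      define m2 where "m2 = (1 + Cf) * m1"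
      have m1: "m \<le> m1" "Cg * m \<le> m1" "m1 > 0" using mp Cg(1) by (auto simp: m1_def algebra_simps add_pos_pos)
      have m2: "m1 \<le> m2" "Cf * m1 \<le> m2" "m2 > 0" using m1(3) Cf(1) by (auto simp: m2_def algebra_simps add_pos_pos)
      have face: "AE y in lebesgue. y \<in> flat F F \<longrightarrow> \<bar>wt E (face_chart F y) - w (face_chart F y)\<bar> \<le> m2" if F: "F \<in> faces_of T E" for F
      proof -
        let ?u = "wt E \<circ> face_chart F" and ?w = "w \<circ> face_chart F"
        have FT: "F \<in> faces T" by (rule c.of_cells(2)[OF F])
        have uw: "?u \<in> V_face k T F" "?w \<in> V_face k T F" using wE wtE F by (auto simp: V_elem_def enhanced_vem_def)
        obtain r where r: "\<rho> * diameter F \<le> r" "star_shaped_wrt_ball F r" using star_face[OF E F] by blast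
        have edge: "\<bar>?u y - ?w y\<bar> \<le> Cg * m" if e: "e \<in> edges_of T F" and y: "y \<in> flat F e" for e y
        proof -
          obtain q1 q2 where q: "q1 \<in> Polys k" "q2 \<in> Polys k" "\<And>y. y \<in> flat F e \<Longrightarrow> ?u y = q1 y" "\<And>y. y \<in> flat F e \<Longrightarrow> ?w y = q2 y"
          proof -
            have "\<exists>q\<in>Polys k. \<forall>y\<in>flat F e. u y = q y" if "u \<in> V_face k T F" for u
              using that e by (simp add: V_face_def enhanced_vem_def)
            from this[OF uw(1)] this[OF uw(2)] show ?thesis by (elim bexE) (rule that, auto)
          qed
          have eE: "e \<subseteq> E" using c.edges_of_subset[OF FT e] c.faces_of_subset[OF E F] by blast
          show ?thesis
          proof (rule c.edge_polynomial_bound[OF Cg(2) assms(4) FT e q _ y])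
            fix z assume z: "z \<in> flat F e" "face_chart F z \<in> verts T \<or> face_chart F z \<in> gauss_lobatto_inner k e"
            then have "face_chart F z \<in> E" using eE by (auto simp: flat_def)
            then have "Point_Value (face_chart F z) \<in> local_dofs k T E"
              using z(2) eE c.of_cells(1)[OF e] by (auto simp: local_dofs_def)
            from dd[OF this] show "\<bar>?u z - ?w z\<bar> \<le> m" using m by simp
          qed
        qed
        have mom: "\<bar>(LINT x:flat F F|lebesgue. ?u x * scaled_monomial (flat F F) \<alpha> x) / measure lebesgue (flat F F) -
           (LINT x:flat F F|lebesgue. ?w x * scaled_monomial (flat F F) \<alpha> x) / measure lebesgue (flat F F)\<bar> \<le> m1" if "mdegree \<alpha> + 2 \<le> k" for \<alpha>
        proof -
          have "Face_Moment F \<alpha> \<in> local_dofs k T E" using F that by (auto simp: local_dofs_def)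
          from dd[OF this] show ?thesis using m m1(1) by simp
        qed
        have "AE y in lebesgue. y \<in> flat F F \<longrightarrow> \<bar>?u y - ?w y\<bar> \<le> Cf * m1"
        proof (rule Cf(2)[OF conf FT r(2,1), unfolded face_stable_def, rule_format, OF uw m1(3)])
          show "\<bar>?u y - ?w y\<bar> \<le> m1" if "e \<in> edges_of T F" "y \<in> flat F e" for e y using edge[OF that] m1(2) by simp
        qed (rule mom)
        then show ?thesis using m2(2) unfolding o_def by (auto elim!: eventually_mono)
      qed
      have mom: "\<bar>dof_value (Elem_Moment E \<alpha>) (wt E) - dof_value (Elem_Moment E \<alpha>) w\<bar> \<le> m2" if "mdegree \<alpha> + 2 \<le> k" for \<alpha>
      proof -
        have "Elem_Moment E \<alpha> \<in> local_dofs k T E" using that by (auto simp: local_dofs_def)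
        from dd[OF this] show ?thesis using m m1(1) m2(1) by simp
      qed
      obtain r where r: "\<rho> * diameter E \<le> r" "star_shaped_wrt_ball E r" using star_elem[OF E] by blast
      have "AE x in lebesgue. x \<in> E \<longrightarrow> \<bar>wt E x - w x\<bar> \<le> Ce * m2"
        by (rule Ce(2)[OF conf E r(2,1), unfolded elem_stable_def, rule_format, OF wtE wE m2(3) mom face])
      then show "AE x in lebesgue. x \<in> E \<longrightarrow> \<bar>wt E x - w x\<bar> \<le> Ct * m" by (simp add: Ct_def m2_def m1_def mult_ac)
    qed
    have "(L2_norm E (\<lambda>x. wt E x - w x))\<^sup>2 \<le> (Ct * m0)\<^sup>2 * measure lebesgue E"
    proof (rule tendsto_lowerbound)
      show "((\<lambda>m. (Ct * m)\<^sup>2 * measure lebesgue E) \<longlongrightarrow> (Ct * m0)\<^sup>2 * measure lebesgue E) (at_right m0)"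
        by (intro tendsto_intros)
      show "\<forall>\<^sub>F m in at_right m0. (L2_norm E (\<lambda>x. wt E x - w x))\<^sup>2 \<le> (Ct * m)\<^sup>2 * measure lebesgue E"
        using bd by (auto simp: eventually_at_right_field intro!: exI[of _ "m0 + 1"])
    qed simp
    also have "\<dots> \<le> (Ct * m0)\<^sup>2 * (\<omega> * diameter E ^ 3)"
    proof (rule mult_left_mono)
      obtain r where r: "\<rho> * diameter E \<le> r" "star_shaped_wrt_ball E r" using star_elem[OF E] by blast
      obtain c where "elem_cell T \<rho> E c"
        using c.elem_star_cell[OF E r(2,1) \<rho>] by blast
      from star_cell.measure_D_le[OF this] show "measure lebesgue E \<le> \<omega> * diameter E ^ 3" by (simp add: \<omega>_def)
    qed simp
    also have "\<dots> = C * diameter E * S"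
    proof -
      have jb: "jump_bound Cp p E = sqrt (Cp * S) * (ka / \<rho>)\<^sup>2 / (diameter E)\<^sup>2"
        unfolding S_def ka_def by (rule jump_bound_def[OF assms(4) Cp(1)]) (rule Cp(2)[OF conf])
      \<comment> \<open>\<open>m0\<close> has order \<open>h_E^(-1)\<close> times the root of the
        jump sum: one power from the weight and minus two from the jump bound. Two of the three
        powers in the volume are thus used up and one remains.\<close>
      have "m0 * diameter E = ka * (N + 1) * (ka / \<rho>)\<^sup>2 * sqrt (Cp * S)"
        unfolding m0_def jb using hE by (simp add: power2_eq_square)
      moreover have "(Ct * m0)\<^sup>2 * (\<omega> * diameter E ^ 3) = Ct\<^sup>2 * \<omega> * (m0 * diameter E)\<^sup>2 * diameter E"
        by (simp add: power2_eq_square power3_eq_cube)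
      ultimately have "(Ct * m0)\<^sup>2 * (\<omega> * diameter E ^ 3) = Ct\<^sup>2 * \<omega> * ((ka * (N + 1) * (ka / \<rho>)\<^sup>2)\<^sup>2 * (sqrt (Cp * S))\<^sup>2) * diameter E"
        by (simp only: power_mult_distrib)
      also have "(sqrt (Cp * S))\<^sup>2 = Cp * S" using Cp(1) jump_sum_nonneg[of p E] by (simp add: S_def)
      finally show ?thesis by (simp add: C_def mult_ac)
    qed
    also have "\<dots> \<le> (C + 1) * diameter E * S" using hE jump_sum_nonneg[of p E] by (intro mult_right_mono) (auto simp: S_def)
    finally show "(L2_norm E (\<lambda>x. wt E x - w x))\<^sup>2 \<le> (C + 1) * diameter E *
           (\<Sum>F\<in>patch_faces T E. (diameter F)\<^sup>2 * (face_L2_norm F (jump T p F))\<^sup>2)" unfolding S_def jump_sum_def .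
  qed
qed

end
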